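(* Let $j$ be a QS flow on $\mathsf A$. Let $Y$ be a strongly continuous quasicontractive multiplier cocycle for $j$ whose adjoint process $Y^*=(Y_t^* )_{t\ge0}$ is strongly continuous. Suppose that $Y$ has a bounded ultraweak stochastic derivative. Then $Y$ is a perturbation process; that is, $Y=Y^{j,F}$ for some $F\in B(\widehat{\mathsf k})\,\overline\otimes\,\mathsf A$.
   Context: All Hilbert spaces are complex, with inner products linear in the second argument. $\mathsf A$ is a von Neumann algebra acting faithfully on a Hilbert space $\mathfrak h$; $\mathsf k$ is a Hilbert space and $\widehat{\mathsf k}:=\mathbb C\oplus\mathsf k$; $\widehat c:=(1,c)$ for $c\in\mathsf k$, $\widehat f(s):=\widehat{f(s)}$. $\underline\otimes$ and $\overline\otimes$ denote algebraic and ultraweak tensor products. Via $\widehat{\mathsf k}\otimes\mathfrak h=\mathfrak h\oplus(\mathsf k\otimes\mathfrak h)$, elements of $B(\widehat{\mathsf k})\,\overline\otimes\,\mathsf A$ are $2\times2$ block matrices. $\Delta:=\begin{bmatrix}0&0\\0&I_{\mathsf k}\end{bmatrix}\in B(\widehat{\mathsf k})$, $\Delta^\perp:=I-\Delta$; their ampliations are denoted in the same way. Fock space: for a subinterval $J$ of $\mathbb R_+$, $\mathcal F_J$ is the symmetric Fock space over $L^2(J;\mathsf k)$, $\mathsf N_J:=B(\mathcal F_J)$, $I_J$ is the identity on $\mathcal F_J$; subscripts are omitted for $J=\mathbb R_+$; $\mathcal F=\mathcal F_{[0,t[}\otimes\mathcal F_{[t,\infty[}$. $\mathbb S$ is the space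 of right-continuous step functions in $L^2(\mathbb R_+;\mathsf k)$; $f_J$ equals $f$ on $J$ and $0$ elsewhere (similarly $c_J$ for a constant $c$); $\varpi(f):=e^{-\|f\|^2/2}\big((n!)^{-1/2}f^{\otimes n}\big)_{n\ge0}$; $\mathcal E$ is the linear span of $\{\varpi(f):f\in\mathbb S\}$. $E_u$ denotes $|u\rangle$ tensored with identity operators (e.g. $E_{\varpi(f)}:\mathfrak h\to\mathfrak h\otimes\mathcal F$, $v\mapsto v\otimes\varpi(f)$) and $E^u:=(E_u)^*$. Processes: an (operator) process on $\mathfrak h$ is a family $X=(X_t)_{t\ge0}$ of (possibly unbounded) operators on $\mathfrak h\otimes\mathcal F$ with domain $\mathfrak h\underline\otimes\mathcal E$ that is weakly measurable in $t$ and adapted: $E^{\varpi(f)}X_tE_{\varpi(g)}=\langle\varpi(f_{[t,\infty[}),\varpi(g_{[t,\infty[})\rangle E^{\varpi(f_{[0,t[})}X_tE_{\varpi(g_{[0,t[})}$ for $f,g\in\mathbb S$; it is a process in $\mathsf A$ if $E^{\varpi(f)}X_tE_{\varpi(g)}\in\mathsf A$ for all $f,g,t$, and is bounded if each $X_t$ is bounded (then identified with its extension to $\mathfrak h\otimes\mathcal F$). A (mapping) process on $\mathsf A$ is a family $k=(k_t)_{t\ge0}$ of linear maps on $\mathsf A$ with $(k_t(a))_{t\ge0}$ a process in $\mathsf A$ for each $a$. If $k$ is normal and completely bounded (i.e. each $k_t$ is), then $k_r(a)=k_{r)}(a)\otimes I_{[r,\infty[}$ with $k_{r)}:\mathsf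 A\to\mathsf A\overline\otimes\mathsf N_{[0,r[}$; put $\widehat k_r:=k_{r)}\overline\otimes\operatorname{id}_{\mathsf N_{[r,\infty[}}$ and $\widetilde k_t:=\operatorname{id}_{B(\widehat{\mathsf k})}\overline\otimes k_t$. Let $T_r:\mathcal F\to\mathcal F_{[r,\infty[}$ be the unitary with $\varpi(f)\mapsto\varpi(f_r)$, $f_r(s)=f(s-r)$, and $\sigma_r:\mathsf A\overline\otimes\mathsf N\to\mathsf A\overline\otimes\mathsf N_{[r,\infty[}$ the normal *-isomorphism with $a\otimes z\mapsto a\otimes T_rzT_r^*$. $k$ is a QS cocycle if $k_0(a)=a\otimes I_{\mathcal F}$ and $k_{r+t}=\widehat k_r\circ\sigma_r\circ k_t$ for all $r,t\ge0$; it is a QS flow if moreover it is pointwise ultraweakly continuous in $t$, *-homomorphic and unital. For the QS flow $j$ put $J_t:=\widehat\jmath_t\circ\sigma_t$, a semigroup of normal unital *-endomorphisms of $\mathsf A\overline\otimes\mathsf N$. Multiplier cocycles: a multiplier cocycle for $j$ is a bounded process $Y$ in $\mathsf A$ with $Y_0=I_{\mathfrak h\otimes\mathcal F}$ and $Y_{s+t}=J_s(Y_t)Y_s$ for all $s,t\ge0$. It is quasicontractive if there is $\omega\in\mathbb R$ with $e^{-\omega t}\|Y_t\|\le1$ for all $t\ge0$. It is strongly continuous if $t\mapsto Y_t\xi$ is continuous for every $\xi\in\mathfrak h\otimes\mathcal F$ (similarly for $Y^*$). For $t>0$ let $V_t:\mathsf k\otimes\mathfrak h\to\mathfrak h\otimes\mathcal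 F$ be the isometry determined by $c\otimes u\mapsto u\otimes(0,t^{-1/2}c_{[0,t[},0,0,\dots)$. $Y$ has bounded ultraweak stochastic derivative if there is $F\in B(\widehat{\mathsf k})\overline\otimes\mathsf A$ with $$\begin{bmatrix}t^{-1/2}E^{\varpi(0)}\\ V_t^*\end{bmatrix}\big(Y_t-I_{\mathfrak h\otimes\mathcal F}\big)\begin{bmatrix}t^{-1/2}E_{\varpi(0)}&V_t\end{bmatrix}\to F\quad\text{ultraweakly as }t\to0 .$$ QS integrals: for an operator process $X$, $\widetilde X_t:=I_{\widehat{\mathsf k}}\underline\otimes X_t$. $\widehat\nabla_s$ is the linear operator with domain $\mathfrak h\underline\otimes\mathcal E$, $\widehat\nabla_s(u\varpi(f))=\widehat f(s)u\varpi(f)$. A family $G=(G_t)_{t\ge0}$ of operators on $\widehat{\mathsf k}\otimes\mathfrak h\otimes\mathcal F$ is QS integrable if, for all $\zeta\in\mathfrak h\underline\otimes\mathcal E$: $\widehat\nabla_t\zeta\in\operatorname{Dom}G_t$ for all $t$; $s\mapsto\Delta^\perp G_s\widehat\nabla_s\zeta$ is locally integrable; $s\mapsto\Delta G_s\widehat\nabla_s\zeta$ is locally square-integrable; and $E^{\varpi(f)}G_t\widehat\nabla_tE_{\varpi(g)}=\langle\varpi(f_{[t,\infty[}),\varpi(g_{[t,\infty[})\rangle E^{\widehat f(t)\varpi(f_{[0,t[})}G_tE_{\widehat g(t)\varpi(g_{[0,t[})}$ for $f,g\in\mathbb S$. Its QS integral is the continuous operator process determined by $\langle\zeta',\int_0^tG_s\,d\Lambda_s\,\zeta\rangle=\int_0^t\langle\widehat\nabla_s\zeta',G_s\widehat\nabla_s\zeta\rangle\,ds$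 for $\zeta,\zeta'\in\mathfrak h\underline\otimes\mathcal E$. Perturbation processes: for $F\in B(\widehat{\mathsf k})\overline\otimes\mathsf A$, $Y^{j,F}$ denotes the unique strong solution of $Y_0=I$, $dY_t=\widetilde\jmath_t(F)\widetilde Y_t\,d\Lambda_t$, i.e. the unique operator process $Y$ such that $(\widetilde\jmath_t(F)\widetilde Y_t)_{t\ge0}$ is QS integrable and $Y_t=I+\int_0^t\widetilde\jmath_s(F)\widetilde Y_s\,d\Lambda_s$ for all $t$ (it exists for every $F$). The processes of this form are called perturbation processes. *)

theory Defs
  imports "HOL-Analysis.Analysis" "HOL-Combinatorics.Permutations"
begin

section \<open>Complex Hilbert spaces\<close>

class scaleC =
  fixes scaleC :: "complex \<Rightarrow> 'a \<Rightarrow> 'a"  (infixr \<open>*\<^sub>C\<close> 75)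

class complex_vector = scaleC + ab_group_add +
  assumes scaleC_add_right: "a *\<^sub>C (x + y) = a *\<^sub>C x + a *\<^sub>C y"
    and scaleC_add_left: "(a + b) *\<^sub>C x = a *\<^sub>C x + b *\<^sub>C x"
    and scaleC_scaleC [simp]: "a *\<^sub>C b *\<^sub>C x = (a * b) *\<^sub>C x"
    and scaleC_one [simp]: "1 *\<^sub>C x = x"

global_interpretation cvec: vector_space "scaleC :: complex \<Rightarrow> 'a \<Rightarrow> 'a::complex_vector"
  by unfold_locales (auto simp: scaleC_add_right scaleC_add_left)

text \<open>Inner products are linear in the second argument. A \<^emph>\<open>semi\<close>-inner product may have
  non-zero null vectors.\<close>

class semi_inner = complex_vector +
  fixes cinner :: "'a \<Rightarrow> 'a \<Rightarrow> complex"
  assumes cinner_commute: "cinner x y = cnj (cinner y x)"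
    and cinner_add_right: "cinner x (y + z) = cinner x y + cinner x z"
    and cinner_scaleC_right: "cinner x (c *\<^sub>C y) = c * cinner x y"
    and Re_cinner_self: "0 \<le> Re (cinner x x)"

class complex_inner = semi_inner + real_inner +
  assumes scaleR_scaleC: "r *\<^sub>R x = complex_of_real r *\<^sub>C x"
    and inner_eq_Re_cinner: "x \<bullet> y = Re (cinner x y)"

class complex_hilbert = complex_inner + complete_space

context semi_inner
begin

lemma cinner_add_left: "cinner (x + y) z = cinner x z + cinner y z"
  by (metis cinner_add_right cinner_commute complex_cnj_add)

lemma cinner_scaleC_left: "cinner (c *\<^sub>C x) y = cnj c * cinner x y"
  by (metis cinner_commute cinner_scaleC_right complex_cnj_mult complex_cnj_cnj)

lemma cinner_zero_right [simp]: "cinner x 0 = 0"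
  using cinner_add_right[of x 0 0] by simp

lemma cinner_zero_left [simp]: "cinner 0 x = 0"
  by (metis cinner_commute cinner_zero_right complex_cnj_zero)

lemma cinner_minus_right [simp]: "cinner x (- y) = - cinner x y"
  using cinner_add_right[of x "- y" y] by (simp add: Groups.eq_neg_iff_add_eq_0)

lemma cinner_minus_left [simp]: "cinner (- x) y = - cinner x y"
  by (metis cinner_commute cinner_minus_right complex_cnj_minus)

lemma cinner_diff_right: "cinner x (y - z) = cinner x y - cinner x z"
  using cinner_add_right[of x y "- z"] by simp

lemma cinner_diff_left: "cinner (x - y) z = cinner x z - cinner y z"
  using cinner_add_left[of x "- y" z] by simp

lemma cinner_sum_right: "cinner x (\<Sum>i\<in>I. f i) = (\<Sum>i\<in>I. cinner x (f i))"
  by (induction I rule: infinite_finite_induct) (auto simp: cinner_add_right)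

lemma cinner_sum_left: "cinner (\<Sum>i\<in>I. f i) x = (\<Sum>i\<in>I. cinner (f i) x)"
  by (induction I rule: infinite_finite_induct) (auto simp: cinner_add_left)

definition seminorm :: "'a \<Rightarrow> real"
  where "seminorm x = sqrt (Re (cinner x x))"

lemma Im_cinner_self [simp]: "Im (cinner x x) = 0"
  by (metis cinner_commute cnj.simps(2) eq_iff_diff_eq_0 minus_unique neg_equal_zero)

lemma cinner_self: "cinner x x = complex_of_real ((seminorm x)\<^sup>2)"
  by (rule complex_eqI) (simp_all add: seminorm_def Re_cinner_self)

lemma seminorm_ge_0 [simp]: "0 \<le> seminorm x"
  by (simp add: seminorm_def Re_cinner_self)

lemma seminorm_zero [simp]: "seminorm 0 = 0"
  by (simp add: seminorm_def)

lemma seminorm_scaleC: "seminorm (c *\<^sub>C x) = cmod c * seminorm x"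
proof -
  have "(seminorm (c *\<^sub>C x))\<^sup>2 = (cmod c * seminorm x)\<^sup>2"
  proof -
    have "complex_of_real ((seminorm (c *\<^sub>C x))\<^sup>2) = (c * cnj c) * complex_of_real ((seminorm x)\<^sup>2)"
      by (simp only: cinner_self[symmetric]) (simp add: cinner_scaleC_left cinner_scaleC_right)
    also have "\<dots> = complex_of_real ((cmod c * seminorm x)\<^sup>2)"
      by (simp only: complex_norm_square[symmetric]) (simp add: power_mult_distrib)
    finally show ?thesis
      by (simp only: of_real_eq_iff)
  qed
  thus ?thesis
    by (simp add: power2_eq_iff_nonneg)
qed

lemma seminorm_minus [simp]: "seminorm (- x) = seminorm x"
  by (simp add: seminorm_def)

lemma seminorm_minus_commute: "seminorm (x - y) = seminorm (y - x)"
  by (metis minus_diff_eq seminorm_minus)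

lemma cinner_Cauchy_Schwarz: "cmod (cinner x y) \<le> seminorm x * seminorm y"
proof -
  define a where "a = (seminorm x)\<^sup>2"
  define d where "d = (seminorm y)\<^sup>2"
  define b where "b = cmod (cinner x y)"
  have key: "0 \<le> a - 2 * t * b\<^sup>2 + t\<^sup>2 * b\<^sup>2 * d" for t :: real
  proof -
    define c where "c = complex_of_real t * cnj (cinner x y)"
    have "0 \<le> Re (cinner (x - c *\<^sub>C y) (x - c *\<^sub>C y))"
      by (rule Re_cinner_self)
    also have "cinner (x - c *\<^sub>C y) (x - c *\<^sub>C y) =
        cinner x x - c * cinner x y - cnj c * cinner y x + cnj c * c * cinner y y"
      by (simp add: cinner_diff_left cinner_diff_right cinner_scaleC_left cinner_scaleC_right
          algebra_simps)
    also have "cinner y x = cnj (cinner x y)"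
      by (rule cinner_commute)
    also have "c * cinner x y = of_real (t * b\<^sup>2)"
      unfolding c_def b_def using complex_norm_square[of "cinner x y"]
      by (simp add: algebra_simps)
    also have "cnj c * cnj (cinner x y) = of_real (t * b\<^sup>2)"
      unfolding c_def b_def using complex_norm_square[of "cinner x y"]
      by (simp add: algebra_simps)
    also have "cnj c * c = of_real (t\<^sup>2 * b\<^sup>2)"
      unfolding c_def b_def using complex_norm_square[of "cinner x y"]
      by (simp add: algebra_simps power2_eq_square)
    finally show ?thesis
      by (simp add: cinner_self a_def d_def)
  qed
  have "b\<^sup>2 \<le> a * d"
  proof (cases "d = 0")
    case True
    have "b = 0"
    proof (rule ccontr)
      assume "b \<noteq> 0"
      then show False
        using key[of "(a + 1) / (2 * b\<^sup>2)"] True by simp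
    qed
    then show ?thesis using True by simp
  next
    case False
    then have "d > 0"
      unfolding d_def by simp
    then show ?thesis
      using key[of "1 / d"] by (simp add: field_simps power2_eq_square)
  qed
  also have "a * d = (seminorm x * seminorm y)\<^sup>2"
    by (simp add: a_def d_def power_mult_distrib)
  finally show ?thesis
    unfolding b_def by (rule power2_le_imp_le) simp
qed

lemma seminorm_triangle: "seminorm (x + y) \<le> seminorm x + seminorm y"
proof (rule power2_le_imp_le)
  have "complex_of_real ((seminorm (x + y))\<^sup>2) =
      cinner x x + cinner y y + cinner x y + cnj (cinner x y)"
    using cinner_commute[of y x]
    by (simp only: cinner_self[symmetric]) (simp add: cinner_add_left cinner_add_right)
  then have "Re (complex_of_real ((seminorm (x + y))\<^sup>2)) =
      Re (cinner x x + cinner y y + cinner x y + cnj (cinner x y))"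
    by simp
  then have "(seminorm (x + y))\<^sup>2 = (seminorm x)\<^sup>2 + (seminorm y)\<^sup>2 + 2 * Re (cinner x y)"
    by (simp add: cinner_self)
  also have "Re (cinner x y) \<le> seminorm x * seminorm y"
    using cinner_Cauchy_Schwarz complex_Re_le_cmod order_trans by blast
  finally show "(seminorm (x + y))\<^sup>2 \<le> (seminorm x + seminorm y)\<^sup>2"
    by (simp add: power2_sum)
qed simp

lemma seminorm_triangle_diff: "seminorm (x - z) \<le> seminorm (x - y) + seminorm (y - z)"
  using seminorm_triangle[of "x - y" "y - z"] by (simp add: algebra_simps)

lemma seminorm_abs_diff: "\<bar>seminorm x - seminorm y\<bar> \<le> seminorm (x - y)"
  using seminorm_triangle[of "x - y" y] seminorm_triangle[of "y - x" x]
  by (simp add: seminorm_minus_commute abs_le_iff)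

end

lemma norm_eq_seminorm: "norm (x :: 'a::complex_inner) = seminorm x"
  by (simp add: norm_eq_sqrt_inner inner_eq_Re_cinner seminorm_def)

instantiation complex :: complex_hilbert
begin
definition scaleC_complex :: "complex \<Rightarrow> complex \<Rightarrow> complex" where "scaleC_complex = (*)"
definition cinner_complex :: "complex \<Rightarrow> complex \<Rightarrow> complex" where "cinner_complex x y = cnj x * y"
instance
  by standard (auto simp: scaleC_complex_def cinner_complex_def algebra_simps inner_complex_def
      scaleR_conv_of_real)
end

instantiation prod :: (scaleC, scaleC) scaleC
begin
definition scaleC_prod :: "complex \<Rightarrow> 'a \<times> 'b \<Rightarrow> 'a \<times> 'b"
  where "scaleC_prod c x = (c *\<^sub>C fst x, c *\<^sub>C snd x)"
instance ..
end

instance prod :: (complex_vector, complex_vector) complex_vector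
  by standard (auto simp: scaleC_prod_def scaleC_add_right scaleC_add_left)

instantiation prod :: (complex_inner, complex_inner) complex_inner
begin
definition cinner_prod :: "'a \<times> 'b \<Rightarrow> 'a \<times> 'b \<Rightarrow> complex"
  where "cinner_prod x y = cinner (fst x) (fst y) + cinner (snd x) (snd y)"
instance
proof
  fix x y z :: "'a \<times> 'b" and c :: complex and r :: real
  show "cinner x y = cnj (cinner y x)"
    unfolding cinner_prod_def complex_cnj_add by (metis cinner_commute)
  show "cinner x (y + z) = cinner x y + cinner x z"
    by (simp add: cinner_prod_def cinner_add_right)
  show "cinner x (c *\<^sub>C y) = c * cinner x y"
    by (simp add: cinner_prod_def scaleC_prod_def cinner_scaleC_right algebra_simps)
  show "0 \<le> Re (cinner x x)"
    by (simp add: cinner_prod_def Re_cinner_self)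
  show "r *\<^sub>R x = complex_of_real r *\<^sub>C x"
    by (simp add: scaleC_prod_def scaleR_prod_def scaleR_scaleC)
  show "x \<bullet> y = Re (cinner x y)"
    by (simp add: inner_prod_def cinner_prod_def inner_eq_Re_cinner)
qed
end

instance prod :: (complex_hilbert, complex_hilbert) complex_hilbert ..


section \<open>Hilbert space completion of a semi-inner product space\<close>

text \<open>The completion is formed from Cauchy sequences; null vectors are identified with 0.\<close>

definition seminorm_Cauchy :: "(nat \<Rightarrow> 'a::semi_inner) \<Rightarrow> bool" where
  "seminorm_Cauchy X \<longleftrightarrow> (\<forall>e>0. \<exists>N. \<forall>m\<ge>N. \<forall>n\<ge>N. seminorm (X m - X n) < e)"

definition completion_rel :: "(nat \<Rightarrow> 'a::semi_inner) \<Rightarrow> (nat \<Rightarrow> 'a) \<Rightarrow> bool" where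
  "completion_rel X Y \<longleftrightarrow>
     seminorm_Cauchy X \<and> seminorm_Cauchy Y \<and> (\<lambda>n. seminorm (X n - Y n)) \<longlonglongrightarrow> 0"

lemma seminorm_CauchyI:
  assumes "\<And>e. e > 0 \<Longrightarrow> \<exists>N. \<forall>m\<ge>N. \<forall>n\<ge>N. seminorm (X m - X n) \<le> e"
  shows "seminorm_Cauchy X"
  unfolding seminorm_Cauchy_def
proof (intro allI impI)
  fix e :: real assume "e > 0"
  then obtain N where "\<forall>m\<ge>N. \<forall>n\<ge>N. seminorm (X m - X n) \<le> e / 2"
    using assms[of "e / 2"] by auto
  moreover have "e / 2 < e" using \<open>e > 0\<close> by simp
  ultimately show "\<exists>N. \<forall>m\<ge>N. \<forall>n\<ge>N. seminorm (X m - X n) < e"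
    by (meson le_less_trans)
qed

lemma seminorm_Cauchy_const [simp]: "seminorm_Cauchy (\<lambda>_. x)"
  by (simp add: seminorm_Cauchy_def)

lemma seminorm_Cauchy_add:
  assumes "seminorm_Cauchy X" "seminorm_Cauchy Y"
  shows "seminorm_Cauchy (\<lambda>n. X n + Y n)"
  unfolding seminorm_Cauchy_def
proof (intro allI impI)
  fix e :: real assume e: "e > 0"
  obtain M where M: "\<forall>m\<ge>M. \<forall>n\<ge>M. seminorm (X m - X n) < e / 2"
    using assms(1) e unfolding seminorm_Cauchy_def by (meson half_gt_zero)
  obtain N where N: "\<forall>m\<ge>N. \<forall>n\<ge>N. seminorm (Y m - Y n) < e / 2"
    using assms(2) e unfolding seminorm_Cauchy_def by (meson half_gt_zero)
  have "seminorm ((X m + Y m) - (X n + Y n)) < e" if "m \<ge> max M N" "n \<ge> max M N" for m n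
  proof -
    have "(X m + Y m) - (X n + Y n) = (X m - X n) + (Y m - Y n)" by simp
    then have "seminorm ((X m + Y m) - (X n + Y n)) \<le> seminorm (X m - X n) + seminorm (Y m - Y n)"
      by (metis seminorm_triangle)
    also have "\<dots> < e / 2 + e / 2"
      using M N that by (intro add_strict_mono) auto
    finally show ?thesis by simp
  qed
  then show "\<exists>N. \<forall>m\<ge>N. \<forall>n\<ge>N. seminorm (X m + Y m - (X n + Y n)) < e"
    by blast
qed

lemma seminorm_Cauchy_scaleC:
  assumes "seminorm_Cauchy X"
  shows "seminorm_Cauchy (\<lambda>n. c *\<^sub>C X n)"
proof (rule seminorm_CauchyI)
  fix e :: real assume e: "e > 0"
  have pos: "cmod c + 1 > 0" by (simp add: add_nonneg_pos)
  then obtain N where N: "\<forall>m\<ge>N. \<forall>n\<ge>N. seminorm (X m - X n) < e / (cmod c + 1)"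
    using assms e unfolding seminorm_Cauchy_def by (meson divide_pos_pos)
  have "seminorm (c *\<^sub>C X m - c *\<^sub>C X n) \<le> e" if "m \<ge> N" "n \<ge> N" for m n
  proof -
    have "seminorm (c *\<^sub>C X m - c *\<^sub>C X n) = cmod c * seminorm (X m - X n)"
      by (simp add: cvec.scale_right_diff_distrib[symmetric] seminorm_scaleC)
    also have "\<dots> \<le> (cmod c + 1) * (e / (cmod c + 1))"
      using N that by (intro mult_mono) (auto intro: less_imp_le)
    finally show ?thesis using pos by simp
  qed
  then show "\<exists>N. \<forall>m\<ge>N. \<forall>n\<ge>N. seminorm (c *\<^sub>C X m - c *\<^sub>C X n) \<le> e"
    by blast
qed

lemma seminorm_Cauchy_minus: "seminorm_Cauchy X \<Longrightarrow> seminorm_Cauchy (\<lambda>n. - X n)"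
  using seminorm_Cauchy_scaleC[of X "-1"] by (simp add: cvec.scale_minus_left)

lemma seminorm_Cauchy_bounded:
  assumes "seminorm_Cauchy X"
  obtains B where "B > 0" "\<And>n. seminorm (X n) \<le> B"
proof -
  obtain N where N: "\<forall>m\<ge>N. \<forall>n\<ge>N. seminorm (X m - X n) < 1"
    using assms unfolding seminorm_Cauchy_def by (meson zero_less_one)
  define B where "B = 1 + seminorm (X N) + (\<Sum>i<N. seminorm (X i))"
  have "seminorm (X n) \<le> B" for n
  proof (cases "n < N")
    case True
    then have "seminorm (X n) \<le> (\<Sum>i<N. seminorm (X i))"
      by (intro member_le_sum) auto
    then show ?thesis
      unfolding B_def using seminorm_ge_0[of "X N"] by linarith
  next
    case False
    then have "seminorm (X n - X N) < 1" using N by simp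
    moreover have "seminorm (X n) \<le> seminorm (X n - X N) + seminorm (X N)"
      using seminorm_triangle[of "X n - X N" "X N"] by simp
    moreover have "0 \<le> (\<Sum>i<N. seminorm (X i))"
      by (simp add: sum_nonneg)
    ultimately show ?thesis
      unfolding B_def by linarith
  qed
  moreover have "B > 0"
    unfolding B_def by (simp add: add_pos_nonneg sum_nonneg)
  ultimately show ?thesis using that by blast
qed

lemma cinner_diff_bound:
  "cmod (cinner x y - cinner x' y') \<le> seminorm (x - x') * seminorm y + seminorm x' * seminorm (y - y')"
proof -
  have "cinner x y - cinner x' y' = cinner (x - x') y + cinner x' (y - y')"
    by (simp add: cinner_diff_left cinner_diff_right)
  then have "cmod (cinner x y - cinner x' y') \<le> cmod (cinner (x - x') y) + cmod (cinner x' (y - y'))"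
    by (simp add: norm_triangle_ineq)
  also have "\<dots> \<le> seminorm (x - x') * seminorm y + seminorm x' * seminorm (y - y')"
    by (intro add_mono cinner_Cauchy_Schwarz)
  finally show ?thesis .
qed

lemma seminorm_Cauchy_cinner:
  assumes "seminorm_Cauchy X" "seminorm_Cauchy Y"
  shows "convergent (\<lambda>n. cinner (X n) (Y n))"
proof -
  obtain A where A: "A > 0" "\<And>n. seminorm (X n) \<le> A"
    using seminorm_Cauchy_bounded[OF assms(1)] by blast
  obtain B where B: "B > 0" "\<And>n. seminorm (Y n) \<le> B"
    using seminorm_Cauchy_bounded[OF assms(2)] by blast
  have "Cauchy (\<lambda>n. cinner (X n) (Y n))"
  proof (rule metric_CauchyI)
    fix e :: real assume e: "e > 0"
    obtain M where M: "\<forall>m\<ge>M. \<forall>n\<ge>M. seminorm (X m - X n) < e / (2 * B)"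
      using assms(1) e B(1) unfolding seminorm_Cauchy_def
      by (meson divide_pos_pos mult_pos_pos zero_less_numeral)
    obtain N where N: "\<forall>m\<ge>N. \<forall>n\<ge>N. seminorm (Y m - Y n) < e / (2 * A)"
      using assms(2) e A(1) unfolding seminorm_Cauchy_def
      by (meson divide_pos_pos mult_pos_pos zero_less_numeral)
    have "dist (cinner (X m) (Y m)) (cinner (X n) (Y n)) < e"
      if "m \<ge> max M N" "n \<ge> max M N" for m n
    proof -
      have "dist (cinner (X m) (Y m)) (cinner (X n) (Y n)) \<le>
          seminorm (X m - X n) * seminorm (Y m) + seminorm (X n) * seminorm (Y m - Y n)"
        unfolding dist_norm by (rule cinner_diff_bound)
      also have "\<dots> \<le> seminorm (X m - X n) * B + A * seminorm (Y m - Y n)"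
        using A B by (intro add_mono mult_mono) (auto intro: less_imp_le)
      also have "\<dots> < e / (2 * B) * B + A * (e / (2 * A))"
        using A B M N that by (intro add_strict_mono mult_strict_right_mono mult_strict_left_mono) auto
      also have "\<dots> = e" using A B by simp
      finally show ?thesis .
    qed
    then show "\<exists>N. \<forall>m\<ge>N. \<forall>n\<ge>N. dist (cinner (X m) (Y m)) (cinner (X n) (Y n)) < e"
      by blast
  qed
  then show ?thesis
    by (simp add: Cauchy_convergent_iff)
qed

lemma cinner_lim_cong:
  assumes X: "completion_rel X X'" and Y: "completion_rel Y Y'"
  shows "lim (\<lambda>n. cinner (X n) (Y n)) = lim (\<lambda>n. cinner (X' n) (Y' n))"
proof -
  obtain A where A: "A > 0" "\<And>n. seminorm (X' n) \<le> A"
    using seminorm_Cauchy_bounded X unfolding completion_rel_def by metis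
  obtain B where B: "B > 0" "\<And>n. seminorm (Y n) \<le> B"
    using seminorm_Cauchy_bounded Y unfolding completion_rel_def by metis
  have lim0: "(\<lambda>n. cinner (X n) (Y n) - cinner (X' n) (Y' n)) \<longlonglongrightarrow> 0"
  proof (rule Lim_null_comparison)
    show "\<forall>\<^sub>F n in sequentially. norm (cinner (X n) (Y n) - cinner (X' n) (Y' n))
        \<le> seminorm (X n - X' n) * B + A * seminorm (Y n - Y' n)"
    proof (rule always_eventually, rule allI)
      fix n
      have "cmod (cinner (X n) (Y n) - cinner (X' n) (Y' n)) \<le>
          seminorm (X n - X' n) * seminorm (Y n) + seminorm (X' n) * seminorm (Y n - Y' n)"
        by (rule cinner_diff_bound)
      also have "\<dots> \<le> seminorm (X n - X' n) * B + A * seminorm (Y n - Y' n)"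
        using A B by (intro add_mono mult_mono) (auto intro: less_imp_le)
      finally show "norm (cinner (X n) (Y n) - cinner (X' n) (Y' n))
        \<le> seminorm (X n - X' n) * B + A * seminorm (Y n - Y' n)" .
    qed
    have "(\<lambda>n. seminorm (X n - X' n) * B + A * seminorm (Y n - Y' n)) \<longlonglongrightarrow> 0 * B + A * 0"
      using X Y unfolding completion_rel_def by (intro tendsto_intros) auto
    then show "(\<lambda>n. seminorm (X n - X' n) * B + A * seminorm (Y n - Y' n)) \<longlonglongrightarrow> 0"
      by simp
  qed
  have "(\<lambda>n. cinner (X n) (Y n)) \<longlonglongrightarrow> lim (\<lambda>n. cinner (X n) (Y n))"
    using X Y seminorm_Cauchy_cinner convergent_LIMSEQ_iff unfolding completion_rel_def by blast
  from tendsto_diff[OF this lim0]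
  have "(\<lambda>n. cinner (X' n) (Y' n)) \<longlonglongrightarrow> lim (\<lambda>n. cinner (X n) (Y n))"
    by simp
  then show ?thesis by (simp add: limI)
qed

quotient_type (overloaded) 'a completion = "nat \<Rightarrow> 'a::semi_inner" / partial: completion_rel
proof (rule part_equivpI)
  show "\<exists>X::nat \<Rightarrow> 'a. completion_rel X X"
    by (rule exI[of _ "\<lambda>_. 0"]) (simp add: completion_rel_def)
  show "symp (completion_rel :: (nat \<Rightarrow> 'a) \<Rightarrow> _)"
    by (rule sympI) (auto simp: completion_rel_def seminorm_minus_commute)
  show "transp (completion_rel :: (nat \<Rightarrow> 'a) \<Rightarrow> _)"
  proof (rule transpI)
    fix X Y Z :: "nat \<Rightarrow> 'a"
    assume XY: "completion_rel X Y" and YZ: "completion_rel Y Z"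
    have "(\<lambda>n. seminorm (X n - Z n)) \<longlonglongrightarrow> 0"
    proof (rule tendsto_sandwich)
      show "\<forall>\<^sub>F n in sequentially. 0 \<le> seminorm (X n - Z n)" by simp
      show "\<forall>\<^sub>F n in sequentially. seminorm (X n - Z n) \<le> seminorm (X n - Y n) + seminorm (Y n - Z n)"
        by (simp add: seminorm_triangle_diff)
      show "(\<lambda>n. seminorm (X n - Y n) + seminorm (Y n - Z n)) \<longlonglongrightarrow> 0"
        using tendsto_add[of "\<lambda>n. seminorm (X n - Y n)" 0 sequentially "\<lambda>n. seminorm (Y n - Z n)" 0]
          XY YZ by (simp add: completion_rel_def)
    qed simp
    then show "completion_rel X Z"
      using XY YZ by (simp add: completion_rel_def)
  qed
qed

lemma completion_rel_add:
  assumes "completion_rel X X'" "completion_rel Y Y'"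
  shows "completion_rel (\<lambda>n. X n + Y n) (\<lambda>n. X' n + Y' n)"
proof -
  have "(\<lambda>n. seminorm (X n + Y n - (X' n + Y' n))) \<longlonglongrightarrow> 0"
  proof (rule tendsto_sandwich[where f = "\<lambda>_. 0" and h = "\<lambda>n. seminorm (X n - X' n) + seminorm (Y n - Y' n)"])
    have "seminorm (X n + Y n - (X' n + Y' n)) \<le> seminorm (X n - X' n) + seminorm (Y n - Y' n)" for n
      using seminorm_triangle[of "X n - X' n" "Y n - Y' n"] by (simp add: algebra_simps)
    then show "\<forall>\<^sub>F n in sequentially. seminorm (X n + Y n - (X' n + Y' n))
        \<le> seminorm (X n - X' n) + seminorm (Y n - Y' n)" by simp
    show "(\<lambda>n. seminorm (X n - X' n) + seminorm (Y n - Y' n)) \<longlonglongrightarrow> 0"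
      using tendsto_add[of "\<lambda>n. seminorm (X n - X' n)" 0 sequentially "\<lambda>n. seminorm (Y n - Y' n)" 0]
        assms by (simp add: completion_rel_def)
  qed simp_all
  then show ?thesis
    using assms by (simp add: completion_rel_def seminorm_Cauchy_add)
qed

lemma completion_rel_scaleC:
  assumes "completion_rel X X'"
  shows "completion_rel (\<lambda>n. c *\<^sub>C X n) (\<lambda>n. c *\<^sub>C X' n)"
proof -
  have "(\<lambda>n. cmod c * seminorm (X n - X' n)) \<longlonglongrightarrow> cmod c * 0"
    using assms by (intro tendsto_intros) (simp add: completion_rel_def)
  then show ?thesis
    using assms by (simp add: completion_rel_def seminorm_Cauchy_scaleC
        cvec.scale_right_diff_distrib[symmetric] seminorm_scaleC)
qed

lemma completion_rel_minus:
  "completion_rel X X' \<Longrightarrow> completion_rel (\<lambda>n. - X n) (\<lambda>n. - X' n)"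
  using completion_rel_scaleC[of X X' "-1"] by (simp add: cvec.scale_minus_left)

instantiation completion :: (semi_inner) complex_inner
begin

lift_definition zero_completion :: "'a completion" is "\<lambda>_. 0"
  by (simp add: completion_rel_def)
lift_definition plus_completion :: "'a completion \<Rightarrow> 'a completion \<Rightarrow> 'a completion"
  is "\<lambda>X Y n. X n + Y n" by (rule completion_rel_add)
lift_definition uminus_completion :: "'a completion \<Rightarrow> 'a completion"
  is "\<lambda>X n. - X n" by (rule completion_rel_minus)
lift_definition minus_completion :: "'a completion \<Rightarrow> 'a completion \<Rightarrow> 'a completion"
  is "\<lambda>X Y n. X n - Y n"
  using completion_rel_add[OF _ completion_rel_minus] by fastforce
lift_definition scaleC_completion :: "complex \<Rightarrow> 'a completion \<Rightarrow> 'a completion"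
  is "\<lambda>c X n. c *\<^sub>C X n" by (rule completion_rel_scaleC)
lift_definition cinner_completion :: "'a completion \<Rightarrow> 'a completion \<Rightarrow> complex"
  is "\<lambda>X Y. lim (\<lambda>n. cinner (X n) (Y n))" by (rule cinner_lim_cong)

definition scaleR_completion :: "real \<Rightarrow> 'a completion \<Rightarrow> 'a completion"
  where "scaleR_completion r x = complex_of_real r *\<^sub>C x"
definition inner_completion :: "'a completion \<Rightarrow> 'a completion \<Rightarrow> real"
  where "inner_completion x y = Re (cinner x y)"
definition norm_completion :: "'a completion \<Rightarrow> real"
  where "norm_completion x = sqrt (x \<bullet> x)"
definition dist_completion :: "'a completion \<Rightarrow> 'a completion \<Rightarrow> real"
  where "dist_completion x y = norm (x - y)"
definition sgn_completion :: "'a completion \<Rightarrow> 'a completion"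
  where "sgn_completion x = inverse (norm x) *\<^sub>R x"
definition uniformity_completion :: "('a completion \<times> 'a completion) filter"
  where "uniformity_completion = (INF e\<in>{0 <..}. principal {(x, y). dist x y < e})"
definition open_completion :: "'a completion set \<Rightarrow> bool"
  where "open_completion U \<longleftrightarrow> (\<forall>x\<in>U. eventually (\<lambda>(x', y). x' = x \<longrightarrow> y \<in> U) uniformity)"

instance
proof
  fix x y z :: "'a completion" and a b :: complex and r s :: real
  show add_assoc: "x + y + z = x + (y + z)"
    by transfer (auto simp: add.assoc completion_rel_def intro!: seminorm_Cauchy_add)
  show "x + y = y + x"
    by transfer (auto simp: add.commute completion_rel_def intro!: seminorm_Cauchy_add)
  show "0 + x = x"
    by transfer (auto simp: completion_rel_def)
  show "- x + x = 0"
    by transfer (auto simp: completion_rel_def)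
  show "x - y = x + - y"
    by transfer (use completion_rel_add[OF _ completion_rel_minus] in fastforce)
  show 1: "a *\<^sub>C (x + y) = a *\<^sub>C x + a *\<^sub>C y" for a and x y :: "'a completion"
    by transfer (simp add: scaleC_add_right completion_rel_add completion_rel_scaleC)
  show 2: "(a + b) *\<^sub>C x = a *\<^sub>C x + b *\<^sub>C x" for a b and x :: "'a completion"
    by transfer (simp add: scaleC_add_left completion_rel_add completion_rel_scaleC)
  show 3: "a *\<^sub>C b *\<^sub>C x = (a * b) *\<^sub>C x" for a b and x :: "'a completion"
    by transfer (simp add: completion_rel_scaleC)
  show 4: "1 *\<^sub>C x = x" for x :: "'a completion"
    by transfer simp
  have conv: "(\<lambda>n. cinner (X n) (Y n)) \<longlonglongrightarrow> lim (\<lambda>n. cinner (X n) (Y n))"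
    if "completion_rel X X" "completion_rel Y Y" for X Y :: "nat \<Rightarrow> 'a"
    using that seminorm_Cauchy_cinner convergent_LIMSEQ_iff unfolding completion_rel_def by blast
  show c1: "cinner x y = cnj (cinner y x)" for x y :: "'a completion"
  proof transfer
    fix X Y :: "nat \<Rightarrow> 'a"
    assume "completion_rel X X" "completion_rel Y Y"
    then have "(\<lambda>n. cnj (cinner (Y n) (X n))) \<longlonglongrightarrow> cnj (lim (\<lambda>n. cinner (Y n) (X n)))"
      by (intro tendsto_cnj conv)
    then show "lim (\<lambda>n. cinner (X n) (Y n)) = cnj (lim (\<lambda>n. cinner (Y n) (X n)))"
      by (subst cinner_commute) (rule limI)
  qed
  show c2: "cinner x (y + z) = cinner x y + cinner x z" for x y z :: "'a completion"
  proof transfer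
    fix X Y Z :: "nat \<Rightarrow> 'a"
    assume "completion_rel X X" "completion_rel Y Y" "completion_rel Z Z"
    then show "lim (\<lambda>n. cinner (X n) (Y n + Z n)) =
        lim (\<lambda>n. cinner (X n) (Y n)) + lim (\<lambda>n. cinner (X n) (Z n))"
      by (intro limI) (simp add: cinner_add_right tendsto_add conv)
  qed
  show c3: "cinner x (a *\<^sub>C y) = a * cinner x y" for a and x y :: "'a completion"
  proof transfer
    fix a and X Y :: "nat \<Rightarrow> 'a"
    assume "completion_rel X X" "completion_rel Y Y"
    then show "lim (\<lambda>n. cinner (X n) (a *\<^sub>C Y n)) = a * lim (\<lambda>n. cinner (X n) (Y n))"
      by (intro limI) (simp add: cinner_scaleC_right tendsto_mult conv)
  qed
  show c4: "0 \<le> Re (cinner x x)" for x :: "'a completion"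
  proof transfer
    fix X :: "nat \<Rightarrow> 'a"
    assume "completion_rel X X"
    then have "(\<lambda>n. Re (cinner (X n) (X n))) \<longlonglongrightarrow> Re (lim (\<lambda>n. cinner (X n) (X n)))"
      by (intro tendsto_Re conv)
    then show "0 \<le> Re (lim (\<lambda>n. cinner (X n) (X n)))"
      by (rule tendsto_lowerbound) (auto simp: Re_cinner_self)
  qed
  show sc: "r *\<^sub>R x = complex_of_real r *\<^sub>C x" for r and x :: "'a completion"
    by (simp add: scaleR_completion_def)
  show ip: "x \<bullet> y = Re (cinner x y)" for x y :: "'a completion"
    by (simp add: inner_completion_def)
  show "r *\<^sub>R (x + y) = r *\<^sub>R x + r *\<^sub>R y" by (simp add: sc 1)
  show "(r + s) *\<^sub>R x = r *\<^sub>R x + s *\<^sub>R x"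
    by (simp add: sc 2)
  show "r *\<^sub>R s *\<^sub>R x = (r * s) *\<^sub>R x" by (simp add: sc 3)
  show "1 *\<^sub>R x = x" by (simp add: sc 4)
  show "dist x y = norm (x - y)" by (rule dist_completion_def)
  show "sgn x = inverse (norm x) *\<^sub>R x" by (rule sgn_completion_def)
  show "norm x = sqrt (x \<bullet> x)" by (rule norm_completion_def)
  show "x \<bullet> y = y \<bullet> x"
    unfolding ip by (subst c1) simp
  show "(x + y) \<bullet> z = x \<bullet> z + y \<bullet> z"
    unfolding ip using c1[of z "x + y"] c1[of z x] c1[of z y] c2[of z x y]
    by (metis c1 complex_cnj_add plus_complex.simps(1))
  show "(r *\<^sub>R x) \<bullet> y = r * (x \<bullet> y)"
  proof -
    have "cinner (complex_of_real r *\<^sub>C x) y = complex_of_real r * cinner x y"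
      by (metis c1 c3 complex_cnj_complex_of_real complex_cnj_mult)
    then show ?thesis by (simp add: ip sc)
  qed
  show "0 \<le> x \<bullet> x" by (simp add: ip c4)
  show "(x \<bullet> x = 0) = (x = 0)"
    unfolding ip
  proof transfer
    fix X :: "nat \<Rightarrow> 'a"
    assume X: "completion_rel X X"
    then have "(\<lambda>n. Re (cinner (X n) (X n))) \<longlonglongrightarrow> Re (lim (\<lambda>n. cinner (X n) (X n)))"
      by (intro tendsto_Re conv)
    then have *: "(\<lambda>n. (seminorm (X n))\<^sup>2) \<longlonglongrightarrow> Re (lim (\<lambda>n. cinner (X n) (X n)))"
      by (simp add: cinner_self)
    show "Re (lim (\<lambda>n. cinner (X n) (X n))) = 0 \<longleftrightarrow> completion_rel X (\<lambda>_. 0)"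
    proof
      assume "Re (lim (\<lambda>n. cinner (X n) (X n))) = 0"
      then have "(\<lambda>n. sqrt ((seminorm (X n))\<^sup>2)) \<longlonglongrightarrow> sqrt 0"
        using * by (intro tendsto_real_sqrt) simp
      then show "completion_rel X (\<lambda>_. 0)"
        using X by (simp add: completion_rel_def)
    next
      assume "completion_rel X (\<lambda>_. 0)"
      then have "(\<lambda>n. (seminorm (X n))\<^sup>2) \<longlonglongrightarrow> 0\<^sup>2"
        by (intro tendsto_power) (simp add: completion_rel_def)
      then show "Re (lim (\<lambda>n. cinner (X n) (X n))) = 0"
        using LIMSEQ_unique[OF *] by simp
    qed
  qed
  show "uniformity = (INF e\<in>{0 <..}. principal {(x, y :: 'a completion). dist x y < e})"
    by (rule uniformity_completion_def)
  show "open U = (\<forall>x\<in>U. eventually (\<lambda>(x', y). x' = x \<longrightarrow> y \<in> U) uniformity)"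
    for U :: "'a completion set"
    by (rule open_completion_def)
qed
end

lift_definition to_completion :: "'a::semi_inner \<Rightarrow> 'a completion" is "\<lambda>x _. x"
  by (simp add: completion_rel_def)

lemma to_completion_add: "to_completion (x + y) = to_completion x + to_completion y"
  by transfer (simp add: completion_rel_def)

lemma to_completion_scaleC: "to_completion (c *\<^sub>C x) = c *\<^sub>C to_completion x"
  by transfer (simp add: completion_rel_def)

lemma to_completion_minus: "to_completion (- x) = - to_completion x"
  by transfer (simp add: completion_rel_def)

lemma to_completion_diff: "to_completion (x - y) = to_completion x - to_completion y"
  by transfer (simp add: completion_rel_def)

lemma cinner_to_completion [simp]: "cinner (to_completion x) (to_completion y) = cinner x y"
  by transfer simp

lemma norm_to_completion [simp]: "norm (to_completion x) = seminorm x"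
  by (simp add: norm_eq_seminorm seminorm_def)

lemma norm_diff_to_completion:
  assumes X: "completion_rel X X"
  shows "(\<lambda>n. seminorm (X n - y)) \<longlonglongrightarrow> norm (abs_completion X - to_completion y)"
proof -
  define Z where "Z = (\<lambda>n. X n - y)"
  have Z: "completion_rel Z Z"
    using X unfolding Z_def completion_rel_def
    using seminorm_Cauchy_add[of X "\<lambda>_. - y"] by simp
  have eq: "abs_completion X - to_completion y = abs_completion Z"
    unfolding to_completion.abs_eq Z_def
    by (subst minus_completion.abs_eq) (use X in \<open>auto simp: completion_rel_def\<close>)
  have "(\<lambda>n. cinner (Z n) (Z n)) \<longlonglongrightarrow> lim (\<lambda>n. cinner (Z n) (Z n))"
    using Z seminorm_Cauchy_cinner convergent_LIMSEQ_iff unfolding completion_rel_def by blast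
  also have "lim (\<lambda>n. cinner (Z n) (Z n)) = cinner (abs_completion Z) (abs_completion Z)"
    by (simp add: cinner_completion.abs_eq Z)
  finally have "(\<lambda>n. sqrt (Re (cinner (Z n) (Z n)))) \<longlonglongrightarrow>
      sqrt (Re (cinner (abs_completion Z) (abs_completion Z)))"
    by (intro tendsto_intros)
  then show ?thesis
    unfolding eq by (simp add: Z_def norm_eq_seminorm seminorm_def)
qed

lemma to_completion_approx:
  assumes X: "completion_rel X X"
  shows "(\<lambda>n. to_completion (X n)) \<longlonglongrightarrow> abs_completion X"
proof (rule metric_LIMSEQ_I)
  fix e :: real assume "e > 0"
  then obtain N where N: "\<forall>m\<ge>N. \<forall>n\<ge>N. seminorm (X m - X n) < e / 2"
    using X unfolding completion_rel_def seminorm_Cauchy_def by (meson half_gt_zero)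
  have "dist (to_completion (X n)) (abs_completion X) < e" if "n \<ge> N" for n
  proof -
    have "norm (abs_completion X - to_completion (X n)) \<le> e / 2"
      by (rule tendsto_upperbound[OF norm_diff_to_completion[OF X]])
        (use N that in \<open>auto intro!: eventually_sequentiallyI[of N] less_imp_le\<close>)
    then show ?thesis
      using \<open>e > 0\<close> by (simp add: dist_norm norm_minus_commute)
  qed
  then show "\<exists>N. \<forall>n\<ge>N. dist (to_completion (X n)) (abs_completion X) < e"
    by blast
qed

lemma to_completion_dense: "closure (range to_completion) = UNIV"
proof -
  have "x \<in> closure (range to_completion)" for x :: "'a completion"
  proof (induction x rule: completion.abs_induct)
    case (1 X)
    then have "(\<lambda>n. to_completion (X n)) \<longlonglongrightarrow> abs_completion X"
      by (rule to_completion_approx)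
    then show ?case
      unfolding closure_sequential by (intro exI[of _ "\<lambda>n. to_completion (X n)"]) simp
  qed
  then show ?thesis by blast
qed

instance completion :: (semi_inner) complex_hilbert
proof
  fix x :: "nat \<Rightarrow> 'a completion"
  assume x: "Cauchy x"
  have "\<exists>a. norm (x n - to_completion a) < inverse (real (Suc n))" for n
  proof -
    have "x n \<in> closure (range to_completion)" by (simp add: to_completion_dense)
    then show ?thesis
      unfolding closure_approachable
      by (metis dist_norm inverse_positive_iff_positive norm_minus_commute of_nat_0_less_iff
          rangeE zero_less_Suc)
  qed
  then obtain a where a: "\<And>n. norm (x n - to_completion (a n)) < inverse (real (Suc n))"
    by metis
  then have lim0: "(\<lambda>n. x n - to_completion (a n)) \<longlonglongrightarrow> 0"
    by (intro Lim_null_comparison[OF _ LIMSEQ_inverse_real_of_nat])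
      (auto intro: less_imp_le always_eventually)
  have "Cauchy (\<lambda>n. to_completion (a n))"
  proof (rule CauchyI)
    fix e :: real assume "e > 0"
    then have e3: "e / 3 > 0" by simp
    obtain M where M: "\<And>m n. m \<ge> M \<Longrightarrow> n \<ge> M \<Longrightarrow> norm (x m - x n) < e / 3"
      using CauchyD[OF x e3] by blast
    obtain N where N: "\<And>n. n \<ge> N \<Longrightarrow> norm (x n - to_completion (a n) - 0) < e / 3"
      using LIMSEQ_D[OF lim0 e3] by blast
    have "norm (to_completion (a m) - to_completion (a n)) < e"
      if "m \<ge> max M N" "n \<ge> max M N" for m n
    proof -
      let ?d = "\<lambda>n. x n - to_completion (a n)"
      have "to_completion (a m) - to_completion (a n) = (x m - x n) - ?d m + ?d n"
        by simp
      also have "norm \<dots> \<le> norm (x m - x n) + norm (?d m) + norm (?d n)"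
        by (meson add_right_mono norm_triangle_ineq norm_triangle_ineq4 order_trans)
      also have "\<dots> < e / 3 + e / 3 + e / 3"
        using M[of m n] N[of m] N[of n] that by (intro add_strict_mono) auto
      finally show ?thesis by simp
    qed
    then show "\<exists>M. \<forall>m\<ge>M. \<forall>n\<ge>M. norm (to_completion (a m) - to_completion (a n)) < e"
      by blast
  qed
  then have "seminorm_Cauchy a"
    unfolding seminorm_Cauchy_def Cauchy_iff by (simp add: to_completion_diff[symmetric])
  then have "completion_rel a a" by (simp add: completion_rel_def)
  from to_completion_approx[OF this] have "(\<lambda>n. to_completion (a n) + (x n - to_completion (a n))) \<longlonglongrightarrow> abs_completion a + 0"
    by (intro tendsto_add lim0)
  then show "convergent x"
    by (auto simp: convergent_def)
qed


section \<open>Hilbert spaces generated by positive definite kernels\<close>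

text \<open>For a positive definite kernel on a type of symbols, the finitely supported formal complex
  combinations of symbols form a semi-inner product space, whose completion is the Hilbert space
  generated by the symbols with the kernel as their inner products.\<close>

definition pos_def_on :: "'i set \<Rightarrow> ('i \<Rightarrow> 'i \<Rightarrow> complex) \<Rightarrow> bool" where
  "pos_def_on I K \<longleftrightarrow> (\<forall>c. 0 \<le> Re (\<Sum>i\<in>I. \<Sum>j\<in>I. cnj (c i) * c j * K i j))"

class pd_kernel =
  fixes ker :: "'a \<Rightarrow> 'a \<Rightarrow> complex"
  assumes ker_commute: "ker x y = cnj (ker y x)"
    and ker_pos_def: "finite I \<Longrightarrow> pos_def_on I ker"

typedef 'a formal = "{f :: 'a \<Rightarrow> complex. finite {x. f x \<noteq> 0}}"
  morphisms formal_coeff formal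
  by (rule exI[of _ "\<lambda>_. 0"]) simp

setup_lifting type_definition_formal

instantiation formal :: (type) complex_vector
begin
lift_definition zero_formal :: "'a formal" is "\<lambda>_. 0" by simp
lift_definition plus_formal :: "'a formal \<Rightarrow> 'a formal \<Rightarrow> 'a formal" is "\<lambda>f g x. f x + g x"
  by (erule (1) finite_subset[OF _ finite_UnI, rotated 1]) auto
lift_definition uminus_formal :: "'a formal \<Rightarrow> 'a formal" is "\<lambda>f x. - f x" by simp
lift_definition minus_formal :: "'a formal \<Rightarrow> 'a formal \<Rightarrow> 'a formal" is "\<lambda>f g x. f x - g x"
  by (erule (1) finite_subset[OF _ finite_UnI, rotated 1]) auto
lift_definition scaleC_formal :: "complex \<Rightarrow> 'a formal \<Rightarrow> 'a formal" is "\<lambda>c f x. c * f x"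
  by (erule rev_finite_subset) auto
instance
  by standard (transfer; auto simp: algebra_simps)+
end

lemma finite_formal_coeff: "finite {x. formal_coeff f x \<noteq> 0}"
  using formal_coeff by auto

instantiation formal :: (pd_kernel) semi_inner
begin
definition cinner_formal :: "'a formal \<Rightarrow> 'a formal \<Rightarrow> complex" where
  "cinner_formal f g = (\<Sum>x | formal_coeff f x \<noteq> 0. \<Sum>y | formal_coeff g y \<noteq> 0. cnj (formal_coeff f x) * formal_coeff g y * ker x y)"

lemma cinner_formal_superset:
  fixes f g :: "'a formal"
  assumes "finite S" "{x. formal_coeff f x \<noteq> 0} \<subseteq> S" "finite T" "{x. formal_coeff g x \<noteq> 0} \<subseteq> T"
  shows "cinner f g = (\<Sum>x\<in>S. \<Sum>y\<in>T. cnj (formal_coeff f x) * formal_coeff g y * ker x y)"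
proof -
  have "cinner f g = (\<Sum>x | formal_coeff f x \<noteq> 0. \<Sum>y\<in>T. cnj (formal_coeff f x) * formal_coeff g y * ker x y)"
    unfolding cinner_formal_def using assms by (intro sum.cong refl sum.mono_neutral_left) auto
  also have "\<dots> = (\<Sum>x\<in>S. \<Sum>y\<in>T. cnj (formal_coeff f x) * formal_coeff g y * ker x y)"
    using assms by (intro sum.mono_neutral_left) auto
  finally show ?thesis .
qed

instance
proof
  fix f g h :: "'a formal" and c :: complex
  define S where "S = {x. formal_coeff f x \<noteq> 0} \<union> {x. formal_coeff g x \<noteq> 0} \<union> {x. formal_coeff h x \<noteq> 0}"
  have S: "finite S" by (simp add: S_def finite_formal_coeff)
  have sup: "{x. formal_coeff f x \<noteq> 0} \<subseteq> S" "{x. formal_coeff g x \<noteq> 0} \<subseteq> S" "{x. formal_coeff h x \<noteq> 0} \<subseteq> S"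
    "{x. formal_coeff (g + h) x \<noteq> 0} \<subseteq> S" "{x. formal_coeff (c *\<^sub>C g) x \<noteq> 0} \<subseteq> S"
    by (auto simp: S_def plus_formal.rep_eq scaleC_formal.rep_eq)
  note eq = cinner_formal_superset[OF S _ S]
  show "cinner f g = cnj (cinner g f)"
    unfolding eq[OF sup(1,2)] eq[OF sup(2,1)] cnj_sum
    by (subst sum.swap) (intro sum.cong refl, subst ker_commute, simp)
  show "cinner f (g + h) = cinner f g + cinner f h"
    unfolding eq[OF sup(1,2)] eq[OF sup(1,3)] eq[OF sup(1,4)]
    by (simp add: plus_formal.rep_eq algebra_simps sum.distrib)
  show "cinner f (c *\<^sub>C g) = c * cinner f g"
    unfolding eq[OF sup(1,2)] eq[OF sup(1,5)]
    by (simp add: scaleC_formal.rep_eq algebra_simps sum_distrib_left)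
  show "0 \<le> Re (cinner f f)"
    unfolding eq[OF sup(1,1)] using ker_pos_def[OF S] unfolding pos_def_on_def by blast
qed
end

lift_definition formal_single :: "'a \<Rightarrow> 'a formal" is "\<lambda>a x. if x = a then 1 else 0" by simp

lemma cinner_formal_single [simp]: "cinner (formal_single a) (formal_single b) = ker a b"
  by (subst cinner_formal_superset[of "{a}" _ "{b}"]) (auto simp: formal_single.rep_eq split: if_splits)

definition generator :: "'a::pd_kernel \<Rightarrow> 'a formal completion"
  where "generator a = to_completion (formal_single a)"

lemma cinner_generator [simp]: "cinner (generator a) (generator b) = ker a b"
  by (simp add: generator_def)


subsection \<open>Positive definiteness of product kernels\<close>

lemma pos_def_onI: "(\<And>c. 0 \<le> Re (\<Sum>i\<in>I. \<Sum>j\<in>I. cnj (c i) * c j * K i j)) \<Longrightarrow> pos_def_on I K"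
  by (simp add: pos_def_on_def)

lemma pos_def_on_cong:
  "(\<And>i j. i \<in> I \<Longrightarrow> j \<in> I \<Longrightarrow> K i j = L i j) \<Longrightarrow> pos_def_on I K \<longleftrightarrow> pos_def_on I L"
  by (simp add: pos_def_on_def)

lemma pos_def_on_1: "pos_def_on I (\<lambda>_ _. 1)"
proof (rule pos_def_onI)
  fix c :: "'a \<Rightarrow> complex"
  have "(\<Sum>i\<in>I. \<Sum>j\<in>I. cnj (c i) * c j * 1) = cnj (\<Sum>i\<in>I. c i) * (\<Sum>i\<in>I. c i)"
    by (simp add: sum_product cnj_sum)
  also have "\<dots> = of_real ((cmod (\<Sum>i\<in>I. c i))\<^sup>2)"
    by (simp add: complex_norm_square mult.commute del: of_real_power)
  finally show "0 \<le> Re (\<Sum>i\<in>I. \<Sum>j\<in>I. cnj (c i) * c j * 1)" by simp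
qed

lemma finite_orthonormal:
  fixes v :: "'i \<Rightarrow> 'a::complex_inner"
  assumes "finite I"
  shows "\<exists>E. finite E \<and> (\<forall>e\<in>E. \<forall>e'\<in>E. cinner e e' = (if e = e' then 1 else 0)) \<and>
    (\<forall>i\<in>I. v i = (\<Sum>e\<in>E. cinner e (v i) *\<^sub>C e))"
  using assms
proof (induction I)
  case empty
  then show ?case by (intro exI[of _ "{}"]) auto
next
  case (insert i I)
  then obtain E where E: "finite E" "\<And>e e'. e \<in> E \<Longrightarrow> e' \<in> E \<Longrightarrow> cinner e e' = (if e = e' then 1 else 0)"
    "\<And>j. j \<in> I \<Longrightarrow> v j = (\<Sum>e\<in>E. cinner e (v j) *\<^sub>C e)"
    by auto
  define w where "w = v i - (\<Sum>e\<in>E. cinner e (v i) *\<^sub>C e)"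
  have w_orth: "cinner e w = 0" if "e \<in> E" for e
  proof -
    have "cinner e w = cinner e (v i) - (\<Sum>e'\<in>E. cinner e' (v i) * cinner e e')"
      by (simp add: w_def cinner_diff_right cinner_sum_right cinner_scaleC_right)
    also have "(\<Sum>e'\<in>E. cinner e' (v i) * cinner e e') = (\<Sum>e'\<in>E. if e' = e then cinner e' (v i) else 0)"
      using that E(2) by (intro sum.cong) auto
    finally show ?thesis using that E(1) by simp
  qed
  show ?case
  proof (cases "w = 0")
    case True
    then show ?thesis
      using E by (intro exI[of _ E]) (auto simp: w_def)
  next
    case False
    define r where "r = norm w"
    have r: "r \<noteq> 0" "r > 0" using False by (auto simp: r_def)
    define e0 where "e0 = complex_of_real (inverse r) *\<^sub>C w"
    have ww: "cinner w w = of_real (r\<^sup>2)"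
      by (simp add: cinner_self r_def norm_eq_seminorm)
    have e0: "cinner e0 e0 = 1"
      using r by (simp add: e0_def cinner_scaleC_left cinner_scaleC_right ww power2_eq_square field_simps)
    have orth: "cinner e e0 = 0" "cinner e0 e = 0" if "e \<in> E" for e
    proof -
      show *: "cinner e e0 = 0"
        using w_orth[OF that] by (simp add: e0_def cinner_scaleC_right)
      show "cinner e0 e = 0"
        by (subst cinner_commute) (simp add: *)
    qed
    have notin: "e0 \<notin> E" using orth(1) e0 by force
    have vi: "v i = w + (\<Sum>e\<in>E. cinner e (v i) *\<^sub>C e)" by (simp add: w_def)
    have "cinner e0 (v i) = cinner e0 w"
      by (subst vi) (simp add: cinner_add_right cinner_sum_right cinner_scaleC_right orth)
    also have "\<dots> = of_real r"
      using r by (simp add: e0_def cinner_scaleC_left ww power2_eq_square)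
    finally have e0vi: "cinner e0 (v i) = of_real r" .
    have "v i = cinner e0 (v i) *\<^sub>C e0 + (\<Sum>e\<in>E. cinner e (v i) *\<^sub>C e)"
      unfolding e0vi using r by (subst vi) (simp add: e0_def flip: of_real_mult)
    moreover have "v j = cinner e0 (v j) *\<^sub>C e0 + (\<Sum>e\<in>E. cinner e (v j) *\<^sub>C e)" if "j \<in> I" for j
    proof -
      have "cinner e0 (v j) = 0"
        by (subst E(3)[OF that]) (simp add: cinner_sum_right cinner_scaleC_right orth)
      then show ?thesis using E(3)[OF that] by simp
    qed
    ultimately show ?thesis
      using E(1,2) notin e0 orth
      by (intro exI[of _ "insert e0 E"]) auto
  qed
qed

lemma pos_def_on_mult_cinner:
  fixes v :: "'i \<Rightarrow> 'a::complex_inner"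
  assumes "finite I" "pos_def_on I K"
  shows "pos_def_on I (\<lambda>i j. K i j * cinner (v i) (v j))"
proof (rule pos_def_onI)
  fix c :: "'i \<Rightarrow> complex"
  obtain E where E: "finite E" "\<And>e e'. e \<in> E \<Longrightarrow> e' \<in> E \<Longrightarrow> cinner e e' = (if e = e' then 1 else 0)"
    "\<And>j. j \<in> I \<Longrightarrow> v j = (\<Sum>e\<in>E. cinner e (v j) *\<^sub>C e)"
    using finite_orthonormal[OF assms(1), of v] by blast
  have v: "cinner (v i) (v j) = (\<Sum>e\<in>E. cnj (cinner e (v i)) * cinner e (v j))" if "j \<in> I" for i j
    by (subst E(3)[OF that])
      (simp add: cinner_sum_right cinner_scaleC_right cinner_commute[of "v i"] mult.commute)
  have "(\<Sum>i\<in>I. \<Sum>j\<in>I. cnj (c i) * c j * (K i j * cinner (v i) (v j))) =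
      (\<Sum>i\<in>I. \<Sum>j\<in>I. \<Sum>e\<in>E. cnj (cinner e (v i) * c i) * (cinner e (v j) * c j) * K i j)"
    by (intro sum.cong refl) (simp add: v sum_distrib_left algebra_simps)
  also have "\<dots> = (\<Sum>i\<in>I. \<Sum>e\<in>E. \<Sum>j\<in>I. cnj (cinner e (v i) * c i) * (cinner e (v j) * c j) * K i j)"
    by (intro sum.cong refl sum.swap)
  also have "\<dots> = (\<Sum>e\<in>E. \<Sum>i\<in>I. \<Sum>j\<in>I. cnj (cinner e (v i) * c i) * (cinner e (v j) * c j) * K i j)"
    by (rule sum.swap)
  finally have eq: "(\<Sum>i\<in>I. \<Sum>j\<in>I. cnj (c i) * c j * (K i j * cinner (v i) (v j))) = \<dots>" .
  show "0 \<le> Re (\<Sum>i\<in>I. \<Sum>j\<in>I. cnj (c i) * c j * (K i j * cinner (v i) (v j)))"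
    unfolding eq Re_sum[of _ E]
    using assms(2) unfolding pos_def_on_def
    by (intro sum_nonneg) (erule allE[of _ "\<lambda>i. cinner _ (v i) * c i"], assumption)
qed

lemma pos_def_on_prod_cinner:
  fixes v :: "nat \<Rightarrow> 'i \<Rightarrow> 'a::complex_inner"
  assumes "finite I"
  shows "pos_def_on I (\<lambda>i j. \<Prod>k<n. cinner (v k i) (v k j))"
proof (induction n)
  case 0
  then show ?case by (simp add: pos_def_on_1)
next
  case (Suc n)
  then show ?case
    using pos_def_on_mult_cinner[OF assms Suc, of "v n"] by simp
qed


section \<open>Hilbert space tensor products\<close>

datatype ('a, 'b) tgen = TGen 'a 'b

instantiation tgen :: (complex_inner, complex_inner) pd_kernel
begin
fun ker_tgen :: "('a, 'b) tgen \<Rightarrow> ('a, 'b) tgen \<Rightarrow> complex" where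
  "ker_tgen (TGen x y) (TGen x' y') = cinner x x' * cinner y y'"
instance
proof
  fix s t :: "('a, 'b) tgen"
  show "ker s t = cnj (ker t s)"
    by (cases s; cases t; simp) (metis cinner_commute complex_cnj_cnj)
next
  fix I :: "('a, 'b) tgen set"
  assume "finite I"
  define f where "f = (\<lambda>s :: ('a, 'b) tgen. case s of TGen x y \<Rightarrow> x)"
  define g where "g = (\<lambda>s :: ('a, 'b) tgen. case s of TGen x y \<Rightarrow> y)"
  have eq: "(ker :: ('a, 'b) tgen \<Rightarrow> _) = (\<lambda>s t. 1 * cinner (f s) (f t) * cinner (g s) (g t))"
    by (intro ext) (auto simp: f_def g_def split: tgen.split)
  show "pos_def_on I (ker :: ('a, 'b) tgen \<Rightarrow> _)"
    unfolding eq by (intro pos_def_on_mult_cinner pos_def_on_1 \<open>finite I\<close>)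
qed
end

type_synonym ('a, 'b) tensor = "('a, 'b) tgen formal completion"

definition tensor :: "'a::complex_inner \<Rightarrow> 'b::complex_inner \<Rightarrow> ('a, 'b) tensor"  (infixr \<open>\<otimes>\<^sub>v\<close> 76)
  where "x \<otimes>\<^sub>v y = generator (TGen x y)"

lemma cinner_tensor [simp]: "cinner (x \<otimes>\<^sub>v y) (x' \<otimes>\<^sub>v y') = cinner x x' * cinner y y'"
  by (simp add: tensor_def)

section \<open>Symmetric Fock space\<close>

text \<open>\<open>SGen [x\<^sub>1, \<dots>, x\<^sub>n]\<close> stands for the orthogonal projection of
  \<open>x\<^sub>1 \<otimes> \<dots> \<otimes> x\<^sub>n\<close> onto the symmetric tensors of rank \<open>n\<close>; the kernel is the inner product
  of two such vectors, and different ranks are orthogonal. In particular \<open>SGen []\<close> is the vacuum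
  vector and \<open>SGen (replicate n x)\<close> is the \<open>n\<close>-fold tensor power of \<open>x\<close>.\<close>

datatype 'a sgen = SGen "'a list"

definition sym_ker :: "'a::complex_inner list \<Rightarrow> 'a list \<Rightarrow> complex" where
  "sym_ker xs ys = (if length xs = length ys
     then (\<Sum>\<pi> | \<pi> permutes {..<length xs}. \<Prod>i<length xs. cinner (xs ! i) (ys ! \<pi> i)) / fact (length xs)
     else 0)"

lemma sym_ker_commute: "sym_ker xs ys = cnj (sym_ker ys xs)"
proof (cases "length xs = length ys")
  case True
  define n where "n = length ys"
  have "(\<Sum>\<pi> | \<pi> permutes {..<n}. \<Prod>i<n. cinner (xs ! i) (ys ! \<pi> i)) =
      (\<Sum>\<pi> | \<pi> permutes {..<n}. \<Prod>i<n. cinner (xs ! i) (ys ! inv \<pi> i))"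
    by (rule sum_permutations_inverse)
  also have "\<dots> = (\<Sum>\<pi> | \<pi> permutes {..<n}. \<Prod>i<n. cinner (xs ! \<pi> i) (ys ! i))"
  proof (rule sum.cong[OF refl])
    fix \<pi> assume "\<pi> \<in> {\<pi>. \<pi> permutes {..<n}}"
    then have p: "\<pi> permutes {..<n}" by simp
    have "(\<Prod>i<n. cinner (xs ! i) (ys ! inv \<pi> i)) = (\<Prod>i<n. cinner (xs ! \<pi> i) (ys ! inv \<pi> (\<pi> i)))"
      using prod.permute[OF p, of "\<lambda>i. cinner (xs ! i) (ys ! inv \<pi> i)"] by (simp add: o_def)
    then show "(\<Prod>i<n. cinner (xs ! i) (ys ! inv \<pi> i)) = (\<Prod>i<n. cinner (xs ! \<pi> i) (ys ! i))"
      using permutes_inverses(2)[OF p] by simp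
  qed
  also have "\<dots> = cnj (\<Sum>\<pi> | \<pi> permutes {..<n}. \<Prod>i<n. cinner (ys ! i) (xs ! \<pi> i))"
    unfolding cnj_sum cnj_prod by (subst (2) cinner_commute) (simp)
  finally show ?thesis
    using True by (simp add: sym_ker_def n_def)
next
  case False
  then show ?thesis by (simp add: sym_ker_def)
qed

lemma sym_ker_eq:
  assumes "length xs = n" "length ys = n"
  shows "sym_ker xs ys = (\<Sum>\<tau> | \<tau> permutes {..<n}. \<Sum>\<pi> | \<pi> permutes {..<n}.
    \<Prod>i<n. cinner (xs ! \<tau> i) (ys ! \<pi> i)) / (fact n)\<^sup>2"
proof -
  let ?P = "{\<pi>. \<pi> permutes {..<n}}"
  let ?s = "\<Sum>\<pi>\<in>?P. \<Prod>i<n. cinner (xs ! i) (ys ! \<pi> i)"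
  have "(\<Sum>\<pi>\<in>?P. \<Prod>i<n. cinner (xs ! \<tau> i) (ys ! \<pi> i)) = ?s" if t: "\<tau> permutes {..<n}" for \<tau>
  proof -
    have "?s = (\<Sum>\<pi>\<in>?P. \<Prod>i<n. cinner (xs ! \<tau> i) (ys ! \<pi> (\<tau> i)))"
      using prod.permute[OF t] by (intro sum.cong refl) (simp add: o_def)
    also have "\<dots> = (\<Sum>\<pi>\<in>?P. \<Prod>i<n. cinner (xs ! \<tau> i) (ys ! \<pi> i))"
      using sum_permutations_compose_right[OF t, of "\<lambda>\<pi>. \<Prod>i<n. cinner (xs ! \<tau> i) (ys ! \<pi> i)"]
      by (simp add: o_def)
    finally show ?thesis by simp
  qed
  then have "(\<Sum>\<tau>\<in>?P. \<Sum>\<pi>\<in>?P. \<Prod>i<n. cinner (xs ! \<tau> i) (ys ! \<pi> i)) = of_nat (card ?P) * ?s"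
    by simp
  also have "card ?P = fact n"
    using card_permutations[of "{..<n}" n] by simp
  finally show ?thesis
    using assms by (simp add: sym_ker_def power2_eq_square)
qed

lemma pos_def_on_sym_ker:
  assumes "finite (I :: 'a::complex_inner list set)"
  shows "pos_def_on I sym_ker"
proof (rule pos_def_onI)
  fix c :: "'a list \<Rightarrow> complex"
  define J where "J n = {xs \<in> I. length xs = n}" for n
  have J: "finite (J n)" for n using assms by (simp add: J_def)
  have "(\<Sum>x\<in>I. \<Sum>y\<in>I. cnj (c x) * c y * sym_ker x y) =
      (\<Sum>n\<in>length ` I. \<Sum>x\<in>J n. \<Sum>y\<in>I. cnj (c x) * c y * sym_ker x y)"
    unfolding J_def using assms by (intro sum.group[symmetric]) auto
  also have "\<dots> = (\<Sum>n\<in>length ` I. \<Sum>x\<in>J n. \<Sum>y\<in>J n. cnj (c x) * c y * sym_ker x y)"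
    using assms by (intro sum.cong refl sum.mono_neutral_right) (auto simp: J_def sym_ker_def)
  finally have eq: "(\<Sum>x\<in>I. \<Sum>y\<in>I. cnj (c x) * c y * sym_ker x y) = \<dots>" .
  have "0 \<le> Re (\<Sum>x\<in>J n. \<Sum>y\<in>J n. cnj (c x) * c y * sym_ker x y)" for n
  proof -
    let ?P = "{\<pi>. \<pi> permutes {..<n}}"
    have fin: "finite ?P" by (simp add: finite_permutations)
    define C where "C = (\<lambda>(x, \<pi> :: nat \<Rightarrow> nat). c x / fact n)"
    define v where "v k = (\<lambda>(x :: 'a list, \<pi>). x ! (\<pi> k :: nat))" for k :: nat
    have "(\<Sum>x\<in>J n. \<Sum>y\<in>J n. cnj (c x) * c y * sym_ker x y) =
        (\<Sum>x\<in>J n. \<Sum>y\<in>J n. \<Sum>\<tau>\<in>?P. \<Sum>\<pi>\<in>?P.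
          cnj (C (x, \<tau>)) * C (y, \<pi>) * (\<Prod>k<n. cinner (v k (x, \<tau>)) (v k (y, \<pi>))))"
      by (intro sum.cong refl)
        (simp add: J_def sym_ker_eq C_def v_def sum_distrib_left sum_divide_distrib power2_eq_square)
    also have "\<dots> = (\<Sum>x\<in>J n. \<Sum>\<tau>\<in>?P. \<Sum>y\<in>J n. \<Sum>\<pi>\<in>?P.
          cnj (C (x, \<tau>)) * C (y, \<pi>) * (\<Prod>k<n. cinner (v k (x, \<tau>)) (v k (y, \<pi>))))"
      by (intro sum.cong refl sum.swap)
    also have "\<dots> = (\<Sum>p\<in>J n \<times> ?P. \<Sum>q\<in>J n \<times> ?P.
          cnj (C p) * C q * (\<Prod>k<n. cinner (v k p) (v k q)))"
    proof -
      define F where "F p q = cnj (C p) * C q * (\<Prod>k<n. cinner (v k p) (v k q))" for p q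
      have "(\<Sum>x\<in>J n. \<Sum>\<tau>\<in>?P. \<Sum>y\<in>J n. \<Sum>\<pi>\<in>?P. F (x, \<tau>) (y, \<pi>)) =
          (\<Sum>x\<in>J n. \<Sum>\<tau>\<in>?P. \<Sum>q\<in>J n \<times> ?P. F (x, \<tau>) q)"
        by (intro sum.cong refl) (simp add: sum.cartesian_product case_prod_unfold)
      also have "\<dots> = (\<Sum>p\<in>J n \<times> ?P. \<Sum>q\<in>J n \<times> ?P. F p q)"
        by (subst sum.cartesian_product) (simp add: case_prod_unfold)
      finally show ?thesis by (simp only: F_def)
    qed
    finally show ?thesis
      using pos_def_on_prod_cinner[of "J n \<times> ?P" v n] J fin
      unfolding pos_def_on_def by simp
  qed
  then show "0 \<le> Re (\<Sum>x\<in>I. \<Sum>y\<in>I. cnj (c x) * c y * sym_ker x y)"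
    unfolding eq Re_sum[of _ "length ` I"] by (intro sum_nonneg)
qed

instantiation sgen :: (complex_inner) pd_kernel
begin
fun ker_sgen :: "'a sgen \<Rightarrow> 'a sgen \<Rightarrow> complex" where
  "ker_sgen (SGen xs) (SGen ys) = sym_ker xs ys"
instance
proof
  fix s t :: "'a sgen"
  show "ker s t = cnj (ker t s)"
    by (cases s; cases t) (simp, rule sym_ker_commute)
next
  fix I :: "'a sgen set"
  assume I: "finite I"
  define f where "f = (\<lambda>s :: 'a sgen. case s of SGen xs \<Rightarrow> xs)"
  have ker: "ker s t = sym_ker (f s) (f t)" for s t
    by (cases s; cases t) (simp add: f_def)
  have inj: "inj_on f I"
    by (auto simp: inj_on_def f_def split: sgen.splits)
  show "pos_def_on I (ker :: 'a sgen \<Rightarrow> _)"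
  proof (rule pos_def_onI)
    fix c :: "'a sgen \<Rightarrow> complex"
    have "f (SGen xs) = xs" for xs by (simp add: f_def)
    have SGen_f: "SGen (f s) = s" for s by (cases s) (simp add: f_def)
    have "(\<Sum>i\<in>I. \<Sum>j\<in>I. cnj (c i) * c j * ker i j) =
        (\<Sum>x\<in>f ` I. \<Sum>y\<in>f ` I. cnj (c (SGen x)) * c (SGen y) * sym_ker x y)"
      by (simp add: sum.reindex[OF inj] SGen_f ker)
    then show "0 \<le> Re (\<Sum>i\<in>I. \<Sum>j\<in>I. cnj (c i) * c j * ker i j)"
      using pos_def_on_sym_ker[of "f ` I"] I unfolding pos_def_on_def by simp
  qed
qed
end

type_synonym 'a fock = "'a sgen formal completion"


lemma tendsto_cinner:
  fixes f g :: "'b \<Rightarrow> 'a::complex_inner"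
  assumes "(f \<longlongrightarrow> x) F" "(g \<longlongrightarrow> y) F"
  shows "((\<lambda>t. cinner (f t) (g t)) \<longlongrightarrow> cinner x y) F"
proof -
  have "((\<lambda>t. cinner (f t) (g t) - cinner x y) \<longlongrightarrow> 0) F"
  proof (rule Lim_null_comparison)
    show "\<forall>\<^sub>F t in F. norm (cinner (f t) (g t) - cinner x y) \<le>
        norm (f t - x) * norm (g t) + norm x * norm (g t - y)"
      using cinner_diff_bound[of "f _" "g _" x y]
      by (auto simp: norm_eq_seminorm intro!: always_eventually)
    have "((\<lambda>t. norm (f t - x) * norm (g t) + norm x * norm (g t - y)) \<longlongrightarrow>
        norm (x - x) * norm y + norm x * norm (y - y)) F"
      using assms by (intro tendsto_intros)
    then show "((\<lambda>t. norm (f t - x) * norm (g t) + norm x * norm (g t - y)) \<longlongrightarrow> 0) F"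
      by simp
  qed
  from tendsto_add[OF this tendsto_const[of "cinner x y"]] show ?thesis by simp
qed

section \<open>Square integrable functions on the half line\<close>

text \<open>Bochner's notion of measurability. It is used because the values may lie in a non-separable
  Hilbert space, for which the library's Bochner integral is not available.\<close>

definition strongly_measurable :: "(real \<Rightarrow> 'a::real_normed_vector) \<Rightarrow> bool" where
  "strongly_measurable f \<longleftrightarrow> (\<exists>s. (\<forall>n. simple_function lebesgue (s n)) \<and>
     (AE t in lebesgue. (\<lambda>n. s n t) \<longlonglongrightarrow> f t))"

text \<open>Functions on \<open>[0, \<infinity>)\<close> are represented by functions on the reals vanishing on the negative
  half line. The completion of the square integrable ones identifies functions that agree almost
  everywhere.\<close>

definition sq_integrable :: "(real \<Rightarrow> 'a::real_normed_vector) \<Rightarrow> bool" where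
  "sq_integrable f \<longleftrightarrow> strongly_measurable f \<and> integrable lebesgue (\<lambda>t. (norm (f t))\<^sup>2) \<and>
     (\<forall>t<0. f t = 0)"

lemma strongly_measurable_0: "strongly_measurable (\<lambda>_. 0)"
  unfolding strongly_measurable_def by (intro exI[of _ "\<lambda>_ _. 0"]) auto

lemma strongly_measurable_add:
  assumes "strongly_measurable f" "strongly_measurable g"
  shows "strongly_measurable (\<lambda>t. f t + g t)"
proof -
  obtain r where r: "\<And>n. simple_function lebesgue (r n)" "AE t in lebesgue. (\<lambda>n. r n t) \<longlonglongrightarrow> f t"
    using assms(1) unfolding strongly_measurable_def by blast
  obtain s where s: "\<And>n. simple_function lebesgue (s n)" "AE t in lebesgue. (\<lambda>n. s n t) \<longlonglongrightarrow> g t"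
    using assms(2) unfolding strongly_measurable_def by blast
  show ?thesis
    unfolding strongly_measurable_def
  proof (intro exI[of _ "\<lambda>n t. r n t + s n t"] conjI allI)
    show "simple_function lebesgue (\<lambda>t. r n t + s n t)" for n
      using r(1) s(1) by (rule simple_function_compose2)
    show "AE t in lebesgue. (\<lambda>n. r n t + s n t) \<longlonglongrightarrow> f t + g t"
      using r(2) s(2) by eventually_elim (rule tendsto_add)
  qed
qed

lemma norm_scaleC: "norm (c *\<^sub>C x) = cmod c * norm (x::'a::complex_inner)"
  by (simp add: norm_eq_seminorm seminorm_scaleC)

lemma bounded_linear_scaleC: "bounded_linear (\<lambda>x::'a::complex_inner. c *\<^sub>C x)"
  by (rule bounded_linear_intro[of _ "cmod c"])
    (auto simp: scaleC_add_right norm_scaleC scaleR_scaleC mult.commute)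

lemma strongly_measurable_scaleC:
  fixes f :: "real \<Rightarrow> 'a::complex_inner"
  assumes "strongly_measurable f"
  shows "strongly_measurable (\<lambda>t. c *\<^sub>C f t)"
proof -
  obtain r where r: "\<And>n. simple_function lebesgue (r n)" "AE t in lebesgue. (\<lambda>n. r n t) \<longlonglongrightarrow> f t"
    using assms unfolding strongly_measurable_def by blast
  show ?thesis
    unfolding strongly_measurable_def
  proof (intro exI[of _ "\<lambda>n t. c *\<^sub>C r n t"] conjI allI)
    show "simple_function lebesgue (\<lambda>t. c *\<^sub>C r n t)" for n
      by (rule simple_function_compose1[OF r(1)])
    show "AE t in lebesgue. (\<lambda>n. c *\<^sub>C r n t) \<longlonglongrightarrow> c *\<^sub>C f t"
      using r(2) by eventually_elim (rule bounded_linear.tendsto[OF bounded_linear_scaleC])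
  qed
qed

lemma strongly_measurable_cinner:
  fixes f g :: "real \<Rightarrow> 'a::complex_inner"
  assumes "strongly_measurable f" "strongly_measurable g"
  shows "(\<lambda>t. cinner (f t) (g t)) \<in> borel_measurable lebesgue"
proof -
  obtain r where r: "\<And>n. simple_function lebesgue (r n)" "AE t in lebesgue. (\<lambda>n. r n t) \<longlonglongrightarrow> f t"
    using assms(1) unfolding strongly_measurable_def by blast
  obtain s where s: "\<And>n. simple_function lebesgue (s n)" "AE t in lebesgue. (\<lambda>n. s n t) \<longlonglongrightarrow> g t"
    using assms(2) unfolding strongly_measurable_def by blast
  have "(\<lambda>t. lim (\<lambda>n. cinner (r n t) (s n t))) \<in> borel_measurable lebesgue"
    by (intro borel_measurable_lim_metric borel_measurable_simple_function
        simple_function_compose2[OF r(1) s(1)])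
  moreover have "AE t in lebesgue. lim (\<lambda>n. cinner (r n t) (s n t)) = cinner (f t) (g t)"
    using r(2) s(2) by eventually_elim (intro limI tendsto_cinner)
  ultimately show ?thesis
    by (rule borel_measurable_AE)
qed

lemma cinner_self_norm: "cinner x x = complex_of_real ((norm (x::'a::complex_inner))\<^sup>2)"
  by (simp add: cinner_self norm_eq_seminorm)

lemma strongly_measurable_norm:
  fixes f :: "real \<Rightarrow> 'a::complex_inner"
  assumes "strongly_measurable f"
  shows "(\<lambda>t. (norm (f t))\<^sup>2) \<in> borel_measurable lebesgue"
proof -
  have "(\<lambda>t. Re (cinner (f t) (f t))) \<in> borel_measurable lebesgue"
    using strongly_measurable_cinner[OF assms assms] by measurable
  then show ?thesis by (simp add: cinner_self_norm)
qed

lemma sq_integrable_cinner: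
  fixes f g :: "real \<Rightarrow> 'a::complex_inner"
  assumes "sq_integrable f" "sq_integrable g"
  shows "integrable lebesgue (\<lambda>t. cinner (f t) (g t))"
proof (rule Bochner_Integration.integrable_bound)
  show "integrable lebesgue (\<lambda>t. (norm (f t))\<^sup>2 + (norm (g t))\<^sup>2)"
    using assms by (auto simp: sq_integrable_def)
  show "(\<lambda>t. cinner (f t) (g t)) \<in> borel_measurable lebesgue"
    using assms by (intro strongly_measurable_cinner) (auto simp: sq_integrable_def)
  have "norm (cinner (f t) (g t)) \<le> norm ((norm (f t))\<^sup>2 + (norm (g t))\<^sup>2)" for t
  proof -
    have "norm (cinner (f t) (g t)) \<le> norm (f t) * norm (g t)"
      using cinner_Cauchy_Schwarz[of "f t" "g t"] by (simp add: norm_eq_seminorm)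
    also have "\<dots> \<le> (norm (f t))\<^sup>2 + (norm (g t))\<^sup>2"
      using sum_squares_bound[of "norm (f t)" "norm (g t)"]
        mult_nonneg_nonneg[OF norm_ge_zero[of "f t"] norm_ge_zero[of "g t"]]
      by linarith
    finally show ?thesis by simp
  qed
  then show "AE t in lebesgue. norm (cinner (f t) (g t)) \<le> norm ((norm (f t))\<^sup>2 + (norm (g t))\<^sup>2)"
    by simp
qed

lemma sq_integrable_0: "sq_integrable (\<lambda>_. 0)"
  by (simp add: sq_integrable_def strongly_measurable_0)

lemma sq_integrable_scaleC:
  fixes f :: "real \<Rightarrow> 'a::complex_inner"
  shows "sq_integrable f \<Longrightarrow> sq_integrable (\<lambda>t. c *\<^sub>C f t)"
  by (auto simp: sq_integrable_def strongly_measurable_scaleC norm_scaleC power_mult_distrib)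

lemma sq_integrable_add:
  fixes f g :: "real \<Rightarrow> 'a::complex_inner"
  assumes "sq_integrable f" "sq_integrable g"
  shows "sq_integrable (\<lambda>t. f t + g t)"
  unfolding sq_integrable_def
proof (intro conjI)
  show sm: "strongly_measurable (\<lambda>t. f t + g t)"
    using assms by (auto simp: sq_integrable_def intro: strongly_measurable_add)
  show "\<forall>t<0. f t + g t = 0"
    using assms by (auto simp: sq_integrable_def)
  show "integrable lebesgue (\<lambda>t. (norm (f t + g t))\<^sup>2)"
  proof (rule Bochner_Integration.integrable_bound)
    show "integrable lebesgue (\<lambda>t. 2 * (norm (f t))\<^sup>2 + 2 * (norm (g t))\<^sup>2)"
      using assms by (auto simp: sq_integrable_def)
    show "(\<lambda>t. (norm (f t + g t))\<^sup>2) \<in> borel_measurable lebesgue"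
      by (rule strongly_measurable_norm[OF sm])
    have "(norm (f t + g t))\<^sup>2 \<le> 2 * (norm (f t))\<^sup>2 + 2 * (norm (g t))\<^sup>2" for t
    proof -
      have "(norm (f t + g t))\<^sup>2 \<le> (norm (f t) + norm (g t))\<^sup>2"
        by (intro power_mono norm_triangle_ineq) simp
      also have "\<dots> \<le> 2 * (norm (f t))\<^sup>2 + 2 * (norm (g t))\<^sup>2"
        using sum_squares_bound[of "norm (f t)" "norm (g t)"] by (simp add: power2_sum)
      finally show ?thesis .
    qed
    then show "AE t in lebesgue. norm ((norm (f t + g t))\<^sup>2) \<le>
        norm (2 * (norm (f t))\<^sup>2 + 2 * (norm (g t))\<^sup>2)"
      by simp
  qed
qed

typedef (overloaded) 'a sqint = "{f :: real \<Rightarrow> 'a::complex_inner. sq_integrable f}"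
  morphisms sqint_fun sqint
  using sq_integrable_0 by blast

setup_lifting type_definition_sqint

instantiation sqint :: (complex_inner) semi_inner
begin
lift_definition zero_sqint :: "'a sqint" is "\<lambda>_. 0" by (rule sq_integrable_0)
lift_definition plus_sqint :: "'a sqint \<Rightarrow> 'a sqint \<Rightarrow> 'a sqint" is "\<lambda>f g t. f t + g t"
  by (rule sq_integrable_add)
lift_definition uminus_sqint :: "'a sqint \<Rightarrow> 'a sqint" is "\<lambda>f t. - f t"
  using sq_integrable_scaleC[of _ "-1"] by (simp add: cvec.scale_minus_left)
lift_definition minus_sqint :: "'a sqint \<Rightarrow> 'a sqint \<Rightarrow> 'a sqint" is "\<lambda>f g t. f t - g t"
proof -
  fix f g :: "real \<Rightarrow> 'a" assume "sq_integrable f" "sq_integrable g"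
  then show "sq_integrable (\<lambda>t. f t - g t)"
    using sq_integrable_add[of f "\<lambda>t. (-1) *\<^sub>C g t"] sq_integrable_scaleC[of g "-1"]
    by (simp add: cvec.scale_minus_left)
qed
lift_definition scaleC_sqint :: "complex \<Rightarrow> 'a sqint \<Rightarrow> 'a sqint" is "\<lambda>c f t. c *\<^sub>C f t"
  by (rule sq_integrable_scaleC)
lift_definition cinner_sqint :: "'a sqint \<Rightarrow> 'a sqint \<Rightarrow> complex"
  is "\<lambda>f g. integral\<^sup>L lebesgue (\<lambda>t. cinner (f t) (g t))" .
instance
proof
  fix f g h :: "'a sqint" and a b :: complex
  show "f + g + h = f + (g + h)" "f + g = g + f" "0 + f = f" "- f + f = 0" "f - g = f + - g"
    "a *\<^sub>C (f + g) = a *\<^sub>C f + a *\<^sub>C g" "(a + b) *\<^sub>C f = a *\<^sub>C f + b *\<^sub>C f"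
    "a *\<^sub>C b *\<^sub>C f = (a * b) *\<^sub>C f" "1 *\<^sub>C f = f"
    by (transfer; auto simp: algebra_simps scaleC_add_left scaleC_add_right)+
  show "cinner f g = cnj (cinner g f)"
    by transfer (subst cinner_commute, simp)
  show "cinner f (g + h) = cinner f g + cinner f h"
    by transfer (simp add: cinner_add_right sq_integrable_cinner)
  show "cinner f (a *\<^sub>C g) = a * cinner f g"
    by transfer (simp add: cinner_scaleC_right)
  show "0 \<le> Re (cinner f f)"
    by transfer (simp add: cinner_self_norm del: of_real_power)
qed
end

type_synonym 'a L2 = "'a sqint completion"

definition L2_class :: "(real \<Rightarrow> 'a::complex_inner) \<Rightarrow> 'a L2" where
  "L2_class f = to_completion (sqint f)"


lemma completion_eq_iff_cinner:
  "x = y \<longleftrightarrow> cinner (x - y) (x - y) = 0" for x y :: "'a::complex_inner"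
  by (simp add: cinner_self_norm del: of_real_power)

lemma tensor_add_left: "(x + x') \<otimes>\<^sub>v y = x \<otimes>\<^sub>v y + x' \<otimes>\<^sub>v y"
  by (subst completion_eq_iff_cinner)
    (simp add: cinner_diff_left cinner_diff_right cinner_add_left cinner_add_right algebra_simps)

lemma tensor_add_right: "x \<otimes>\<^sub>v (y + y') = x \<otimes>\<^sub>v y + x \<otimes>\<^sub>v y'"
  by (subst completion_eq_iff_cinner)
    (simp add: cinner_diff_left cinner_diff_right cinner_add_left cinner_add_right algebra_simps)

lemma tensor_scaleC_left: "(c *\<^sub>C x) \<otimes>\<^sub>v y = c *\<^sub>C (x \<otimes>\<^sub>v y)"
  by (subst completion_eq_iff_cinner)
    (simp add: cinner_diff_left cinner_diff_right cinner_scaleC_left cinner_scaleC_right algebra_simps)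

lemma tensor_scaleC_right: "x \<otimes>\<^sub>v (c *\<^sub>C y) = c *\<^sub>C (x \<otimes>\<^sub>v y)"
  by (subst completion_eq_iff_cinner)
    (simp add: cinner_diff_left cinner_diff_right cinner_scaleC_left cinner_scaleC_right algebra_simps)


section \<open>Bounded operators and von Neumann algebras\<close>

instantiation blinfun :: (real_normed_vector, complex_inner) complex_vector
begin
lift_definition scaleC_blinfun :: "complex \<Rightarrow> 'a \<Rightarrow>\<^sub>L 'b \<Rightarrow> 'a \<Rightarrow>\<^sub>L 'b" is "\<lambda>c T x. c *\<^sub>C T x"
  by (rule bounded_linear_compose[OF bounded_linear_scaleC])
instance
  by standard (transfer; simp add: scaleC_add_left scaleC_add_right)+
end

text \<open>The library type of bounded operators contains all bounded \<^emph>\<open>real\<close>-linear operators;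
  \<open>bops\<close> are the complex-linear ones.\<close>

definition bops :: "('a::complex_inner \<Rightarrow>\<^sub>L 'b::complex_inner) set" where
  "bops = {T. \<forall>c x. blinfun_apply T (c *\<^sub>C x) = c *\<^sub>C blinfun_apply T x}"

definition adj :: "('a::complex_hilbert \<Rightarrow>\<^sub>L 'b::complex_hilbert) \<Rightarrow> 'b \<Rightarrow>\<^sub>L 'a" where
  "adj T = (THE S. \<forall>x y. cinner x (blinfun_apply T y) = cinner (blinfun_apply S x) y)"

text \<open>Here and below, bounded operators that are determined by their values on a total set are
  introduced by definite description.\<close>

definition tensor_op ::
  "('a::complex_hilbert \<Rightarrow>\<^sub>L 'c::complex_hilbert) \<Rightarrow> ('b::complex_hilbert \<Rightarrow>\<^sub>L 'd::complex_hilbert) \<Rightarrow>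
    ('a, 'b) tensor \<Rightarrow>\<^sub>L ('c, 'd) tensor"  (infixr \<open>\<otimes>\<^sub>o\<close> 76) where
  "S \<otimes>\<^sub>o T = (THE R. R \<in> bops \<and>
     (\<forall>x y. blinfun_apply R (x \<otimes>\<^sub>v y) = blinfun_apply S x \<otimes>\<^sub>v blinfun_apply T y))"

definition sq_summable :: "(nat \<Rightarrow> 'a::real_normed_vector) \<Rightarrow> bool" where
  "sq_summable \<xi> \<longleftrightarrow> summable (\<lambda>n. (norm (\<xi> n))\<^sup>2)"

definition ultraweak :: "('a::complex_hilbert \<Rightarrow>\<^sub>L 'a) topology" where
  "ultraweak = topology_generated_by
     {{T \<in> bops. (\<Sum>n. cinner (\<xi> n) (blinfun_apply T (\<eta> n))) \<in> U} | \<xi> \<eta> U.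
        sq_summable \<xi> \<and> sq_summable \<eta> \<and> open U}"

definition von_neumann_algebra :: "('a::complex_hilbert \<Rightarrow>\<^sub>L 'a) set \<Rightarrow> bool" where
  "von_neumann_algebra A \<longleftrightarrow> A \<subseteq> bops \<and> cvec.subspace A \<and> id_blinfun \<in> A \<and>
     (\<forall>S\<in>A. \<forall>T\<in>A. S o\<^sub>L T \<in> A) \<and> (\<forall>T\<in>A. adj T \<in> A) \<and> closedin ultraweak A"

definition vn_tensor ::
  "('a::complex_hilbert \<Rightarrow>\<^sub>L 'a) set \<Rightarrow> ('b::complex_hilbert \<Rightarrow>\<^sub>L 'b) set \<Rightarrow>
    (('a, 'b) tensor \<Rightarrow>\<^sub>L ('a, 'b) tensor) set"  (infixr \<open>\<otimes>\<^sub>N\<close> 76) where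
  "M \<otimes>\<^sub>N N = ultraweak closure_of cvec.span {S \<otimes>\<^sub>o T | S T. S \<in> M \<and> T \<in> N}"

definition linear_on :: "'a::complex_vector set \<Rightarrow> ('a \<Rightarrow> 'b::complex_vector) \<Rightarrow> bool" where
  "linear_on M \<phi> \<longleftrightarrow> (\<forall>x\<in>M. \<forall>y\<in>M. \<phi> (x + y) = \<phi> x + \<phi> y) \<and>
     (\<forall>c. \<forall>x\<in>M. \<phi> (c *\<^sub>C x) = c *\<^sub>C \<phi> x)"

definition normal_on ::
  "('a::complex_hilbert \<Rightarrow>\<^sub>L 'a) set \<Rightarrow> (('a \<Rightarrow>\<^sub>L 'a) \<Rightarrow> 'b::complex_hilbert \<Rightarrow>\<^sub>L 'b) \<Rightarrow> bool" where
  "normal_on M \<phi> \<longleftrightarrow> continuous_map (subtopology ultraweak M) ultraweak \<phi>"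

text \<open>\<open>matrix_norm_le n a C\<close>: the operator matrix \<open>(a i j)\<close>, with \<open>i, j < n\<close>, acts on the \<open>n\<close>-fold
  direct sum with norm at most \<open>C\<close>.\<close>

definition matrix_norm_le ::
  "nat \<Rightarrow> (nat \<Rightarrow> nat \<Rightarrow> 'a::complex_hilbert \<Rightarrow>\<^sub>L 'a) \<Rightarrow> real \<Rightarrow> bool" where
  "matrix_norm_le n a C \<longleftrightarrow> (\<forall>x.
     sqrt (\<Sum>i<n. (norm (\<Sum>j<n. blinfun_apply (a i j) (x j)))\<^sup>2) \<le> C * sqrt (\<Sum>j<n. (norm (x j))\<^sup>2))"

definition completely_bounded_on ::
  "('a::complex_hilbert \<Rightarrow>\<^sub>L 'a) set \<Rightarrow> (('a \<Rightarrow>\<^sub>L 'a) \<Rightarrow> 'b::complex_hilbert \<Rightarrow>\<^sub>L 'b) \<Rightarrow> bool" where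
  "completely_bounded_on M \<phi> \<longleftrightarrow> (\<exists>C\<ge>0. \<forall>n a B. (\<forall>i<n. \<forall>j<n. a i j \<in> M) \<longrightarrow> 0 \<le> B \<longrightarrow>
     matrix_norm_le n a B \<longrightarrow> matrix_norm_le n (\<lambda>i j. \<phi> (a i j)) (C * B))"

text \<open>The ultraweak tensor product of two normal completely bounded maps \<open>\<phi>\<close>, \<open>\<psi>\<close> on \<open>M\<close>, \<open>N\<close>.
  Such maps are determined by their values on \<open>S \<otimes> T\<close>.\<close>

definition tensor_map ::
  "('a::complex_hilbert \<Rightarrow>\<^sub>L 'a) set \<Rightarrow> ('b::complex_hilbert \<Rightarrow>\<^sub>L 'b) set \<Rightarrow>
    (('a \<Rightarrow>\<^sub>L 'a) \<Rightarrow> 'c::complex_hilbert \<Rightarrow>\<^sub>L 'c) \<Rightarrow> (('b \<Rightarrow>\<^sub>L 'b) \<Rightarrow> 'd::complex_hilbert \<Rightarrow>\<^sub>L 'd) \<Rightarrow>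
    (('a, 'b) tensor \<Rightarrow>\<^sub>L ('a, 'b) tensor) \<Rightarrow> ('c, 'd) tensor \<Rightarrow>\<^sub>L ('c, 'd) tensor" where
  "tensor_map M N \<phi> \<psi> = (THE \<Phi>. \<Phi> \<in> extensional (M \<otimes>\<^sub>N N) \<and> linear_on (M \<otimes>\<^sub>N N) \<Phi> \<and>
     normal_on (M \<otimes>\<^sub>N N) \<Phi> \<and> (\<forall>S\<in>M. \<forall>T\<in>N. \<Phi> (S \<otimes>\<^sub>o T) = \<phi> S \<otimes>\<^sub>o \<psi> T))"

definition closed_proj :: "'a::complex_hilbert set \<Rightarrow> 'a \<Rightarrow>\<^sub>L 'a" where
  "closed_proj V = (THE P. P \<in> bops \<and>
     (\<forall>x. blinfun_apply P x \<in> V \<and> (\<forall>y\<in>V. cinner y (x - blinfun_apply P x) = 0)))"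

text \<open>Unbounded operators are partial functions.\<close>

definition lin_operator :: "('a::complex_vector \<rightharpoonup> 'b::complex_vector) \<Rightarrow> bool" where
  "lin_operator X \<longleftrightarrow> cvec.subspace (dom X) \<and> linear_on (dom X) (\<lambda>x. the (X x))"


section \<open>Fock space over the half line\<close>

type_synonym 'k Fock = "'k L2 fock"

definition normalized_exponential :: "'a::complex_hilbert \<Rightarrow> 'a fock" where
  "normalized_exponential x = exp (- (norm x)\<^sup>2 / 2) *\<^sub>R
     (\<Sum>n. (1 / sqrt (fact n)) *\<^sub>R generator (SGen (replicate n x)))"

definition varpi :: "(real \<Rightarrow> 'k::complex_hilbert) \<Rightarrow> 'k Fock" where
  "varpi f = normalized_exponential (L2_class f)"

definition step_funs :: "(real \<Rightarrow> 'k::complex_hilbert) set" where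
  "step_funs = {(\<lambda>t. \<Sum>i<n. indicator {a i..<b i} t *\<^sub>R c i) | n a b c. \<forall>i<(n::nat). (0::real) \<le> a i}"

definition cut :: "real set \<Rightarrow> (real \<Rightarrow> 'k::complex_hilbert) \<Rightarrow> real \<Rightarrow> 'k" where
  "cut J f = (\<lambda>t. indicator J t *\<^sub>R f t)"

text \<open>The Fock space over a subinterval \<open>J\<close> of \<open>[0, \<infinity>)\<close> is the closed subspace \<open>fock_sub J\<close> of the
  Fock space over \<open>[0, \<infinity>)\<close>. Operators on it are identified with their extensions by 0 to the
  orthogonal complement, so that its identity operator is the projection \<open>fock_id J\<close>.\<close>

definition fock_sub :: "real set \<Rightarrow> 'k::complex_hilbert Fock set" where
  "fock_sub J = closure (cvec.span {generator (SGen xs) | xs.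
     set xs \<subseteq> {L2_class f | f. sq_integrable f \<and> (\<forall>t. t \<notin> J \<longrightarrow> f t = 0)}})"

definition fock_id :: "real set \<Rightarrow> 'k::complex_hilbert Fock \<Rightarrow>\<^sub>L 'k Fock" where
  "fock_id J = closed_proj (fock_sub J)"

definition noise_alg :: "real set \<Rightarrow> ('k::complex_hilbert Fock \<Rightarrow>\<^sub>L 'k Fock) set" where
  "noise_alg J = {z \<in> bops. fock_id J o\<^sub>L z o\<^sub>L fock_id J = z}"

text \<open>The isometry of \<open>h \<otimes> F\<close> onto \<open>(h \<otimes> F\<^bsub>[0,r)\<^esub>) \<otimes> F\<^bsub>[r,\<infinity>)\<^esub>\<close>, regarded as a subspace of
  \<open>(h \<otimes> F) \<otimes> F\<close>.\<close>

definition fock_split ::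
  "real \<Rightarrow> ('h::complex_hilbert, 'k::complex_hilbert Fock) tensor \<Rightarrow>\<^sub>L (('h, 'k Fock) tensor, 'k Fock) tensor"
  where "fock_split r = (THE S. S \<in> bops \<and> (\<forall>u. \<forall>f\<in>step_funs.
     blinfun_apply S (u \<otimes>\<^sub>v varpi f) = (u \<otimes>\<^sub>v varpi (cut {0..<r} f)) \<otimes>\<^sub>v varpi (cut {r..} f)))"

definition fock_shift :: "real \<Rightarrow> 'k::complex_hilbert Fock \<Rightarrow>\<^sub>L 'k Fock" where
  "fock_shift r = (THE T. T \<in> bops \<and>
     (\<forall>f\<in>step_funs. blinfun_apply T (varpi f) = varpi (\<lambda>s. f (s - r))))"

definition exp_domain :: "('h::complex_hilbert, 'k::complex_hilbert Fock) tensor set" where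
  "exp_domain = cvec.span {u \<otimes>\<^sub>v varpi f | u f. f \<in> step_funs}"

text \<open>\<open>ket x\<close> is the operator \<open>E\<^sub>x\<close>; its adjoint is \<open>E\<^sup>x\<close>.\<close>

definition ket :: "'f::complex_hilbert \<Rightarrow> 'h::complex_hilbert \<Rightarrow>\<^sub>L ('h, 'f) tensor" where
  "ket x = Blinfun (\<lambda>u. u \<otimes>\<^sub>v x)"


section \<open>Processes\<close>

definition matrix_element ::
  "(real \<Rightarrow> 'k::complex_hilbert) \<Rightarrow> (('h::complex_hilbert, 'k Fock) tensor \<rightharpoonup> ('h, 'k Fock) tensor) \<Rightarrow>
    (real \<Rightarrow> 'k) \<Rightarrow> 'h \<Rightarrow> 'h" where
  "matrix_element f X g u = blinfun_apply (adj (ket (varpi f))) (the (X (blinfun_apply (ket (varpi g)) u)))"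

text \<open>Families indexed by \<open>t \<ge> 0\<close> are functions on the reals. For operator processes, the value at
  negative times is by convention the empty partial function, so that two processes are equal if
  and only if they agree at all \<open>t \<ge> 0\<close>.\<close>

definition operator_process ::
  "(real \<Rightarrow> ('h::complex_hilbert, 'k::complex_hilbert Fock) tensor \<rightharpoonup> ('h, 'k Fock) tensor) \<Rightarrow> bool" where
  "operator_process X \<longleftrightarrow> (\<forall>t<0. X t = Map.empty) \<and>
     (\<forall>t\<ge>0. dom (X t) = exp_domain \<and> lin_operator (X t)) \<and>
     (\<forall>\<xi>. \<forall>\<zeta>\<in>exp_domain. (\<lambda>t. cinner \<xi> (the (X t \<zeta>))) \<in> borel_measurable (lebesgue_on {0..})) \<and>
     (\<forall>t\<ge>0. \<forall>f\<in>step_funs. \<forall>g\<in>step_funs. \<forall>u. matrix_element f (X t) g u =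
        cinner (varpi (cut {t..} f)) (varpi (cut {t..} g)) *\<^sub>C
          matrix_element (cut {0..<t} f) (X t) (cut {0..<t} g) u)"

definition process_in ::
  "('h::complex_hilbert \<Rightarrow>\<^sub>L 'h) set \<Rightarrow>
    (real \<Rightarrow> ('h, 'k::complex_hilbert Fock) tensor \<rightharpoonup> ('h, 'k Fock) tensor) \<Rightarrow> bool" where
  "process_in A X \<longleftrightarrow> operator_process X \<and>
     (\<forall>t\<ge>0. \<forall>f\<in>step_funs. \<forall>g\<in>step_funs. \<exists>a\<in>A. blinfun_apply a = matrix_element f (X t) g)"

text \<open>The operator process given by a family of everywhere defined bounded operators.\<close>

definition as_process ::
  "(real \<Rightarrow> ('h::complex_hilbert, 'k::complex_hilbert Fock) tensor \<Rightarrow>\<^sub>L ('h, 'k Fock) tensor) \<Rightarrow>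
    real \<Rightarrow> ('h, 'k Fock) tensor \<rightharpoonup> ('h, 'k Fock) tensor" where
  "as_process Y t = (if t < 0 then Map.empty else (Some \<circ> blinfun_apply (Y t)) |` exp_domain)"

definition bounded_process_in ::
  "('h::complex_hilbert \<Rightarrow>\<^sub>L 'h) set \<Rightarrow>
    (real \<Rightarrow> ('h, 'k::complex_hilbert Fock) tensor \<Rightarrow>\<^sub>L ('h, 'k Fock) tensor) \<Rightarrow> bool" where
  "bounded_process_in A Y \<longleftrightarrow> (\<forall>t\<ge>0. Y t \<in> bops) \<and> process_in A (as_process Y)"

text \<open>Mapping processes occur here only with bounded values \<open>k t a\<close>, as cocycles are normal and
  completely bounded.\<close>

definition mapping_process ::
  "('h::complex_hilbert \<Rightarrow>\<^sub>L 'h) set \<Rightarrow>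
    (real \<Rightarrow> ('h \<Rightarrow>\<^sub>L 'h) \<Rightarrow> ('h, 'k::complex_hilbert Fock) tensor \<Rightarrow>\<^sub>L ('h, 'k Fock) tensor) \<Rightarrow> bool" where
  "mapping_process A k \<longleftrightarrow> (\<forall>t\<ge>0. linear_on A (k t)) \<and>
     (\<forall>a\<in>A. bounded_process_in A (\<lambda>t. k t a))"


section \<open>Quantum stochastic cocycles and flows\<close>

text \<open>\<open>restrict_process A k r a\<close> is the operator \<open>x\<close> on \<open>h \<otimes> F\<^bsub>[0,r)\<^esub>\<close> with
  \<open>k r a = x \<otimes> I\<^bsub>[r,\<infinity>)\<^esub>\<close>, and \<open>khat\<close> is the tensor product of this map with the identity map on
  the operators on \<open>F\<^bsub>[r,\<infinity>)\<^esub>\<close>.\<close>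

definition restrict_process ::
  "('h::complex_hilbert \<Rightarrow>\<^sub>L 'h) set \<Rightarrow>
    (real \<Rightarrow> ('h \<Rightarrow>\<^sub>L 'h) \<Rightarrow> ('h, 'k::complex_hilbert Fock) tensor \<Rightarrow>\<^sub>L ('h, 'k Fock) tensor) \<Rightarrow>
    real \<Rightarrow> ('h \<Rightarrow>\<^sub>L 'h) \<Rightarrow> ('h, 'k Fock) tensor \<Rightarrow>\<^sub>L ('h, 'k Fock) tensor" where
  "restrict_process A k r a = (THE x. x \<in> A \<otimes>\<^sub>N noise_alg {0..<r} \<and>
     k r a = adj (fock_split r) o\<^sub>L (x \<otimes>\<^sub>o fock_id {r..}) o\<^sub>L fock_split r)"

definition khat ::
  "('h::complex_hilbert \<Rightarrow>\<^sub>L 'h) set \<Rightarrow>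
    (real \<Rightarrow> ('h \<Rightarrow>\<^sub>L 'h) \<Rightarrow> ('h, 'k::complex_hilbert Fock) tensor \<Rightarrow>\<^sub>L ('h, 'k Fock) tensor) \<Rightarrow>
    real \<Rightarrow> (('h, 'k Fock) tensor \<Rightarrow>\<^sub>L ('h, 'k Fock) tensor) \<Rightarrow>
    ('h, 'k Fock) tensor \<Rightarrow>\<^sub>L ('h, 'k Fock) tensor" where
  "khat A k r X = adj (fock_split r) o\<^sub>L
     tensor_map A (noise_alg {r..}) (restrict_process A k r) (\<lambda>z. z) X o\<^sub>L fock_split r"

definition sigma ::
  "('h::complex_hilbert \<Rightarrow>\<^sub>L 'h) set \<Rightarrow> real \<Rightarrow>
    (('h, 'k::complex_hilbert Fock) tensor \<Rightarrow>\<^sub>L ('h, 'k Fock) tensor) \<Rightarrow>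
    ('h, 'k Fock) tensor \<Rightarrow>\<^sub>L ('h, 'k Fock) tensor" where
  "sigma A r = tensor_map A bops (\<lambda>a. a) (\<lambda>z. fock_shift r o\<^sub>L z o\<^sub>L adj (fock_shift r))"

definition ktilde ::
  "('h::complex_hilbert \<Rightarrow>\<^sub>L 'h) set \<Rightarrow>
    (real \<Rightarrow> ('h \<Rightarrow>\<^sub>L 'h) \<Rightarrow> ('h, 'k::complex_hilbert Fock) tensor \<Rightarrow>\<^sub>L ('h, 'k Fock) tensor) \<Rightarrow>
    real \<Rightarrow> ((complex \<times> 'k, 'h) tensor \<Rightarrow>\<^sub>L (complex \<times> 'k, 'h) tensor) \<Rightarrow>
    (complex \<times> 'k, ('h, 'k Fock) tensor) tensor \<Rightarrow>\<^sub>L (complex \<times> 'k, ('h, 'k Fock) tensor) tensor" where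
  "ktilde A k t = tensor_map bops A (\<lambda>b. b) (k t)"

definition qs_cocycle ::
  "('h::complex_hilbert \<Rightarrow>\<^sub>L 'h) set \<Rightarrow>
    (real \<Rightarrow> ('h \<Rightarrow>\<^sub>L 'h) \<Rightarrow> ('h, 'k::complex_hilbert Fock) tensor \<Rightarrow>\<^sub>L ('h, 'k Fock) tensor) \<Rightarrow> bool" where
  "qs_cocycle A k \<longleftrightarrow> mapping_process A k \<and>
     (\<forall>t\<ge>0. normal_on A (k t) \<and> completely_bounded_on A (k t)) \<and>
     (\<forall>a\<in>A. k 0 a = a \<otimes>\<^sub>o id_blinfun) \<and>
     (\<forall>r\<ge>0. \<forall>t\<ge>0. \<forall>a\<in>A. k (r + t) a = khat A k r (sigma A r (k t a)))"

definition qs_flow ::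
  "('h::complex_hilbert \<Rightarrow>\<^sub>L 'h) set \<Rightarrow>
    (real \<Rightarrow> ('h \<Rightarrow>\<^sub>L 'h) \<Rightarrow> ('h, 'k::complex_hilbert Fock) tensor \<Rightarrow>\<^sub>L ('h, 'k Fock) tensor) \<Rightarrow> bool" where
  "qs_flow A j \<longleftrightarrow> qs_cocycle A j \<and>
     (\<forall>a\<in>A. continuous_map (top_of_set {0..}) ultraweak (\<lambda>t. j t a)) \<and>
     (\<forall>t\<ge>0. (\<forall>a\<in>A. \<forall>b\<in>A. j t (a o\<^sub>L b) = j t a o\<^sub>L j t b) \<and>
        (\<forall>a\<in>A. j t (adj a) = adj (j t a)) \<and> j t id_blinfun = id_blinfun)"


section \<open>Multiplier cocycles\<close>

definition multiplier_cocycle ::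
  "('h::complex_hilbert \<Rightarrow>\<^sub>L 'h) set \<Rightarrow>
    (real \<Rightarrow> ('h \<Rightarrow>\<^sub>L 'h) \<Rightarrow> ('h, 'k::complex_hilbert Fock) tensor \<Rightarrow>\<^sub>L ('h, 'k Fock) tensor) \<Rightarrow>
    (real \<Rightarrow> ('h, 'k Fock) tensor \<Rightarrow>\<^sub>L ('h, 'k Fock) tensor) \<Rightarrow> bool" where
  "multiplier_cocycle A j Y \<longleftrightarrow> bounded_process_in A Y \<and> Y 0 = id_blinfun \<and>
     (\<forall>s\<ge>0. \<forall>t\<ge>0. Y (s + t) = khat A j s (sigma A s (Y t)) o\<^sub>L Y s)"

definition quasicontractive :: "(real \<Rightarrow> 'a::complex_hilbert \<Rightarrow>\<^sub>L 'a) \<Rightarrow> bool" where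
  "quasicontractive Y \<longleftrightarrow> (\<exists>\<omega>::real. \<forall>t\<ge>0. exp (- \<omega> * t) * norm (Y t) \<le> 1)"

definition strongly_continuous :: "(real \<Rightarrow> 'a::complex_hilbert \<Rightarrow>\<^sub>L 'a) \<Rightarrow> bool" where
  "strongly_continuous Y \<longleftrightarrow> (\<forall>\<xi>. continuous_on {0..} (\<lambda>t. blinfun_apply (Y t) \<xi>))"

definition V_iso ::
  "real \<Rightarrow> ('k::complex_hilbert, 'h::complex_hilbert) tensor \<Rightarrow>\<^sub>L ('h, 'k Fock) tensor" where
  "V_iso t = (THE V. V \<in> bops \<and> (\<forall>c u. blinfun_apply V (c \<otimes>\<^sub>v u) =
     u \<otimes>\<^sub>v generator (SGen [(1 / sqrt t) *\<^sub>R L2_class (cut {0..<t} (\<lambda>_. c))])))"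

text \<open>The identification of \<open>(\<complex> \<oplus> k) \<otimes> h\<close> with \<open>h \<oplus> (k \<otimes> h)\<close>.\<close>

definition block_iso ::
  "(complex \<times> 'k::complex_hilbert, 'h::complex_hilbert) tensor \<Rightarrow>\<^sub>L ('h \<times> ('k, 'h) tensor)" where
  "block_iso = (THE W. W \<in> bops \<and>
     (\<forall>z c u. blinfun_apply W ((z, c) \<otimes>\<^sub>v u) = (z *\<^sub>C u, c \<otimes>\<^sub>v u)))"

definition block_row ::
  "('a::complex_hilbert \<Rightarrow>\<^sub>L 'c::complex_hilbert) \<Rightarrow> ('b::complex_hilbert \<Rightarrow>\<^sub>L 'c) \<Rightarrow> ('a \<times> 'b) \<Rightarrow>\<^sub>L 'c" where
  "block_row S T = Blinfun (\<lambda>(x, y). blinfun_apply S x + blinfun_apply T y)"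

definition block_column ::
  "('c::complex_hilbert \<Rightarrow>\<^sub>L 'a::complex_hilbert) \<Rightarrow> ('c \<Rightarrow>\<^sub>L 'b::complex_hilbert) \<Rightarrow> 'c \<Rightarrow>\<^sub>L ('a \<times> 'b)" where
  "block_column S T = Blinfun (\<lambda>x. (blinfun_apply S x, blinfun_apply T x))"

definition bounded_ultraweak_stochastic_derivative ::
  "('h::complex_hilbert \<Rightarrow>\<^sub>L 'h) set \<Rightarrow>
    (real \<Rightarrow> ('h, 'k::complex_hilbert Fock) tensor \<Rightarrow>\<^sub>L ('h, 'k Fock) tensor) \<Rightarrow>
    ((complex \<times> 'k, 'h) tensor \<Rightarrow>\<^sub>L (complex \<times> 'k, 'h) tensor) \<Rightarrow> bool" where
  "bounded_ultraweak_stochastic_derivative A Y F \<longleftrightarrow> F \<in> bops \<otimes>\<^sub>N A \<and>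
     limitin ultraweak
       (\<lambda>t. block_column ((1 / sqrt t) *\<^sub>R adj (ket (varpi (\<lambda>_. 0)))) (adj (V_iso t)) o\<^sub>L
          (Y t - id_blinfun) o\<^sub>L
          block_row ((1 / sqrt t) *\<^sub>R ket (varpi (\<lambda>_. 0))) (V_iso t))
       (block_iso o\<^sub>L F o\<^sub>L adj block_iso) (at_right 0)"


section \<open>Quantum stochastic integrals\<close>

definition Delta ::
  "(complex \<times> 'k::complex_hilbert, 'b::complex_hilbert) tensor \<Rightarrow>\<^sub>L (complex \<times> 'k, 'b) tensor" where
  "Delta = Blinfun (\<lambda>(z, c). (0, c)) \<otimes>\<^sub>o id_blinfun"

definition Delta_perp ::
  "(complex \<times> 'k::complex_hilbert, 'b::complex_hilbert) tensor \<Rightarrow>\<^sub>L (complex \<times> 'k, 'b) tensor" where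
  "Delta_perp = id_blinfun - Delta"

definition nabla ::
  "real \<Rightarrow> ('h::complex_hilbert, 'k::complex_hilbert Fock) tensor \<rightharpoonup>
    (complex \<times> 'k, ('h, 'k Fock) tensor) tensor" where
  "nabla s = (THE D. lin_operator D \<and> dom D = exp_domain \<and>
     (\<forall>u. \<forall>f\<in>step_funs. D (u \<otimes>\<^sub>v varpi f) = Some ((1, f s) \<otimes>\<^sub>v (u \<otimes>\<^sub>v varpi f))))"

text \<open>\<open>ket2 x y\<close> is the operator \<open>E\<^bsub>x y\<^esub>\<close> from \<open>h\<close> to the triple tensor product.\<close>

definition ket2 ::
  "'c::complex_hilbert \<Rightarrow> 'f::complex_hilbert \<Rightarrow> 'h::complex_hilbert \<Rightarrow>\<^sub>L ('c, ('h, 'f) tensor) tensor" where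
  "ket2 x y = Blinfun (\<lambda>u. x \<otimes>\<^sub>v (u \<otimes>\<^sub>v y))"

definition locally_integrable :: "(real \<Rightarrow> 'a::real_normed_vector) \<Rightarrow> bool" where
  "locally_integrable f \<longleftrightarrow> (\<forall>T\<ge>0. strongly_measurable (\<lambda>s. indicator {0..T} s *\<^sub>R f s) \<and>
     set_integrable lebesgue {0..T} (\<lambda>s. norm (f s)))"

definition locally_sq_integrable :: "(real \<Rightarrow> 'a::real_normed_vector) \<Rightarrow> bool" where
  "locally_sq_integrable f \<longleftrightarrow> (\<forall>T\<ge>0. strongly_measurable (\<lambda>s. indicator {0..T} s *\<^sub>R f s) \<and>
     set_integrable lebesgue {0..T} (\<lambda>s. (norm (f s))\<^sup>2))"

text \<open>In the adaptedness condition both sides are operators on \<open>h\<close>, and the operators composed there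
  are required to be defined on all of \<open>h\<close>.\<close>

definition qs_integrable ::
  "(real \<Rightarrow> (complex \<times> 'k::complex_hilbert, ('h::complex_hilbert, 'k Fock) tensor) tensor \<rightharpoonup>
      (complex \<times> 'k, ('h, 'k Fock) tensor) tensor) \<Rightarrow> bool" where
  "qs_integrable G \<longleftrightarrow> (\<forall>t\<ge>0. lin_operator (G t)) \<and>
     (\<forall>\<zeta>\<in>exp_domain.
        (\<forall>t\<ge>0. the (nabla t \<zeta>) \<in> dom (G t)) \<and>
        locally_integrable (\<lambda>s. blinfun_apply Delta_perp (the (G s (the (nabla s \<zeta>))))) \<and>
        locally_sq_integrable (\<lambda>s. blinfun_apply Delta (the (G s (the (nabla s \<zeta>)))))) \<and>
     (\<forall>t\<ge>0. \<forall>f\<in>step_funs. \<forall>g\<in>step_funs. \<forall>u.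
        blinfun_apply (ket2 (1, g t) (varpi (cut {0..<t} g))) u \<in> dom (G t) \<and>
        blinfun_apply (adj (ket2 (1, f t) (varpi f)))
          (the (G t (the (nabla t (blinfun_apply (ket (varpi g)) u))))) =
        cinner (varpi (cut {t..} f)) (varpi (cut {t..} g)) *\<^sub>C
          blinfun_apply (adj (ket2 (1, f t) (varpi (cut {0..<t} f))))
            (the (G t (blinfun_apply (ket2 (1, g t) (varpi (cut {0..<t} g))) u))))"

definition continuous_process ::
  "(real \<Rightarrow> ('h::complex_hilbert, 'k::complex_hilbert Fock) tensor \<rightharpoonup> ('h, 'k Fock) tensor) \<Rightarrow> bool" where
  "continuous_process X \<longleftrightarrow> operator_process X \<and>
     (\<forall>\<zeta>\<in>exp_domain. continuous_on {0..} (\<lambda>t. the (X t \<zeta>)))"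

definition qs_integral ::
  "(real \<Rightarrow> (complex \<times> 'k::complex_hilbert, ('h::complex_hilbert, 'k Fock) tensor) tensor \<rightharpoonup>
      (complex \<times> 'k, ('h, 'k Fock) tensor) tensor) \<Rightarrow>
    real \<Rightarrow> ('h, 'k Fock) tensor \<rightharpoonup> ('h, 'k Fock) tensor" where
  "qs_integral G = (THE X. continuous_process X \<and>
     (\<forall>t\<ge>0. \<forall>\<zeta>\<in>exp_domain. \<forall>\<zeta>'\<in>exp_domain. cinner \<zeta>' (the (X t \<zeta>)) =
        (LINT s:{0..t}|lebesgue. cinner (the (nabla s \<zeta>')) (the (G s (the (nabla s \<zeta>)))))))"


section \<open>Perturbation processes\<close>

text \<open>The algebraic ampliation \<open>I \<otimes> X\<close> of an unbounded operator.\<close>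

definition ampliation ::
  "('a::complex_hilbert \<rightharpoonup> 'a) \<Rightarrow> ('c::complex_hilbert, 'a) tensor \<rightharpoonup> ('c, 'a) tensor" where
  "ampliation X = (THE Z. lin_operator Z \<and> dom Z = cvec.span {x \<otimes>\<^sub>v \<zeta> | x \<zeta>. \<zeta> \<in> dom X} \<and>
     (\<forall>x. \<forall>\<zeta>\<in>dom X. Z (x \<otimes>\<^sub>v \<zeta>) = Some (x \<otimes>\<^sub>v the (X \<zeta>))))"

definition perturbation_integrand ::
  "('h::complex_hilbert \<Rightarrow>\<^sub>L 'h) set \<Rightarrow>
    (real \<Rightarrow> ('h \<Rightarrow>\<^sub>L 'h) \<Rightarrow> ('h, 'k::complex_hilbert Fock) tensor \<Rightarrow>\<^sub>L ('h, 'k Fock) tensor) \<Rightarrow>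
    ((complex \<times> 'k, 'h) tensor \<Rightarrow>\<^sub>L (complex \<times> 'k, 'h) tensor) \<Rightarrow>
    (real \<Rightarrow> ('h, 'k Fock) tensor \<rightharpoonup> ('h, 'k Fock) tensor) \<Rightarrow>
    real \<Rightarrow> (complex \<times> 'k, ('h, 'k Fock) tensor) tensor \<rightharpoonup> (complex \<times> 'k, ('h, 'k Fock) tensor) tensor" where
  "perturbation_integrand A j F X t = (Some \<circ> blinfun_apply (ktilde A j t F)) \<circ>\<^sub>m ampliation (X t)"

definition strong_solution ::
  "('h::complex_hilbert \<Rightarrow>\<^sub>L 'h) set \<Rightarrow>
    (real \<Rightarrow> ('h \<Rightarrow>\<^sub>L 'h) \<Rightarrow> ('h, 'k::complex_hilbert Fock) tensor \<Rightarrow>\<^sub>L ('h, 'k Fock) tensor) \<Rightarrow>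
    ((complex \<times> 'k, 'h) tensor \<Rightarrow>\<^sub>L (complex \<times> 'k, 'h) tensor) \<Rightarrow>
    (real \<Rightarrow> ('h, 'k Fock) tensor \<rightharpoonup> ('h, 'k Fock) tensor) \<Rightarrow> bool" where
  "strong_solution A j F X \<longleftrightarrow> operator_process X \<and> qs_integrable (perturbation_integrand A j F X) \<and>
     (\<forall>t\<ge>0. \<forall>\<zeta>\<in>exp_domain.
        the (X t \<zeta>) = \<zeta> + the (qs_integral (perturbation_integrand A j F X) t \<zeta>))"

text \<open>\<open>is_perturbation_process A j F X\<close> says that \<open>X\<close> is \<^emph>\<open>the\<close> perturbation process \<open>Y\<^bsup>j,F\<^esup>\<close>.\<close>

definition is_perturbation_process ::
  "('h::complex_hilbert \<Rightarrow>\<^sub>L 'h) set \<Rightarrow>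
    (real \<Rightarrow> ('h \<Rightarrow>\<^sub>L 'h) \<Rightarrow> ('h, 'k::complex_hilbert Fock) tensor \<Rightarrow>\<^sub>L ('h, 'k Fock) tensor) \<Rightarrow>
    ((complex \<times> 'k, 'h) tensor \<Rightarrow>\<^sub>L (complex \<times> 'k, 'h) tensor) \<Rightarrow>
    (real \<Rightarrow> ('h, 'k Fock) tensor \<rightharpoonup> ('h, 'k Fock) tensor) \<Rightarrow> bool" where
  "is_perturbation_process A j F X \<longleftrightarrow> strong_solution A j F X \<and>
     (\<forall>X'. strong_solution A j F X' \<longrightarrow> X' = X)"

end

theory Submission
 imports Defs
begin

text \<open>By the cocycle identity the matrix element of \<open>Y (s + h) - Y s\<close> between \<open>u ox f\<close> and \<open>v ox g\<close> is that of
 \<open>j s a\<^sub>h oo Y s\<close> between \<open>u ox lo s f\<close> and \<open>v ox lo s g\<close>, where \<open>a\<^sub>h\<close> is the slice of \<open>Y h - 1\<close> at the exponential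
 vectors of \<open>f\<close> and \<open>g\<close> shifted back by \<open>s\<close>. The existence of the stochastic derivative \<open>F\<close> and the strong
 continuity of \<open>Y\<close> and its adjoint give the ultraweak limit of \<open>a\<^sub>h / h\<close>, and \<open>j s\<close> is normal, so the matrix
 elements of \<open>Y\<close> have the right derivatives prescribed by the integrand of the perturbation equation. These are
 right continuous, and integrating them gives the equation. Uniqueness follows from the fundamental estimate for
 quantum stochastic integrals and Gronwall's inequality. Normality of \<open>j s\<close> enters through isometries \<open>W\<close> with
 \<open>j s a = adj W oo (a \<otimes> 1) oo W\<close>, from which the tensor products of \<open>j s\<close> with identity maps are built.\<close>

text \<open>The maps \<open>tensor_map\<close> are definite descriptions, so an ultraweakly
  continuous candidate has to be exhibited before anything can be computed; the isometries supply
  one, since X -> X \<otimes> 1 is ultraweakly continuous on all bounded operators. They come from a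
  GNS type construction: normality dominates each vector functional by a countable sum of vector
  functionals, and a Radon-Nikodym argument turns domination into equality. The paths to be
  integrated take values in possibly non-separable spaces, so quantum stochastic integrals are built
  weakly: the fundamental estimate bounds the defining functional on exponential vectors, and
  duality yields the vector. The stochastic derivative tests \<open>Y\<close> only on vacuum and
  one-particle vectors, whose distance to exponential vectors is of the order of the time step;
  boundedness of \<open>Y\<close> alone would leave an error in the limit, and this is where strong
  continuity of \<open>Y\<close> and its adjoint enters. Step functions are merely right continuous,
  so only right derivatives are available, and they are integrated by a version of the fundamental
  theorem of calculus for continuous functions with right derivatives.\<close>

no_notation fps_compose (infixl "oo" 55)
notation tensor (infixr "\<odot>" 76) and tensor_op (infixr "\<otimes>" 76) and blinfun_compose (infixl "oo" 55)
  and scaleC (infixr "*c" 75) and scaleR (infixr "*r" 75)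
  and tendsto (infixr "--->" 55) and LIMSEQ ("((_)/ ----> (_))" [60, 60] 60)
type_notation blinfun ("(_ =>L /_)" [22, 21] 21)
type_synonym 'a op = "'a =>L 'a"
type_synonym ('h, 'k) hf = "('h, 'k Fock) tensor"
type_synonym ('h, 'k) fop = "('h, 'k) hf op"
type_synonym ('k, 'h) ch = "(complex \<times> 'k, 'h) tensor"
abbreviation (input) "fsets == finite_subsets_at_top UNIV"
abbreviation (input) "nexp == normalized_exponential"
abbreviation (input) ox :: "'h::complex_hilbert => (real => 'k::complex_hilbert) => ('h, 'k) hf" (infixr "ox" 76)
 where "u ox f == u \<odot> varpi f"

section \<open>Hilbert space preliminaries\<close>

lemma cinner_zero_iff: "cinner x x = 0 \<longleftrightarrow> x = (0::'a::complex_inner)"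
 using completion_eq_iff_cinner[of x 0] by simp

lemma cinner_extI: "(!!z. cinner z x = cinner z y) ==> x = (y::'a::complex_inner)"
 using completion_eq_iff_cinner[of x y] by (simp add: cinner_diff_right)

lemma cmod_cinner_le: "cmod (cinner x y) <= norm x * norm (y::'a::complex_inner)"
 unfolding norm_eq_seminorm[of x] norm_eq_seminorm[of y] by (rule cinner_Cauchy_Schwarz)

lemma le_of_mult_self_le: "a * a <= a * b ==> 0 <= b ==> (a::real) <= b"
 by (metis linorder_not_le mult_less_cancel_left_pos order.strict_trans1)

lemma cinner_scaleR_right [simp]: "cinner x (r *r y) = of_real r * cinner x (y::'a::complex_inner)"
 by (simp add: scaleR_scaleC cinner_scaleC_right)

lemma cinner_scaleR_left [simp]: "cinner (r *r x) y = of_real r * cinner x (y::'a::complex_inner)"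
 by (simp add: scaleR_scaleC cinner_scaleC_left)

lemma Re_cinner_norm: "Re (cinner x x) = (norm (x::'a::complex_inner))^2"
 by (simp add: cinner_self_norm)

lemma norm_eq_of_cinner: "cinner x x = cinner y y ==> norm (x::'a::complex_inner) = norm (y::'b::complex_inner)"
 by (metis Re_cinner_norm norm_ge_zero power2_eq_iff_nonneg)

lemma csubspace_closure:
 fixes S :: "'a::complex_inner set"
 assumes "cvec.subspace S" shows "cvec.subspace (closure S)"
proof (rule cvec.subspaceI)
 show "0 : closure S" using cvec.subspace_0[OF assms] closure_subset by blast
 fix x y assume "x : closure S" "y : closure S"
 then obtain a b where a: "!!n. a n : S" "a ----> x" and b: "!!n. b n : S" "b ----> y"
  unfolding closure_sequential by blast
 thus "x + y : closure S"
  unfolding closure_sequential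
  by (intro exI[of _ "%n. a n + b n"]) (auto intro: tendsto_add cvec.subspace_add[OF assms])
next
 fix c x assume "x : closure S"
 then obtain a where a: "!!n. a n : S" "a ----> x"
  unfolding closure_sequential by blast
 thus "c *c x : closure S"
  unfolding closure_sequential
  by (intro exI[of _ "%n. c *c a n"])
   (auto intro: bounded_linear.tendsto[OF bounded_linear_scaleC] cvec.subspace_scale[OF assms])
qed

text \<open>The parallelogram law bounds the diameter of the set of almost minimising points of
  \<open>V\<close>, so the nested closed sets \<open>S n\<close> have a common point by
  completeness. The variational inequality for a closest point of a convex set, used for
  \<open>v\<close> and \<open>-v\<close>, kills the real part of the inner product; multiplying
  \<open>v\<close> by the imaginary unit kills the imaginary part.\<close>

lemma projection_exists:
 fixes V :: "'a::complex_hilbert set"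
 assumes sub: "cvec.subspace V" and cl: "closed V"
 shows "EX p:V. ALL y:V. cinner y (x - p) = 0"
proof -
 note add = cvec.subspace_add[OF sub] and sc = cvec.subspace_scale[OF sub]
 have scR: "r *r y : V" if "y : V" for r y using sc[OF that] by (simp add: scaleR_scaleC)
 define d where "d = infdist x V"
 have ne: "V ~= {}" using cvec.subspace_0[OF sub] by auto
 have dle: "d <= dist x y" if "y : V" for y unfolding d_def using that by (rule infdist_le)
 have d0: "0 <= d" by (simp add: d_def infdist_nonneg)
 have par: "(dist y z)^2 <= 2 * (dist x y)^2 + 2 * (dist x z)^2 - 4 * d\<^sup>2" if "y : V" "z : V" for y z
 proof -
  define u where "u = x - y" define v where "v = x - z"
  have "u + v = 2 *r (x - (1/2) *r (y + z))" by (simp add: u_def v_def algebra_simps scaleR_2)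
  hence "norm (u + v) = 2 * dist x ((1/2) *r (y + z))" by (simp add: dist_norm)
  hence "(2 * d)^2 <= (norm (u + v))^2" using dle[OF scR[OF add[OF that]], of "1/2"] d0 by (intro power_mono) auto
  moreover have "(norm (u - v))^2 + (norm (u + v))^2 = 2 * (norm u)^2 + 2 * (norm v)^2"
   by (simp add: power2_norm_eq_inner inner_add_left inner_add_right inner_diff_left inner_diff_right inner_commute)
  moreover have "dist y z = norm (u - v)" by (simp add: u_def v_def dist_norm norm_minus_commute)
  ultimately show ?thesis by (simp add: u_def v_def dist_norm power_mult_distrib)
 qed
 define S where "S n = V \<inter> cball x (d + inverse (real (Suc n)))" for n
 obtain p where p: "!!n. p : S n"
 proof (rule decreasing_closed_nest[of S])
  show "closed (S n)" for n by (simp add: S_def closed_Int cl)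
  show "S n ~= {}" for n
  proof
   assume "S n = {}"
   hence "d + inverse (real (Suc n)) <= dist x y" if "y : V" for y using that unfolding S_def by force
   hence "d + inverse (real (Suc n)) <= infdist x V" using ne unfolding infdist_def by (auto intro!: cINF_greatest)
   thus False unfolding d_def by (simp add: not_less[symmetric] del: of_nat_Suc)
  qed
  show "S n \<subseteq> S m" if "m <= n" for m n using that unfolding S_def
   by (intro Int_mono order_refl subset_cball add_left_mono le_imp_inverse_le) auto
  fix e :: real assume e: "e > 0"
  \<comment> \<open>Once both squared distances to \<open>x\<close> are below d^2 + e^2/4,
    \<open>par\<close> gives a squared diameter below e^2.\<close>
  have "(%n. (d + inverse (real (Suc n)))^2) ----> (d + 0)\<^sup>2" by (intro tendsto_intros LIMSEQ_inverse_real_of_nat)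
  hence "\<forall>\<^sub>F n in sequentially. (d + inverse (real (Suc n)))^2 < d\<^sup>2 + e\<^sup>2 / 4"
   by (rule order_tendstoD) (use e in simp)
  then obtain n where n: "(d + inverse (real (Suc n)))^2 < d\<^sup>2 + e\<^sup>2 / 4" unfolding eventually_sequentially by blast
  have b: "y : V & (dist x y)^2 <= (d + inverse (real (Suc n)))^2" if "y : S n" for y
   using that unfolding S_def by (auto intro: power_mono)
  have "dist y z < e" if "y : S n" "z : S n" for y z
  proof -
   have "(dist y z)^2 < e\<^sup>2" using par[of y z] n b[OF that(1)] b[OF that(2)] by linarith
   thus ?thesis using e by (simp add: power_less_imp_less_base)
  qed
  thus "EX n. ALL y:S n. ALL z:S n. dist y z < e" by blast
 qed (rule that)
 have pV: "p : V" using p[of 0] by (simp add: S_def)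
 have "dist x p <= d + 0"
  by (rule LIMSEQ_le_const[OF tendsto_add[OF tendsto_const LIMSEQ_inverse_real_of_nat]]) (use p in "simp add: S_def")
 hence "ALL z:V. dist x p <= dist x z" using dle by force
 moreover have "convex V" by (auto simp: convex_def intro: add scR)
 ultimately have "inner (x - p) v <= 0" if "v : V" for v
  using any_closest_point_dot[of V p "p + v" x] cl pV add[OF pV that] by simp
 note i = this this[OF cvec.subspace_neg[OF sub]]
 have Re: "Re (cinner v (x - p)) = 0" if "v : V" for v
  using i(1)[OF that] i(2)[OF that] by (simp add: inner_commute[of _ v] flip: inner_eq_Re_cinner)
 have "cinner v (x - p) = 0" if "v : V" for v
  using Re[OF that] Re[OF sc[OF that], of \<i>] by (simp add: complex_eq_iff cinner_scaleC_left)
 thus ?thesis using pV by blast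
qed

lemma linear_onD:
 assumes "linear_on UNIV P"
 shows "P (x + y) = P x + P y" "P (c *c x) = c *c P x" "P 0 = 0" "P (- x) = - P x" "P (x - y) = P x - P y"
proof -
 show a: "P (x + y) = P x + P y" and s: "P (c *c x) = c *c P x" for x y c
  using assms by (auto simp: linear_on_def)
 show "P 0 = 0" using s[of 0 0] by simp
 show m: "P (- x) = - P x" for x using s[of "-1" x] by (simp)
 show "P (x - y) = P x - P y" using a[of x "- y"] by (simp add: m)
qed

lemma linear_on_sum:
 assumes "linear_on UNIV P" shows "P (SUM i:I. f i) = (SUM i:I. P (f i))"
 by (induction I rule: infinite_finite_induct) (auto simp: linear_onD[OF assms])

lemma csubspace_range:
 assumes P: "linear_on UNIV P" shows "cvec.subspace (range P)"
proof (rule cvec.subspaceI)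
 show "0 : range P" using linear_onD(3)[OF P] by (metis rangeI)
 fix x y c assume "x : range P"
 then obtain u where u: "x = P u" by blast
 show "c *c x : range P" unfolding u linear_onD(2)[OF P, symmetric] by (rule rangeI)
 assume "y : range P"
 then obtain w where w: "y = P w" by blast
 show "x + y : range P" unfolding u w linear_onD(1)[OF P, symmetric] by (rule rangeI)
qed

lemma riesz:
 fixes f :: "'a::complex_hilbert => complex"
 assumes lin: "linear_on UNIV f" and bnd: "!!x. cmod (f x) <= C * norm x"
 obtains z where "!!x. f x = cinner z x"
proof (cases "ALL x. f x = 0")
 case True
 thus ?thesis using that[of 0] by simp
next
 case False
 then obtain x0 where x0: "f x0 ~= 0" by blast
 define K where "K = {x. f x = 0}"
 have subK: "cvec.subspace K"
  unfolding K_def by (rule cvec.subspaceI) (auto simp: linear_onD[OF lin])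
 have "bounded_linear f"
  by (rule bounded_linear_intro[of _ C])
   (auto simp: linear_onD[OF lin] bnd mult.commute scaleR_scaleC)
 hence clK: "closed K"
  unfolding K_def by (intro closed_Collect_eq) (auto intro: linear_continuous_on)
 obtain p where p: "p : K" "!!y. y : K ==> cinner y (x0 - p) = 0"
  using projection_exists[OF subK clK] by blast
 define r where "r = x0 - p"
 have fr: "f r = f x0" using p(1) by (simp add: r_def linear_onD[OF lin] K_def)
 hence "r ~= 0" using x0 linear_onD(3)[OF lin] by auto
 hence rr: "cinner r r ~= 0" by (simp add: cinner_zero_iff)
 define z where "z = cnj (f r / cinner r r) *c r"
 have "f x = cinner z x" for x
 proof -
  have "x - (f x / f r) *c r : K"
   using fr x0 by (simp add: K_def linear_onD[OF lin] scaleC_complex_def)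
  hence "cinner (x - (f x / f r) *c r) r = 0" using p(2) by (simp add: r_def)
  hence "cinner r (x - (f x / f r) *c r) = 0" by (subst cinner_commute) simp
  hence "cinner r x = f x / f r * cinner r r" by (simp add: cinner_diff_right cinner_scaleC_right)
  thus ?thesis using fr x0 rr by (simp add: z_def cinner_scaleC_left)
 qed
 thus ?thesis using that by blast
qed

subsection \<open>Complex linear bounded operators and adjoints\<close>

lemma bopsD: "T : bops ==> T (c *c x) = c *c T x" by (simp add: bops_def)

lemma bops_comp [intro, simp]: "S : bops ==> T : bops ==> S oo T : bops" by (simp add: bops_def)
lemma bops_id [intro, simp]: "id_blinfun : bops" by (simp add: bops_def)
lemma bops_zero [intro, simp]: "0 : bops" by (simp add: bops_def)
lemma bops_add [intro, simp]: "S : bops ==> T : bops ==> S + T : bops"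
 by (simp add: bops_def blinfun.add_left scaleC_add_right)
lemma bops_diff [intro, simp]: "S : bops ==> T : bops ==> S - T : bops"
 by (simp add: bops_def blinfun.diff_left cvec.scale_right_diff_distrib)
lemma scaleC_blinfun_apply [simp]: "blinfun_apply (c *c T) x = c *c blinfun_apply T x"
 by (simp add: scaleC_blinfun.rep_eq)
lemma bops_scaleC [intro, simp]: "T : bops ==> c *c T : bops"
 by (simp add: bops_def)
lemma bops_sum [intro]: "(!!i. i : I ==> T i : bops) ==> (SUM i:I. T i) : bops"
 by (induction I rule: infinite_finite_induct) auto
lemma subspace_bops: "cvec.subspace bops"
 by (rule cvec.subspaceI) auto

lemma scaleC_blinfun_comp: "(c *c S) oo T = c *c (S oo T)" "S : bops ==> S oo (c *c T) = c *c (S oo T)"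
 by (auto intro!: blinfun_eqI simp: bopsD)

lemma bops_Blinfun:
 assumes lin: "linear_on UNIV f" and bnd: "!!x. norm (f x) <= C * norm x"
 shows "Blinfun f : bops" "blinfun_apply (Blinfun f) x = f x"
proof -
 have "bounded_linear f"
  by (rule bounded_linear_intro[of _ C])
   (auto simp: linear_onD[OF lin] bnd mult.commute scaleR_scaleC)
 thus eq: "blinfun_apply (Blinfun f) x = f x" for x by (simp add: bounded_linear_Blinfun_apply)
 show "Blinfun f : bops" by (simp add: bops_def eq linear_onD[OF lin])
qed

lemma blinfun_cinner_eqI:
 "(!!x y. cinner x (blinfun_apply S y) = cinner x (blinfun_apply T y)) ==> S = (T :: 'a::complex_inner =>L 'b::complex_inner)"
 by (rule blinfun_eqI, rule cinner_extI)

lemma adj_exists: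
 fixes T :: "'a::complex_hilbert =>L 'b::complex_hilbert"
 assumes T: "T : bops"
 shows "EX S:bops. ALL x y. cinner x (T y) = cinner (blinfun_apply S x) y"
proof -
 have "EX z. ALL y. cinner x (T y) = cinner z y" for x
 proof -
  have "linear_on UNIV (%y. cinner x (T y))"
   by (simp add: linear_on_def blinfun.add_right bopsD[OF T] cinner_add_right cinner_scaleC_right scaleC_complex_def)
  moreover have "cmod (cinner x (T y)) <= (norm x * norm T) * norm y" for y
   using order_trans[OF cmod_cinner_le mult_left_mono[OF norm_blinfun]] by (simp add: mult.assoc)
  ultimately show ?thesis using riesz by metis
 qed
 then obtain S where S: "!!x y. cinner x (T y) = cinner (S x) y" by metis
 have S': "cinner y (S x) = cinner (T y) x" for x y using S by (metis cinner_commute)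
 have lin: "linear_on UNIV S"
  unfolding linear_on_def
  by (intro conjI ballI allI; rule cinner_extI) (auto simp: S' cinner_add_right cinner_scaleC_right)
 have "norm (S x) <= norm T * norm x" for x
 proof -
  have "(norm (S x))^2 = cmod (cinner (S x) (S x))" by (simp add: cinner_self_norm flip: of_real_power)
  also have "... = cmod (cinner (T (S x)) x)" by (simp add: S')
  also have "... <= norm (T (S x)) * norm x" by (rule cmod_cinner_le)
  also have "... <= norm T * norm (S x) * norm x" by (intro mult_right_mono norm_blinfun) auto
  finally have "norm (S x) * norm (S x) <= norm (S x) * (norm T * norm x)"
   by (simp add: power2_eq_square algebra_simps)
  thus ?thesis by (rule le_of_mult_self_le) simp
 qed
 from bops_Blinfun[OF lin this] show ?thesis using S by (intro bexI[of _ "Blinfun S"]) auto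
qed

lemma adj_ex1:
 fixes T :: "'a::complex_hilbert =>L 'b::complex_hilbert"
 assumes T: "T : bops"
 shows "adj T : bops" "cinner x (T y) = cinner (adj T x) y"
proof -
 obtain S where S: "S : bops" "!!x y. cinner x (T y) = cinner (blinfun_apply S x) y" using adj_exists[OF T] by blast
 have "adj T = S"
  unfolding adj_def
 proof (rule the_equality)
  show "ALL x y. cinner x (T y) = cinner (S x) y" using S by blast
  fix S' assume "ALL x y. cinner x (T y) = cinner (blinfun_apply S' x) y"
  thus "S' = S" using S(2) by (intro blinfun_cinner_eqI) (metis cinner_commute)
 qed
 thus "adj T : bops" "cinner x (T y) = cinner (adj T x) y" using S by auto
qed

lemmas bops_adj [intro, simp] = adj_ex1(1)
lemma cinner_adj_left: "T : bops ==> cinner (adj T x) y = cinner x (blinfun_apply T y)" by (simp add: adj_ex1(2))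
lemma cinner_adj_right: "T : bops ==> cinner x (adj T y) = cinner (blinfun_apply T x) y"
 by (metis adj_ex1(2) cinner_commute)

lemma adjI:
 assumes "T : bops" "!!x y. cinner x (blinfun_apply T y) = cinner (blinfun_apply S x) y"
 shows "adj T = S"
 using assms by (intro blinfun_cinner_eqI) (metis cinner_adj_right cinner_commute)

lemma adj_adj [simp]: "T : bops ==> adj (adj T) = T"
 by (rule adjI) (auto simp: cinner_adj_right)
lemma adj_comp: "S : bops ==> T : bops ==> adj (S oo T) = adj T oo adj S"
 by (rule adjI) (auto simp: cinner_adj_left)
lemma adj_id [simp]: "adj id_blinfun = id_blinfun" by (rule adjI) auto

lemma norm_adj_le: "T : bops ==> norm (adj T) <= norm T"
proof (rule norm_blinfun_bound)
 fix x assume T: "T : bops"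
 have "(norm (adj T x))^2 = cmod (cinner (adj T x) (adj T x))" by (simp add: cinner_self_norm flip: of_real_power)
 also have "... = cmod (cinner (T (adj T x)) x)" using T by (simp add: cinner_adj_right)
 also have "... <= norm (T (adj T x)) * norm x" by (rule cmod_cinner_le)
 also have "... <= norm T * norm (adj T x) * norm x" by (intro mult_right_mono norm_blinfun) auto
 finally have "norm (adj T x) * norm (adj T x) <= norm (adj T x) * (norm T * norm x)"
  by (simp add: power2_eq_square algebra_simps)
 thus "norm (adj T x) <= norm T * norm x" by (rule le_of_mult_self_le) simp
qed auto

lemma isometry_adj_comp:
 assumes "V : bops" "!!x y. cinner (blinfun_apply V x) (blinfun_apply V y) = cinner x y"
 shows "adj V oo V = id_blinfun" "blinfun_apply (adj V) (blinfun_apply V x) = x"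
proof -
 show "adj V oo V = id_blinfun" by (rule blinfun_cinner_eqI) (use assms in "auto simp: cinner_adj_right")
 thus "blinfun_apply (adj V) (blinfun_apply V x) = x" by (metis blinfun_apply_blinfun_compose blinfun_apply_id_blinfun)
qed

subsection \<open>Total sets\<close>

definition total :: "'a::complex_inner set => bool" where
 "total S \<longleftrightarrow> closure (cvec.span S) = UNIV"

lemma orthogonal_span:
 assumes "!!s. s : S ==> cinner s x = 0" "y : cvec.span S" shows "cinner y x = 0"
 using assms(2) by (induction rule: cvec.span_induct_alt) (auto simp: cinner_add_left cinner_scaleC_left assms(1))

lemma orthogonal_closure:
 fixes x :: "'a::complex_inner"
 assumes "!!s. s : S ==> cinner s x = 0" "y : closure S" shows "cinner y x = 0"
proof -
 obtain a where a: "!!n. a n : S" "a ----> y" using assms(2) unfolding closure_sequential by blast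
 have "(%n. cinner (a n) x) ----> cinner y x" using a(2) by (intro tendsto_cinner) auto
 thus ?thesis using a(1) assms(1) LIMSEQ_unique[OF _ tendsto_const] by fastforce
qed

lemma totalD:
 fixes x :: "'a::complex_inner"
 assumes "total S" "!!s. s : S ==> cinner s x = 0" shows "x = 0"
proof -
 have "cinner x x = 0"
  by (rule orthogonal_closure[of "cvec.span S"]) (use assms in "auto simp: total_def intro: orthogonal_span[of S]")
 thus ?thesis by (simp add: cinner_zero_iff)
qed

lemma totalI:
 fixes S :: "'a::complex_hilbert set"
 assumes "!!x. (!!s. s : S ==> cinner s x = 0) ==> x = 0" shows "total S"
proof -
 have "x : closure (cvec.span S)" for x
 proof -
  obtain p where p: "p : closure (cvec.span S)" "!!y. y : closure (cvec.span S) ==> cinner y (x - p) = 0"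
   using projection_exists[of "closure (cvec.span S)" x] csubspace_closure[OF cvec.subspace_span[of S]] by auto
  have "x - p = 0" using assms[of "x - p"] p(2) cvec.span_base closure_subset by blast
  thus ?thesis using p(1) by simp
 qed
 thus ?thesis by (auto simp: total_def)
qed

lemma total_eqI:
 fixes x y :: "'a::complex_inner"
 assumes "total S" "!!s. s : S ==> cinner s x = cinner s y" shows "x = y"
 using totalD[OF assms(1), of "x - y"] assms(2) by (auto simp: cinner_diff_right)

lemma total_op_eqI:
 assumes tot: "total S" and "T : bops" "T' : bops" "!!s. s : S ==> blinfun_apply T s = blinfun_apply T' s"
 shows "T = T'"
proof (rule blinfun_eqI)
 fix x
 have span: "T y = T' y" if "y : cvec.span S" for y
  using that by (induction rule: cvec.span_induct_alt)
   (auto simp: blinfun.add_right assms(2-4) bopsD)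
 have "x : closure (cvec.span S)" using tot by (simp add: total_def)
 then obtain a where a: "!!n. a n : cvec.span S" "a ----> x" unfolding closure_sequential by blast
 have "(%n. T (a n)) ----> T x" "(%n. T' (a n)) ----> T' x" using a(2) by (auto intro: tendsto_intros)
 thus "T x = T' x" using span a(1) LIMSEQ_unique by fastforce
qed

lemma total_form_eqI:
 assumes tot: "total S" "total S'" and ops: "T : bops" "T' : bops"
  and eq: "!!s s'. s : S ==> s' : S' ==> cinner s (blinfun_apply T s') = cinner s (blinfun_apply T' s')"
 shows "T = T'"
 by (rule total_op_eqI[OF tot(2) ops]) (rule total_eqI[OF tot(1)], rule eq)

lemma total_mono: "total S ==> S \<subseteq> S' ==> total S'"
 unfolding total_def by (metis closure_mono cvec.span_mono top.extremum_uniqueI)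

subsection \<open>Extension of operators from families of vectors\<close>

lemma closed_proj_props:
 fixes V :: "'a::complex_hilbert set"
 assumes sub: "cvec.subspace V" and cl: "closed V"
 shows "closed_proj V : bops" "blinfun_apply (closed_proj V) x : V" "!!y. y : V ==> cinner y (x - blinfun_apply (closed_proj V) x) = 0"
  "x : V ==> blinfun_apply (closed_proj V) x = x" "norm (blinfun_apply (closed_proj V) x) <= norm x"
proof -
 have "EX p. p : V & (ALL y:V. cinner y (x - p) = 0)" for x using projection_exists[OF sub cl] by blast
 then obtain p where p: "!!x. p x : V" "!!x y. y : V ==> cinner y (x - p x) = 0" by metis
 have uniq: "q = p x" if "q : V" "!!y. y : V ==> cinner y (x - q) = 0" for x q
 proof -
  have "q - p x : V" using that p cvec.subspace_diff[OF sub] by blast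
  from that(2)[OF this] p(2)[OF this, of x] have "cinner (q - p x) ((x - p x) - (x - q)) = 0"
   by (simp add: cinner_diff_right del: diff_diff_eq2)
  thus ?thesis by (simp add: cinner_zero_iff)
 qed
 have lin: "linear_on UNIV p"
  unfolding linear_on_def
 proof (intro conjI ballI allI)
  fix x y show "p (x + y) = p x + p y"
  proof (rule uniq[symmetric])
   show "p x + p y : V" by (intro cvec.subspace_add[OF sub] p)
   fix z assume "z : V" from p(2)[OF this, of x] p(2)[OF this, of y]
   show "cinner z (x + y - (p x + p y)) = 0" by (simp add: cinner_add_right cinner_diff_right)
  qed
 next
  fix c x show "p (c *c x) = c *c p x"
  proof (rule uniq[symmetric])
   show "c *c p x : V" by (intro cvec.subspace_scale[OF sub] p)
   fix z assume "z : V" from p(2)[OF this, of x]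
   show "cinner z (c *c x - c *c p x) = 0" by (simp add: cinner_scaleC_right cinner_diff_right)
  qed
 qed
 have nrm: "norm (p x) <= 1 * norm x" for x
 proof -
  have "(norm (p x))^2 = cmod (cinner (p x) (p x))" by (simp add: cinner_self_norm flip: of_real_power)
  also have "... = cmod (cinner (p x) x)" using p(2)[OF p(1), of x x] by (simp add: cinner_diff_right)
  also have "... <= norm (p x) * norm x" by (rule cmod_cinner_le)
  finally show ?thesis using le_of_mult_self_le[of "norm (p x)" "norm x"] by (simp add: power2_eq_square)
 qed
 note B = bops_Blinfun[OF lin nrm]
 have "closed_proj V = Blinfun p"
  unfolding closed_proj_def
 proof (rule the_equality)
  show "Blinfun p : bops & (ALL x. blinfun_apply (Blinfun p) x : V & (ALL y:V. cinner y (x - blinfun_apply (Blinfun p) x) = 0))"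
   using B p by simp
  fix Q assume "Q : bops & (ALL x. blinfun_apply Q x : V & (ALL y:V. cinner y (x - blinfun_apply Q x) = 0))"
  thus "Q = Blinfun p" by (intro blinfun_eqI) (simp add: B uniq)
 qed
 thus "closed_proj V : bops" "blinfun_apply (closed_proj V) x : V" "!!y. y : V ==> cinner y (x - blinfun_apply (closed_proj V) x) = 0"
  "x : V ==> blinfun_apply (closed_proj V) x = x" "norm (blinfun_apply (closed_proj V) x) <= norm x"
  using B p uniq[of x x] nrm[of x] by auto
qed

text \<open>\<open>P\<close> parametrises a subspace, possibly with redundancy, and the bound is
  what makes \<open>P v\<close> to \<open>Q v\<close> well defined. The operator is read off from
  the closure \<open>G\<close> of the graph: the bound survives the closure and makes
  \<open>G\<close> single valued, completeness makes its domain all of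
  \<open>closure (range P)\<close>, and composing with the projection makes the operator vanish on
  the orthogonal complement.\<close>

lemma extension_exists:
 fixes P :: "'v::complex_vector => 'a::complex_hilbert" and Q :: "'v => 'b::complex_hilbert"
 assumes linP: "linear_on UNIV P" and linQ: "linear_on UNIV Q" and bnd: "!!v. norm (Q v) <= C * norm (P v)" and C: "C >= 0"
 obtains V where "V : bops" "!!v. blinfun_apply V (P v) = Q v" "norm V <= C"
  "!!x. (!!v. cinner (P v) x = 0) ==> blinfun_apply V x = 0"
proof -
 let ?p = "closed_proj (closure (range P))" and ?R = "range (%v. (P v, Q v))"
 note p = closed_proj_props[OF csubspace_closure[OF csubspace_range[OF linP]] closed_closure]
 note lin = linear_onD[OF linP] linear_onD[OF linQ]
 define G where "G = closure ?R"
 have G: "cvec.subspace G"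
  unfolding G_def by (intro csubspace_closure csubspace_range) (simp add: linear_on_def lin scaleC_prod_def)
 have Gb: "norm (snd z) <= C * norm (fst z)" if "z : G" for z
 proof -
  have "closed {z :: 'a \<times> 'b. norm (snd z) <= C * norm (fst z)}" by (intro closed_Collect_le continuous_intros)
  moreover have "?R \<subseteq> {z. norm (snd z) <= C * norm (fst z)}" using bnd by auto
  ultimately show ?thesis using closure_minimal that unfolding G_def by blast
 qed
 have uniq: "y = y'" if "(x, y) : G" "(x, y') : G" for x y y'
  using Gb[OF cvec.subspace_diff[OF G that]] by simp
 have ex: "EX y. (x, y) : G" if x: "x : closure (range P)" for x
 proof -
  obtain a where a: "!!n. a n : range P" "a ----> x" using x unfolding closure_sequential by blast
  define v where "v n = inv P (a n)" for n
  have v: "P (v n) = a n" for n using f_inv_into_f[OF a(1)] by (simp add: v_def)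
  have "Cauchy (%n. Q (v n))"
  proof (rule CauchyI)
   fix e :: real assume e: "e > 0"
   \<comment> \<open>\<open>C + 1\<close> instead of \<open>C\<close> keeps the divisor positive
     when \<open>C\<close> is 0.\<close>
   hence "e / (C + 1) > 0" using C by simp
   from CauchyD[OF LIMSEQ_imp_Cauchy[OF a(2)] this] obtain M
    where M: "!!m n. m >= M ==> n >= M ==> norm (a m - a n) < e / (C + 1)" by blast
   have "norm (Q (v m) - Q (v n)) < e" if "m >= M" "n >= M" for m n
   proof -
    have "norm (Q (v m) - Q (v n)) <= C * norm (a m - a n)" using bnd[of "v m - v n"] by (simp add: v lin)
    also have "... <= C * (e / (C + 1))" using M[OF that] C by (intro mult_left_mono) auto
    also have "... < e" using e C by (simp add: field_simps)
    finally show ?thesis .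
   qed
   thus "EX M. ALL m>=M. ALL n>=M. norm (Q (v m) - Q (v n)) < e" by blast
  qed
  then obtain y where "(%n. Q (v n)) ----> y" using Cauchy_convergent convergent_def by blast
  hence "(%n. (P (v n), Q (v n))) ----> (x, y)" unfolding v by (rule tendsto_Pair[OF a(2)])
  thus ?thesis unfolding G_def closure_sequential by (intro exI[of _ y] exI[of _ "%n. (P (v n), Q (v n))"]) auto
 qed
 obtain V where V: "!!x. (?p x, V x) : G" using ex[OF p(2)] by metis
 have lV: "linear_on UNIV V"
  unfolding linear_on_def
 proof (intro conjI ballI allI)
  fix x y c
  show "V (x + y) = V x + V y"
   using cvec.subspace_add[OF G V[of x] V[of y]] by (intro uniq[OF V]) (simp add: blinfun.add_right)
  show "V (c *c x) = c *c V x"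
   using cvec.subspace_scale[OF G V[of x], of c] by (intro uniq[OF V]) (simp add: bopsD[OF p(1)] scaleC_prod_def)
 qed
 have "norm (V x) <= C * norm x" for x using Gb[OF V[of x]] mult_left_mono[OF p(5)[of x] C] by simp
 note B = bops_Blinfun[OF lV this]
 show ?thesis
 proof (rule that[of "Blinfun V"])
  show "Blinfun V : bops" by (rule B)
  show "norm (Blinfun V) <= C" by (rule norm_blinfun_bound) (auto simp: B \<open>!!x. norm (V x) <= C * norm x\<close> C)
  show "Blinfun V (P v) = Q v" for v
  proof -
   have "P v : closure (range P)" "(P v, Q v) : G" unfolding G_def by (rule subsetD[OF closure_subset], blast)+
   thus ?thesis using V[of "P v"] p(4) by (simp add: B uniq)
  qed
  fix x assume "!!v. cinner (P v) x = 0"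
  hence "cinner (?p x) x = 0" by (intro orthogonal_closure[OF _ p(2)]) auto
  hence "cinner (?p x) (?p x) = 0" using p(3)[OF p(2), of x x] by (simp add: cinner_diff_right)
  thus "Blinfun V x = 0" using Gb[OF V[of x]] by (simp add: B(2) cinner_zero_iff)
 qed
qed

text \<open>The linear map on finitely supported coefficient functions induced by a family of
  vectors. Two of these are the \<open>P\<close> and \<open>Q\<close> to which
  \<open>extension_exists\<close> is applied, so that linear dependences inside a family need no
  separate treatment.\<close>

definition lincomb :: "('i => 'a::complex_vector) => 'i formal => 'a" where
 "lincomb a f = (\<Sum>i | formal_coeff f i ~= 0. formal_coeff f i *c a i)"

lemma lincomb_superset:
 assumes "finite S" "{i. formal_coeff f i ~= 0} \<subseteq> S"
 shows "lincomb a f = (SUM i:S. formal_coeff f i *c a i)"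
 unfolding lincomb_def using assms by (intro sum.mono_neutral_left) auto

lemma linear_on_lincomb:
 fixes a :: "'i => 'a::complex_vector"
 shows "linear_on UNIV (lincomb a)"
 unfolding linear_on_def
proof (intro conjI ballI allI)
 fix f g :: "'i formal" and c
 define S where "S = {i. formal_coeff f i ~= 0} \<union> {i. formal_coeff g i ~= 0}"
 have S: "finite S" by (simp add: S_def finite_formal_coeff)
 have sub: "{i. formal_coeff f i ~= 0} \<subseteq> S" "{i. formal_coeff g i ~= 0} \<subseteq> S"
  "{i. formal_coeff (f + g) i ~= 0} \<subseteq> S" "{i. formal_coeff (c *c f) i ~= 0} \<subseteq> S"
  by (auto simp: S_def plus_formal.rep_eq scaleC_formal.rep_eq)
 show "lincomb a (f + g) = lincomb a f + lincomb a g"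
  unfolding lincomb_superset[OF S sub(1)] lincomb_superset[OF S sub(2)] lincomb_superset[OF S sub(3)]
  by (simp add: plus_formal.rep_eq scaleC_add_left sum.distrib)
 show "lincomb a (c *c f) = c *c lincomb a f"
  unfolding lincomb_superset[OF S sub(1)] lincomb_superset[OF S sub(4)]
  by (simp add: scaleC_formal.rep_eq cvec.scale_sum_right)
qed

lemma lincomb_single [simp]: "lincomb a (formal_single i) = a i"
proof -
 have "{j. formal_coeff (formal_single i) j ~= 0} \<subseteq> {i}" by (auto simp: formal_single.rep_eq split: if_splits)
 from lincomb_superset[OF _ this, of a] show ?thesis by (simp add: formal_single.rep_eq)
qed

lemma cinner_lincomb:
 "cinner (lincomb a f) (lincomb b g) = (\<Sum>i | formal_coeff f i ~= 0. \<Sum>j | formal_coeff g j ~= 0.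
  cnj (formal_coeff f i) * formal_coeff g j * cinner (a i) (b j))"
 by (simp add: lincomb_def cinner_sum_left cinner_sum_right cinner_scaleC_left cinner_scaleC_right sum_distrib_left mult.assoc)
  (subst sum.swap, simp add: mult.left_commute)

lemma span_lincomb: "cvec.span (range a) = range (lincomb a)"
proof
 have "a i : range (lincomb a)" for i by (metis lincomb_single rangeI)
 thus "cvec.span (range a) \<subseteq> range (lincomb a)"
  by (intro cvec.span_minimal csubspace_range linear_on_lincomb) auto
 show "range (lincomb a) \<subseteq> cvec.span (range a)"
  unfolding lincomb_def by (intro image_subsetI cvec.span_sum cvec.span_scale cvec.span_base rangeI)
qed

lemma lincomb_generator: "lincomb generator f = to_completion f"
proof -
 have *: "linear_on UNIV (to_completion :: 'a formal => _)"
  by (simp add: linear_on_def to_completion_add to_completion_scaleC)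
 have f: "f = lincomb formal_single f"
 proof -
  have "formal_coeff (lincomb formal_single f) x = formal_coeff f x" for x
  proof -
   have sum: "formal_coeff (SUM i:I. g i) x = (SUM i:I. formal_coeff (g i) x)" for I :: "'a set" and g
    by (induction I rule: infinite_finite_induct) (auto simp: zero_formal.rep_eq plus_formal.rep_eq)
   show ?thesis
    by (simp add: lincomb_def sum scaleC_formal.rep_eq formal_single.rep_eq finite_formal_coeff
      if_distrib[of "(*) _"] cong: if_cong)
  qed
  thus ?thesis by (metis formal_coeff_inject ext)
 qed
 have "to_completion f = to_completion (lincomb formal_single f)" using f by simp
 also have "... = lincomb generator f"
  by (simp add: lincomb_def linear_on_sum[OF *] to_completion_scaleC generator_def)
 finally show ?thesis by simp
qed

lemma total_generator: "total (range (generator :: 'i::pd_kernel => _))"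
proof -
 have "range (lincomb (generator :: 'i => _)) = range to_completion" by (simp add: lincomb_generator)
 thus ?thesis unfolding total_def span_lincomb using to_completion_dense by metis
qed

lemma family_extension:
 fixes a :: "'i => 'a::complex_hilbert" and b :: "'i => 'b::complex_hilbert"
 assumes "!!f. norm (lincomb b f) <= C * norm (lincomb a f)" "C >= 0"
 obtains V where "V : bops" "!!i. blinfun_apply V (a i) = b i" "norm V <= C"
  "!!x. (!!i. cinner (a i) x = 0) ==> blinfun_apply V x = 0"
proof -
 obtain V where V: "V : bops" "!!v. blinfun_apply V (lincomb a v) = lincomb b v" "norm V <= C"
  "!!x. (!!v. cinner (lincomb a v) x = 0) ==> blinfun_apply V x = 0"
  using extension_exists[OF linear_on_lincomb linear_on_lincomb assms] by metis
 show ?thesis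
 proof (rule that[OF V(1) _ V(3)])
  show "V (a i) = b i" for i using V(2)[of "formal_single i"] by simp
  fix x assume "!!i. cinner (a i) x = 0"
  thus "V x = 0" by (intro V(4)) (auto simp: lincomb_def cinner_sum_left cinner_scaleC_left)
 qed
qed

lemma isometry_on_total:
 fixes V :: "'a::complex_hilbert =>L 'b::complex_hilbert"
 assumes V: "V : bops" and tot: "total (range a)"
  and g: "!!i j. cinner (blinfun_apply V (a i)) (blinfun_apply V (a j)) = cinner (a i) (a j)"
 shows "cinner (blinfun_apply V x) (blinfun_apply V y) = cinner x y"
proof -
 have "adj V oo V = id_blinfun"
  by (rule total_form_eqI[OF tot tot]) (use V g in "auto simp: cinner_adj_right")
 hence "adj V (V y) = y" by (metis blinfun_apply_blinfun_compose blinfun_apply_id_blinfun)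
 thus ?thesis using V by (metis cinner_adj_right)
qed

text \<open>Norms of linear combinations depend only on the Gram matrix, so the bound of
  \<open>family_extension\<close> holds with constant 1.\<close>

lemma gram_isometry:
 fixes a :: "'i => 'a::complex_hilbert" and b :: "'i => 'b::complex_hilbert"
 assumes g: "!!i j. cinner (b i) (b j) = cinner (a i) (a j)"
 obtains V where "V : bops" "!!i. blinfun_apply V (a i) = b i" "norm V <= 1"
  "!!x. (!!i. cinner (a i) x = 0) ==> blinfun_apply V x = 0"
proof -
 have "norm (lincomb b f) <= 1 * norm (lincomb a f)" for f
  using norm_eq_of_cinner[of "lincomb b f" "lincomb a f"] by (simp add: cinner_lincomb g)
 from family_extension[OF this] show ?thesis using that by auto
qed

lemma gram_isometry_total:
 fixes a :: "'i => 'a::complex_hilbert" and b :: "'i => 'b::complex_hilbert"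
 assumes g: "!!i j. cinner (b i) (b j) = cinner (a i) (a j)" and tot: "total (range a)"
 obtains V where "V : bops" "!!i. blinfun_apply V (a i) = b i"
  "!!x y. cinner (blinfun_apply V x) (blinfun_apply V y) = cinner x y"
proof -
 obtain V where V: "V : bops" "!!i. blinfun_apply V (a i) = b i"
  by (rule gram_isometry[OF g]) (rule that)
 show ?thesis using that[OF V isometry_on_total[OF V(1) tot]] by (simp add: V g)
qed

subsection \<open>Tensor products of operators\<close>

lemma tensor_zero [simp]: "0 \<odot> y = 0" "x \<odot> 0 = 0"
 using tensor_scaleC_left[of 0 0 y] tensor_scaleC_right[of x 0 0] by auto

lemma tensor_sum_left: "(SUM i:I. x i) \<odot> y = (SUM i:I. x i \<odot> y)"
 by (induction I rule: infinite_finite_induct) (auto simp: tensor_add_left)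
lemma tensor_sum_right: "x \<odot> (SUM i:I. y i) = (SUM i:I. x \<odot> y i)"
 by (induction I rule: infinite_finite_induct) (auto simp: tensor_add_right)
lemma tensor_diff_left: "(x - x') \<odot> y = x \<odot> y - x' \<odot> y"
 using tensor_add_left[of "x - x'" x' y] by simp
lemma tensor_diff_right: "x \<odot> (y - y') = x \<odot> y - x \<odot> y'"
 using tensor_add_right[of x "y - y'" y'] by simp
lemma tensor_scaleR_right: "x \<odot> (r *r y) = r *r (x \<odot> y)"
 by (simp add: scaleR_scaleC tensor_scaleC_right)

lemma norm_tensor [simp]: "norm (x \<odot> y) = norm x * norm (y::'b::complex_inner)"
 for x :: "'a::complex_inner"
proof -
 have "cinner (x \<odot> y) (x \<odot> y) = complex_of_real ((norm x)^2) * complex_of_real ((norm y)^2)"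
  unfolding cinner_tensor by (simp only: cinner_self_norm)
 hence "(norm (x \<odot> y))^2 = (norm x)^2 * (norm y)^2"
  by (metis Re_cinner_norm Re_complex_of_real of_real_mult)
 thus ?thesis
  by (metis mult_nonneg_nonneg norm_ge_zero power2_eq_iff_nonneg power_mult_distrib)
qed

lemma total_tensor_range: "total (range (%(x, y). x \<odot> y))"
proof -
 have "range (generator :: ('a, 'b) tgen => _) \<subseteq> range (%(x, y). x \<odot> y)"
 proof
  fix z assume "z : range (generator :: ('a, 'b) tgen => _)"
  then obtain g :: "('a, 'b) tgen" where "z = generator g" by blast
  thus "z : range (%(x, y). x \<odot> y)" by (cases g) (auto simp: tensor_def)
 qed
 thus ?thesis using total_generator total_mono by blast
qed

text \<open>A vector \<open>z\<close> orthogonal to all products is shown to vanish one factor at a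
  time: for fixed \<open>s'\<close> the Riesz vector of x -> <z, x \<odot> s'> is orthogonal to
  \<open>S\<close>, hence 0, and then the same argument applies in the second factor.\<close>

lemma total_tensor:
 fixes S :: "'a::complex_hilbert set" and S' :: "'b::complex_hilbert set"
 assumes "total S" "total S'" shows "total {s \<odot> s' | s s'. s : S & s' : S'}"
proof (rule totalI)
 fix z :: "('a, 'b) tensor"
 assume z: "!!s. s : {s \<odot> s' | s s'. s : S & s' : S'} ==> cinner s z = 0"
 have r1: "EX w. ALL x. cinner z (x \<odot> y) = cinner w x" for y :: 'b
 proof -
  have l: "linear_on UNIV (%x::'a. cinner z (x \<odot> y))"
   by (simp add: linear_on_def tensor_add_left tensor_scaleC_left cinner_add_right cinner_scaleC_right scaleC_complex_def)
  have "cmod (cinner z (x \<odot> y)) <= (norm z * norm y) * norm x" for x :: 'a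
   using cmod_cinner_le[of z "x \<odot> y"] by (simp add: mult.commute mult.left_commute)
  thus ?thesis using riesz[OF l] by metis
 qed
 have r2: "EX w. ALL y. cinner z (x \<odot> y) = cinner w y" for x :: 'a
 proof -
  have l: "linear_on UNIV (%y::'b. cinner z (x \<odot> y))"
   by (simp add: linear_on_def tensor_add_right tensor_scaleC_right cinner_add_right cinner_scaleC_right scaleC_complex_def)
  have "cmod (cinner z (x \<odot> y)) <= (norm z * norm x) * norm y" for y :: 'b
   using cmod_cinner_le[of z "x \<odot> y"] by (simp add: mult.commute mult.left_commute)
  thus ?thesis using riesz[OF l] by metis
 qed
 have 1: "cinner z (x \<odot> s') = 0" if s': "s' : S'" for x s'
 proof -
  obtain w where w: "!!x. cinner z (x \<odot> s') = cinner w x" using r1 by metis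
  have "cinner s w = 0" if "s : S" for s
  proof -
   have "cinner (s \<odot> s') z = 0" using z that s' by blast
   thus ?thesis using w by (metis cinner_commute)
  qed
  hence "w = 0" using totalD[OF assms(1)] by blast
  thus ?thesis using w by simp
 qed
 have "cinner z (x \<odot> y) = 0" for x y
 proof -
  obtain w where w: "!!y. cinner z (x \<odot> y) = cinner w y" using r2 by metis
  have "cinner s' w = 0" if "s' : S'" for s'
   using 1[OF that, of x] w by (metis cinner_commute complex_cnj_zero)
  hence "w = 0" using totalD[OF assms(2)] by blast
  thus ?thesis using w by simp
 qed
 hence "cinner s z = 0" if "s : range (%(x, y). x \<odot> y)" for s
  using that by (auto) (metis cinner_commute complex_cnj_zero)
 thus "z = 0" by (rule totalD[OF total_tensor_range])
qed

lemma tensor_op_eqI: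
 assumes "R : bops" "R' : bops" "!!x y. blinfun_apply R (x \<odot> y) = blinfun_apply R' (x \<odot> y)"
 shows "R = R'"
 by (rule total_op_eqI[OF total_tensor_range assms(1,2)]) (use assms(3) in auto)

lemma orthonormal_norm_sum:
 assumes "finite E" "!!e e'. e : E ==> e' : E ==> cinner e e' = (if e = e' then 1 else 0)"
 shows "(norm (SUM e:E. z e \<odot> e))^2 = (SUM e:E. (norm (z e))^2)"
  "(norm (SUM e:E. e \<odot> z' e))^2 = (SUM e:E. (norm (z' e))^2)"
proof -
 have "complex_of_real ((norm (SUM e:E. z e \<odot> e))^2) = (SUM e:E. SUM e':E. if e' = e then cinner (z e) (z e') else 0)"
  unfolding cinner_self_norm[symmetric] cinner_sum_left cinner_sum_right
  by (subst sum.swap, intro sum.cong refl) (use assms in auto)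
 also have "... = of_real (SUM e:E. (norm (z e))^2)" using assms(1) by (simp add: cinner_self_norm)
 finally show "(norm (SUM e:E. z e \<odot> e))^2 = (SUM e:E. (norm (z e))^2)" by (simp only: of_real_eq_iff)
 have "complex_of_real ((norm (SUM e:E. e \<odot> z' e))^2) = (SUM e:E. SUM e':E. if e' = e then cinner (z' e) (z' e') else 0)"
  unfolding cinner_self_norm[symmetric] cinner_sum_left cinner_sum_right
  by (subst sum.swap, intro sum.cong refl) (use assms in auto)
 also have "... = of_real (SUM e:E. (norm (z' e))^2)" using assms(1) by (simp add: cinner_self_norm)
 finally show "(norm (SUM e:E. e \<odot> z' e))^2 = (SUM e:E. (norm (z' e))^2)" by (simp only: of_real_eq_iff)
qed

text \<open>Expanding all \<open>y i\<close> in one finite orthonormal system rewrites the sum with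
  orthonormal second legs. There the squared norm is the sum of the squared norms of the first legs,
  and \<open>S\<close> acts on each of them separately.\<close>

lemma norm_tensor_op_left_le:
 fixes S :: "'a::complex_hilbert =>L 'c::complex_hilbert" and y :: "'i => 'b::complex_hilbert"
 assumes S: "S : bops" and "finite I"
 shows "norm (SUM i:I. S (x i) \<odot> y i) <= norm S * norm (SUM i:I. x i \<odot> y i)"
proof -
 obtain E where E: "finite E" "!!e e'. e : E ==> e' : E ==> cinner e e' = (if e = e' then 1 else 0)"
  "!!i. i : I ==> y i = (SUM e:E. cinner e (y i) *c e)"
  using finite_orthonormal[OF \<open>finite I\<close>, of y] by blast
 have ex: "(SUM i:I. w i \<odot> y i) = (SUM e:E. (SUM i:I. cinner e (y i) *c w i) \<odot> e)" for w :: "'i => 'd::complex_hilbert"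
 proof -
  have "(SUM i:I. w i \<odot> y i) = (SUM i:I. w i \<odot> (SUM e:E. cinner e (y i) *c e))"
   by (intro sum.cong refl arg_cong2[of _ _ _ _ tensor] E(3))
  also have "... = (SUM e:E. SUM i:I. (cinner e (y i) *c w i) \<odot> e)"
   unfolding tensor_sum_right by (subst sum.swap) (simp add: tensor_scaleC_left tensor_scaleC_right)
  finally show ?thesis by (simp add: tensor_sum_left)
 qed
 have "(norm (SUM i:I. S (x i) \<odot> y i))^2 = (SUM e:E. (norm (S (SUM i:I. cinner e (y i) *c x i)))^2)"
  by (simp add: ex orthonormal_norm_sum[OF E(1,2)] blinfun.sum_right bopsD[OF S])
 also have "... <= (SUM e:E. (norm S * norm (SUM i:I. cinner e (y i) *c x i))^2)"
  by (intro sum_mono power_mono norm_blinfun) auto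
 also have "... = (norm S * norm (SUM i:I. x i \<odot> y i))^2"
  by (simp add: ex orthonormal_norm_sum[OF E(1,2)] power_mult_distrib sum_distrib_left)
 finally show ?thesis by (rule power2_le_imp_le) simp
qed

lemma norm_tensor_sum_swap:
 fixes x :: "'i => 'a::complex_hilbert" and y :: "'i => 'b::complex_hilbert"
 shows "norm (SUM i:I. x i \<odot> y i) = norm (SUM i:I. y i \<odot> x i)"
 by (rule norm_eq_of_cinner) (simp add: cinner_sum_left cinner_sum_right mult.commute)

lemma norm_tensor_op_right_le:
 fixes T :: "'b::complex_hilbert =>L 'd::complex_hilbert" and x :: "'i => 'a::complex_hilbert"
 assumes T: "T : bops" and "finite I"
 shows "norm (SUM i:I. x i \<odot> T (y i)) <= norm T * norm (SUM i:I. x i \<odot> y i)"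
 unfolding norm_tensor_sum_swap[of x] by (rule norm_tensor_op_left_le[OF assms])

lemma tensor_op_exists:
 fixes S :: "'a::complex_hilbert =>L 'c::complex_hilbert" and T :: "'b::complex_hilbert =>L 'd::complex_hilbert"
 assumes S: "S : bops" and T: "T : bops"
 shows "EX R:bops. (ALL x y. blinfun_apply R (x \<odot> y) = S x \<odot> T y) & norm R <= norm S * norm T"
proof -
 define a where "a = (%(x::'a, y::'b). x \<odot> y)"
 define b where "b = (%(x::'a, y::'b). S x \<odot> T y)"
 have "norm (lincomb b f) <= (norm S * norm T) * norm (lincomb a f)" for f
 proof -
  let ?I = "{i. formal_coeff f i ~= 0}"
  have fin: "finite ?I" by (rule finite_formal_coeff)
  have "lincomb b f = (SUM i:?I. S (formal_coeff f i *c fst i) \<odot> T (snd i))"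
   by (simp add: lincomb_def b_def case_prod_unfold bopsD[OF S] tensor_scaleC_left)
  also have "norm ... <= norm S * norm (SUM i:?I. (formal_coeff f i *c fst i) \<odot> T (snd i))"
   by (rule norm_tensor_op_left_le[OF S fin])
  also have "... <= norm S * (norm T * norm (SUM i:?I. (formal_coeff f i *c fst i) \<odot> snd i))"
   by (intro mult_left_mono norm_tensor_op_right_le[OF T fin]) auto
  also have "(SUM i:?I. (formal_coeff f i *c fst i) \<odot> snd i) = lincomb a f"
   by (simp add: lincomb_def a_def case_prod_unfold tensor_scaleC_left)
  finally show ?thesis by (simp)
 qed
 then obtain V where V: "V : bops" "!!i. blinfun_apply V (a i) = b i" "norm V <= norm S * norm T"
  using family_extension[of b "norm S * norm T" a] by (metis mult_nonneg_nonneg norm_ge_zero)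
 have "V (x \<odot> y) = S x \<odot> T y" for x y using V(2)[of "(x, y)"] by (simp add: a_def b_def)
 thus ?thesis using V by blast
qed

lemma tensor_op_props:
 fixes S :: "'a::complex_hilbert =>L 'c::complex_hilbert" and T :: "'b::complex_hilbert =>L 'd::complex_hilbert"
 assumes S: "S : bops" and T: "T : bops"
 shows "S \<otimes> T : bops" "blinfun_apply (S \<otimes> T) (x \<odot> y) = S x \<odot> T y" "norm (S \<otimes> T) <= norm S * norm T"
proof -
 obtain R where R: "R : bops" "!!x y. blinfun_apply R (x \<odot> y) = S x \<odot> T y" "norm R <= norm S * norm T"
  using tensor_op_exists[OF S T] by blast
 have "S \<otimes> T = R"
  unfolding tensor_op_def by (rule the_equality) (use R in "auto intro: tensor_op_eqI")
 thus "S \<otimes> T : bops" "blinfun_apply (S \<otimes> T) (x \<odot> y) = S x \<odot> T y" "norm (S \<otimes> T) <= norm S * norm T"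
  using R by auto
qed

lemmas bops_tensor_op [intro, simp] = tensor_op_props(1)
lemmas tensor_op_apply [simp] = tensor_op_props(2)
lemmas norm_tensor_op_le = tensor_op_props(3)

lemma tensor_op_comp:
 assumes "S : bops" "T : bops" "S' : bops" "T' : bops"
 shows "(S \<otimes> T) oo (S' \<otimes> T') = (S oo S') \<otimes> (T oo T')"
 using assms by (intro tensor_op_eqI) auto

lemma adj_tensor_op:
 assumes "S : bops" "T : bops" shows "adj (S \<otimes> T) = adj S \<otimes> adj T"
 by (rule total_form_eqI[OF total_tensor_range total_tensor_range])
  (use assms in "auto simp: cinner_adj_right")

lemma tensor_op_id [simp]: "id_blinfun \<otimes> id_blinfun = id_blinfun"
 by (rule tensor_op_eqI) auto

lemma ket_props: "ket x : bops" "blinfun_apply (ket x) u = u \<odot> x"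
 unfolding ket_def
 by (rule bops_Blinfun[where C = "norm x"], auto simp: linear_on_def tensor_add_left tensor_scaleC_left)+

lemmas bops_ket [intro, simp] = ket_props(1)
lemmas ket_apply [simp] = ket_props(2)

lemma adj_ket_tensor [simp]: "adj (ket x) (u \<odot> y) = cinner x y *c u"
 by (rule cinner_extI) (simp add: cinner_adj_right cinner_scaleC_right)

lemma blinfun_compose_algebra:
 "(R oo S) oo T = R oo (S oo T)" "R oo (S' + T') = (R oo S') + (R oo T')" "(P + Q) oo S = (P oo S) + (Q oo S)"
 by (auto intro!: blinfun_eqI simp: blinfun.add_left blinfun.add_right)

section \<open>The ultraweak topology\<close>

definition uw :: "(nat => 'a::complex_hilbert) => (nat => 'b::complex_hilbert) => ('b =>L 'a) => complex" where
 "uw \<xi> \<eta> T = (\<Sum>n. cinner (\<xi> n) (blinfun_apply T (\<eta> n)))"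

lemma sq_summable_mult:
 assumes "sq_summable x" "sq_summable y"
 shows "summable (%n. norm (x n) * norm (y n))"
proof (rule summable_comparison_test'[where N = 0])
 show "summable (%n. (norm (x n))^2 + (norm (y n))^2)"
  using assms by (intro summable_add) (auto simp: sq_summable_def)
 fix n
 have "norm (x n) * norm (y n) <= (norm (x n))^2 + (norm (y n))^2"
  using sum_squares_bound[of "norm (x n)" "norm (y n)"] mult_nonneg_nonneg[of "norm (x n)" "norm (y n)"] norm_ge_zero[of "x n"] norm_ge_zero[of "y n"] by linarith
 thus "norm (norm (x n) * norm (y n)) <= (norm (x n))^2 + (norm (y n))^2" by simp
qed

lemma uw_term_le: "cmod (cinner (x::'a::complex_inner) (blinfun_apply T y)) <= norm T * (norm x * norm y)"
proof -
 have "cmod (cinner x (T y)) <= norm x * norm (T y)" by (rule cmod_cinner_le)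
 also have "... <= norm x * (norm T * norm y)" by (intro mult_left_mono norm_blinfun) auto
 finally show ?thesis by (simp add: algebra_simps)
qed

lemma uw_summable:
 fixes x :: "nat => 'a::complex_inner" and y :: "nat => 'b::real_normed_vector"
 assumes "sq_summable x" "sq_summable y"
 shows "summable (%n. norm (cinner (x n) (blinfun_apply T (y n))))"
 by (rule summable_comparison_test'[where N = 0, OF summable_mult[OF sq_summable_mult[OF assms], of "norm T"]])
  (simp add: uw_term_le)

lemma sq_summable_bounded_op:
 assumes "sq_summable x" shows "sq_summable (%n. blinfun_apply T (x n))"
 unfolding sq_summable_def
proof (rule summable_comparison_test'[where N = 0])
 show "summable (%n. (norm T)^2 * (norm (x n))^2)" using assms by (intro summable_mult) (simp add: sq_summable_def)
 show "norm ((norm (T (x n)))^2) <= (norm T)^2 * (norm (x n))^2" for n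
  using power_mono[OF norm_blinfun[of T "x n"] norm_ge_zero, of 2] by (simp add: power_mult_distrib)
qed

text \<open>Makes every matrix element <x, T y> an instance of \<open>uw\<close>, so that weak
  statements follow from ultraweak ones.\<close>

lemma sq_summable_single: "sq_summable (%n. if n = 0 then x else 0)"
 unfolding sq_summable_def by (rule summable_finite[of "{0}"]) auto

lemma uw_single: "uw (%n. if n = 0 then x else 0) (%n. if n = 0 then y else 0) T = cinner x (blinfun_apply T y)"
proof -
 have "uw (%n. if n = 0 then x else 0) (%n. if n = 0 then y else 0) T =
   (SUM n:{0::nat}. cinner (if n = 0 then x else 0) (T (if n = 0 then y else 0)))"
  unfolding uw_def by (rule suminf_finite) auto
 thus ?thesis by simp
qed

lemma uw_add: "sq_summable x ==> sq_summable y ==> uw x y (S + T) = uw x y S + uw x y T"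
 unfolding uw_def by (subst suminf_add) (auto intro: summable_norm_cancel uw_summable simp: blinfun.add_left cinner_add_right)

lemma uw_scaleC: "sq_summable x ==> sq_summable y ==> uw x y (c *c T) = c * uw x y T"
 unfolding uw_def by (subst suminf_mult[symmetric]) (auto intro: summable_norm_cancel uw_summable simp: cinner_scaleC_right)

lemma topspace_ultraweak [simp]: "topspace ultraweak = (bops :: ('a::complex_hilbert op) set)"
proof -
 have "T : \<Union>{{T : bops. (\<Sum>n. cinner (x n) (blinfun_apply T (y n))) : U} | x y U.
    sq_summable x & sq_summable y & open U}" if "T : bops" for T :: "'a op"
  by (rule UnionI[of "{T : bops. (\<Sum>n. cinner ((%n. 0) n) (blinfun_apply T ((%n. 0) n))) : UNIV}"])
   (use that in \<open>auto simp: sq_summable_def intro!: exI[of _ "%_. 0"] exI[of _ UNIV]\<close>)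
 thus ?thesis unfolding ultraweak_def by auto
qed

lemma continuous_map_uw:
 assumes "sq_summable x" "sq_summable y" shows "continuous_map ultraweak euclidean (uw x y)"
 unfolding continuous_map_def
proof (intro conjI allI impI)
 fix U :: "complex set" assume "openin euclidean U"
 hence "open U" by simp
 hence "openin ultraweak {T : bops. uw x y T : U}"
  unfolding ultraweak_def uw_def by (intro topology_generated_by_Basis) (use assms in blast)
 thus "openin ultraweak {T : topspace ultraweak. uw x y T : U}" by simp
qed simp

lemma continuous_map_ultraweakI:
 fixes g :: "'x => 'a::complex_hilbert op"
 assumes g: "!!x. x : topspace X ==> g x : bops"
  and c: "!!y h. sq_summable y ==> sq_summable h ==> continuous_map X euclidean (%x. uw y h (g x))"
 shows "continuous_map X ultraweak g"
 unfolding ultraweak_def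
proof (rule continuous_on_generated_topo)
 show "g ` topspace X \<subseteq> \<Union>{{T : bops. (\<Sum>n. cinner (y n) (blinfun_apply T (h n))) : U} | y h U.
    sq_summable y & sq_summable h & open U}"
  using g topspace_ultraweak unfolding ultraweak_def topology_generated_by_topspace by blast
 fix U :: "('a op) set" assume "U : {{T : bops. (\<Sum>n. cinner (y n) (blinfun_apply T (h n))) : U} | y h U.
    sq_summable y & sq_summable h & open U}"
 then obtain y h U' where U: "U = {T : bops. uw y h T : U'}" "sq_summable y" "sq_summable h" "open U'"
  unfolding uw_def by blast
 have "g -` U \<inter> topspace X = {x : topspace X. uw y h (g x) : U'}" using U(1) g by auto
 thus "openin X (g -` U \<inter> topspace X)"
  using c[OF U(2,3)] U(4) unfolding continuous_map_def by auto
qed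

lemma limitin_ultraweakD:
 assumes "limitin ultraweak f l F" "sq_summable x" "sq_summable y"
 shows "((%i. uw x y (f i)) ---> uw x y l) F"
 using continuous_map_limit[OF continuous_map_uw[OF assms(2,3)] assms(1)] by (simp add: o_def)

lemma limitin_ultraweak_weak:
 assumes "limitin ultraweak f l F"
 shows "((%i. cinner x (blinfun_apply (f i) y)) ---> cinner x (blinfun_apply l y)) F"
 using limitin_ultraweakD[OF assms sq_summable_single[of x] sq_summable_single[of y]] by (simp add: uw_single)

text \<open>Convergence along all functionals \<open>uw\<close> suffices because they generate the
  topology; the induction runs over the construction of an open set.\<close>

lemma limitin_ultraweakI:
 assumes l: "l : bops" and f: "eventually (%i. f i : bops) F"
  and c: "!!x y. sq_summable x ==> sq_summable y ==> ((%i. uw x y (f i)) ---> uw x y l) F"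
 shows "limitin ultraweak f l F"
 unfolding limitin_def
proof (intro conjI allI impI)
 show "l : topspace ultraweak" using l by simp
 fix U :: "('a op) set" assume "openin ultraweak U & l : U"
 hence "generate_topology_on {{T : bops. (\<Sum>n. cinner (x n) (blinfun_apply T (y n))) : U} | x y U.
    sq_summable x & sq_summable y & open U} U" "l : U"
  unfolding ultraweak_def openin_topology_generated_by_iff by auto
 thus "eventually (%i. f i : U) F"
 proof (induction rule: generate_topology_on.induct)
  case Empty thus ?case by simp
 next
  case (Int a b) thus ?case by (auto intro: eventually_conj)
 next
  case (UN K)
  then obtain k where k: "k : K" "l : k" by blast
  show ?case using UN.IH[OF k] by (rule eventually_mono) (use k in blast)
 next
  case (Basis s)
  then obtain x y U' where U: "s = {T : bops. uw x y T : U'}" "sq_summable x" "sq_summable y" "open U'"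
   unfolding uw_def by blast
  have "eventually (%i. uw x y (f i) : U') F"
   using c[OF U(2,3)] U(4) Basis(2) by (auto simp: U(1) tendsto_def)
  with f show ?case by eventually_elim (simp add: U(1))
 qed
qed

text \<open>Along a bounded net weak convergence is enough: the terms of the series are dominated by
  \<open>C\<close> times products of norms, and Tannery's theorem exchanges limit and sum.\<close>

lemma uw_tendsto_bounded:
 fixes f :: "'i => 'b::complex_hilbert =>L 'a::complex_hilbert"
 assumes F: "F ~= bot" and bnd: "eventually (%i. norm (f i) <= C) F"
  and c: "!!x y. ((%i. cinner x (blinfun_apply (f i) y)) ---> cinner x (blinfun_apply l y)) F"
  and s: "sq_summable z" "sq_summable h"
 shows "((%i. uw z h (f i)) ---> uw z h l) F"
proof -
 have "eventually (%(k, i). norm (cinner (z k) (f i (h k))) <= C * (norm (z k) * norm (h k))) (at_top \<times>\<^sub>F F)"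
 proof -
  have "eventually (%(k::nat, i). norm (f i) <= C) (at_top \<times>\<^sub>F F)"
   using eventually_prod2[of "at_top::nat filter" "%i. norm (f i) <= C" F] bnd by (simp)
  thus ?thesis
  proof (rule eventually_mono)
   fix p :: "nat \<times> 'i" assume "case p of (k, i) => norm (f i) <= C"
   thus "case p of (k, i) => norm (cinner (z k) (f i (h k))) <= C * (norm (z k) * norm (h k))"
    by (cases p) (auto intro!: order_trans[OF uw_term_le] mult_right_mono)
  qed
 qed
 from tannerys_theorem[OF c this summable_mult[OF sq_summable_mult[OF s]] F]
 show ?thesis unfolding uw_def by blast
qed

lemma limitin_ultraweak_bounded:
 assumes F: "F ~= bot" and l: "l : bops" and f: "eventually (%i. f i : bops) F"
  and bnd: "eventually (%i. norm (f i) <= C) F"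
  and c: "!!x y. ((%i. cinner x (blinfun_apply (f i) y)) ---> cinner x (blinfun_apply l y)) F"
 shows "limitin ultraweak f l F"
 using uw_tendsto_bounded[OF F bnd c] by (intro limitin_ultraweakI l f)

lemma limit_in_closure_of:
 assumes "limitin X f l F" "F ~= bot" "eventually (%i. f i : S) F" "S \<subseteq> topspace X"
 shows "l : X closure_of S"
 by (rule limitin_closedin[OF assms(1) closedin_closure_of _ assms(2)])
  (use assms(3) closure_of_subset[OF assms(4)] in "auto elim: eventually_mono")

lemma continuous_map_euclidean_eqI:
 assumes "x : X closure_of S" "continuous_map X euclidean f" "continuous_map X euclidean g"
  "!!x. x : S ==> f x = (g x :: complex)"
 shows "f x = g x"
 using forall_in_closure_of_eq[OF assms(1) _ assms(2,3,4)] by (simp)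

lemma continuous_map_vec: "continuous_map ultraweak euclidean (%T. cinner x (blinfun_apply T y))"
 using continuous_map_uw[OF sq_summable_single[of x] sq_summable_single[of y]] by (simp add: uw_single[abs_def] cong: if_cong)

lemma continuous_map_conj:
 fixes V :: "'c::complex_hilbert =>L 'a::complex_hilbert"
 assumes V: "V : bops" and W: "W : bops"
 shows "continuous_map ultraweak ultraweak (%X. adj V oo X oo W)"
proof (rule continuous_map_ultraweakI)
 fix x y :: "nat => 'c" assume s: "sq_summable x" "sq_summable y"
 have "uw x y (adj V oo X oo W) = uw (%n. V (x n)) (%n. W (y n)) X" for X
  using V by (simp add: uw_def cinner_adj_right)
 thus "continuous_map ultraweak euclidean (%X. uw x y (adj V oo X oo W))"
  using continuous_map_uw[OF sq_summable_bounded_op[OF s(1), of V] sq_summable_bounded_op[OF s(2), of W]] by simp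
qed (use V W in auto)

lemma continuous_map_plus_const:
 fixes Y :: "'a::complex_hilbert op"
 assumes "Y : bops" shows "continuous_map ultraweak ultraweak (%X. X + Y)"
proof (rule continuous_map_ultraweakI)
 fix x y :: "nat => 'a" assume s: "sq_summable x" "sq_summable y"
 show "continuous_map ultraweak euclidean (%X. uw x y (X + Y))"
  unfolding uw_add[OF s] by (intro continuous_map_add continuous_map_uw s) auto
qed (use assms in auto)

lemma continuous_map_scaleC: "continuous_map ultraweak ultraweak (%X. c *c (X :: 'a::complex_hilbert op))"
proof (rule continuous_map_ultraweakI)
 fix x y :: "nat => 'a" assume s: "sq_summable x" "sq_summable y"
 show "continuous_map ultraweak euclidean (%X. uw x y (c *c X))"
  unfolding uw_scaleC[OF s] using continuous_map_compose[OF continuous_map_uw[OF s], of euclidean "%z. c * z"]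
  by (simp add: o_def)
qed auto

text \<open>Addition is used only through translations, so sums are treated one argument at a time:
  first closure plus \<open>S\<close>, then closure plus closure.\<close>

lemma subspace_ultraweak_closure:
 fixes S :: "('a::complex_hilbert op) set"
 assumes S: "cvec.subspace S" "S \<subseteq> bops"
 shows "cvec.subspace (ultraweak closure_of S)"
proof (rule cvec.subspaceI)
 let ?C = "ultraweak closure_of S"
 have sub: "S \<subseteq> ?C" by (rule closure_of_subset) (use S in simp)
 have Cb: "?C \<subseteq> bops" using closure_of_subset_topspace[of ultraweak S] by simp
 show "0 : ?C" using sub cvec.subspace_0[OF S(1)] by blast
 show "c *c x : ?C" if "x : ?C" for c x
 proof -
  have "(%X. c *c X) ` S \<subseteq> S" using cvec.subspace_scale[OF S(1)] by blast
  thus ?thesis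
   using continuous_map_image_closure_subset[OF continuous_map_scaleC, of c S] that
    closure_of_mono[of "(%X. c *c X) ` S" S ultraweak] by blast
 qed
 have 1: "x + y : ?C" if "x : ?C" "y : S" for x y
 proof -
  have "(%X. X + y) ` S \<subseteq> S" using cvec.subspace_add[OF S(1)] that(2) by blast
  thus ?thesis
   using continuous_map_image_closure_subset[OF continuous_map_plus_const, of y S] that S(2)
    closure_of_mono[of "(%X. X + y) ` S" S ultraweak] by blast
 qed
 show "x + y : ?C" if "x : ?C" "y : ?C" for x y
 proof -
  have "(%X. X + x) ` S \<subseteq> ?C" using 1[OF that(1)] by (auto simp: add.commute)
  hence "ultraweak closure_of ((%X. X + x) ` S) \<subseteq> ?C" by (rule closure_of_minimal) simp
  moreover have "y + x : ultraweak closure_of ((%X. X + x) ` S)"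
   using continuous_map_image_closure_subset[OF continuous_map_plus_const, of x S] that Cb by blast
  ultimately show ?thesis by (auto simp: add.commute)
 qed
qed

lemma span_tensor_bops:
 assumes "M \<subseteq> bops" "N \<subseteq> bops"
 shows "cvec.span {S \<otimes> T | S T. S : M & T : N} \<subseteq> bops"
 using assms by (intro cvec.span_minimal subspace_bops) auto

lemma vn_tensor_props:
 assumes M: "M \<subseteq> bops" and N: "N \<subseteq> bops"
 shows "M \<otimes>\<^sub>N N \<subseteq> bops" "cvec.subspace (M \<otimes>\<^sub>N N)"
  "cvec.span {S \<otimes> T | S T. S : M & T : N} \<subseteq> M \<otimes>\<^sub>N N"
  "S : M ==> T : N ==> S \<otimes> T : M \<otimes>\<^sub>N N"
proof -
 note sp = span_tensor_bops[OF M N]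
 show "M \<otimes>\<^sub>N N \<subseteq> bops" using closure_of_subset_topspace[of ultraweak] unfolding vn_tensor_def by auto
 show "cvec.subspace (M \<otimes>\<^sub>N N)" unfolding vn_tensor_def by (intro subspace_ultraweak_closure cvec.subspace_span sp)
 show *: "cvec.span {S \<otimes> T | S T. S : M & T : N} \<subseteq> M \<otimes>\<^sub>N N"
  unfolding vn_tensor_def by (rule closure_of_subset) (use sp in simp)
 show "S \<otimes> T : M \<otimes>\<^sub>N N" if "S : M" "T : N" using that by (intro subsetD[OF *] cvec.span_base) blast
qed

text \<open>Resolves the definite description: it is enough to exhibit one linear, ultraweakly
  continuous \<Phi> on all bounded operators with the right values on elementary tensors. Uniqueness
  holds because the span of these tensors is ultraweakly dense in
  \<open>M \<otimes>\<^sub>N N\<close>, by definition of the latter.\<close>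

lemma tensor_map_eqI:
 fixes \<Phi> :: "('a::complex_hilbert, 'b::complex_hilbert) tensor op => ('c::complex_hilbert, 'd::complex_hilbert) tensor op"
 assumes M: "M \<subseteq> bops" and N: "N \<subseteq> bops"
  and lin: "!!x y. x : bops ==> y : bops ==> \<Phi> (x + y) = \<Phi> x + \<Phi> y" "!!c x. x : bops ==> \<Phi> (c *c x) = c *c \<Phi> x"
  and cont: "continuous_map ultraweak ultraweak \<Phi>"
  and val: "!!S T. S : M ==> T : N ==> \<Phi> (S \<otimes> T) = p S \<otimes> \<psi> T"
  and X: "X : M \<otimes>\<^sub>N N"
 shows "tensor_map M N p \<psi> X = \<Phi> X"
proof -
 note P = vn_tensor_props[OF M N]
 define G where "G = {S \<otimes> T | S T. S : M & T : N}"
 have "tensor_map M N p \<psi> = restrict \<Phi> (M \<otimes>\<^sub>N N)"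
  unfolding tensor_map_def
 proof (rule the_equality, intro conjI)
  show "restrict \<Phi> (M \<otimes>\<^sub>N N) : extensional (M \<otimes>\<^sub>N N)" by simp
  show "linear_on (M \<otimes>\<^sub>N N) (restrict \<Phi> (M \<otimes>\<^sub>N N))"
   unfolding linear_on_def using cvec.subspace_add[OF P(2)] cvec.subspace_scale[OF P(2)] P(1)
   by (auto simp: lin subset_iff)
  show "normal_on (M \<otimes>\<^sub>N N) (restrict \<Phi> (M \<otimes>\<^sub>N N))"
   unfolding normal_on_def
   by (rule continuous_map_eq[OF continuous_map_from_subtopology[OF cont]]) auto
  show "ALL S:M. ALL T:N. restrict \<Phi> (M \<otimes>\<^sub>N N) (S \<otimes> T) = p S \<otimes> \<psi> T"
   using P(4) val by simp
  fix Q :: "('a, 'b) tensor op => ('c, 'd) tensor op"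
  assume Q: "Q : extensional (M \<otimes>\<^sub>N N) & linear_on (M \<otimes>\<^sub>N N) Q & normal_on (M \<otimes>\<^sub>N N) Q &
   (ALL S:M. ALL T:N. Q (S \<otimes> T) = p S \<otimes> \<psi> T)"
  have span: "Z : M \<otimes>\<^sub>N N & Q Z = \<Phi> Z" if "Z : cvec.span G" for Z
   using that
  proof (induction rule: cvec.span_induct_alt)
   case base
   have "0 : M \<otimes>\<^sub>N N" by (rule cvec.subspace_0[OF P(2)])
   moreover have "Q (0 *c 0) = 0 *c Q 0" using Q \<open>0 : M \<otimes>\<^sub>N N\<close> unfolding linear_on_def by blast
   moreover have "\<Phi> (0 *c 0) = 0 *c \<Phi> 0" by (rule lin) simp
   ultimately show ?case by simp
  next
   case (step c x y)
   then obtain S T where x: "x = S \<otimes> T" "S : M" "T : N" by (auto simp: G_def)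
   have xm: "x : M \<otimes>\<^sub>N N" using x P(4) by simp
   hence cx: "c *c x : M \<otimes>\<^sub>N N" by (rule cvec.subspace_scale[OF P(2)])
   have "Q (c *c x + y) = c *c Q x + Q y"
    using Q xm cx step unfolding linear_on_def by metis
   moreover have "Q x = \<Phi> x" using x Q val by simp
   moreover have "c *c x : bops" "x : bops" "y : bops" using cx xm step P(1) by blast+
   ultimately show ?case using step cx cvec.subspace_add[OF P(2)] by (simp add: lin)
  qed
  show "Q = restrict \<Phi> (M \<otimes>\<^sub>N N)"
  proof (rule extensionalityI[of _ "M \<otimes>\<^sub>N N"])
   show "Q : extensional (M \<otimes>\<^sub>N N)" using Q by blast
   fix Z assume Z: "Z : M \<otimes>\<^sub>N N"
   have "cinner x (Q Z y) = cinner x (\<Phi> Z y)" for x y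
   proof (rule continuous_map_euclidean_eqI[where X = "subtopology ultraweak (M \<otimes>\<^sub>N N)" and S = "cvec.span G"])
    have "cvec.span G \<subseteq> M \<otimes>\<^sub>N N" using P(3) by (simp add: G_def)
    thus "Z : subtopology ultraweak (M \<otimes>\<^sub>N N) closure_of cvec.span G"
     using Z unfolding closure_of_subtopology by (simp add: vn_tensor_def G_def Int_absorb1)
    show "continuous_map (subtopology ultraweak (M \<otimes>\<^sub>N N)) euclidean (%Z. cinner x (Q Z y))"
     using continuous_map_compose[OF _ continuous_map_vec[of x y]] Q unfolding normal_on_def o_def by blast
    show "continuous_map (subtopology ultraweak (M \<otimes>\<^sub>N N)) euclidean (%Z. cinner x (\<Phi> Z y))"
     using continuous_map_compose[OF continuous_map_from_subtopology[OF cont] continuous_map_vec[of x y]] unfolding o_def by blast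
   qed (use span in simp)
   hence "Q Z = \<Phi> Z" by (rule blinfun_cinner_eqI)
   thus "Q Z = restrict \<Phi> (M \<otimes>\<^sub>N N) Z" using Z by simp
  qed simp
 qed
 thus ?thesis using X by simp
qed

section \<open>Slices\<close>

definition lket :: "'c::complex_hilbert => 'h::complex_hilbert =>L ('c, 'h) tensor" where
 "lket x = Blinfun (%u. x \<odot> u)"

lemma lket_props: "lket x : bops" "blinfun_apply (lket x) u = x \<odot> u"
 unfolding lket_def
 by (rule bops_Blinfun[where C = "norm x"], auto simp: linear_on_def tensor_add_right tensor_scaleC_right)+

lemmas bops_lket [intro, simp] = lket_props(1)
lemmas lket_apply [simp] = lket_props(2)

lemma adj_lket_tensor [simp]: "adj (lket x) (y \<odot> u) = cinner x y *c u"
 by (rule cinner_extI) (simp add: cinner_adj_right cinner_scaleC_right)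

section \<open>Finite rank projections and strong limits\<close>

definition butterfly :: "'a::complex_hilbert => 'b::complex_hilbert => 'b =>L 'a" where
 "butterfly e e' = Blinfun (%x. cinner e' x *c e)"

lemma butterfly_props: "butterfly e e' : bops" "blinfun_apply (butterfly e e') x = cinner e' x *c e"
proof -
 have "norm (cinner e' x *c e) <= norm e' * norm e * norm x" for x
  using mult_right_mono[OF cmod_cinner_le[of e' x] norm_ge_zero[of e]] by (simp add: norm_scaleC algebra_simps)
 note B = bops_Blinfun[OF _ this]
 show "butterfly e e' : bops" "blinfun_apply (butterfly e e') x = cinner e' x *c e"
  unfolding butterfly_def by (rule B, simp add: linear_on_def cinner_add_right cinner_scaleC_right scaleC_add_left)+
qed

lemmas bops_butterfly [intro, simp] = butterfly_props(1)
lemmas butterfly_apply [simp] = butterfly_props(2)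

definition onb_of :: "'a::complex_inner set => 'a set" where
 "onb_of I = (SOME E. finite E & (ALL e:E. ALL e':E. cinner e e' = (if e = e' then 1 else 0)) &
  (ALL v:I. v = (SUM e:E. cinner e v *c e)))"

lemma onb_of:
 assumes "finite I"
 shows "finite (onb_of I)" "!!e e'. e : onb_of I ==> e' : onb_of I ==> cinner e e' = (if e = e' then 1 else 0)"
  "!!v. v : I ==> (SUM e:onb_of I. cinner e v *c e) = v"
 using someI_ex[OF finite_orthonormal[OF assms, of "%v. v"]] unfolding onb_of_def[symmetric] by auto

text \<open>A finite rank projection fixing every vector of \<open>I\<close>. Indexing by all finite
  sets of vectors, rather than by subsets of an orthonormal basis, makes convergence to the identity
  trivial: \<open>fproj I\<close> fixes \<open>x\<close> as soon as \<open>x\<close> belongs to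
  \<open>I\<close>.\<close>

definition fproj :: "'a::complex_hilbert set => 'a op" where
 "fproj I = (SUM e:onb_of I. butterfly e e)"

lemma bops_fproj [intro, simp]: "fproj I : bops" unfolding fproj_def by (intro bops_sum) auto

lemma fproj_apply: "fproj I x = (SUM e:onb_of I. cinner e x *c e)"
 by (simp add: fproj_def blinfun.sum_left)

lemma adj_fproj: "adj (fproj I) = fproj I"
 by (rule adjI) (auto simp: fproj_apply cinner_sum_left cinner_sum_right cinner_scaleC_left cinner_scaleC_right
   intro!: sum.cong, metis cinner_commute)

lemma norm_fproj_le: assumes "finite I" shows "norm (fproj I) <= 1"
proof (rule norm_blinfun_bound)
 fix x
 have pp: "fproj I (fproj I x) = fproj I x"
 proof -
  have "cinner e (fproj I x) = cinner e x" if "e : onb_of I" for e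
  proof -
   have "cinner e (fproj I x) = (SUM e':onb_of I. if e' = e then cinner e x else 0)"
    unfolding fproj_apply cinner_sum_right using onb_of(2)[OF assms that]
    by (intro sum.cong) (auto simp: cinner_scaleC_right)
   thus ?thesis using that onb_of(1)[OF assms] by simp
  qed
  hence "(SUM e:onb_of I. cinner e (fproj I x) *c e) = (SUM e:onb_of I. cinner e x *c e)" by simp
  thus ?thesis by (metis fproj_apply)
 qed
 have "norm (fproj I x) * norm (fproj I x) = cmod (cinner (fproj I x) (fproj I x))"
  by (simp add: cinner_self_norm power2_eq_square flip: of_real_mult)
 also have "cinner (fproj I x) (fproj I x) = cinner (fproj I x) x"
  using cinner_adj_left[OF bops_fproj, of I "fproj I x" x] by (simp add: adj_fproj pp)
 also have "cmod ... <= norm (fproj I x) * norm x" by (rule cmod_cinner_le)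
 finally show "norm (fproj I x) <= 1 * norm x" using le_of_mult_self_le[of "norm (fproj I x)" "norm x"] by simp
qed simp

lemma strong_limit_total:
 fixes T :: "'i => 'a::complex_hilbert =>L 'b::complex_hilbert"
 assumes tot: "total G" and T: "!!i. T i : bops" and l: "l : bops"
  and bnd: "eventually (%i. norm (T i) <= C) F"
  and c: "!!g. g : G ==> ((%i. T i g) ---> l g) F"
 shows "((%i. T i x) ---> l x) F"
proof -
 have span: "((%i. T i y) ---> l y) F" if "y : cvec.span G" for y
  using that
 proof (induction rule: cvec.span_induct_alt)
  case base thus ?case by simp
 next
  case (step a g y)
  have "((%i. a *c T i g + T i y) ---> a *c l g + l y) F"
   by (intro tendsto_add step bounded_linear.tendsto[OF bounded_linear_scaleC] c)
  thus ?case by (simp add: blinfun.add_right bopsD[OF T] bopsD[OF l])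
 qed
 define K where "K = max C 0 + norm l + 1"
 have K: "K > 0" by (simp add: K_def add_nonneg_pos)
 show ?thesis
 proof (rule tendstoI)
  fix e :: real assume e: "e > 0"
  have "x : closure (cvec.span G)" using tot by (simp add: total_def)
  then obtain y where y: "y : cvec.span G" "dist y x < e / (2 * K)"
   unfolding closure_approachable using e K by (meson divide_pos_pos mult_pos_pos zero_less_numeral)
  have "eventually (%i. dist (T i y) (l y) < e / 2) F" by (rule tendstoD[OF span[OF y(1)]]) (use e in simp)
  with bnd show "eventually (%i. dist (T i x) (l x) < e) F"
  proof eventually_elim
   case (elim i)
   have "T i x - l x = T i (x - y) + (T i y - l y) + l (y - x)" by (simp add: blinfun.diff_right)
   hence "norm (T i x - l x) <= norm (T i (x - y)) + norm (T i y - l y) + norm (l (y - x))"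
    by (metis norm_triangle_le norm_triangle_ineq add_right_mono)
   also have "... <= max C 0 * norm (x - y) + norm (T i y - l y) + norm l * norm (x - y)"
   proof -
    have "norm (T i (x - y)) <= norm (T i) * norm (x - y)" by (rule norm_blinfun)
    also have "... <= max C 0 * norm (x - y)" using elim by (intro mult_right_mono) auto
    finally show ?thesis using norm_blinfun[of l "y - x"] by (simp add: norm_minus_commute)
   qed
   also have "... <= K * norm (x - y) + norm (T i y - l y)" by (simp add: K_def algebra_simps)
   also have "... < K * (e / (2 * K)) + e / 2"
    using y(2) K elim(2) by (intro add_strict_mono mult_strict_left_mono) (auto simp: dist_norm norm_minus_commute)
   also have "... = e" using K by simp
   finally show ?case by (simp add: dist_norm)
  qed
 qed
qed

lemma fproj_tendsto: "((%I. fproj I x) ---> x) fsets"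
proof (rule tendsto_eventually)
 have "eventually (%I. finite I & {x} \<subseteq> I & I \<subseteq> UNIV) fsets"
  unfolding eventually_finite_subsets_at_top by (intro exI[of _ "{x}"]) auto
 thus "eventually (%I. fproj I x = x) fsets"
  by eventually_elim (auto simp: fproj_apply onb_of(3))
qed

lemma eventually_finite_norm_fproj: "eventually (%I. norm (fproj I) <= 1) fsets"
 using norm_fproj_le by blast

lemma id_tensor_fproj_tendsto:
 fixes z :: "('a::complex_hilbert, 'b::complex_hilbert) tensor" and z' :: "('c::complex_hilbert, 'd::complex_hilbert) tensor"
 shows
 "((%I. (id_blinfun \<otimes> fproj I) z) ---> z) fsets"
 "((%I. (fproj I \<otimes> id_blinfun) z') ---> z') fsets"
proof -
 have id1: "norm (id_blinfun :: 'c::complex_hilbert op) <= 1" by (rule norm_blinfun_id_le)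
 have "((%I. (id_blinfun \<otimes> fproj I) z) ---> id_blinfun z) fsets"
 proof (rule strong_limit_total[OF total_tensor_range, where C = 1])
  show "eventually (%I. norm (id_blinfun \<otimes> fproj I) <= 1) fsets"
   using eventually_finite_norm_fproj
  proof eventually_elim
   case (elim I)
   show ?case using order_trans[OF norm_tensor_op_le mult_mono[OF norm_blinfun_id_le elim]] by fastforce
  qed
  fix g :: "('a, 'b) tensor" assume "g : range (%(x, y). x \<odot> y)"
  then obtain x y where g: "g = x \<odot> y" by auto
  have "((%I. lket x (fproj I y)) ---> lket x y) fsets"
   by (intro tendsto_intros fproj_tendsto)
  thus "((%I. (id_blinfun \<otimes> fproj I) g) ---> id_blinfun g) fsets" by (simp add: g)
 qed auto
 thus "((%I. (id_blinfun \<otimes> fproj I) z) ---> z) fsets" by simp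
 have "((%I. (fproj I \<otimes> id_blinfun) z') ---> id_blinfun z') fsets"
 proof (rule strong_limit_total[OF total_tensor_range, where C = 1])
  show "eventually (%I. norm (fproj I \<otimes> id_blinfun) <= 1) fsets"
   using eventually_finite_norm_fproj
  proof eventually_elim
   case (elim I)
   show ?case using order_trans[OF norm_tensor_op_le mult_mono[OF elim norm_blinfun_id_le]] by fastforce
  qed
  fix g :: "('c, 'd) tensor" assume "g : range (%(x, y). x \<odot> y)"
  then obtain x y where g: "g = x \<odot> y" by auto
  have "((%I. ket y (fproj I x)) ---> ket y x) fsets"
   by (intro tendsto_intros fproj_tendsto)
  thus "((%I. (fproj I \<otimes> id_blinfun) g) ---> id_blinfun g) fsets" by (simp add: g)
 qed auto
 thus "((%I. (fproj I \<otimes> id_blinfun) z') ---> z') fsets" by simp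
qed

section \<open>Slices and membership in von Neumann tensor products\<close>

lemma vn_subset_bops: "von_neumann_algebra A ==> A \<subseteq> bops" by (simp add: von_neumann_algebra_def)
lemma vn_subspace: "von_neumann_algebra A ==> cvec.subspace A" by (simp add: von_neumann_algebra_def)
lemma vn_comp: "von_neumann_algebra A ==> S : A ==> T : A ==> S oo T : A" by (simp add: von_neumann_algebra_def)
lemma vn_adj: "von_neumann_algebra A ==> S : A ==> adj S : A" by (simp add: von_neumann_algebra_def)
lemma vn_id: "von_neumann_algebra A ==> id_blinfun : A" by (simp add: von_neumann_algebra_def)
lemma vn_closed: "von_neumann_algebra A ==> closedin ultraweak A" by (simp add: von_neumann_algebra_def)

text \<open>Cutting \<open>x\<close> down by \<open>id_blinfun \<otimes> fproj I\<close> gives a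
  finite sum of slices tensored with finite rank operators, an element of the algebraic tensor
  product. These operators are uniformly bounded and converge weakly, hence ultraweakly, to
  \<open>x\<close>. The corner given by \<open>p\<close> has the form of \<open>noise_alg\<close>,
  whose elements act on a subspace of the Fock space.\<close>

lemma vn_tensor_of_slices:
 fixes x :: "('h::complex_hilbert, 'f::complex_hilbert) tensor op"
 assumes A: "A \<subseteq> bops" and x: "x : bops" and p: "p : bops" "p oo p = p" "adj p = p"
  and sl: "!!e e'. adj (ket e) oo x oo ket e' : A"
  and corner: "(id_blinfun \<otimes> p) oo x oo (id_blinfun \<otimes> p) = x"
 shows "x : A \<otimes>\<^sub>N {z : bops. p oo z oo p = z}"
 unfolding vn_tensor_def
proof (rule limit_in_closure_of)
 define N where "N = {z : bops. p oo z oo p = z}"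
 define f where "f I = (id_blinfun \<otimes> p) oo (id_blinfun \<otimes> fproj I) oo x oo (id_blinfun \<otimes> fproj I) oo (id_blinfun \<otimes> p)" for I
 have fb: "f I : bops" for I unfolding f_def using x p by auto
 have f_eq: "f I = (SUM e:onb_of I. SUM e':onb_of I. (adj (ket e) oo x oo ket e') \<otimes> (p oo butterfly e e' oo p))" for I
 proof (rule total_form_eqI[OF total_tensor_range total_tensor_range])
  show "(SUM e:onb_of I. SUM e':onb_of I. (adj (ket e) oo x oo ket e') \<otimes> (p oo butterfly e e' oo p)) : bops"
   using x p by (intro bops_sum) auto
  fix s s' :: "('h, 'f) tensor" assume "s : range (%(x, y). x \<odot> y)" "s' : range (%(x, y). x \<odot> y)"
  then obtain u y v w where s: "s = u \<odot> y" "s' = v \<odot> w" by auto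
  have ax: "adj (id_blinfun \<otimes> p) = id_blinfun \<otimes> p" "adj (id_blinfun \<otimes> fproj I) = id_blinfun \<otimes> fproj I"
   using p by (auto simp: adj_tensor_op adj_fproj)
  have pself: "cinner y (p k) = cinner (p y) k" for y k using cinner_adj_left[OF p(1), of y k] p(3) by simp
  have mv: "cinner a ((id_blinfun \<otimes> p) b) = cinner ((id_blinfun \<otimes> p) a) b"
   "cinner a ((id_blinfun \<otimes> fproj I) b) = cinner ((id_blinfun \<otimes> fproj I) a) b" for a b :: "('h, 'f) tensor"
   using cinner_adj_left[of "id_blinfun \<otimes> p" a b] cinner_adj_left[of "id_blinfun \<otimes> fproj I" a b] p by (auto simp: ax)
  have "cinner s (f I s') = cinner (u \<odot> fproj I (p y)) (x (v \<odot> fproj I (p w)))"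
   using p(1) by (simp add: f_def s mv)
  also have "... = (SUM e:onb_of I. SUM e':onb_of I. cnj (cinner e (p y)) * cinner e' (p w) * cinner (u \<odot> e) (x (v \<odot> e')))"
   unfolding fproj_apply tensor_sum_right blinfun.sum_right cinner_sum_left cinner_sum_right
   by (subst sum.swap) (simp add: tensor_scaleC_right bopsD[OF x] cinner_scaleC_left cinner_scaleC_right ac_simps)
  also have "... = cinner s ((SUM e:onb_of I. SUM e':onb_of I. (adj (ket e) oo x oo ket e') \<otimes> (p oo butterfly e e' oo p)) s')"
  proof -
   have "cinner s (((adj (ket e) oo x oo ket e') \<otimes> (p oo butterfly e e' oo p)) s') =
     cnj (cinner e (p y)) * cinner e' (p w) * cinner (u \<odot> e) (x (v \<odot> e'))" for e e'
    using x p(1) by (simp add: s bopsD cinner_scaleC_right cinner_adj_right)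
     (metis cinner_commute pself)
   thus ?thesis by (simp add: blinfun.sum_left cinner_sum_right)
  qed
  finally show "cinner s (f I s') = cinner s ((SUM e:onb_of I. SUM e':onb_of I. (adj (ket e) oo x oo ket e') \<otimes> (p oo butterfly e e' oo p)) s')" .
 qed (rule fb)
 have bN: "p oo butterfly e e' oo p : N" for e e'
 proof -
  have "p oo (p oo butterfly e e' oo p) oo p = (p oo p) oo butterfly e e' oo (p oo p)" by (simp add: blinfun_compose_algebra(1))
  thus ?thesis unfolding p(2) N_def using p(1) by simp
 qed
 show "cvec.span {S \<otimes> T | S T. S : A & T : {z : bops. p oo z oo p = z}} \<subseteq> topspace ultraweak"
  using span_tensor_bops[OF A, of "{z : bops. p oo z oo p = z}"] by auto
 show "\<forall>\<^sub>F I in fsets. f I : cvec.span {S \<otimes> T | S T. S : A & T : {z : bops. p oo z oo p = z}}"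
  unfolding f_eq N_def[symmetric]
  by (intro always_eventually allI cvec.span_sum cvec.span_base) (use sl bN in blast)
 show "finite_subsets_at_top (UNIV :: 'f set) ~= bot" by simp
 show "limitin ultraweak f x fsets"
 proof (rule limitin_ultraweak_bounded)
  show "\<forall>\<^sub>F i in fsets. f i : bops" using fb by simp
  show "\<forall>\<^sub>F I in fsets. norm (f I) <= norm p * norm x * norm p"
   using eventually_finite_norm_fproj
  proof eventually_elim
   case (elim I)
   have 1: "norm (id_blinfun \<otimes> fproj I :: ('h, 'f) tensor =>L _) <= 1"
    using order_trans[OF norm_tensor_op_le mult_mono[OF norm_blinfun_id_le elim]] by fastforce
   have 2: "norm (id_blinfun \<otimes> p :: ('h, 'f) tensor =>L _) <= norm p"
    using order_trans[OF norm_tensor_op_le mult_mono[OF norm_blinfun_id_le order_refl]] p(1) by fastforce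
   have "norm (f I) <= norm p * 1 * norm x * 1 * norm p"
    unfolding f_def
    by (rule order_trans[OF norm_blinfun_compose mult_mono[OF _ 2]],
      rule order_trans[OF norm_blinfun_compose mult_mono[OF _ 1]],
      rule order_trans[OF norm_blinfun_compose mult_mono[OF _ order_refl]],
      rule order_trans[OF norm_blinfun_compose mult_mono[OF 2 1]]) auto
   thus ?case by simp
  qed
  fix s s' :: "('h, 'f) tensor"
  have ax: "adj (id_blinfun \<otimes> p) = id_blinfun \<otimes> p" "adj (id_blinfun \<otimes> fproj I) = id_blinfun \<otimes> fproj I" for I
   using p by (auto simp: adj_tensor_op adj_fproj)
  have mv: "cinner a ((id_blinfun \<otimes> p) b) = cinner ((id_blinfun \<otimes> p) a) b"
   "cinner a ((id_blinfun \<otimes> fproj I) b) = cinner ((id_blinfun \<otimes> fproj I) a) b" for a b :: "('h, 'f) tensor" and I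
   using cinner_adj_left[of "id_blinfun \<otimes> p" a b] cinner_adj_left[of "id_blinfun \<otimes> fproj I" a b] p by (auto simp: ax)
  have "cinner s (f I s') = cinner ((id_blinfun \<otimes> fproj I) ((id_blinfun \<otimes> p) s)) (x ((id_blinfun \<otimes> fproj I) ((id_blinfun \<otimes> p) s')))" for I
   by (simp add: f_def mv)
  moreover have "((%I. cinner ((id_blinfun \<otimes> fproj I) ((id_blinfun \<otimes> p) s)) (x ((id_blinfun \<otimes> fproj I) ((id_blinfun \<otimes> p) s')))) --->
    cinner ((id_blinfun \<otimes> p) s) (x ((id_blinfun \<otimes> p) s'))) fsets"
   by (intro tendsto_cinner id_tensor_fproj_tendsto blinfun.tendsto tendsto_const)
  moreover have "cinner ((id_blinfun \<otimes> p) s) (x ((id_blinfun \<otimes> p) s')) = cinner s (x s')"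
   by (metis mv(1) corner blinfun_apply_blinfun_compose)
  ultimately show "((%I. cinner s (f I s')) ---> cinner s (x s')) fsets" by simp
 qed (use x in simp_all)
qed

lemma vn_tensor_all_of_slices:
 fixes x :: "('h::complex_hilbert, 'f::complex_hilbert) tensor op"
 assumes "A \<subseteq> bops" "x : bops" "!!e e'. adj (ket e) oo x oo ket e' : A"
 shows "x : A \<otimes>\<^sub>N bops"
proof -
 have eq: "{z : bops. id_blinfun oo z oo id_blinfun = z} = (bops :: ('f op) set)" by (auto intro: blinfun_eqI)
 have "x : A \<otimes>\<^sub>N {z : bops. id_blinfun oo z oo id_blinfun = z}"
  by (rule vn_tensor_of_slices[OF assms(1,2) _ _ _ assms(3)]) (auto intro: blinfun_eqI)
 thus ?thesis by (simp only: eq)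
qed

lemma image_closure_closed:
 assumes f: "continuous_map X Y f" and C: "closedin Y C" and S: "f ` S \<subseteq> C" and x: "x : X closure_of S"
 shows "f x : C"
 using continuous_map_image_closure_subset[OF f, of S] closure_of_minimal[OF S C] x by blast

text \<open>Slicing is ultraweakly continuous and \<open>A\<close> is ultraweakly closed, so only
  the span of the elementary tensors has to be checked.\<close>

lemma lslice_in:
 fixes x :: "('c::complex_hilbert, 'h::complex_hilbert) tensor op"
 assumes A: "von_neumann_algebra A" and N: "N \<subseteq> bops" and x: "x : N \<otimes>\<^sub>N A"
 shows "adj (lket e) oo x oo lket e' : A"
proof (rule image_closure_closed[OF continuous_map_conj vn_closed[OF A] _ x[unfolded vn_tensor_def]])
 show "(%X. adj (lket e) oo X oo lket e') ` cvec.span {S \<otimes> T | S T. S : N & T : A} \<subseteq> A"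
 proof safe
  fix X assume "X : cvec.span {S \<otimes> T | S T. S : N & T : A}"
  thus "adj (lket e) oo X oo lket e' : A"
  proof (induction rule: cvec.span_induct_alt)
   case base thus ?case using cvec.subspace_0[OF vn_subspace[OF A]] by simp
  next
   case (step c x y)
   then obtain S T where x: "x = S \<otimes> T" "S : N" "T : A" by blast
   hence ST: "S : bops" "T : bops" using vn_subset_bops[OF A] N by auto
   have "adj (lket e) oo (S \<otimes> T) oo lket e' = cinner e (S e') *c T"
    using ST by (intro blinfun_eqI) simp
   hence "adj (lket e) oo (c *c x + y) oo lket e' = (c * cinner e (S e')) *c T + (adj (lket e) oo y oo lket e')"
    by (simp add: x(1) blinfun_compose_algebra(2,3) scaleC_blinfun_comp)
   thus ?case using step.IH x(3)
    by (simp add: cvec.subspace_add[OF vn_subspace[OF A]] cvec.subspace_scale[OF vn_subspace[OF A]])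
  qed
 qed
qed auto

text \<open>Inserting \<open>fproj I \<otimes> id_blinfun\<close> between the two factors turns the
  slice into a finite sum of products of slices, and the limit over \<open>I\<close> stays in
  \<open>A\<close>. It serves for \<open>adj F oo F\<close> in the proof that \<open>ktilde\<close>
  is strongly continuous.\<close>

lemma lslice_adj_mult_in:
 fixes x :: "('c::complex_hilbert, 'h::complex_hilbert) tensor op"
 assumes A: "von_neumann_algebra A" and x: "x : bops" and sl: "!!e e'. adj (lket e) oo x oo lket e' : A"
 shows "adj (lket e) oo (adj x oo x) oo lket e' : A"
proof (rule limitin_closedin[OF _ vn_closed[OF A]])
 define f where "f I = adj (lket e) oo (adj x oo (fproj I \<otimes> id_blinfun) oo x) oo lket e'" for I
 have f_eq: "f I = (SUM k:onb_of I. adj (adj (lket k) oo x oo lket e) oo (adj (lket k) oo x oo lket e'))" for I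
 proof -
  have "fproj I \<otimes> id_blinfun = (SUM k:onb_of I. lket k oo adj (lket k) :: ('c, 'h) tensor =>L _)"
   by (rule tensor_op_eqI) (auto simp: blinfun.sum_left fproj_apply tensor_sum_left tensor_scaleC_left bopsD intro!: bops_sum sum.cong,
     metis bopsD bops_lket lket_apply)
  moreover have "adj (lket e) oo (adj x oo (SUM k:K. lket k oo adj (lket k)) oo x) oo lket e' =
   (SUM k:K. adj (lket e) oo (adj x oo (lket k oo adj (lket k)) oo x) oo lket e')" for K
   by (intro blinfun_eqI) (simp add: blinfun.sum_left blinfun.sum_right)
  ultimately show ?thesis using x by (simp add: f_def adj_comp blinfun_compose_algebra(1))
 qed
 show "\<forall>\<^sub>F I in fsets. f I : A"
  unfolding f_eq by (intro always_eventually allI cvec.subspace_sum[OF vn_subspace[OF A]] vn_comp[OF A] vn_adj[OF A] sl)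
 show "\<not> trivial_limit (finite_subsets_at_top (UNIV :: 'c set))" by simp
 show "limitin ultraweak f (adj (lket e) oo (adj x oo x) oo lket e') fsets"
 proof (rule limitin_ultraweak_bounded)
  show "\<forall>\<^sub>F i in fsets. f i : bops" using x by (simp add: f_def)
  show "\<forall>\<^sub>F I in fsets. norm (f I) <= norm (adj (lket e :: 'h =>L _)) * (norm (adj x) * 1 * norm x) * norm (lket e' :: 'h =>L _)"
   using eventually_finite_norm_fproj
  proof eventually_elim
   case (elim I)
   have 1: "norm (fproj I \<otimes> id_blinfun :: ('c, 'h) tensor =>L _) <= 1"
    using order_trans[OF norm_tensor_op_le mult_mono[OF elim norm_blinfun_id_le]] by fastforce
   show ?case unfolding f_def
    by (rule order_trans[OF norm_blinfun_compose mult_mono[OF _ order_refl]],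
      rule order_trans[OF norm_blinfun_compose mult_mono[OF order_refl]],
      rule order_trans[OF norm_blinfun_compose mult_mono[OF _ order_refl]],
      rule order_trans[OF norm_blinfun_compose mult_mono[OF order_refl 1]]) auto
  qed
  fix s s' :: "'h"
  have "cinner s (f I s') = cinner (x (e \<odot> s)) ((fproj I \<otimes> id_blinfun) (x (e' \<odot> s')))" for I
   using x by (simp add: f_def cinner_adj_right)
  moreover have "cinner s ((adj (lket e) oo (adj x oo x) oo lket e') s') = cinner (x (e \<odot> s)) (x (e' \<odot> s'))"
   using x by (simp add: cinner_adj_right)
  moreover have "((%I. cinner (x (e \<odot> s)) ((fproj I \<otimes> id_blinfun) (x (e' \<odot> s')))) ---> cinner (x (e \<odot> s)) (x (e' \<odot> s'))) fsets"
   by (intro tendsto_cinner id_tensor_fproj_tendsto tendsto_const)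
  ultimately show "((%I. cinner s (f I s')) ---> cinner s ((adj (lket e) oo (adj x oo x) oo lket e') s')) fsets"
   by simp
 qed (use x in simp_all)
qed

lemma id_blinfun_comp [simp]: "id_blinfun oo S = S" "S oo id_blinfun = S"
 by (auto intro: blinfun_eqI)

section \<open>Amplifications are ultraweakly continuous\<close>

text \<open>The Hilbert space \<open>'i ell2\<close> is generated by symbols with the Kronecker
  delta as kernel. The index type is arbitrary because the structure theorem for normal
  representations needs one summand for each vector of a possibly uncountable family.\<close>

datatype 'i ell2gen = EGen 'i

instantiation ell2gen :: (type) pd_kernel
begin
definition ker_ell2gen :: "'a ell2gen => 'a ell2gen => complex" where
 "ker_ell2gen x y = (if x = y then 1 else 0)"
instance
proof
 fix x y :: "'a ell2gen"
 show "ker x y = cnj (ker y x)" by (simp add: ker_ell2gen_def)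
next
 fix I :: "'a ell2gen set" assume I: "finite I"
 show "pos_def_on I ker"
 proof (rule pos_def_onI)
  fix c :: "'a ell2gen => complex"
  have "(SUM i:I. SUM j:I. cnj (c i) * c j * ker i j) = (SUM i:I. complex_of_real ((cmod (c i))^2))"
  proof (rule sum.cong[OF refl])
   fix i assume i: "i : I"
   have "(SUM j:I. cnj (c i) * c j * ker i j) = (SUM j:I. if i = j then cnj (c i) * c j else 0)"
    by (rule sum.cong) (auto simp: ker_ell2gen_def)
   also have "... = cnj (c i) * c i" using I i by simp
   finally show "(SUM j:I. cnj (c i) * c j * ker i j) = complex_of_real ((cmod (c i))^2)"
    by (metis complex_norm_square mult.commute)
  qed
  thus "0 <= Re (SUM i:I. SUM j:I. cnj (c i) * c j * ker i j)" by (simp add: sum_nonneg)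
 qed
qed
end

type_synonym 'i ell2 = "'i ell2gen formal completion"

definition eb :: "'i => 'i ell2" where "eb i = generator (EGen i)"

lemma cinner_eb [simp]: "cinner (eb i) (eb j) = (if i = j then 1 else 0)"
 by (simp add: eb_def ker_ell2gen_def)

lemma total_eb: "total (range eb)"
proof -
 have "range (generator :: 'i ell2gen => _) \<subseteq> range eb"
 proof safe
  fix g :: "'i ell2gen" show "generator g : range eb" by (cases g) (auto simp: eb_def)
 qed
 thus ?thesis using total_generator total_mono by blast
qed

abbreviation coef :: "'i => ('h::complex_hilbert, 'i ell2) tensor => 'h" where
 "coef i \<alpha> == blinfun_apply (adj (ket (eb i))) \<alpha>"

lemma norm_sum_eb: "finite F ==> (norm (SUM i:F. x i \<odot> eb i))\<^sup>2 = (SUM i:F. (norm (x i))^2)"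
proof -
 assume F: "finite F"
 have "complex_of_real ((norm (SUM i:F. x i \<odot> eb i))^2) = (SUM i:F. SUM j:F. if j = i then cinner (x i) (x j) else 0)"
  unfolding cinner_self_norm[symmetric] cinner_sum_left cinner_sum_right
  by (subst sum.swap) (auto intro!: sum.cong)
 also have "... = of_real (SUM i:F. (norm (x i))^2)" using F by (simp add: cinner_self_norm)
 finally show ?thesis by (simp only: of_real_eq_iff)
qed

lemma norm_amp_le: "norm ((X::'a::complex_hilbert =>L 'b::complex_hilbert) \<otimes> (id_blinfun :: 'c::complex_hilbert op)) <= norm X" if "X : bops"
proof -
 have "norm (X \<otimes> (id_blinfun :: 'c op)) <= norm X * norm (id_blinfun :: 'c op)"
  using that by (intro norm_tensor_op_le) auto
 also have "... <= norm X * 1" by (intro mult_left_mono norm_blinfun_id_le) auto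
 finally show ?thesis by simp
qed

definition trunc :: "'i set => ('h::complex_hilbert, 'i ell2) tensor op" where
 "trunc F = (SUM i:F. ket (eb i) oo adj (ket (eb i)))"

lemma bops_trunc [intro, simp]: "trunc F : bops" unfolding trunc_def by (intro bops_sum) auto

lemma trunc_apply: "trunc F a = (SUM i:F. coef i a \<odot> eb i)"
 by (simp add: trunc_def blinfun.sum_left)

text \<open>The squared norm of \<open>trunc F a\<close> equals <trunc F a, a>, so the
  Cauchy-Schwarz inequality gives Bessel's inequality.\<close>

lemma trunc_bessel:
 assumes F: "finite F" shows "(SUM i:F. (norm (coef i a))^2) <= (norm a)^2" "norm (trunc F) <= 1"
proof -
 have 1: "norm (trunc F a) <= norm a" for a
 proof -
  have "cinner (trunc F a) (trunc F a) = of_real (SUM i:F. (norm (coef i a))^2)"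
   unfolding trunc_apply cinner_self_norm norm_sum_eb[OF F] ..
  also have "... = (SUM i:F. cinner (coef i a) (coef i a))" by (simp add: cinner_self_norm)
  also have "... = cinner (trunc F a) a" by (simp add: trunc_apply cinner_sum_left cinner_adj_right)
  finally have "cmod (cinner (trunc F a) (trunc F a)) <= norm (trunc F a) * norm a" by (simp only: cmod_cinner_le)
  hence "norm (trunc F a) * norm (trunc F a) <= norm (trunc F a) * norm a"
   by (simp add: cinner_self_norm power2_eq_square norm_mult)
  thus ?thesis by (rule le_of_mult_self_le) simp
 qed
 show "norm (trunc F) <= 1" by (rule norm_blinfun_bound) (use 1 in auto)
 have "(SUM i:F. (norm (coef i a))^2) = (norm (trunc F a))^2" by (simp add: trunc_apply norm_sum_eb[OF F])
 also have "... <= (norm a)^2" by (intro power_mono 1) simp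
 finally show "(SUM i:F. (norm (coef i a))^2) <= (norm a)^2" .
qed

lemma trunc_tendsto:
 fixes c :: "('a::complex_hilbert, 'b ell2) tensor"
 shows "((%F. trunc F c) ---> c) fsets"
proof -
 have "((%F. trunc F c) ---> id_blinfun c) fsets"
 proof (rule strong_limit_total[OF total_tensor[OF _ total_eb], where C = 1])
  show "total UNIV" by (simp add: total_def)
  show "eventually (%F. norm (trunc F) <= 1) fsets"
   by (rule eventually_finite_subsets_at_top_weakI) (rule trunc_bessel(2))
  fix g :: "('a, 'b ell2) tensor" assume "g : {s \<odot> s' |s s'. s : UNIV & s' : range eb}"
  then obtain x j where g: "g = x \<odot> eb j" by auto
  have "eventually (%F. finite F & {j} \<subseteq> F & F \<subseteq> UNIV) fsets"
   unfolding eventually_finite_subsets_at_top by (intro exI[of _ "{j}"]) auto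
  hence "eventually (%F. trunc F g = g) fsets"
  proof eventually_elim
   case (elim F)
   have "trunc F g = (SUM i:F. if i = j then x \<odot> eb j else 0)" unfolding trunc_apply by (rule sum.cong) (auto simp: g)
   also have "... = g" using elim by (simp add: g)
   finally show ?case .
  qed
  thus "((%F. trunc F g) ---> id_blinfun g) fsets" by (simp add: tendsto_eventually)
 qed auto
 thus ?thesis by simp
qed

lemma coef_amp:
 assumes X: "X : bops" shows "coef i ((X \<otimes> id_blinfun) c) = X (coef i c)"
proof -
 have "adj (ket (eb i)) oo (X \<otimes> id_blinfun) = X oo adj (ket (eb i))"
  by (rule tensor_op_eqI) (use X in "auto simp: bopsD")
 thus ?thesis by (metis blinfun_apply_blinfun_compose)
qed

lemma amp_has_sum:
 assumes X: "X : bops"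
 shows "((%i. cinner (coef i a) (X (coef i c))) has_sum cinner a ((X \<otimes> id_blinfun) c)) UNIV"
proof -
 have "(%F. cinner (trunc F a) ((X \<otimes> id_blinfun) c)) = sum (%i. cinner (coef i a) (X (coef i c)))"
  unfolding trunc_apply cinner_sum_left by (intro ext sum.cong refl) (simp add: coef_amp[OF X, symmetric] cinner_adj_right)
 moreover have "((%F. cinner (trunc F a) ((X \<otimes> id_blinfun) c)) ---> cinner a ((X \<otimes> id_blinfun) c)) fsets"
  by (intro tendsto_cinner trunc_tendsto tendsto_const)
 ultimately show ?thesis by (simp add: has_sum_def)
qed

definition seq_of :: "('j => 'h::zero) => ('j => nat) => 'j set => nat => 'h" where
 "seq_of \<xi> g C n = (if n : g ` C then \<xi> (inv_into C g n) else 0)"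

lemma seq_of_image: "inj_on g C ==> j : C ==> seq_of x g C (g j) = x j"
 by (simp add: seq_of_def)

text \<open>The components of the vectors \<open>p n\<close> and \<open>q n\<close> form families
  indexed by pairs (n, i), square summable by Bessel's inequality, and the functional becomes a sum
  over pairs. Only countably many components are non-zero, even if the index type is uncountable, so
  they can be enumerated by natural numbers. The last conclusion keeps functionals of the form
  \<open>uw p p\<close> in this form.\<close>

lemma amp_uw:
 fixes p q :: "nat => ('h::complex_hilbert, 'i ell2) tensor"
 assumes s: "sq_summable p" "sq_summable q"
 obtains p' q' :: "nat => 'h" where "sq_summable p'" "sq_summable q'"
  "!!X. X : bops ==> uw p q (X \<otimes> id_blinfun) = uw p' q' X" "p = q ==> p' = q'"
proof -
 define a where "a = (%(n, i). coef i (p n))"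
 define b where "b = (%(n, i). coef i (q n))"
 have sm: "(%(n, i). (norm (coef i (w n)))^2) summable_on UNIV" if z: "sq_summable w" for w :: "nat => ('h, 'i ell2) tensor"
 proof (rule nonneg_bdd_above_summable_on)
  show "bdd_above (sum (%(n, i). (norm (coef i (w n)))^2) ` {F. F \<subseteq> UNIV & finite F})"
  proof (rule bdd_aboveI2)
   fix F :: "(nat \<times> 'i) set" assume "F : {F. F \<subseteq> UNIV & finite F}"
   hence F: "finite F" by simp
   have "sum (%(n, i). (norm (coef i (w n)))^2) F <= sum (%(n, i). (norm (coef i (w n)))^2) (fst ` F \<times> snd ` F)"
    using F by (intro sum_mono2) force+
   also have "... = (SUM n:fst ` F. SUM i:snd ` F. (norm (coef i (w n)))^2)" by (simp add: sum.cartesian_product)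
   also have "... <= (SUM n:fst ` F. (norm (w n))^2)" using F by (intro sum_mono trunc_bessel) simp
   also have "... <= (\<Sum>n. (norm (w n))^2)" using F z by (intro sum_le_suminf) (auto simp: sq_summable_def)
   finally show "sum (%(n, i). (norm (coef i (w n)))^2) F <= (\<Sum>n. (norm (w n))^2)" .
  qed
 qed auto
 have sa: "(%j. (norm (a j))^2) summable_on UNIV" and sb: "(%j. (norm (b j))^2) summable_on UNIV"
  using sm[OF s(1)] sm[OF s(2)] by (simp_all add: a_def b_def case_prod_unfold)
 \<comment> \<open>One set for both families, so that \<open>p'\<close> and \<open>q'\<close> are
   enumerated in parallel.\<close>
 define C where "C = {j. a j ~= 0 \<or> b j ~= 0}"
 have "C = {j : UNIV. (norm (a j))^2 ~= 0} \<union> {j : UNIV. (norm (b j))^2 ~= 0}" by (auto simp: C_def)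
 also have "countable ..." by (rule countable_Un[OF summable_countable_real[OF sa] summable_countable_real[OF sb]])
 finally have cC: "countable C" .
 define g where "g = to_nat_on C"
 have g: "inj_on g C" unfolding g_def by (rule inj_on_to_nat_on[OF cC])
 define p' where "p' = seq_of a g C"
 define q' where "q' = seq_of b g C"
 have transfer: "((%n. f (p' n) (q' n)) has_sum x) UNIV" if "((%j. f (a j) (b j)) has_sum x) UNIV" "f 0 0 = 0"
  for f :: "'h => 'h => 'z::{comm_monoid_add, topological_space}" and x
 proof -
  have "((%j. f (a j) (b j)) has_sum x) C"
   using has_sum_cong_neutral[of UNIV C "%j. f (a j) (b j)" "%j. f (a j) (b j)" x] that by (auto simp: C_def)
  hence "(((%n. f (p' n) (q' n)) \<circ> g) has_sum x) C"
   by (subst has_sum_cong[of C _ "%j. f (a j) (b j)"]) (auto simp: p'_def q'_def seq_of_image[OF g])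
  hence "((%n. f (p' n) (q' n)) has_sum x) (g ` C)" by (simp add: has_sum_reindex[OF g])
  thus ?thesis
   using has_sum_cong_neutral[of UNIV "g ` C" "%n. f (p' n) (q' n)" "%n. f (p' n) (q' n)" x]
   by (auto simp: p'_def q'_def seq_of_def that(2))
 qed
 have "((%n. (norm (p' n))^2) has_sum infsum (%j. (norm (a j))^2) UNIV) UNIV"
  by (rule transfer[of "%x y. (norm x)^2"]) (use sa in auto)
 hence s1: "sq_summable p'" unfolding sq_summable_def using has_sum_imp_sums sums_summable by blast
 have "((%n. (norm (q' n))^2) has_sum infsum (%j. (norm (b j))^2) UNIV) UNIV"
  by (rule transfer[of "%x y. (norm y)^2"]) (use sb in auto)
 hence s2: "sq_summable q'" unfolding sq_summable_def using has_sum_imp_sums sums_summable by blast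
 have "uw p q (X \<otimes> id_blinfun) = uw p' q' X" if X: "X : bops" for X
 proof -
  have abs: "(%j. cinner (a j) (X (b j))) summable_on UNIV"
  proof (rule abs_summable_summable, rule summable_on_comparison_test)
   show "(%j. norm X * ((norm (a j))^2 + (norm (b j))^2)) summable_on UNIV"
    by (intro summable_on_cmult_right summable_on_add sa sb)
   fix j
   have "cmod (cinner (a j) (X (b j))) <= norm X * (norm (a j) * norm (b j))" by (rule uw_term_le)
   also have "... <= norm X * ((norm (a j))^2 + (norm (b j))^2)"
    using sum_squares_bound[of "norm (a j)" "norm (b j)"] mult_nonneg_nonneg[of "norm (a j)" "norm (b j)"] norm_ge_zero[of "a j"] norm_ge_zero[of "b j"]
    by (intro mult_left_mono) (linarith, simp)
   finally show "norm (cinner (a j) (X (b j))) <= norm X * ((norm (a j))^2 + (norm (b j))^2)" .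
  qed simp
  hence hs: "((%j. cinner (a j) (X (b j))) has_sum infsum (%j. cinner (a j) (X (b j))) UNIV) (Sigma UNIV (%_. UNIV))" by simp
  have "((%n. cinner (p n) ((X \<otimes> id_blinfun) (q n))) has_sum infsum (%j. cinner (a j) (X (b j))) UNIV) UNIV"
   by (rule has_sum_Sigma'[OF hs]) (use amp_has_sum[OF X] in "simp add: a_def b_def")
  hence 1: "uw p q (X \<otimes> id_blinfun) = infsum (%j. cinner (a j) (X (b j))) UNIV"
   unfolding uw_def by (rule sums_unique[OF has_sum_imp_sums, symmetric])
  have "((%n. cinner (p' n) (X (q' n))) has_sum infsum (%j. cinner (a j) (X (b j))) UNIV) UNIV"
   by (rule transfer[of "%x y. cinner x (X y)"]) (use abs in auto)
  hence "uw p' q' X = infsum (%j. cinner (a j) (X (b j))) UNIV"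
   unfolding uw_def by (rule sums_unique[OF has_sum_imp_sums, symmetric])
  with 1 show ?thesis by simp
 qed
 moreover have "p' = q'" if "p = q" using that by (simp add: p'_def q'_def a_def b_def)
 ultimately show ?thesis using that s1 s2 by blast
qed

lemma continuous_map_amp:
 "continuous_map ultraweak ultraweak (%X::'h::complex_hilbert op. X \<otimes> (id_blinfun :: 'i ell2 =>L _))"
proof (rule continuous_map_ultraweakI)
 fix x y :: "nat => ('h, 'i ell2) tensor" assume s: "sq_summable x" "sq_summable y"
 obtain x' y' where t: "sq_summable x'" "sq_summable y'" "!!X. X : bops ==> uw x y (X \<otimes> id_blinfun) = uw x' y' X"
  using amp_uw[OF s] by metis
 show "continuous_map ultraweak euclidean (%X. uw x y (X \<otimes> id_blinfun))"
  by (rule continuous_map_eq[OF continuous_map_uw[OF t(1,2)]]) (simp add: t(3))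
qed auto

lemma continuous_map_amp_conj:
 fixes V :: "'c::complex_hilbert =>L ('h::complex_hilbert, 'i ell2) tensor"
 assumes "V : bops"
 shows "continuous_map ultraweak ultraweak (%X. adj V oo (X \<otimes> id_blinfun) oo V)"
 using continuous_map_compose[OF continuous_map_amp continuous_map_conj[OF assms assms]] by (simp add: o_def)

lemma tensor_op_add_left:
 assumes "S : bops" "S' : bops" "T : bops" shows "(S + S') \<otimes> T = S \<otimes> T + S' \<otimes> T"
 by (rule tensor_op_eqI) (use assms in "auto simp: blinfun.add_left tensor_add_left")

lemma tensor_op_scaleC_left:
 assumes "S : bops" "T : bops" shows "(c *c S) \<otimes> T = c *c (S \<otimes> T)"
 by (rule tensor_op_eqI) (use assms in "auto simp: tensor_scaleC_left")

section \<open>The structure of normal representations\<close>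

lemma ell2_vector:
 fixes w :: "nat => 'h::complex_hilbert" and g :: "nat => 'i"
 assumes s: "sq_summable w" and g: "inj g"
 shows "\<exists>z::('h, 'i ell2) tensor. (%N. \<Sum>n<N. w n \<odot> eb (g n)) ----> z"
proof -
 define S where "S N = (\<Sum>n<N. w n \<odot> eb (g n))" for N
 have nrm: "(norm (SUM n:F. w n \<odot> eb (g n)))^2 = (SUM n:F. (norm (w n))^2)" if "finite F" for F
 proof -
  have ig: "inj_on g F" using g inj_on_subset by blast
  have inv: "inv_into F g (g n) = n" if "n : F" for n using ig that by simp
  have "(SUM n:F. w n \<odot> eb (g n)) = (SUM i:g ` F. w (inv_into F g i) \<odot> eb i)"
   by (subst sum.reindex[OF ig]) (simp add: inv)
  also have "(norm ...)^2 = (SUM i:g ` F. (norm (w (inv_into F g i)))^2)" using that by (intro norm_sum_eb) simp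
  also have "... = (SUM n:F. (norm (w n))^2)" by (subst sum.reindex[OF ig]) (simp add: inv)
  finally show ?thesis .
 qed
 have "Cauchy S"
 proof (rule CauchyI', unfold dist_norm)
  fix e :: real assume e: "e > 0"
  have "Cauchy (%N. \<Sum>n<N. (norm (w n))^2)"
   using s unfolding sq_summable_def summable_iff_convergent by (rule convergent_Cauchy)
  then obtain M where M: "!!m n. m >= M ==> n >= M ==> norm ((\<Sum>n<m. (norm (w n))^2) - (\<Sum>n<n. (norm (w n))^2)) < e\<^sup>2"
   using CauchyD[of _ "e\<^sup>2"] e by (metis zero_less_power)
  have "norm (S m - S n) < e" if "m >= M" "n > m" for m n
  proof -
   have split: "{..<n} = {..<m} \<union> {m..<n}" using that by auto
   have "S n - S m = (SUM k:{m..<n}. w k \<odot> eb (g k))" unfolding S_def split by (subst sum.union_disjoint) auto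
   hence "(norm (S n - S m))^2 = (SUM k:{m..<n}. (norm (w k))^2)" by (simp add: nrm)
   also have "... = (\<Sum>k<n. (norm (w k))^2) - (\<Sum>k<m. (norm (w k))^2)" unfolding split by (subst sum.union_disjoint) auto
   also have "... < e\<^sup>2" using M[of n m] that by auto
   finally show ?thesis using e by (simp add: power_less_imp_less_base norm_minus_commute)
  qed
  thus "EX M. ALL m>=M. ALL n>m. norm (S m - S n) < e" by blast
 qed
 thus ?thesis unfolding S_def[symmetric] using Cauchy_convergent convergent_def by blast
qed

definition ell2vec :: "(nat => 'h::complex_hilbert) => (nat => 'i) => ('h, 'i ell2) tensor" where
 "ell2vec \<zeta> g = lim (%N. \<Sum>n<N. \<zeta> n \<odot> eb (g n))"

lemma ell2vec_lim:
 assumes "sq_summable w" "inj g"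
 shows "(%N. \<Sum>n<N. w n \<odot> eb (g n)) ----> ell2vec w g"
proof -
 obtain z where "(%N. \<Sum>n<N. w n \<odot> eb (g n)) ----> z" using ell2_vector[OF assms] by blast
 thus ?thesis unfolding ell2vec_def by (simp add: limI)
qed

text \<open>The hypothesis \<open>eq\<close> covers two situations at once: for \<open>b\<close>
  true the two enumerations coincide, for \<open>b\<close> false their ranges are disjoint and the
  vectors live on orthogonal summands.\<close>

lemma cinner_amp_ell2vec:
 assumes s: "sq_summable z" "sq_summable z'" and g: "inj g" "inj g'" and X: "X : bops" "Y : bops"
  and eq: "!!n m. g n = g' m \<longleftrightarrow> b & n = m"
 shows "cinner ((X \<otimes> id_blinfun) (ell2vec z g)) ((Y \<otimes> id_blinfun) (ell2vec z' g')) =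
  (if b then (\<Sum>n. cinner (X (z n)) (Y (z' n))) else 0)"
proof -
 define P where "P N = (\<Sum>n<N. z n \<odot> eb (g n))" for N
 define P' where "P' N = (\<Sum>n<N. z' n \<odot> eb (g' n))" for N
 have lim: "(%N. cinner ((X \<otimes> id_blinfun) (P N)) ((Y \<otimes> id_blinfun) (P' N))) ---->
  cinner ((X \<otimes> id_blinfun) (ell2vec z g)) ((Y \<otimes> id_blinfun) (ell2vec z' g'))"
  unfolding P_def P'_def by (intro tendsto_cinner blinfun.tendsto tendsto_const ell2vec_lim s g)
 have "cinner ((X \<otimes> id_blinfun) (P N)) ((Y \<otimes> id_blinfun) (P' N)) =
   (\<Sum>n<N. if b then cinner (X (z n)) (Y (z' n)) else 0)" for N
 proof -
  have "cinner ((X \<otimes> id_blinfun) (P N)) ((Y \<otimes> id_blinfun) (P' N)) =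
   (\<Sum>m<N. \<Sum>n<N. if n = m then (if b then cinner (X (z n)) (Y (z' m)) else 0) else 0)"
   unfolding P_def P'_def blinfun.sum_right cinner_sum_left cinner_sum_right
   by (intro sum.cong refl) (use X in "auto simp: eq")
  also have "... = (\<Sum>n<N. if b then cinner (X (z n)) (Y (z' n)) else 0)"
   by (intro sum.cong refl) (simp)
  finally show ?thesis .
 qed
 hence lim': "(%N. \<Sum>n<N. if b then cinner (X (z n)) (Y (z' n)) else 0) ---->
  cinner ((X \<otimes> id_blinfun) (ell2vec z g)) ((Y \<otimes> id_blinfun) (ell2vec z' g'))" using lim by simp
 show ?thesis
 proof (cases b)
  case True thus ?thesis using lim' by (simp add: sums_def[symmetric] sums_iff)
 next
  case False thus ?thesis using lim' by (simp add: LIMSEQ_const_iff)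
 qed
qed

section \<open>Vector functionals of normal representations\<close>

lemma sq_summable_interleave:
 fixes a b :: "nat => 'a::real_normed_vector"
 assumes "sq_summable a" "sq_summable b"
 shows "sq_summable (%n. if even n then a (n div 2) else b (n div 2))"
  "(\<Sum>n. (norm (if even n then a (n div 2) else b (n div 2)))^2) = (\<Sum>n. (norm (a n))^2) + (\<Sum>n. (norm (b n))^2)"
proof -
 have "(%n. if even n then (norm (a (n div 2)))\<^sup>2 else (norm (b ((n - 1) div 2)))\<^sup>2) sums ((\<Sum>n. (norm (b n))^2) + (\<Sum>n. (norm (a n))^2))"
  using assms by (intro sums_if) (auto simp: sq_summable_def)
 moreover have "(if even n then (norm (a (n div 2)))\<^sup>2 else (norm (b ((n - 1) div 2)))\<^sup>2) =
  (norm (if even n then a (n div 2) else b (n div 2)))^2" for n :: nat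
  by (cases "even n") (auto elim!: oddE)
 ultimately have "(%n. (norm (if even n then a (n div 2) else b (n div 2)))^2) sums ((\<Sum>n. (norm (a n))^2) + (\<Sum>n. (norm (b n))^2))"
  by (simp add: add.commute)
 thus "sq_summable (%n. if even n then a (n div 2) else b (n div 2))"
  "(\<Sum>n. (norm (if even n then a (n div 2) else b (n div 2)))^2) = (\<Sum>n. (norm (a n))^2) + (\<Sum>n. (norm (b n))^2)"
  by (auto simp: sq_summable_def sums_iff)
qed

text \<open>On elements of the form \<open>adj X oo X\<close> a functional \<open>uw w q\<close> is
  bounded by the sum of the squared norms of the \<open>X (w n)\<close> and the
  \<open>X (q n)\<close>, so every subbasic neighbourhood contains such a set; intersections are
  handled by interleaving two sequences.\<close>

lemma ultraweak_nbhd_zero: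
 fixes U :: "('h::complex_hilbert op) set"
 assumes "openin ultraweak U" "0 : U"
 shows "\<exists>z::nat => 'h. sq_summable z & (ALL X::'h op:bops. (\<Sum>n. (norm (blinfun_apply X (z n)))^2) < 1 --> adj X oo X : U)"
proof -
 have "generate_topology_on {{T : bops. (\<Sum>n. cinner (w n) (blinfun_apply T (q n))) : U} | w q U.
    sq_summable w & sq_summable q & open U} U"
  using assms(1) unfolding ultraweak_def openin_topology_generated_by_iff .
 thus ?thesis using assms(2)
 proof (induction rule: generate_topology_on.induct)
  case Empty thus ?case by simp
 next
  case (Int a b)
  have "0 : a" "0 : b" using Int.prems by auto
  from Int.IH(1)[OF this(1)] obtain x where x: "sq_summable x" "ALL X::'h op:bops. (\<Sum>n. (norm (blinfun_apply X (x n)))^2) < 1 --> adj X oo X : a"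
   by (elim exE conjE) (rule that)
  from Int.IH(2)[OF \<open>0 : b\<close>] obtain y where y: "sq_summable y" "ALL X::'h op:bops. (\<Sum>n. (norm (blinfun_apply X (y n)))^2) < 1 --> adj X oo X : b"
   by (elim exE conjE) (rule that)
  show ?case
  proof (intro exI conjI ballI impI)
   show "sq_summable (%n. if even n then x (n div 2) else y (n div 2))" by (rule sq_summable_interleave[OF x(1) y(1)])
   fix X :: "'h op" assume X: "X : bops" "(\<Sum>n. (norm (X (if even n then x (n div 2) else y (n div 2))))^2) < 1"
   have "(\<Sum>n. (norm (X (if even n then x (n div 2) else y (n div 2))))^2) = (\<Sum>n. (norm (X (x n)))^2) + (\<Sum>n. (norm (X (y n)))^2)"
    using sq_summable_interleave(2)[OF sq_summable_bounded_op[OF x(1), of X] sq_summable_bounded_op[OF y(1), of X]]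
    by (simp add: if_distrib[of "blinfun_apply X"] cong: if_cong)
   moreover have "(\<Sum>n. (norm (X (x n)))^2) >= 0" "(\<Sum>n. (norm (X (y n)))^2) >= 0"
    using sq_summable_bounded_op[OF x(1), of X] sq_summable_bounded_op[OF y(1), of X] by (auto simp: sq_summable_def intro!: suminf_nonneg)
   ultimately have "(\<Sum>n. (norm (X (x n)))^2) < 1" "(\<Sum>n. (norm (X (y n)))^2) < 1" using X(2) by linarith+
   thus "adj X oo X : a \<inter> b" using x(2) y(2) X(1) by blast
  qed
 next
  case (UN K)
  then obtain k where k: "k : K" "0 : k" by blast
  from UN.IH[OF k] obtain z where "sq_summable z"
   "ALL X::'h op:bops. (\<Sum>n. (norm (blinfun_apply X (z n)))^2) < 1 --> adj X oo X : k" by (elim exE conjE) (rule that)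
  thus ?case using k(1) by (intro exI[of _ z]) blast
 next
  case (Basis s)
  then obtain w q U' where U: "s = {T : bops. uw w q T : U'}" "sq_summable w" "sq_summable q" "open U'"
   unfolding uw_def by blast
  hence "0 : U'" using Basis(2) by (auto simp: uw_def)
  then obtain e where e: "e > 0" "ball 0 e \<subseteq> U'" using U(4) open_contains_ball by blast
  \<comment> \<open>Scaling the vectors by \<open>r\<close> turns the threshold 1 into
    \<open>e\<close>.\<close>
  define r where "r = 1 / sqrt e"
  have r: "r\<^sup>2 = 1 / e" using e by (simp add: r_def power_divide)
  have sx: "sq_summable (%n. r *r w n)" "sq_summable (%n. r *r q n)"
   using U(2,3) by (auto simp: sq_summable_def power_mult_distrib)
  show ?case
  proof (intro exI conjI ballI impI)
   show "sq_summable (%n. if even n then r *r w (n div 2) else r *r q (n div 2))" by (rule sq_summable_interleave[OF sx])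
   fix X :: "'h op" assume X: "X : bops" "(\<Sum>n. (norm (X (if even n then r *r w (n div 2) else r *r q (n div 2))))^2) < 1"
   have sX: "summable (%n. (norm (X (w n)))^2)" "summable (%n. (norm (X (q n)))^2)"
    using sq_summable_bounded_op[OF U(2), of X] sq_summable_bounded_op[OF U(3), of X] by (auto simp: sq_summable_def)
   have "(\<Sum>n. (norm (X (if even n then r *r w (n div 2) else r *r q (n div 2))))^2) =
     (\<Sum>n. (norm (X (r *r w n)))^2) + (\<Sum>n. (norm (X (r *r q n)))^2)"
    using sq_summable_interleave(2)[OF sq_summable_bounded_op[OF sx(1), of X] sq_summable_bounded_op[OF sx(2), of X]]
    by (simp add: if_distrib[of "blinfun_apply X"] cong: if_cong)
   also have "... = (1 / e) * ((\<Sum>n. (norm (X (w n)))^2) + (\<Sum>n. (norm (X (q n)))^2))"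
    by (simp add: blinfun.scaleR_right power_mult_distrib r suminf_mult[OF sX(1)] suminf_mult[OF sX(2)] distrib_left suminf_divide sX)
   finally have "(1 / e) * ((\<Sum>n. (norm (X (w n)))^2) + (\<Sum>n. (norm (X (q n)))^2)) < 1" using X(2) by linarith
   hence lt: "(\<Sum>n. (norm (X (w n)))^2) + (\<Sum>n. (norm (X (q n)))^2) < e" using e by (simp)
   have "cmod (uw w q (adj X oo X)) <= (\<Sum>n. (norm (X (w n)))^2 + (norm (X (q n)))^2)"
    unfolding uw_def
   proof (rule order_trans[OF summable_norm suminf_le])
    show "summable (%n. norm (cinner (w n) ((adj X oo X) (q n))))" by (rule uw_summable[OF U(2,3)])
    thus "summable (%n. norm (cinner (w n) ((adj X oo X) (q n))))" .
    show "summable (%n. (norm (X (w n)))^2 + (norm (X (q n)))^2)" by (intro summable_add sX)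
    fix n
    have "cmod (cinner (w n) ((adj X oo X) (q n))) <= norm (X (w n)) * norm (X (q n))"
     using X(1) cmod_cinner_le by (simp add: cinner_adj_right)
    also have "... <= (norm (X (w n)))^2 + (norm (X (q n)))^2"
     using sum_squares_bound[of "norm (X (w n))" "norm (X (q n))"] mult_nonneg_nonneg[of "norm (X (w n))" "norm (X (q n))"]
      norm_ge_zero[of "X (w n)"] norm_ge_zero[of "X (q n)"] by linarith
    finally show "norm (cinner (w n) ((adj X oo X) (q n))) <= (norm (X (w n)))^2 + (norm (X (q n)))^2" .
   qed
   also have "... < e" using lt by (simp add: suminf_add[OF sX])
   finally have "uw w q (adj X oo X) : U'" using e(2) by auto
   thus "adj X oo X : s" using X(1) by (simp add: U(1))
  qed
 qed
qed

definition repn :: "('h::complex_hilbert op) set => (('h op) => 'f::complex_hilbert op) => bool" where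
 "repn A \<phi> \<longleftrightarrow> linear_on A \<phi> & normal_on A \<phi> & (ALL a:A. \<phi> a : bops) &
  (ALL a:A. ALL b:A. \<phi> (a oo b) = \<phi> a oo \<phi> b) & (ALL a:A. \<phi> (adj a) = adj (\<phi> a)) & \<phi> id_blinfun = id_blinfun"

text \<open>By normality the elements of \<open>A\<close> whose image has matrix element below 1 at
  \<open>x\<close> form a relative neighbourhood of 0, which contains those
  \<open>adj X oo X\<close> for which the sum over \<open>w\<close> is below 1. So a sum below 1
  forces \<open>norm (p X x)\<close> below 1, and homogeneity gives the inequality.\<close>

lemma repn_bound:
 assumes A: "von_neumann_algebra A" and r: "repn A p"
 shows "EX w. sq_summable w & (ALL X:A. (norm (p X x))^2 <= (\<Sum>n. (norm (blinfun_apply X (w n)))^2))"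
proof -
 define O1 where "O1 = {T : bops. cmod (cinner x (blinfun_apply T x)) < 1}"
 have "openin ultraweak {T : topspace ultraweak. cinner x (blinfun_apply T x) : ball 0 1}"
  using continuous_map_vec[of x x] unfolding continuous_map_def by (simp del: topspace_ultraweak mem_ball mem_ball_0)
 moreover have "{T : topspace ultraweak. cinner x (blinfun_apply T x) : ball 0 1} = O1" by (auto simp: O1_def)
 ultimately have O1: "openin ultraweak O1" by simp
 have "openin (subtopology ultraweak A) {a : topspace (subtopology ultraweak A). p a : O1}"
  using r O1 unfolding repn_def normal_on_def continuous_map_def by blast
 then obtain U where U: "openin ultraweak U" "{a : topspace (subtopology ultraweak A). p a : O1} = U \<inter> A"
  unfolding openin_subtopology by metis
 have Ab: "A \<subseteq> bops" by (rule vn_subset_bops[OF A])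
 have sub: "a : A ==> a : U \<longleftrightarrow> p a : O1" for a using U(2) Ab by auto
 have A0: "0 : A" by (rule cvec.subspace_0[OF vn_subspace[OF A]])
 have "p (0 *c 0) = 0 *c p 0" using r A0 unfolding repn_def linear_on_def by blast
 hence "p 0 = 0" by simp
 hence "0 : U" using sub[OF A0] by (simp add: O1_def)
 from ultraweak_nbhd_zero[OF U(1) this] obtain w where
  z: "sq_summable w" "!!X::'a op. X : bops ==> (\<Sum>n. (norm (blinfun_apply X (w n)))^2) < 1 ==> adj X oo X : U" by blast
 have small: "(norm (p X x))^2 < 1" if X: "X : A" "(\<Sum>n. (norm (X (w n)))^2) < 1" for X
 proof -
  have aX: "adj X : A" "adj X oo X : A" using X A by (auto intro: vn_adj vn_comp)
  have "p (adj X oo X) : O1" using z(2)[of X] X Ab sub[OF aX(2)] by blast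
  moreover have "p (adj X oo X) = adj (p X) oo p X" using r X aX unfolding repn_def by metis
  moreover have "p X : bops" using r X unfolding repn_def by blast
  ultimately have "cmod (cinner (p X x) (p X x)) < 1" by (simp add: O1_def cinner_adj_right)
  thus ?thesis by (simp add: cinner_self_norm norm_power)
 qed
 have "(norm (p X x))^2 <= (\<Sum>n. (norm (X (w n)))^2)" if X: "X : A" for X
 proof (rule ccontr)
  assume neg: "\<not> ?thesis"
  have sm: "summable (%n. (norm (X (w n)))^2)" using sq_summable_bounded_op[OF z(1), of X] by (simp add: sq_summable_def)
  have "0 <= (\<Sum>n. (norm (X (w n)))^2)" by (intro suminf_nonneg sm) simp
  define c where "c = 1 / norm (p X x)"
  have pos: "norm (p X x) > 0" using neg \<open>0 <= (\<Sum>n. (norm (X (w n)))^2)\<close> by (cases "norm (p X x) = 0") auto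
  have cX: "complex_of_real c *c X : A" using X by (rule cvec.subspace_scale[OF vn_subspace[OF A]])
  have "(\<Sum>n. (norm ((complex_of_real c *c X) (w n)))^2) = c\<^sup>2 * (\<Sum>n. (norm (X (w n)))^2)"
   by (simp add: norm_scaleC power_mult_distrib suminf_mult[OF sm])
  also have "... < c\<^sup>2 * (norm (p X x))^2" using neg pos by (intro mult_strict_left_mono) (auto simp: c_def)
  also have "... = 1" using pos by (simp add: c_def power_divide)
  finally have "(norm (p (complex_of_real c *c X) x))^2 < 1" by (rule small[OF cX])
  moreover have "p (complex_of_real c *c X) = complex_of_real c *c p X" using r X unfolding repn_def linear_on_def by blast
  moreover have "norm (complex_of_real c *c p X x) = 1" using pos by (simp add: norm_scaleC c_def norm_divide)
  ultimately show False by simp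
 qed
 thus ?thesis using z(1) by blast
qed

text \<open>If \<open>0 <= T <= 1\<close> and \<open>T\<^sub>0 = T\<close>, \<open>T\<^sub>k\<^sub>+\<^sub>1 = T\<^sub>k - T\<^sub>k\<^sup>2\<close>, then \<open>T = \<Sum>\<^sub>k T\<^sub>k\<^sup>2\<close>. This replaces the
 square root of \<open>T\<close> below.\<close>

fun tseq :: "('a::complex_hilbert op) => nat => 'a op" where
 "tseq T 0 = T" | "tseq T (Suc k) = tseq T k - (tseq T k oo tseq T k)"

text \<open>The order interval from 0 to 1 is preserved since each iterate \<open>B\<close>
  satisfies B - B^2 <= B and B - B^2 = (1 - B) B (1 - B) + B (1 - B) B.\<close>

lemma tseq_props:
 assumes T: "T : bops" "adj T = T" and pos: "!!v. 0 <= Re (cinner v (T v))" and le: "!!v. Re (cinner v (T v)) <= (norm v)^2"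
 shows "tseq T k : bops & (ALL x y. cinner x (tseq T k y) = cinner (tseq T k x) y) &
  (ALL v. 0 <= Re (cinner v (tseq T k v)) & Re (cinner v (tseq T k v)) <= (norm v)^2)"
proof (induction k)
 case 0
 have "cinner x (T y) = cinner (T x) y" for x y using cinner_adj_left[OF T(1), of x y] T(2) by simp
 thus ?case using T pos le by simp
next
 case (Suc k)
 define B where "B = tseq T k"
 have B: "B : bops" "!!x y. cinner x (B y) = cinner (B x) y" "!!v. 0 <= Re (cinner v (B v))" "!!v. Re (cinner v (B v)) <= (norm v)^2"
  using Suc by (auto simp: B_def)
 have S: "tseq T (Suc k) x = B x - B (B x)" for x by (simp add: B_def blinfun.diff_left)
 have "0 <= Re (cinner v (B v - B (B v)))" for v
 proof -
  have "0 <= Re (cinner (v - B v) (B (v - B v)))" by (rule B)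
  moreover have "Re (cinner (B v) (B (B v))) <= (norm (B v))^2" by (rule B)
  moreover have "cinner (v - B v) (B (v - B v)) = cinner v (B v - B (B v)) - cinner (B v) (B v) + cinner (B v) (B (B v))"
   by (simp add: blinfun.diff_right cinner_diff_left cinner_diff_right)
  ultimately show ?thesis using Re_cinner_norm[of "B v"] by (simp only: minus_complex.simps plus_complex.simps)
 qed
 moreover have "Re (cinner v (B v - B (B v))) <= (norm v)^2" for v
 proof -
  have "Re (cinner v (B (B v))) = (norm (B v))^2" unfolding B(2)[of v "B v"] by (rule Re_cinner_norm)
  thus ?thesis using B(4)[of v] zero_le_power2[of "norm (B v)"] by (simp only: cinner_diff_right minus_complex.simps)
 qed
 moreover have "cinner x (B y - B (B y)) = cinner (B x - B (B x)) y" for x y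
  by (simp add: cinner_diff_left cinner_diff_right B(2))
 moreover have "tseq T (Suc k) : bops" using B(1) by (simp add: B_def)
 ultimately show ?case unfolding S by blast
qed

text \<open>The series telescopes with remainder <x, T_n y>, where T_n is \<open>tseq T n\<close>.
  The norms of the T_n v decrease, and n times the square of the n-th one is at most the sum of the
  previous squares, hence at most the squared norm of \<open>v\<close>; so the remainder tends to
  0.\<close>

lemma tseq_sum:
 assumes T: "T : bops" "adj T = T" and pos: "!!v. 0 <= Re (cinner v (T v))" and le: "!!v. Re (cinner v (T v)) <= (norm v)^2"
 shows "(%k. cinner (tseq T k x) (tseq T k y)) sums cinner x (T y)"
proof -
 note P = tseq_props[OF assms]
 have sa: "cinner x (tseq T k y) = cinner (tseq T k x) y" for k x y using P by blast
 have partial: "(\<Sum>k<n. cinner (tseq T k x) (tseq T k y)) = cinner x (T y) - cinner x (tseq T n y)" for n x y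
 proof (induction n)
  case (Suc n) thus ?case by (simp add: blinfun.diff_left cinner_diff_right sa)
 qed simp
 have decr: "norm (tseq T (Suc k) v) <= norm (tseq T k v)" for k v
 proof -
  define w where "w = tseq T k v"
  have "tseq T (Suc k) v = w - tseq T k w" by (simp add: w_def blinfun.diff_left)
  have "0 <= Re (cinner w (tseq T (Suc k) w))" using P by blast
  hence 1: "(norm (tseq T k w))^2 <= Re (cinner w (tseq T k w))"
   using sa[of w k "tseq T k w"] Re_cinner_norm[of "tseq T k w"]
   by (simp only: tseq.simps blinfun.diff_left blinfun_apply_blinfun_compose cinner_diff_right minus_complex.simps)
  have 2: "0 <= Re (cinner w (tseq T k w))" using P by blast
  have "cinner (tseq T k w) w = cinner w (tseq T k w)" by (rule sa[symmetric])
  hence "(norm (w - tseq T k w))^2 = (norm w)^2 + (norm (tseq T k w))^2 - 2 * Re (cinner w (tseq T k w))"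
   unfolding Re_cinner_norm[symmetric] by (simp add: cinner_diff_left cinner_diff_right)
  hence "(norm (w - tseq T k w))^2 <= (norm w)^2" using 1 2 by linarith
  hence "norm (w - tseq T k w) <= norm w" by (rule power2_le_imp_le) simp
  thus ?thesis unfolding \<open>tseq T (Suc k) v = w - tseq T k w\<close> by (simp add: w_def)
 qed
 have mono: "norm (tseq T n v) <= norm (tseq T k v)" if "k <= n" for k n v
  using that by (induction rule: dec_induct) (auto intro: order_trans[OF decr] simp del: tseq.simps)
 have bound: "real n * (norm (tseq T n v))^2 <= (norm v)^2" for n v
 proof -
  have "real n * (norm (tseq T n v))^2 = (\<Sum>k<n. (norm (tseq T n v))^2)" by simp
  also have "... <= (\<Sum>k<n. (norm (tseq T k v))^2)" by (intro sum_mono power_mono mono) auto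
  also have "... = Re (\<Sum>k<n. cinner (tseq T k v) (tseq T k v))" by (simp add: Re_cinner_norm)
  also have "... = Re (cinner v (T v)) - Re (cinner v (tseq T n v))" by (simp add: partial)
  also have "... <= (norm v)^2" using le[of v] P[of n] by (smt (verit))
  finally show ?thesis .
 qed
 have "(%n. norm (tseq T n y)) ----> 0"
 proof -
  have "(%n. (norm (tseq T n y))^2) ----> 0"
  proof (rule Lim_null_comparison)
   show "\<forall>\<^sub>F n in sequentially. norm ((norm (tseq T n y))^2) <= (norm y)^2 * inverse (real n)"
    using eventually_gt_at_top[of 0]
   proof eventually_elim
    case (elim n) thus ?case using bound[of n y] by (simp add: field_simps)
   qed
   show "(%n. (norm y)^2 * inverse (real n)) ----> 0"
    using tendsto_mult_right_zero[OF lim_inverse_n, of "(norm y)^2"] by simp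
  qed
  thus ?thesis by fastforce
 qed
 hence "(%n. norm x * norm (tseq T n y)) ----> 0" by (rule tendsto_mult_right_zero)
 hence "(%n. cinner x (tseq T n y)) ----> 0"
  by (rule Lim_null_comparison[OF always_eventually, rotated]) (simp add: cmod_cinner_le)
 hence "(%n. cinner x (T y) - cinner x (tseq T n y)) ----> cinner x (T y) - 0" by (intro tendsto_intros)
 thus ?thesis unfolding sums_def partial by simp
qed

text \<open>Let \<open>z\<close> be the vector of h \<otimes> l2 with components \<open>w0\<close>.
  By \<open>repn_bound\<close>, sending \<open>amp X z\<close> to \<open>p X y\<close> is a
  contraction \<open>R\<close>; then \<open>T = adj R oo R\<close> lies between 0 and 1, commutes
  with the amplification of \<open>A\<close>, and <y, p Z y> = <z, T (amp Z z)>. Expanding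
  \<open>T\<close> by \<open>tseq_sum\<close> distributes it over both sides: the functional is the
  sum of the vector functionals of the amplification at the \<open>tseq T k z\<close>. This is a
  Radon-Nikodym argument without square roots.\<close>

lemma repn_vector_functional:
 fixes A :: "('h::complex_hilbert op) set" and p :: "('h op) => 'f::complex_hilbert op"
 assumes A: "von_neumann_algebra A" and r: "repn A p"
 shows "EX w. sq_summable w & (ALL Z:A. cinner y (p Z y) = uw w w Z)"
proof -
 obtain w0 where z0: "sq_summable w0" "!!X. X : A ==> (norm (p X y))\<^sup>2 <= (\<Sum>n. (norm (blinfun_apply X (w0 n)))^2)"
  using repn_bound[OF A r] by blast
 have Ab: "A \<subseteq> bops" by (rule vn_subset_bops[OF A])
 have phi: "!!a. a : A ==> p a : bops" "!!a b. a : A ==> b : A ==> p (a oo b) = p a oo p b" "!!a. a : A ==> p (adj a) = adj (p a)"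
  "p id_blinfun = id_blinfun" "!!a b. a : A ==> b : A ==> p (a + b) = p a + p b" "!!a c. a : A ==> p (c *c a) = c *c p a"
  using r unfolding repn_def linear_on_def by auto
 note sub = vn_subspace[OF A]
 define z :: "('h, nat ell2) tensor" where "z = ell2vec w0 (%n. n)"
 define amp :: "('h op) => ('h, nat ell2) tensor op" where "amp X = X \<otimes> id_blinfun" for X
 have amp: "!!X. X : A ==> amp X : bops" using Ab by (auto simp: amp_def)
 have amp_comp: "amp (X oo Y) = amp X oo amp Y" if "X : A" "Y : A" for X Y
  unfolding amp_def using that Ab by (subst tensor_op_comp) auto
 have amp_adj: "adj (amp X) = amp (adj X)" if "X : A" for X
  unfolding amp_def using that Ab by (subst adj_tensor_op) auto
 have nz: "(norm (amp X z))^2 = (\<Sum>n. (norm (X (w0 n)))^2)" if X: "X : A" for X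
 proof -
  have sm: "summable (%n. (norm (X (w0 n)))^2)" using sq_summable_bounded_op[OF z0(1), of X] by (simp add: sq_summable_def)
  have "complex_of_real ((norm (amp X z))^2) = (\<Sum>n. cinner (X (w0 n)) (X (w0 n)))"
   unfolding cinner_self_norm[symmetric] amp_def z_def
   using cinner_amp_ell2vec[OF z0(1) z0(1), of "%n. n" "%n. n" X X True] X Ab by auto
  also have "... = of_real (\<Sum>n. (norm (X (w0 n)))^2)"
   unfolding cinner_self_norm by (rule suminf_of_real[OF sm, symmetric])
  finally show ?thesis by (simp only: of_real_eq_iff)
 qed
 \<comment> \<open>The family is indexed by a whole type, so operators outside \<open>A\<close>
   receive the value 0.\<close>
 define a where "a X = (if X : A then amp X z else 0)" for X
 define b where "b X = (if X : A then p X y else 0)" for X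
 have lin: "EX Y:A. lincomb a f = amp Y z & lincomb b f = p Y y" for f
 proof -
  define Y where "Y = lincomb (%X. if X : A then X else 0) f"
  have fin: "EX Y:A. (SUM X:F. c X *c a X) = amp Y z & (SUM X:F. c X *c b X) = p Y y" if "finite F" for F c
   using that
  proof (induction F)
   case empty
   have "p (0 *c 0) = 0 *c p 0" by (rule phi(6)) (rule cvec.subspace_0[OF sub])
   moreover have "amp 0 z = 0"
   proof -
    have "(norm (amp 0 z))^2 = 0" using nz[OF cvec.subspace_0[OF sub]] by simp
    thus ?thesis by simp
   qed
   ultimately show ?case using cvec.subspace_0[OF sub] by (intro bexI[of _ 0]) auto
  next
   case (insert X F)
   then obtain Y where Y: "Y : A" "(SUM X:F. c X *c a X) = amp Y z" "(SUM X:F. c X *c b X) = p Y y" by blast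
   show ?case
   proof (cases "X : A")
    case False thus ?thesis using Y insert by (auto simp: a_def b_def)
   next
    case True
    have cX: "c X *c X : A" using True by (rule cvec.subspace_scale[OF sub])
    have "amp (c X *c X + Y) = c X *c amp X + amp Y"
     unfolding amp_def using True Y Ab by (subst tensor_op_add_left) (auto simp: tensor_op_scaleC_left)
    moreover have "p (c X *c X + Y) = c X *c p X + p Y" using True Y cX by (simp add: phi)
    ultimately show ?thesis using True Y insert cX
     by (intro bexI[of _ "c X *c X + Y"]) (auto simp: a_def b_def blinfun.add_left intro: cvec.subspace_add[OF sub])
   qed
  qed
  show ?thesis unfolding lincomb_def by (rule fin) (rule finite_formal_coeff)
 qed
 have "norm (lincomb b f) <= 1 * norm (lincomb a f)" for f
 proof -
  obtain Y where Y: "Y : A" "lincomb a f = amp Y z" "lincomb b f = p Y y" using lin by blast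
  have "(norm (p Y y))^2 <= (norm (amp Y z))^2" using z0(2)[OF Y(1)] nz[OF Y(1)] by simp
  hence "norm (p Y y) <= norm (amp Y z)" by (rule power2_le_imp_le) simp
  thus ?thesis unfolding Y(2,3) by simp
 qed
 then obtain R where R: "R : bops" "!!X. R (a X) = b X" "norm R <= 1" "!!x. (!!X. cinner (a X) x = 0) ==> R x = 0"
  using family_extension[of b 1 a] by (metis zero_le_one)
 have comm: "R oo amp X = p X oo R" if X: "X : A" for X
 proof (rule total_op_eqI)
  \<comment> \<open>A set together with its orthogonal complement is total, and \<open>R\<close> is
    known on both: it vanishes on the complement.\<close>
  show "total (range a \<union> {x. ALL X. cinner (a X) x = 0})"
  proof (rule totalI)
   fix x assume x: "!!s. s : range a \<union> {x. ALL X. cinner (a X) x = 0} ==> cinner s x = 0"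
   hence "ALL X. cinner (a X) x = 0" by blast
   hence "cinner x x = 0" using x by blast
   thus "x = 0" by (simp add: cinner_zero_iff)
  qed
  show "R oo amp X : bops" "p X oo R : bops" using X R amp phi by auto
  fix s assume "s : range a \<union> {x. ALL X. cinner (a X) x = 0}"
  then consider Y where "s = a Y" | "ALL X. cinner (a X) s = 0" by blast
  thus "(R oo amp X) s = (p X oo R) s"
  proof cases
   case (1 Y)
   show ?thesis
   proof (cases "Y : A")
    case True
    have XY: "X oo Y : A" using A X True by (rule vn_comp)
    have "R (amp X s) = R (a (X oo Y))" using True X XY by (simp add: 1 a_def amp_comp)
    also have "... = p X (R s)" using True X XY by (simp add: 1 R(2)) (simp add: b_def phi)
    finally show ?thesis by simp
   qed (simp add: 1 a_def)
  next
   case 2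
   have "R s = 0" using 2 R(4) by blast
   \<comment> \<open>The complement is invariant under \<open>amp X\<close> because \<open>A\<close>
     is closed under adjoints.\<close>
   moreover have "R (amp X s) = 0"
   proof (rule R(4))
    fix Y
    show "cinner (a Y) (amp X s) = 0"
    proof (cases "Y : A")
     case True
     have XY: "adj X oo Y : A" using A X True by (intro vn_comp vn_adj)
     have "cinner (amp Y z) (amp X s) = cinner (adj (amp X) (amp Y z)) s" using amp[OF X] by (simp add: cinner_adj_left)
     also have "... = cinner (a (adj X oo Y)) s" using X True XY A by (simp add: a_def amp_adj amp_comp vn_adj)
     also have "... = 0" using 2 by blast
     finally show ?thesis by (simp add: a_def)
    qed (simp add: a_def)
   qed
   ultimately show ?thesis by simp
  qed
 qed
 define T where "T = adj R oo R"
 have T: "T : bops" "adj T = T" using R(1) by (auto simp: T_def adj_comp)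
 have Tv: "Re (cinner v (T v)) = (norm (R v))^2" for v using R(1) by (simp add: T_def cinner_adj_right Re_cinner_norm)
 have pos: "0 <= Re (cinner v (T v))" for v by (simp add: Tv)
 have le: "Re (cinner v (T v)) <= (norm v)^2" for v
 proof -
  have "norm (R v) <= norm R * norm v" by (rule norm_blinfun)
  also have "... <= 1 * norm v" using R(3) by (intro mult_right_mono) auto
  finally show ?thesis unfolding Tv by (simp)
 qed
 have Tcomm: "T oo amp X = amp X oo T" if X: "X : A" for X
 proof -
  have "adj (R oo amp (adj X)) = adj (p (adj X) oo R)" using comm[OF vn_adj[OF A X]] by simp
  hence 1: "amp X oo adj R = adj R oo p X"
   using X R(1) amp[OF X] phi(1)[OF X] amp[OF vn_adj[OF A X]] phi(1)[OF vn_adj[OF A X]] Ab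
   by (simp add: adj_comp amp_adj[symmetric] phi(3))
  have "T oo amp X = adj R oo (R oo amp X)" by (simp add: T_def blinfun_compose_algebra(1))
  also have "... = (adj R oo p X) oo R" unfolding comm[OF X] by (simp add: blinfun_compose_algebra(1))
  also have "... = amp X oo T" unfolding 1[symmetric] by (simp add: T_def blinfun_compose_algebra(1))
  finally show ?thesis .
 qed
 have kcomm: "tseq T k (amp X v) = amp X (tseq T k v)" if X: "X : A" for X k v
 proof (induction k arbitrary: v)
  case 0 show ?case using arg_cong[OF Tcomm[OF X], of "%S. blinfun_apply S v"] by simp
 next
  case (Suc k) thus ?case by (simp add: blinfun.diff_left blinfun.diff_right)
 qed
 define c where "c k = tseq T k z" for k
 have csum: "sq_summable c"
 proof -
  have "(%k. cinner (c k) (c k)) sums cinner z (T z)" unfolding c_def by (rule tseq_sum[OF T pos le])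
  hence "(%k. Re (cinner (c k) (c k))) sums Re (cinner z (T z))" by (rule sums_Re)
  thus ?thesis unfolding sq_summable_def Re_cinner_norm by (rule sums_summable)
 qed
 obtain w where w: "sq_summable w" "!!X. X : bops ==> uw c c (X \<otimes> id_blinfun) = uw w w X"
  by (rule amp_uw[OF csum csum]) (metis)
 have id: "id_blinfun : A" by (rule vn_id[OF A])
 have "amp id_blinfun = id_blinfun" by (simp add: amp_def)
 hence Rz: "R z = y" using R(2)[of id_blinfun] id by (simp add: a_def b_def phi)
 have "cinner y (p Z y) = uw w w Z" if Z: "Z : A" for Z
 proof -
  have "p Z (R z) = R (amp Z z)" using comm[OF Z] by (metis blinfun_apply_blinfun_compose)
  hence "cinner y (p Z y) = cinner (R z) (R (amp Z z))" by (simp add: Rz)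
  also have "... = cinner z (T (amp Z z))" using R(1) by (simp add: T_def cinner_adj_right)
  also have "... = (\<Sum>k. cinner (tseq T k z) (tseq T k (amp Z z)))" using tseq_sum[OF T pos le] by (simp add: sums_iff)
  also have "... = uw c c (amp Z)" unfolding kcomm[OF Z] uw_def c_def ..
  also have "... = uw w w Z" unfolding amp_def using Z Ab by (intro w) auto
  finally show ?thesis .
 qed
 thus ?thesis using w(1) by blast
qed

text \<open>Zorn's lemma gives a maximal set \<Omega> of vectors whose cyclic subspaces are mutually
  orthogonal. Each \<open>p\<close> in \<Omega> is modelled by a square summable sequence with the
  same vector functional, placed on the basis vectors labelled (n, p), so that different
  \<open>p\<close> occupy orthogonal summands; hence mapping \<open>q X p\<close> to
  \<open>amp X (z p)\<close> preserves inner products. Maximality makes the vectors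
  \<open>q X p\<close> total.\<close>

theorem repn_structure:
 fixes A :: "('h::complex_hilbert op) set" and q :: "('h op) => 'f::complex_hilbert op"
 assumes A: "von_neumann_algebra A" and r: "repn A q"
 obtains W :: "'f =>L ('h, (nat \<times> 'f) ell2) tensor" where "W : bops"
  "!!x y. cinner (blinfun_apply W x) (blinfun_apply W y) = cinner x y"
  "!!a. a : A ==> (a \<otimes> id_blinfun) oo W = W oo q a"
proof -
 have Ab: "A \<subseteq> bops" by (rule vn_subset_bops[OF A])
 have phi: "!!a. a : A ==> q a : bops" "!!a b. a : A ==> b : A ==> q (a oo b) = q a oo q b" "!!a. a : A ==> q (adj a) = adj (q a)"
  "q id_blinfun = id_blinfun"
  using r unfolding repn_def by auto
 define P where "P \<Omega> \<longleftrightarrow> 0 \<notin> \<Omega> & (ALL p:\<Omega>. ALL p':\<Omega>. p ~= p' --> (ALL X:A. ALL Y:A. cinner (q X p) (q Y p') = 0))" for \<Omega> :: "'f set"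
 have "EX M:Collect P. ALL X:Collect P. M \<subseteq> X --> X = M"
 proof (rule subset_Zorn_nonempty)
  show "Collect P ~= {}" by (auto simp: P_def)
  fix \<C> assume C: "\<C> ~= {}" "subset.chain (Collect P) \<C>"
  hence PC: "!!c. c : \<C> ==> P c" and ch: "!!c d. c : \<C> ==> d : \<C> ==> c \<subseteq> d \<or> d \<subseteq> c"
   unfolding subset.chain_def by auto
  have "P (\<Union>\<C>)"
   unfolding P_def
  proof (intro conjI ballI impI)
   show "0 \<notin> \<Union>\<C>" using PC unfolding P_def by blast
   fix p p' X Y assume *: "p : \<Union>\<C>" "p' : \<Union>\<C>" "p ~= p'" "X : A" "Y : A"
   then obtain c where "c : \<C>" "p : c" "p' : c" using ch by blast
   thus "cinner (q X p) (q Y p') = 0" using PC[of c] * unfolding P_def by blast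
  qed
  thus "\<Union>\<C> : Collect P" by simp
 qed
 then obtain \<Omega> where \<Omega>: "P \<Omega>" and mx: "!!X. P X ==> \<Omega> \<subseteq> X ==> X = \<Omega>" by blast
 have "EX w. sq_summable w & (ALL Z:A. cinner p (q Z p) = uw w w Z)" for p by (rule repn_vector_functional[OF A r])
 then obtain w where w: "!!p. sq_summable (w p)" "!!p Z. Z : A ==> cinner p (q Z p) = uw (w p) (w p) Z" by metis
 define amp :: "('h op) => ('h, (nat \<times> 'f) ell2) tensor =>L ('h, (nat \<times> 'f) ell2) tensor" where "amp X = X \<otimes> id_blinfun" for X
 define z :: "'f => ('h, (nat \<times> 'f) ell2) tensor" where "z p = ell2vec (w p) (%n. (n, p))" for p
 define a where "a = (%(X, p). if X : A & p : \<Omega> then q X p else 0)"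
 define b where "b = (%(X, p). if X : A & p : \<Omega> then amp X (z p) else 0)"
 have gram: "cinner (b i) (b j) = cinner (a i) (a j)" for i j
 proof -
  obtain X p Y p' where ij: "i = (X, p)" "j = (Y, p')" by (cases i; cases j)
  have main: "cinner (amp X (z p)) (amp Y (z p')) = cinner (q X p) (q Y p')"
   if *: "X : A" "p : \<Omega>" "Y : A" "p' : \<Omega>"
  proof -
   have xy: "X : bops" "Y : bops" "adj X oo Y : A" using * Ab A by (auto intro: vn_comp vn_adj)
   have "cinner (amp X (z p)) (amp Y (z p')) = (if p = p' then (\<Sum>n. cinner (X (w p n)) (Y (w p' n))) else 0)"
    unfolding amp_def z_def by (rule cinner_amp_ell2vec) (use w xy in "auto simp: inj_on_def")
   also have "... = cinner (q X p) (q Y p')"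
   proof (cases "p = p'")
    case True
    have "cinner (q X p) (q Y p) = cinner p (q (adj X oo Y) p)"
     using * phi A by (simp add: phi(2)[OF vn_adj[OF A]] cinner_adj_right)
    also have "... = (\<Sum>n. cinner (X (w p n)) (Y (w p n)))"
     unfolding w(2)[OF xy(3)] uw_def using xy by (simp add: cinner_adj_right)
    finally show ?thesis using True by simp
   next
    case False thus ?thesis using \<Omega> * unfolding P_def by simp
   qed
   finally show ?thesis .
  qed
  thus ?thesis by (simp add: ij a_def b_def)
 qed
 have tot: "total (range a)"
 proof (rule totalI)
  fix v assume v: "!!s. s : range a ==> cinner s v = 0"
  have v': "cinner (q X p) v = 0" if "X : A" "p : \<Omega>" for X p
   using v[OF rangeI[of a "(X, p)"]] that by (simp add: a_def)
  show "v = 0"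
  proof (rule ccontr)
   assume v0: "v ~= 0"
   have orth: "cinner (q X p) (q Y v) = 0" if "X : A" "Y : A" "p : \<Omega>" for X Y p
   proof -
    have "cinner (q X p) (q Y v) = cinner (q (adj Y oo X) p) v"
     using that phi by (simp add: phi(2)[OF vn_adj[OF A]] cinner_adj_left)
    also have "... = 0" using that A by (intro v') (auto intro: vn_comp vn_adj)
    finally show ?thesis .
   qed
   have orth': "cinner (q Y v) (q X p) = 0" if "X : A" "Y : A" "p : \<Omega>" for X Y p
    using orth[OF that] by (metis cinner_commute complex_cnj_zero)
   \<comment> \<open>A non-zero vector orthogonal to all cyclic subspaces generates a cyclic
     subspace orthogonal to them, so it could be added to \<Omega>.\<close>
   have "P (insert v \<Omega>)" using \<Omega> v0 orth orth' unfolding P_def by auto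
   hence "v : \<Omega>" using mx by blast
   hence "cinner (q id_blinfun v) v = 0" by (intro v' vn_id[OF A])
   thus False using v0 by (simp add: phi(4) cinner_zero_iff)
  qed
 qed
 obtain W where W: "W : bops" "!!i. W (a i) = b i" "!!x y. cinner (blinfun_apply W x) (blinfun_apply W y) = cinner x y"
  by (rule gram_isometry_total[OF gram tot]) (rule that)
 show ?thesis
 proof (rule that[OF W(1,3)])
  fix Z assume Z: "Z : A"
  show "(Z \<otimes> id_blinfun) oo W = W oo q Z"
  proof (rule total_op_eqI[OF tot])
   show "(Z \<otimes> id_blinfun) oo W : bops" "W oo q Z : bops" using Z Ab W(1) phi by auto
   fix s assume "s : range a"
   then obtain X p where s: "s = a (X, p)" by auto
   show "((Z \<otimes> id_blinfun) oo W) s = (W oo q Z) s"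
   proof (cases "X : A & p : \<Omega>")
    case True
    have ZX: "Z oo X : A" using Z True by (intro vn_comp[OF A]) auto
    have "(Z \<otimes> id_blinfun) (W s) = amp Z (amp X (z p))" using True by (simp add: s W(2)) (simp add: b_def amp_def)
    also have "... = amp (Z oo X) (z p)"
    proof -
     have "amp Z oo amp X = amp (Z oo X)" unfolding amp_def using Z True Ab by (subst tensor_op_comp) auto
     thus ?thesis by (metis blinfun_apply_blinfun_compose)
    qed
    also have "... = W (a (Z oo X, p))" unfolding W(2) using True ZX by (simp add: b_def)
    also have "... = W (q Z s)" using True ZX Z by (simp add: s a_def phi)
    finally show ?thesis by simp
   next
    case False thus ?thesis by (auto simp: s a_def)
   qed
  qed
 qed
qed

section \<open>Ultraweak tensor products with identity maps\<close>

definition swap3 :: "(('a::complex_hilbert, 'l::complex_hilbert) tensor, 'b::complex_hilbert) tensor =>L (('a, 'b) tensor, 'l) tensor" where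
 "swap3 = (SOME V. V : bops & (ALL x l y. blinfun_apply V ((x \<odot> l) \<odot> y) = (x \<odot> y) \<odot> l))"

definition assoc3 :: "('c::complex_hilbert, ('a::complex_hilbert, 'l::complex_hilbert) tensor) tensor =>L (('c, 'a) tensor, 'l) tensor" where
 "assoc3 = (SOME V. V : bops & (ALL c x l. blinfun_apply V (c \<odot> (x \<odot> l)) = (c \<odot> x) \<odot> l) &
  (ALL x y. cinner (blinfun_apply V x) (blinfun_apply V y) = cinner x y))"

lemma total_UNIV: "total (UNIV :: 'a::complex_inner set)" by (simp add: total_def)

lemma total_triple_left: "total (range (%(x::'a::complex_hilbert, l::'l::complex_hilbert, y::'b::complex_hilbert). (x \<odot> l) \<odot> y))"
proof (rule total_mono[OF total_tensor[OF total_tensor_range total_UNIV]])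
 have "(x \<odot> l) \<odot> y : range (%(x::'a, l::'l, y::'b). (x \<odot> l) \<odot> y)" for x l y
  by (rule image_eqI[of _ _ "(x, l, y)"]) auto
 thus "{s \<odot> s' |s s'. s : range (%(x::'a, y::'l). x \<odot> y) & s' : UNIV} \<subseteq> range (%(x::'a, l::'l, y::'b). (x \<odot> l) \<odot> y)"
  by auto
qed

lemma total_triple_right: "total (range (%(c::'c::complex_hilbert, x::'a::complex_hilbert, l::'l::complex_hilbert). c \<odot> (x \<odot> l)))"
proof (rule total_mono[OF total_tensor[OF total_UNIV total_tensor_range]])
 have "c \<odot> (x \<odot> l) : range (%(c::'c, x::'a, l::'l). c \<odot> (x \<odot> l))" for c x l
  by (rule image_eqI[of _ _ "(c, x, l)"]) auto
 thus "{s \<odot> s' |s s'. s : UNIV & s' : range (%(x::'a, y::'l). x \<odot> y)} \<subseteq> range (%(c::'c, x::'a, l::'l). c \<odot> (x \<odot> l))"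
  by auto
qed

lemma swap3_props:
 fixes x :: "'a::complex_hilbert" and l :: "'b::complex_hilbert" and y :: "'c::complex_hilbert"
 shows "(swap3 :: (('a, 'b) tensor, 'c) tensor =>L _) : bops" "swap3 ((x \<odot> l) \<odot> y) = (x \<odot> y) \<odot> l"
proof -
 obtain V :: "(('a, 'b) tensor, 'c) tensor =>L (('a, 'c) tensor, 'b) tensor" where
  V: "V : bops" "!!i. V ((%(x, l, y). (x \<odot> l) \<odot> y) i) = (%(x, l, y). (x \<odot> y) \<odot> l) i"
  by (rule gram_isometry_total[OF _ total_triple_left, where b = "%(x, l, y). (x \<odot> y) \<odot> l"]) (auto)
 have "V ((x \<odot> l) \<odot> y) = (x \<odot> y) \<odot> l" for x l y using V(2)[of "(x, l, y)"] by simp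
 hence "\<exists>V :: (('a, 'b) tensor, 'c) tensor =>L (('a, 'c) tensor, 'b) tensor.
  V : bops & (ALL x l y. blinfun_apply V ((x \<odot> l) \<odot> y) = (x \<odot> y) \<odot> l)" using V(1) by blast
 from someI_ex[OF this] show "(swap3 :: (('a, 'b) tensor, 'c) tensor =>L _) : bops" "swap3 ((x \<odot> l) \<odot> y) = (x \<odot> y) \<odot> l"
  unfolding swap3_def[symmetric] by auto
qed

lemma assoc3_props:
 fixes c :: "'a::complex_hilbert" and x :: "'b::complex_hilbert" and l :: "'c::complex_hilbert"
  and u v :: "('a, ('b, 'c) tensor) tensor"
 shows "(assoc3 :: ('a, ('b, 'c) tensor) tensor =>L _) : bops" "assoc3 (c \<odot> (x \<odot> l)) = (c \<odot> x) \<odot> l"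
 "cinner (blinfun_apply assoc3 u) (blinfun_apply assoc3 v) = cinner u v"
proof -
 obtain V :: "('a, ('b, 'c) tensor) tensor =>L (('a, 'b) tensor, 'c) tensor" where
  V: "V : bops" "!!i. V ((%(c, x, l). c \<odot> (x \<odot> l)) i) = (%(c, x, l). (c \<odot> x) \<odot> l) i"
   "!!x y. cinner (blinfun_apply V x) (blinfun_apply V y) = cinner x y"
  by (rule gram_isometry_total[OF _ total_triple_right, where b = "%(c, x, l). (c \<odot> x) \<odot> l"]) (auto)
 have "V (c \<odot> (x \<odot> l)) = (c \<odot> x) \<odot> l" for c x l using V(2)[of "(c, x, l)"] by simp
 hence "\<exists>V :: ('a, ('b, 'c) tensor) tensor =>L (('a, 'b) tensor, 'c) tensor.
  V : bops & (ALL c x l. blinfun_apply V (c \<odot> (x \<odot> l)) = (c \<odot> x) \<odot> l) &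
  (ALL x y. cinner (blinfun_apply V x) (blinfun_apply V y) = cinner x y)" using V(1,3) by blast
 from someI_ex[OF this] show "(assoc3 :: ('a, ('b, 'c) tensor) tensor =>L _) : bops" "assoc3 (c \<odot> (x \<odot> l)) = (c \<odot> x) \<odot> l"
  "cinner (blinfun_apply assoc3 u) (blinfun_apply assoc3 v) = cinner u v"
  unfolding assoc3_def[symmetric] by auto
qed

text \<open>If \<open>W\<close> implements a map f as f a = adj W (a \<otimes> 1) W, this is f
  tensored with the identity on the second factor: \<open>swap3\<close> moves the auxiliary l2
  factor to the end, where \<open>X\<close> is amplified. The formula makes sense for every bounded
  \<open>X\<close>, as \<open>tensor_map_eqI\<close> requires.\<close>

definition right_map :: "('k::complex_hilbert =>L ('h::complex_hilbert, 'i ell2) tensor) =>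
  ('h, 'f::complex_hilbert) tensor op => ('k, 'f) tensor op" where
 "right_map W X = adj (swap3 oo (W \<otimes> id_blinfun)) oo (X \<otimes> id_blinfun) oo (swap3 oo (W \<otimes> id_blinfun))"

definition left_map :: "('k::complex_hilbert =>L ('h::complex_hilbert, 'i ell2) tensor) =>
  ('c::complex_hilbert, 'h) tensor op => ('c, 'k) tensor op" where
 "left_map W X = adj (assoc3 oo (id_blinfun \<otimes> W)) oo (X \<otimes> id_blinfun) oo (assoc3 oo (id_blinfun \<otimes> W))"

text \<open>The hypotheses \<open>e\<close> move the slicing maps through \<open>V\<close>; on the
  other side they act on the first factor of an amplification and combine with
  \<open>X\<close>.\<close>

lemma conj_slice:
 assumes b: "V : bops" "X : bops" "W : bops" "k : bops" "l : bops" "l' : bops"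
  and e: "V oo k = (l \<otimes> id_blinfun) oo W" "V oo k' = (l' \<otimes> id_blinfun) oo W"
 shows "adj k oo (adj V oo (X \<otimes> id_blinfun) oo V) oo k' = adj W oo ((adj l oo X oo l') \<otimes> id_blinfun) oo W"
proof -
 have 1: "adj k oo adj V = adj W oo (adj l \<otimes> id_blinfun)"
  using arg_cong[OF e(1), of adj] b by (simp add: adj_comp adj_tensor_op)
 have 2: "(adj l \<otimes> id_blinfun) oo (X \<otimes> id_blinfun) oo (l' \<otimes> id_blinfun) = (adj l oo X oo l') \<otimes> id_blinfun"
  by (rule tensor_op_eqI) (use b in auto)
 have "adj k oo (adj V oo (X \<otimes> id_blinfun) oo V) oo k' = (adj k oo adj V) oo (X \<otimes> id_blinfun) oo (V oo k')"
  by (simp add: blinfun_compose_algebra(1))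
 thus ?thesis unfolding 1 e(2) unfolding 2[symmetric] by (simp add: blinfun_compose_algebra(1))
qed

text \<open>Slicing commutes with tensoring by the identity, so by \<open>slice_eqI\<close>
  identities for \<open>right_map\<close> reduce to identities for \<open>W\<close> alone.\<close>

lemma right_map_slice:
 assumes W: "W : bops" and X: "X : bops"
 shows "adj (ket e) oo right_map W X oo ket e' = adj W oo ((adj (ket e) oo X oo ket e') \<otimes> id_blinfun) oo W"
proof -
 have k: "(swap3 oo (W \<otimes> id_blinfun)) oo ket e = (ket e \<otimes> id_blinfun) oo W" for e
 proof -
  have "swap3 oo ket e = ket e \<otimes> id_blinfun" by (rule tensor_op_eqI) (auto simp: swap3_props)
  moreover have "(W \<otimes> id_blinfun) oo ket e = ket e oo W" using W by (intro blinfun_eqI) simp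
  ultimately show ?thesis by (metis blinfun_compose_algebra(1))
 qed
 show ?thesis unfolding right_map_def by (rule conj_slice[OF _ X W _ _ _ k k]) (use W swap3_props(1) in auto)
qed

lemma left_map_slice:
 assumes W: "W : bops" and X: "X : bops"
 shows "adj (lket e) oo left_map W X oo lket e' = adj W oo ((adj (lket e) oo X oo lket e') \<otimes> id_blinfun) oo W"
proof -
 have k: "(assoc3 oo (id_blinfun \<otimes> W)) oo lket e = (lket e \<otimes> id_blinfun) oo W" for e
 proof -
  have "assoc3 oo lket e = lket e \<otimes> id_blinfun" by (rule tensor_op_eqI) (auto simp: assoc3_props)
  moreover have "(id_blinfun \<otimes> W) oo lket e = lket e oo W" using W by (intro blinfun_eqI) simp
  ultimately show ?thesis by (metis blinfun_compose_algebra(1))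
 qed
 show ?thesis unfolding left_map_def by (rule conj_slice[OF _ X W _ _ _ k k]) (use W assoc3_props(1) in auto)
qed

lemma right_map_bops: "W : bops ==> X : bops ==> right_map W X : bops"
 unfolding right_map_def by (intro bops_comp bops_adj bops_tensor_op swap3_props(1) bops_id)

lemma left_map_bops: "W : bops ==> X : bops ==> left_map W X : bops"
 unfolding left_map_def by (intro bops_comp bops_adj bops_tensor_op assoc3_props(1) bops_id)

lemma slice_eqI:
 fixes R R' :: "('a::complex_hilbert, 'b::complex_hilbert) tensor op"
 assumes R: "R : bops" "R' : bops" and e: "!!e e'. adj (ket e) oo R oo ket e' = adj (ket e) oo R' oo ket e'"
 shows "R = R'"
proof (rule total_form_eqI[OF total_tensor_range total_tensor_range R])
 fix s s' :: "('a, 'b) tensor" assume "s : range (%(x, y). x \<odot> y)" "s' : range (%(x, y). x \<odot> y)"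
 then obtain u y v w where s: "s = u \<odot> y" "s' = v \<odot> w" by auto
 have eq: "cinner s (Q s') = cinner u ((adj (ket y) oo Q oo ket w) v)" for Q :: "('a, 'b) tensor op" by (simp add: s cinner_adj_right)
 show "cinner s (R s') = cinner s (R' s')" unfolding eq e ..
qed

lemma lslice_eqI:
 fixes R R' :: "('a::complex_hilbert, 'b::complex_hilbert) tensor op"
 assumes R: "R : bops" "R' : bops" and e: "!!e e'. adj (lket e) oo R oo lket e' = adj (lket e) oo R' oo lket e'"
 shows "R = R'"
proof (rule total_form_eqI[OF total_tensor_range total_tensor_range R])
 fix s s' :: "('a, 'b) tensor" assume "s : range (%(x, y). x \<odot> y)" "s' : range (%(x, y). x \<odot> y)"
 then obtain u y v w where s: "s = u \<odot> y" "s' = v \<odot> w" by auto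
 have eq: "cinner s (Q s') = cinner y ((adj (lket u) oo Q oo lket v) w)" for Q :: "('a, 'b) tensor op" by (simp add: s cinner_adj_right)
 show "cinner s (R s') = cinner s (R' s')" unfolding eq e ..
qed

lemma amp_conj_linear:
 assumes V: "V : bops"
 shows "X : bops ==> Y : bops ==>
   adj V oo ((X + Y) \<otimes> id_blinfun) oo V = (adj V oo (X \<otimes> id_blinfun) oo V) + (adj V oo (Y \<otimes> id_blinfun) oo V)"
  "X : bops ==> adj V oo ((c *c X) \<otimes> id_blinfun) oo V = c *c (adj V oo (X \<otimes> id_blinfun) oo V)"
 using V by (auto simp: tensor_op_add_left tensor_op_scaleC_left blinfun_compose_algebra(2,3) scaleC_blinfun_comp)

lemma ket_slice_tensor: "S : bops ==> T : bops ==> adj (ket e) oo (S \<otimes> T) oo ket e' = cinner e (T e') *c S"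
 by (intro blinfun_eqI) simp

lemma lket_slice_tensor: "S : bops ==> T : bops ==> adj (lket e) oo (S \<otimes> T) oo lket e' = cinner e (S e') *c T"
 by (intro blinfun_eqI) simp

lemma tensor_map_conj:
 fixes V :: "('a::complex_hilbert, 'b::complex_hilbert) tensor =>L (('d::complex_hilbert, 'e::complex_hilbert) tensor, 'i ell2) tensor"
 assumes M: "M \<subseteq> bops" "N \<subseteq> bops" and V: "V : bops" and X: "X : M \<otimes>\<^sub>N N"
  and e: "!!S T. S : M ==> T : N ==> adj V oo ((S \<otimes> T) \<otimes> id_blinfun) oo V = p S \<otimes> \<psi> T"
 shows "tensor_map M N p \<psi> X = adj V oo (X \<otimes> id_blinfun) oo V"
 by (rule tensor_map_eqI[of M N "%X. adj V oo (X \<otimes> id_blinfun) oo V" p \<psi> X,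
    OF M amp_conj_linear[OF V] continuous_map_amp_conj[OF V] e X])

lemma tensor_map_right:
 assumes A: "A \<subseteq> bops" and N: "N \<subseteq> bops" and W: "W : bops"
  and phi: "!!a. a : A ==> f a = adj W oo (a \<otimes> id_blinfun) oo W" and X: "X : A \<otimes>\<^sub>N N"
 shows "tensor_map A N f (%z. z) X = right_map W X"
 unfolding right_map_def
proof (rule tensor_map_conj[OF A N _ X], unfold right_map_def[symmetric])
 show "swap3 oo (W \<otimes> id_blinfun) : bops" using W swap3_props(1) by auto
 show "right_map W (S \<otimes> T) = f S \<otimes> T" if ST: "S : A" "T : N" for S T
 proof (rule slice_eqI)
  have S: "S : bops" "T : bops" using A N ST by auto
  have p: "f S : bops" using S W by (simp add: phi[OF ST(1)])
  show "right_map W (S \<otimes> T) : bops" "f S \<otimes> T : bops" using S W p by (auto intro: right_map_bops)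
  show "adj (ket e) oo right_map W (S \<otimes> T) oo ket e' = adj (ket e) oo (f S \<otimes> T) oo ket e'" for e e'
   using S p W by (simp add: right_map_slice ket_slice_tensor phi[OF ST(1)] amp_conj_linear)
 qed
qed

lemma tensor_map_left:
 assumes A: "A \<subseteq> bops" and N: "N \<subseteq> bops" and W: "W : bops"
  and phi: "!!a. a : A ==> f a = adj W oo (a \<otimes> id_blinfun) oo W" and X: "X : N \<otimes>\<^sub>N A"
 shows "tensor_map N A (%z. z) f X = left_map W X"
 unfolding left_map_def
proof (rule tensor_map_conj[OF N A _ X], unfold left_map_def[symmetric])
 show "assoc3 oo (id_blinfun \<otimes> W) : bops" using W assoc3_props(1) by auto
 show "left_map W (T \<otimes> S) = T \<otimes> f S" if ST: "T : N" "S : A" for S T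
 proof (rule lslice_eqI)
  have S: "S : bops" "T : bops" using A N ST by auto
  have p: "f S : bops" using S W by (simp add: phi[OF ST(2)])
  show "left_map W (T \<otimes> S) : bops" "T \<otimes> f S : bops" using S W p by (auto intro: left_map_bops)
  show "adj (lket e) oo left_map W (T \<otimes> S) oo lket e' = adj (lket e) oo (T \<otimes> f S) oo lket e'" for e e'
   using S p W by (simp add: left_map_slice lket_slice_tensor phi[OF ST(2)] amp_conj_linear)
 qed
qed

section \<open>Step functions in L2\<close>

instance complex_hilbert \<subseteq> banach ..

lemma sqint_fun_sqint: "sq_integrable f ==> sqint_fun (sqint f) = f"
 by (simp add: sqint_inverse)

lemma cinner_L2_class:
 assumes "sq_integrable f" "sq_integrable g"
 shows "cinner (L2_class f) (L2_class g) = (LINT t|lebesgue. cinner (f t) (g t))"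
 using assms by (simp add: L2_class_def cinner_sqint.rep_eq sqint_fun_sqint)

lemma L2_class_add:
 fixes f g :: "real => 'a::complex_inner"
 assumes "sq_integrable f" "sq_integrable g"
 shows "L2_class (%t. f t + g t) = L2_class f + L2_class g"
proof -
 have "sqint_fun (sqint f + sqint g) = (%t. f t + g t)" by (simp add: plus_sqint.rep_eq sqint_fun_sqint assms)
 from arg_cong[OF this, of sqint] have "sqint (%t. f t + g t) = sqint f + sqint g" by (simp add: sqint_fun_inverse)
 thus ?thesis by (simp add: L2_class_def to_completion_add)
qed

lemma L2_class_scaleC:
 fixes f :: "real => 'a::complex_inner"
 assumes "sq_integrable f"
 shows "L2_class (%t. c *c f t) = c *c L2_class f"
proof -
 have "sqint_fun (c *c sqint f) = (%t. c *c f t)" by (simp add: scaleC_sqint.rep_eq sqint_fun_sqint assms)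
 from arg_cong[OF this, of sqint] have "sqint (%t. c *c f t) = c *c sqint f" by (simp add: sqint_fun_inverse)
 thus ?thesis by (simp add: L2_class_def to_completion_scaleC)
qed

lemma sq_integrable_diff:
 fixes f g :: "real => 'a::complex_inner"
 assumes "sq_integrable f" "sq_integrable g" shows "sq_integrable (%t. f t - g t)"
 using sq_integrable_add[OF assms(1) sq_integrable_scaleC[OF assms(2), of "-1"]] by (simp)

lemma L2_class_diff:
 fixes f g :: "real => 'a::complex_inner"
 assumes "sq_integrable f" "sq_integrable g"
 shows "L2_class (%t. f t - g t) = L2_class f - L2_class g"
 using L2_class_add[OF assms(1) sq_integrable_scaleC[OF assms(2), of "-1"]] L2_class_scaleC[OF assms(2), of "-1"]
 by (simp)

lemma norm_L2_class:
 fixes f :: "real => 'a::complex_inner"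
 assumes "sq_integrable f" shows "(norm (L2_class f))^2 = (LINT t|lebesgue. (norm (f t))^2)"
proof -
 have "complex_of_real ((norm (L2_class f))^2) = (LINT t|lebesgue. complex_of_real ((norm (f t))^2))"
  unfolding cinner_self_norm[symmetric] cinner_L2_class[OF assms assms] ..
 also have "... = of_real (LINT t|lebesgue. (norm (f t))^2)" by (rule integral_complex_of_real)
 finally show ?thesis by (simp only: of_real_eq_iff)
qed

lemma L2_class_eqI:
 fixes f g :: "real => 'a::complex_inner"
 assumes "sq_integrable f" "sq_integrable g" "AE t in lebesgue. f t = g t"
 shows "L2_class f = L2_class g"
proof -
 have "(norm (L2_class f - L2_class g))^2 = (LINT t|lebesgue. (norm (f t - g t))^2)"
  using norm_L2_class[OF sq_integrable_diff[OF assms(1,2)]] by (simp add: L2_class_diff assms)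
 also have "... = (LINT t|(lebesgue::real measure). 0)"
 proof (rule integral_cong_AE)
  show "(%t. (norm (f t - g t))^2) : borel_measurable lebesgue"
   using sq_integrable_diff[OF assms(1,2)] by (intro strongly_measurable_norm) (simp add: sq_integrable_def)
  show "AE t in lebesgue. (norm (f t - g t))^2 = 0" using assms(3) by eventually_elim simp
 qed simp
 finally show ?thesis by simp
qed

text \<open>Dominated convergence for the scalar function given by the squared pointwise
  distance.\<close>

lemma L2_class_tendsto:
 fixes f :: "real => 'a::complex_inner"
 assumes f: "sq_integrable f" and s: "!!n. sq_integrable (s n)"
  and lim: "AE t in lebesgue. (%n. s n t) ----> f t"
  and w: "integrable lebesgue w" "!!n. AE t in lebesgue. (norm (s n t - f t))^2 <= w t"
 shows "(%n. L2_class (s n)) ----> L2_class f"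
proof -
 have "(%n. LINT t|lebesgue. (norm (s n t - f t))^2) ----> (LINT t|(lebesgue::real measure). 0)"
 proof (rule integral_dominated_convergence[OF _ _ w(1)])
  show "(%t. (norm (s n t - f t))^2) : borel_measurable lebesgue" for n
   using sq_integrable_diff[OF s f] by (intro strongly_measurable_norm) (simp add: sq_integrable_def)
  show "AE t in lebesgue. (%n. (norm (s n t - f t))^2) ----> 0"
   using lim
  proof eventually_elim
   case (elim t)
   have "(%n. (norm (s n t - f t))^2) ----> (norm (f t - f t))\<^sup>2" by (intro tendsto_intros elim)
   thus ?case by simp
  qed
  show "AE t in lebesgue. norm ((norm (s n t - f t))^2) <= w t" for n using w(2)[of n] by simp
 qed simp
 moreover have "(LINT t|lebesgue. (norm (s n t - f t))^2) = (norm (L2_class (s n) - L2_class f))^2" for n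
  using norm_L2_class[OF sq_integrable_diff[OF s f]] by (simp add: L2_class_diff s f)
 ultimately have "(%n. (norm (L2_class (s n) - L2_class f))^2) ----> 0" by simp
 from tendsto_real_sqrt[OF this] have "(%n. norm (L2_class (s n) - L2_class f)) ----> 0" by simp
 thus ?thesis by (rule LIM_zero_cancel[OF tendsto_norm_zero_cancel])
qed

lemma strongly_measurable_simple: "simple_function lebesgue f ==> strongly_measurable f"
 unfolding strongly_measurable_def by (intro exI[of _ "%_. f"]) auto

lemma simple_function_indicator_scaleR:
 assumes "A : sets M" shows "simple_function M (%t. indicator A t *r (c::'a::real_vector))"
proof -
 have "simple_function M (%t. if t : A then c else 0)"
  using simple_function_If_set[of M "%_. c" "%_. 0" A] assms by (simp)
 moreover have "(%t. indicator A t *r c) = (%t. if t : A then c else 0)" by (auto)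
 ultimately show ?thesis by simp
qed

lemma sq_integrable_indicator:
 fixes c :: "'a::complex_inner"
 assumes "A : lmeasurable" "A \<subseteq> {0..}" shows "sq_integrable (%t. indicator A t *r c)"
 unfolding sq_integrable_def
proof (intro conjI allI impI)
 have A: "A : sets lebesgue" using assms by (simp)
 show "strongly_measurable (%t. indicator A t *r c)" by (intro strongly_measurable_simple simple_function_indicator_scaleR A)
 have "integrable lebesgue (%t. indicator A t *r (norm c)^2)"
  using assms(1) by (intro integrable_scaleR_left) (intro integrable_real_indicator, auto simp: fmeasurable_def)
 moreover have "(norm (indicator A t *r c))^2 = indicator A t *r (norm c)^2" for t by (simp add: indicator_def)
 ultimately show "integrable lebesgue (%t. (norm (indicator A t *r c))^2)" by simp
 fix t :: real assume "t < 0"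
 thus "indicator A t *r c = 0" using assms(2) by (auto simp: indicator_def)
qed

lemma step_zero: "(%_. 0) : step_funs"
 unfolding step_funs_def by (rule CollectI, intro exI[of _ 0]) auto

lemma step_indicator: "0 <= a ==> (%t. indicator {a..<b} t *r c) : step_funs"
 unfolding step_funs_def by (rule CollectI, intro exI[of _ 1] exI[of _ "%_. a"] exI[of _ "%_. b"] exI[of _ "%_. c"]) auto

lemma step_add_indicator:
 assumes "f : step_funs" "0 <= a" shows "(%t. f t + indicator {a..<b} t *r c) : step_funs"
proof -
 obtain n a' b' c' where f: "f = (%t. \<Sum>i<n. indicator {a' i..<b' i} t *r c' i)" "ALL i<(n::nat). (0::real) <= a' i"
  using assms(1) unfolding step_funs_def by blast
 have "(%t. f t + indicator {a..<b} t *r c) =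
  (%t. \<Sum>i<Suc n. indicator {(a'(n := a)) i..<(b'(n := b)) i} t *r (c'(n := c)) i)"
  by (simp add: f(1))
 moreover have "ALL i<Suc n. 0 <= (a'(n := a)) i" using f(2) assms(2) by (auto)
 ultimately show ?thesis unfolding step_funs_def by blast
qed

text \<open>The added interval may be empty or overlap the earlier ones; closure properties of step
  functions are proved by adding one indicator at a time.\<close>

lemma step_induct [consumes 1, case_names zero add]:
 assumes f: "f : step_funs" and 0: "P (%_. 0)"
  and add: "!!f a b c. f : step_funs ==> P f ==> 0 <= a ==> P (%t. f t + indicator {a..<b} t *r c)"
 shows "P f"
proof -
 obtain n a' b' c' where f: "f = (%t. \<Sum>i<n. indicator {a' i..<b' i} t *r c' i)" "ALL i<(n::nat). (0::real) <= a' i"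
  using assms(1) unfolding step_funs_def by blast
 have "(%t. \<Sum>i<m. indicator {a' i..<b' i} t *r c' i) : step_funs & P (%t. \<Sum>i<m. indicator {a' i..<b' i} t *r c' i)" if "m <= n" for m
  using that
 proof (induction m)
  case 0 thus ?case using \<open>P (%_. 0)\<close> step_zero by simp
 next
  case (Suc m)
  thus ?case using add[of _ "a' m" "b' m" "c' m"] step_add_indicator[of _ "a' m" "b' m" "c' m"] f(2) by simp
 qed
 thus ?thesis using f(1) by simp
qed

lemma step_add:
 assumes g: "g : step_funs" and f: "f : step_funs" shows "(%t. f t + g t) : step_funs"
 using g
proof (induction rule: step_induct)
 case zero thus ?case using f by simp
next
 case (add g a b c)
 have "(%t. (f t + g t) + indicator {a..<b} t *r c) : step_funs" using add by (intro step_add_indicator)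
 thus ?case by (simp add: add.assoc)
qed

lemma step_scaleC:
 assumes "f : step_funs" shows "(%t. z *c f t) : step_funs"
 using assms
proof (induction rule: step_induct)
 case zero thus ?case using step_zero by simp
next
 case (add g a b c)
 have "(%t. z *c g t + indicator {a..<b} t *r (z *c c)) : step_funs" using add by (intro step_add_indicator)
 thus ?case by (simp add: scaleC_add_right scaleR_scaleC mult.commute)
qed

lemma step_cut_ge:
 assumes "f : step_funs" shows "cut {s..} f : step_funs"
 using assms
proof (induction rule: step_induct)
 case zero thus ?case using step_zero by (simp add: cut_def)
next
 case (add g a b c)
 have "(%t. cut {s..} g t + indicator {max a s..<b} t *r c) : step_funs" using add by (intro step_add_indicator) auto
 moreover have "cut {s..} (%t. g t + indicator {a..<b} t *r c) = (%t. cut {s..} g t + indicator {max a s..<b} t *r c)"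
  by (auto simp: cut_def indicator_def)
 ultimately show ?case by simp
qed

lemma step_cut_lt:
 assumes "f : step_funs" shows "cut {s..<t} f : step_funs"
 using assms
proof (induction rule: step_induct)
 case zero thus ?case using step_zero by (simp add: cut_def)
next
 case (add g a b c)
 have "(%x. cut {s..<t} g x + indicator {max a s..<min b t} x *r c) : step_funs" using add by (intro step_add_indicator) auto
 moreover have "cut {s..<t} (%t. g t + indicator {a..<b} t *r c) = (%x. cut {s..<t} g x + indicator {max a s..<min b t} x *r c)"
  by (auto simp: cut_def indicator_def)
 ultimately show ?case by simp
qed

lemma step_shift:
 assumes "f : step_funs" "r >= 0" shows "(%t. f (t - r)) : step_funs"
 using assms(1)
proof (induction rule: step_induct)
 case zero thus ?case using step_zero by simp
next
 case (add g a b c)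
 have "(%t. g (t - r) + indicator {a + r..<b + r} t *r c) : step_funs" using add assms(2) by (intro step_add_indicator) auto
 moreover have "indicator {a..<b} (t - r) = (indicator {a + r..<b + r} t :: real)" for t by (auto simp: indicator_def)
 ultimately show ?case by simp
qed

text \<open>Inverse of the right shift on functions carried by [r, \<infinity>); the indicator
  discards what would be moved to negative times.\<close>

definition unshift :: "real => (real => 'k::complex_hilbert) => real => 'k" where
 "unshift r f = (%t. indicator {0..} t *r f (t + r))"

lemma step_unshift:
 assumes "f : step_funs" shows "unshift r f : step_funs"
 using assms
proof (induction rule: step_induct)
 case zero thus ?case using step_zero by (simp add: unshift_def)
next
 case (add g a b c)
 have "(%t. unshift r g t + indicator {max 0 (a - r)..<b - r} t *r c) : step_funs" using add by (intro step_add_indicator) auto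
 moreover have "unshift r (%t. g t + indicator {a..<b} t *r c) = (%t. unshift r g t + indicator {max 0 (a - r)..<b - r} t *r c)"
  by (auto simp: unshift_def indicator_def fun_eq_iff)
 ultimately show ?case by simp
qed

lemma shift_unshift: "(%t. unshift r f (t - r)) = cut {r..} f"
 by (auto simp: unshift_def cut_def indicator_def)

lemma step_sq_integrable [simp]:
 assumes "f : step_funs" shows "sq_integrable f"
 using assms
proof (induction rule: step_induct)
 case zero thus ?case by (rule sq_integrable_0)
next
 case (add f a b c)
 have "{a..<b} : lmeasurable" by (rule bounded_set_imp_lmeasurable) auto
 thus ?case using add by (intro sq_integrable_add sq_integrable_indicator) auto
qed

lemma step_neg: "f : step_funs ==> t < 0 ==> f t = (0::'k::complex_hilbert)"
 using step_sq_integrable[of f] by (simp add: sq_integrable_def)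

text \<open>A vector \<open>z\<close> orthogonal to the indicators of intervals is orthogonal to
  those of Borel sets in [0, N) by a Dynkin class argument, to those of Lebesgue sets by changing
  null sets, then to simple functions, and by dominated convergence to all square integrable
  functions.\<close>

lemma L2_total_indicators:
 "total {L2_class (%t. indicator {a..<b} t *r c) | a b (c::'k::complex_hilbert). (0::real) <= a}"
proof (rule totalI)
 fix z :: "'k L2"
 assume z: "!!s. s : {L2_class (%t. indicator {a..<b} t *r c) | a b (c::'k). (0::real) <= a} ==> cinner s z = 0"
 have z': "cinner z (L2_class (%t. indicator {a..<b} t *r c)) = 0" if "0 <= a" for a b c
 proof -
  have "cinner (L2_class (%t. indicator {a..<b} t *r c)) z = 0" by (rule z) (use that in blast)
  thus ?thesis by (metis cinner_commute complex_cnj_zero)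
 qed
 have borel: "cinner z (L2_class (%t. indicator (A \<inter> {0..<N}) t *r c)) = 0"
  if N: "0 <= (N::real)" and A: "A : sets borel" for A c N
 proof -
  have meas: "B \<inter> {0..<N} : lmeasurable" if "B : sets borel" for B
   using that by (intro bounded_set_imp_lmeasurable) (auto)
  have sqB: "sq_integrable (%t. indicator (B \<inter> {0..<N}) t *r c)" if "B : sets borel" for B
   by (rule sq_integrable_indicator[OF meas[OF that]]) auto
  have A': "A : sigma_sets UNIV (range lessThan)" using A by (simp add: borel_Iio)
  have bor: "B : sets borel" if "B : sigma_sets UNIV (range (lessThan :: real => _))" for B
   using that by (simp add: borel_Iio)
  have IS: "Int_stable (range (lessThan :: real => _))" 
  proof (rule Int_stableI)
   fix a b assume "a : range (lessThan :: real => _)" "b : range (lessThan :: real => _)"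
   then obtain u v :: real where "a = {..<u}" "b = {..<v}" by blast
   hence "a \<inter> b = {..<min u v}" by auto
   thus "a \<inter> b : range lessThan" by blast
  qed
  have rP: "range (lessThan :: real => _) \<subseteq> Pow UNIV" by simp
  show ?thesis
   using IS rP A'
  proof (induction rule: sigma_sets_induct_disjoint)
   case (basic B)
   then obtain b where "B = {..<b}" by blast
   hence "B \<inter> {0..<N} = {0..<min b N}" by auto
   thus ?case using z' by simp
  next
   case empty
   show ?case using z'[of 0 0 c] by simp
  next
   case (compl B)
   have "indicator ((UNIV - B) \<inter> {0..<N}) t *r c = indicator {0..<N} t *r c - indicator (B \<inter> {0..<N}) t *r c" for t
    by (auto simp: indicator_def)
   moreover have "L2_class (%t. indicator {0..<N} t *r c - indicator (B \<inter> {0..<N}) t *r c) =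
     L2_class (%t. indicator {0..<N} t *r c) - L2_class (%t. indicator (B \<inter> {0..<N}) t *r c)"
    using sqB[of UNIV] sqB[OF bor[OF compl(1)]] by (intro L2_class_diff) auto
   ultimately show ?case using compl z'[of 0 N c] by (simp add: cinner_diff_right)
  next
   case (union B)
   have Bb: "B i : sets borel" for i using union(2) bor by blast
   define S where "S n t = indicator ((\<Union>i<n. B i) \<inter> {0..<N}) t *r c" for n t
   have sqS: "sq_integrable (S n)" for n unfolding S_def by (rule sqB) (use Bb in auto)
   have zS: "cinner z (L2_class (S n)) = 0" for n
   proof (induction n)
    case 0 thus ?case using z'[of 0 0 c] by (simp add: S_def)
   next
    case (Suc n)
    have "S (Suc n) = (%t. S n t + indicator (B n \<inter> {0..<N}) t *r c)"
    proof
     fix t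
     have "B i \<inter> B n = {}" if "i < n" for i using union(1) that unfolding disjoint_family_on_def by simp
     hence "t : B n ==> t \<notin> (\<Union>i<n. B i)" by blast
     thus "S (Suc n) t = S n t + indicator (B n \<inter> {0..<N}) t *r c"
      by (auto simp: S_def indicator_def less_Suc_eq)
    qed
    thus ?case using Suc union(3)[of n] L2_class_add[OF sqS[of n] sqB[OF Bb[of n]]]
     by (simp add: cinner_add_right)
   qed
   have "(%n. L2_class (S n)) ----> L2_class (%t. indicator ((\<Union>i. B i) \<inter> {0..<N}) t *r c)"
   proof (rule L2_class_tendsto[OF _ sqS])
    show sqU: "sq_integrable (%t. indicator ((\<Union>i. B i) \<inter> {0..<N}) t *r c)" by (rule sqB) (use Bb in auto)
    show "integrable lebesgue (%t. (norm (indicator ((\<Union>i. B i) \<inter> {0..<N}) t *r c))^2)"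
     using sqU by (simp add: sq_integrable_def)
    show "AE t in lebesgue. (norm (S n t - indicator ((\<Union>i. B i) \<inter> {0..<N}) t *r c))^2 <=
     (norm (indicator ((\<Union>i. B i) \<inter> {0..<N}) t *r c))^2" for n
     by (rule AE_I2) (auto simp: S_def indicator_def)
    show "AE t in lebesgue. (%n. S n t) ----> indicator ((\<Union>i. B i) \<inter> {0..<N}) t *r c"
    proof (rule AE_I2)
     fix t
     show "(%n. S n t) ----> indicator ((\<Union>i. B i) \<inter> {0..<N}) t *r c"
     proof (cases "EX i. t : B i")
      case True
      then obtain i where i: "t : B i" by blast
      have "\<forall>\<^sub>F n in sequentially. S n t = indicator ((\<Union>i. B i) \<inter> {0..<N}) t *r c"
       using eventually_gt_at_top[of i] by eventually_elim (use i in "auto simp: S_def indicator_def")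
      thus ?thesis by (rule tendsto_eventually)
     next
      case False
      hence "S n t = indicator ((\<Union>i. B i) \<inter> {0..<N}) t *r c" for n by (auto simp: S_def)
      thus ?thesis by simp
     qed
    qed
   qed
   hence "(%n. cinner z (L2_class (S n))) ----> cinner z (L2_class (%t. indicator ((\<Union>i. B i) \<inter> {0..<N}) t *r c))"
    by (intro tendsto_cinner tendsto_const)
   thus ?case by (simp add: zS LIMSEQ_const_iff)
  qed
 qed
 have leb: "cinner z (L2_class (%t. indicator A t *r c)) = 0"
  if A: "A : sets lebesgue" "A \<subseteq> {0..<N}" and N: "0 <= (N::real)" for A c N
 proof -
  obtain S M M' where S: "A = S \<union> M" "M \<subseteq> M'" "M' : null_sets lborel" "S : sets lborel"
   by (rule sets_completionE[OF A(1)])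
  have S': "S \<inter> {0..<N} = S" using A(2) S(1) by auto
  have Sb: "S : sets borel" using S(4) by simp
  have bA: "bounded A" "bounded S" using A(2) S(1) by (auto intro: bounded_subset[of "{0..<N}"])
  have "L2_class (%t. indicator A t *r c) = L2_class (%t. indicator S t *r c)"
  proof (rule L2_class_eqI)
   show "sq_integrable (%t. indicator A t *r c)"
    using A bA by (intro sq_integrable_indicator bounded_set_imp_lmeasurable) auto
   show "sq_integrable (%t. indicator S t *r c)"
    using A S(1) Sb bA by (intro sq_integrable_indicator bounded_set_imp_lmeasurable) auto
   have "AE t in lborel. t \<notin> M'" by (rule AE_not_in[OF S(3)])
   hence "AE t in lebesgue. t \<notin> M'" by (rule AE_completion)
   thus "AE t in lebesgue. indicator A t *r c = indicator S t *r c"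
    by eventually_elim (use S in "auto simp: indicator_def")
  qed
  thus ?thesis using borel[OF N Sb, of c] S' by simp
 qed
 have simple: "cinner z (L2_class s) = 0"
  if s: "simple_function lebesgue s" and N: "0 <= N" and supp: "!!t. t \<notin> {0..<N} ==> s t = 0" for s :: "real => 'k" and N :: real
 proof -
  have fin: "finite (range s)" using s by (simp add: simple_function_def)
  have lev: "s -` {y} : sets lebesgue" for y
  proof (cases "y : range s")
   case True
   then obtain x where "y = s x" by blast
   thus ?thesis using s unfolding simple_function_def by simp
  next
   case False
   hence "s -` {y} = {}" by auto
   thus ?thesis by simp
  qed
  define F where "F = range s - {0}"
  have s_eq: "s t = (SUM y:F. indicator (s -` {y}) t *r y)" for t
  proof -
   have "(SUM y:F. indicator (s -` {y}) t *r y) = (SUM y:F. if y = s t then y else 0)"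
    by (rule sum.cong) (auto)
   also have "... = s t" using fin by (auto simp: F_def)
   finally show ?thesis by simp
  qed
  have sub: "s -` {y} \<subseteq> {0..<N}" if "y : F" for y
  proof
   fix t assume "t : s -` {y}"
   hence "s t ~= 0" using that by (auto simp: F_def)
   thus "t : {0..<N}" using supp[of t] by blast
  qed
  have sq: "sq_integrable (%t. indicator (s -` {y}) t *r y)" if "y : F" for y
   using sub[OF that] lev by (intro sq_integrable_indicator bounded_set_imp_lmeasurable) (auto intro: bounded_subset[of "{0..<N}"])
  have "sq_integrable (%t. SUM y:G. indicator (s -` {y}) t *r y) & cinner z (L2_class (%t. SUM y:G. indicator (s -` {y}) t *r y)) = 0"
   if "finite G" "G \<subseteq> F" for G
   using that
  proof (induction G)
   case empty
   show ?case using z'[of 0 0 0] sq_integrable_0 by simp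
  next
   case (insert y G)
   hence y: "y : F" and IH: "sq_integrable (%t. SUM y:G. indicator (s -` {y}) t *r y)"
    "cinner z (L2_class (%t. SUM y:G. indicator (s -` {y}) t *r y)) = 0" by auto
   show ?case
    unfolding sum.insert[OF insert(1,2)] L2_class_add[OF sq[OF y] IH(1)] cinner_add_right IH(2) leb[OF lev sub[OF y] N, of y]
    using sq_integrable_add[OF sq[OF y] IH(1)] by simp
  qed
  from conjunct2[OF this[of F]] show ?thesis unfolding s_eq[symmetric] using fin by (simp add: F_def)
 qed
 have all: "cinner z (L2_class f) = 0" if f: "sq_integrable f" for f
 proof -
  obtain s where s: "!!n. simple_function lebesgue (s n)" "AE t in lebesgue. (%n. s n t) ----> f t"
   using f unfolding sq_integrable_def strongly_measurable_def by blast
  \<comment> \<open>The simple approximants are kept only where they are at most twice as large as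
    \<open>f\<close> and t < n. This gives a dominating function, with 9 = (2 + 1)^2, and bounded
    support, and where \<open>f\<close> is non-zero it eventually removes nothing.\<close>
  define P where "P n = {t. (norm (s n t))^2 <= 4 * (norm (f t))^2} \<inter> {0..<real n}" for n
  have fm: "(%t. (norm (f t))^2) : borel_measurable lebesgue" using f by (intro strongly_measurable_norm) (simp add: sq_integrable_def)
  have Pm: "P n : sets lebesgue" for n
  proof -
   have "(%t. (norm (s n t))^2) : borel_measurable lebesgue"
    by (intro strongly_measurable_norm strongly_measurable_simple s)
   hence "{t : space lebesgue. (norm (s n t))^2 <= 4 * (norm (f t))^2} : sets lebesgue"
    by (intro borel_measurable_le borel_measurable_times fm borel_measurable_const)
   thus ?thesis unfolding P_def by (intro sets.Int) auto
  qed
  define S where "S n t = (if t : P n then s n t else 0)" for n t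
  have Ss: "simple_function lebesgue (S n)" for n
   unfolding S_def using s(1)[of n] Pm[of n] by (intro simple_function_If_set) (auto)
  have bound: "(norm (S n t))^2 <= 4 * (norm (f t))^2" for n t by (auto simp: S_def P_def)
  have sqS: "sq_integrable (S n)" for n
   unfolding sq_integrable_def
  proof (intro conjI)
   show sm: "strongly_measurable (S n)" by (rule strongly_measurable_simple[OF Ss])
   show "integrable lebesgue (%t. (norm (S n t))^2)"
    by (rule Bochner_Integration.integrable_bound[of _ "%t. 4 * (norm (f t))^2"])
     (use f bound strongly_measurable_norm[OF sm] in "auto simp: sq_integrable_def")
   show "ALL t<0. S n t = 0" by (auto simp: S_def P_def)
  qed
  have "(%n. L2_class (S n)) ----> L2_class f"
  proof (rule L2_class_tendsto[OF f sqS])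
   show "integrable lebesgue (%t. 9 * (norm (f t))^2)" using f by (simp add: sq_integrable_def)
   have "(norm (S n t - f t))^2 <= 9 * (norm (f t))^2" for n t
   proof -
    have "(norm (S n t))^2 <= (2 * norm (f t))^2" using bound[of n t] by (simp)
    hence "norm (S n t) <= 2 * norm (f t)" by (rule power2_le_imp_le) simp
    hence "norm (S n t - f t) <= 3 * norm (f t)" using norm_triangle_ineq4[of "S n t" "f t"] by simp
    hence "(norm (S n t - f t))^2 <= (3 * norm (f t))^2" by (intro power_mono) auto
    thus ?thesis by (simp)
   qed
   thus "AE t in lebesgue. (norm (S n t - f t))^2 <= 9 * (norm (f t))^2" for n by simp
   show "AE t in lebesgue. (%n. S n t) ----> f t"
    using s(2)
   proof eventually_elim
    case (elim t)
    show ?case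
    proof (cases "f t = 0")
     case True
     hence "S n t = 0" for n using bound[of n t] by simp
     thus ?thesis using True by simp
    next
     case False
     hence t: "t >= 0" using f unfolding sq_integrable_def by (meson not_le)
     have "(%n. (norm (s n t))^2) ----> (norm (f t))\<^sup>2" by (intro tendsto_intros elim)
     hence "\<forall>\<^sub>F n in sequentially. (norm (s n t))^2 < 4 * (norm (f t))^2"
      by (rule order_tendstoD) (use False in simp)
     moreover have "\<forall>\<^sub>F n in sequentially. t < real n" using filterlim_real_sequentially by (simp add: filterlim_at_top_dense)
     ultimately have "\<forall>\<^sub>F n in sequentially. s n t = S n t"
      by eventually_elim (use t in "auto simp: S_def P_def")
     thus ?thesis using elim tendsto_cong by fast
    qed
   qed
  qed
  hence "(%n. cinner z (L2_class (S n))) ----> cinner z (L2_class f)" by (intro tendsto_cinner tendsto_const)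
  moreover have "cinner z (L2_class (S n)) = 0" for n
   by (rule simple[OF Ss, of "real n"]) (auto simp: S_def P_def)
  ultimately show ?thesis by (simp add: LIMSEQ_const_iff)
 qed
 have "z : closure (range to_completion)" by (simp add: to_completion_dense)
 have "cinner y z = 0" if y: "y : range to_completion" for y :: "'k L2"
 proof -
  obtain w where w: "y = to_completion w" using y by blast
  have "sq_integrable (sqint_fun w)" using sqint_fun by blast
  moreover have "y = L2_class (sqint_fun w)" by (simp add: w L2_class_def sqint_fun_inverse)
  ultimately show ?thesis using all by (metis cinner_commute complex_cnj_zero)
 qed
 hence "cinner z z = 0" using orthogonal_closure[of "range to_completion" z z] to_completion_dense by blast
 thus "z = 0" by (simp add: cinner_zero_iff)
qed

lemma step_dense: "closure (L2_class ` step_funs) = (UNIV :: 'k::complex_hilbert L2 set)"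
proof -
 have "cvec.subspace (L2_class ` (step_funs :: (real => 'k) set))"
 proof (rule cvec.subspaceI)
  show "0 : L2_class ` (step_funs :: (real => 'k) set)"
  proof (rule image_eqI[OF _ step_zero])
   have "L2_class (%t. 0 *c (0::'k)) = 0 *c L2_class (%_. 0)" by (rule L2_class_scaleC[OF sq_integrable_0])
   thus "0 = L2_class (%_. 0::'k)" by simp
  qed
  fix x y :: "'k L2" and c assume "x : L2_class ` step_funs"
  then obtain f where f: "x = L2_class f" "f : step_funs" by blast
  show "c *c x : L2_class ` step_funs"
   unfolding f(1) L2_class_scaleC[OF step_sq_integrable[OF f(2)], symmetric] by (rule imageI[OF step_scaleC[OF f(2)]])
  assume "y : L2_class ` step_funs"
  then obtain g where g: "y = L2_class g" "g : step_funs" by blast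
  show "x + y : L2_class ` step_funs"
   unfolding f(1) g(1) L2_class_add[OF step_sq_integrable[OF f(2)] step_sq_integrable[OF g(2)], symmetric]
   by (rule imageI[OF step_add[OF g(2) f(2)]])
 qed
 hence "cvec.span {L2_class (%t. indicator {a..<b} t *r c) | a b (c::'k). (0::real) <= a} \<subseteq> L2_class ` step_funs"
  by (intro cvec.span_minimal) (auto intro: imageI[OF step_indicator])
 thus ?thesis using L2_total_indicators closure_mono unfolding total_def by blast
qed

section \<open>Exponential vectors\<close>

lemma sym_ker_replicate: "sym_ker xs (replicate n x) = (if length xs = n then (\<Prod>i<n. cinner (xs ! i) x) else 0)"
proof (cases "length xs = n")
 case True
 have "(\<Prod>i<n. cinner (xs ! i) (replicate n x ! p i)) = (\<Prod>i<n. cinner (xs ! i) x)" if "p permutes {..<n}" for p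
  using permutes_in_image[OF that] by (intro prod.cong refl) simp
 hence "(\<Sum>p | p permutes {..<n}. \<Prod>i<n. cinner (xs ! i) (replicate n x ! p i)) =
   of_nat (card {p. p permutes {..<n}}) * (\<Prod>i<n. cinner (xs ! i) x)" by simp
 also have "card {p. p permutes {..<n}} = fact n" using card_permutations[of "{..<n}" n] by simp
 finally show ?thesis by (simp add: sym_ker_def)
qed (simp add: sym_ker_def)

lemma bounded_linear_cinner_right: "bounded_linear (cinner (x::'a::complex_inner))"
 by (rule bounded_linear_intro[of _ "norm x"]) (auto simp: cinner_add_right scaleR_conv_of_real intro: order_trans[OF cmod_cinner_le])

lemma bounded_linear_cinner_left: "bounded_linear (%y. cinner y (x::'a::complex_inner))"
 by (rule bounded_linear_intro[of _ "norm x"]) (auto simp: cinner_add_left scaleR_conv_of_real intro: order_trans[OF cmod_cinner_le])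

lemma norm_generator_replicate: "norm (generator (SGen (replicate n x))) = norm x ^ n"
proof -
 have "cinner (generator (SGen (replicate n x))) (generator (SGen (replicate n x))) = cinner x x ^ n"
  by (simp add: sym_ker_replicate)
 hence "(norm (generator (SGen (replicate n x))))^2 = (norm x ^ n)^2"
  unfolding Re_cinner_norm[symmetric] by (simp add: cinner_self_norm flip: power_mult)
   (simp add: mult.commute)
 thus ?thesis by (simp)
qed

text \<open>With \<open>B\<close> the norm of the n-th term enlarged by 2^n, the inequality 2 B
  (1/2)^n <= B^2 + (1/4)^n dominates the series by an exponential and a geometric one.\<close>

lemma summable_exp_series: "summable (%n. norm ((1 / sqrt (fact n)) *r generator (SGen (replicate n x))))"
proof (rule summable_comparison_test'[where N = 0])
 let ?a = "norm x"
 show "summable (%n. (4 * ?a\<^sup>2) ^ n /\<^sub>R fact n + (1 / 4) ^ n)"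
  by (intro summable_add summable_exp_generic summable_geometric) simp
 fix n
 define B where "B = (2 * ?a) ^ n * (1 / sqrt (fact n))"
 have "2 * B * (1/2) ^ n <= B\<^sup>2 + ((1/2) ^ n)^2" by (rule sum_squares_bound)
 moreover have "B\<^sup>2 = (4 * ?a\<^sup>2) ^ n /\<^sub>R fact n"
 proof -
  have "((2 * ?a) ^ n)^2 = ((2 * ?a)^2) ^ n" by (simp only: power_mult[symmetric] mult.commute)
  also have "(2 * ?a)^2 = 4 * ?a\<^sup>2" by (simp)
  finally have "((2 * ?a) ^ n)^2 = (4 * ?a\<^sup>2) ^ n" .
  moreover have "B\<^sup>2 = ((2 * ?a) ^ n)^2 * (1 / fact n)"
   unfolding B_def by (simp add: power_divide)
  ultimately show ?thesis by (simp add: divide_inverse_commute)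
 qed
 moreover have "((1/2::real) ^ n)^2 = (1/4) ^ n"
 proof -
  have "((1/2::real) ^ n)^2 = ((1/2)^2) ^ n" by (simp only: power_mult[symmetric] mult.commute)
  thus ?thesis by (simp add: power2_eq_square)
 qed
 moreover have "B * (1/2) ^ n = norm ((1 / sqrt (fact n)) *r generator (SGen (replicate n x)))"
  by (simp add: B_def norm_generator_replicate power_divide)
 moreover have "0 <= norm ((1 / sqrt (fact n)) *r generator (SGen (replicate n x)))" by simp
 moreover have "0 <= (4 * ?a\<^sup>2) ^ n /\<^sub>R fact n + (1 / 4) ^ n" by simp
 ultimately have "norm ((1 / sqrt (fact n)) *r generator (SGen (replicate n x))) <= (4 * ?a\<^sup>2) ^ n /\<^sub>R fact n + (1 / 4) ^ n"
  by linarith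
 thus "norm (norm ((1 / sqrt (fact n)) *r generator (SGen (replicate n x)))) <= (4 * ?a\<^sup>2) ^ n /\<^sub>R fact n + (1 / 4) ^ n"
  by simp
qed

lemma cinner_generator_exp:
 fixes x :: "'a::complex_hilbert"
 shows "cinner (generator (SGen xs)) (nexp x) =
  of_real (exp (- (norm x)\<^sup>2 / 2) / sqrt (fact (length xs))) * (\<Prod>i<length xs. cinner (xs ! i) x)"
proof -
 have s: "(%n. (1 / sqrt (fact n)) *r generator (SGen (replicate n x))) sums
   (\<Sum>n. (1 / sqrt (fact n)) *r generator (SGen (replicate n x)))"
  using summable_norm_cancel[OF summable_exp_series] by (rule summable_sums)
 have "(%n. cinner (generator (SGen xs)) ((1 / sqrt (fact n)) *r generator (SGen (replicate n x)))) sums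
   cinner (generator (SGen xs)) (\<Sum>n. (1 / sqrt (fact n)) *r generator (SGen (replicate n x)))"
  by (rule bounded_linear.sums[OF bounded_linear_cinner_right s])
 moreover have "(%n. cinner (generator (SGen xs)) ((1 / sqrt (fact n)) *r generator (SGen (replicate n x)))) =
   (%n. if n = length xs then of_real (1 / sqrt (fact n)) * (\<Prod>i<n. cinner (xs ! i) x) else 0)"
  by (auto simp: sym_ker_replicate)
 moreover have "(%n. if n = length xs then of_real (1 / sqrt (fact n)) * (\<Prod>i<n. cinner (xs ! i) x) else 0) sums
   (of_real (1 / sqrt (fact (length xs))) * (\<Prod>i<length xs. cinner (xs ! i) x))"
  by (rule sums_single)
 ultimately have "cinner (generator (SGen xs)) (\<Sum>n. (1 / sqrt (fact n)) *r generator (SGen (replicate n x))) =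
   of_real (1 / sqrt (fact (length xs))) * (\<Prod>i<length xs. cinner (xs ! i) x)" by (simp only: sums_unique2)
 thus ?thesis by (simp add: normalized_exponential_def)
qed

lemma cinner_exp_exp:
 fixes x y :: "'a::complex_hilbert"
 shows "cinner (nexp x) (nexp y) =
  exp (- of_real ((norm x)^2) / 2 - of_real ((norm y)^2) / 2 + cinner x y)"
proof -
 have s: "(%n. (1 / sqrt (fact n)) *r generator (SGen (replicate n x))) sums
   (\<Sum>n. (1 / sqrt (fact n)) *r generator (SGen (replicate n x)))"
  using summable_norm_cancel[OF summable_exp_series] by (rule summable_sums)
 have "(%n. cinner ((1 / sqrt (fact n)) *r generator (SGen (replicate n x))) (nexp y)) sums
   cinner (\<Sum>n. (1 / sqrt (fact n)) *r generator (SGen (replicate n x))) (nexp y)"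
  by (rule bounded_linear.sums[OF bounded_linear_cinner_left s])
 moreover have "cinner ((1 / sqrt (fact n)) *r generator (SGen (replicate n x))) (nexp y) =
   of_real (exp (- (norm y)\<^sup>2 / 2)) * (cinner x y ^ n /\<^sub>R fact n)" for n
 proof -
  have "(1 / sqrt (fact n)) * (1 / sqrt (fact n)) = 1 / (fact n :: real)" by simp
  from arg_cong[OF this, of complex_of_real]
  have "complex_of_real (1 / sqrt (fact n)) * complex_of_real (1 / sqrt (fact n)) = 1 / fact n"
   unfolding of_real_mult by simp
  thus ?thesis by (simp add: cinner_generator_exp scaleR_conv_of_real field_simps)
 qed
 moreover have "(%n. of_real (exp (- (norm y)\<^sup>2 / 2)) * (cinner x y ^ n /\<^sub>R fact n)) sums
   (of_real (exp (- (norm y)\<^sup>2 / 2)) * exp (cinner x y))"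
  by (intro sums_mult exp_converges)
 ultimately have "cinner (\<Sum>n. (1 / sqrt (fact n)) *r generator (SGen (replicate n x))) (nexp y) =
   of_real (exp (- (norm y)\<^sup>2 / 2)) * exp (cinner x y)" by (simp only: sums_unique2)
 hence "cinner (nexp x) (nexp y) =
  exp (of_real (- (norm x)\<^sup>2 / 2)) * (exp (of_real (- (norm y)\<^sup>2 / 2)) * exp (cinner x y))"
  unfolding normalized_exponential_def[of x] exp_of_real by simp
 also have "... = exp (of_real (- (norm x)\<^sup>2 / 2) + (of_real (- (norm y)\<^sup>2 / 2) + cinner x y))" by (simp only: exp_add)
 finally show ?thesis by (simp add: algebra_simps)
qed

lemma exp_exponent_zero: "- complex_of_real r / 2 - complex_of_real r / 2 + complex_of_real r = 0"
 by (simp)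

lemma norm_exp [simp]: "norm (nexp x) = 1"
proof -
 have "cinner (nexp x) (nexp x) = 1"
  unfolding cinner_exp_exp cinner_self_norm[of x] by simp
 hence "(norm (nexp x))^2 = 1" unfolding Re_cinner_norm[symmetric] by simp
 thus ?thesis by (metis norm_ge_zero power2_eq_1_iff not_one_le_zero neg_0_le_iff_le)
qed

text \<open>Exponential vectors are unit vectors, so their distance is determined by the real part
  of their inner product.\<close>

lemma exp_continuous:
 assumes "a ----> x" shows "(%n. nexp (a n)) ----> nexp x"
proof -
 have "(%n. cinner (nexp (a n)) (nexp x)) ---->
   exp (- of_real ((norm x)^2) / 2 - of_real ((norm x)^2) / 2 + cinner x x)"
  unfolding cinner_exp_exp by (intro tendsto_intros tendsto_cinner assms) simp_all
 hence "(%n. Re (cinner (nexp (a n)) (nexp x))) ----> Re 1"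
  unfolding cinner_self_norm exp_exponent_zero exp_zero by (rule tendsto_Re)
 hence "(%n. 2 - 2 * Re (cinner (nexp (a n)) (nexp x))) ----> 2 - 2 * Re 1"
  by (rule tendsto_diff[OF tendsto_const tendsto_mult_left])
 moreover have "2 - 2 * Re (cinner (nexp (a n)) (nexp x)) =
   (norm (nexp (a n) - nexp x))^2" for n
 proof -
  let ?u = "nexp (a n)" and ?v = "nexp x"
  have "Re (cinner ?v ?u) = Re (cinner ?u ?v)" by (metis cinner_commute cnj.simps(1))
  moreover have "(norm (?u - ?v))^2 = Re (cinner ?u ?u) - Re (cinner ?u ?v) - Re (cinner ?v ?u) + Re (cinner ?v ?v)"
   unfolding Re_cinner_norm[symmetric] by (simp add: cinner_diff_left cinner_diff_right)
  ultimately show ?thesis by (simp add: Re_cinner_norm)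
 qed
 ultimately have "(%n. (norm (nexp (a n) - nexp x))^2) ----> 0" by simp
 from tendsto_real_sqrt[OF this] have "(%n. norm (nexp (a n) - nexp x)) ----> 0" by simp
 thus ?thesis by (rule LIM_zero_cancel[OF tendsto_norm_zero_cancel])
qed

section \<open>Totality of the exponential vectors\<close>

lemma sum_Pow_alternating:
 assumes "finite N" "R \<subseteq> N"
 shows "(SUM S:Pow N. (-1) ^ card S * (if R \<subseteq> S then 1 else 0)) = (if R = N then (-1) ^ card N else (0::complex))"
proof (cases "R = N")
 case True
 have "(SUM S:Pow N. (-1) ^ card S * (if R \<subseteq> S then 1 else 0)) = (SUM S:Pow N. if S = N then (-1) ^ card N else (0::complex))"
  by (rule sum.cong) (auto simp: True)
 thus ?thesis using True assms(1) by simp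
next
 case False
 then obtain i where i: "i : N" "i \<notin> R" using assms(2) by blast
 \<comment> \<open>Subsets without \<open>i\<close> are paired with those containing it, and the
   signs cancel.\<close>
 define N' where "N' = N - {i}"
 have N: "N = insert i N'" "i \<notin> N'" "finite N'" using i assms(1) by (auto simp: N'_def)
 have "(SUM S:Pow N. (-1) ^ card S * (if R \<subseteq> S then 1 else 0)) =
  (SUM S:Pow N'. (-1) ^ card S * (if R \<subseteq> S then 1 else (0::complex))) + (SUM S:insert i ` Pow N'. (-1) ^ card S * (if R \<subseteq> S then 1 else 0))"
  unfolding N(1) Pow_insert using N(2,3) by (intro sum.union_disjoint) auto
 also have "(SUM S:insert i ` Pow N'. (-1) ^ card S * (if R \<subseteq> S then 1 else (0::complex))) =
   (SUM S:Pow N'. (-1) ^ card (insert i S) * (if R \<subseteq> insert i S then 1 else 0))"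
  using N(2) by (subst sum.reindex) (auto simp: inj_on_def)
 also have "... = (SUM S:Pow N'. - ((-1) ^ card S * (if R \<subseteq> S then 1 else 0)))"
 proof (rule sum.cong[OF refl])
  fix S assume S: "S : Pow N'"
  hence "card (insert i S) = Suc (card S)" using N(2,3) by (subst card_insert_disjoint) (auto intro: finite_subset)
  moreover have "R \<subseteq> insert i S \<longleftrightarrow> R \<subseteq> S" using i by auto
  ultimately show "(-1) ^ card (insert i S) * (if R \<subseteq> insert i S then 1 else 0) = - ((-1) ^ card S * (if R \<subseteq> S then 1 else (0::complex)))"
   by simp
 qed
 finally show ?thesis using False by (simp add: sum_negf)
qed

text \<open>Ryser's formula for the permanent: symmetric tensors are linear combinations of powers, so that the
 derivatives at \<open>0\<close> of exponential vectors span the Fock space.\<close>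

lemma ryser:
 fixes a :: "nat => nat => complex"
 shows "(SUM S:Pow {..<n}. (-1) ^ card S * (\<Prod>j<n. SUM i:S. a j i)) = (-1) ^ n * (\<Sum>q | q permutes {..<n}. \<Prod>j<n. a j (q j))"
proof -
 let ?N = "{..<n}"
 let ?F = "PiE ?N (%_. ?N)"
 have finF: "finite ?F" by (intro finite_PiE) auto
 have "(SUM S:Pow ?N. (-1) ^ card S * (\<Prod>j<n. SUM i:S. a j i)) =
  (SUM S:Pow ?N. SUM f:?F. (-1) ^ card S * (if f ` ?N \<subseteq> S then 1 else 0) * (\<Prod>j<n. a j (f j)))"
 proof (rule sum.cong[OF refl])
  fix S assume S: "S : Pow ?N"
  have "(\<Prod>j<n. SUM i:S. a j i) = (SUM f:PiE ?N (%_. S). \<Prod>j<n. a j (f j))"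
   using S by (intro prod_sum_PiE) (auto intro: finite_subset)
  also have "... = (SUM f:?F. if f ` ?N \<subseteq> S then \<Prod>j<n. a j (f j) else 0)"
  proof -
   have "PiE ?N (%_. S) = {f : ?F. f ` ?N \<subseteq> S}"
   proof (intro set_eqI iffI)
    fix f assume "f : PiE ?N (%_. S)"
    thus "f : {f : ?F. f ` ?N \<subseteq> S}" using S by (auto)
   next
    fix f assume "f : {f : ?F. f ` ?N \<subseteq> S}"
    hence "f : extensional ?N" "f ` ?N \<subseteq> S" by (simp_all add: PiE_def)
    thus "f : PiE ?N (%_. S)" by (simp add: PiE_def image_subset_iff)
   qed
   thus ?thesis using finF by (simp add: sum.inter_filter)
  qed
  finally show "(-1) ^ card S * (\<Prod>j<n. SUM i:S. a j i) = (SUM f:?F. (-1) ^ card S * (if f ` ?N \<subseteq> S then 1 else 0) * (\<Prod>j<n. a j (f j)))"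
   by (simp add: sum_distrib_left if_distrib[of "%x. _ * x"] if_distrib[of "%x. x * _"] cong: if_cong)
 qed
 also have "... = (SUM f:?F. (SUM S:Pow ?N. (-1) ^ card S * (if f ` ?N \<subseteq> S then 1 else 0)) * (\<Prod>j<n. a j (f j)))"
  by (subst sum.swap) (simp add: sum_distrib_right)
 also have "... = (SUM f:?F. (if f ` ?N = ?N then (-1) ^ n else 0) * (\<Prod>j<n. a j (f j)))"
  by (intro sum.cong refl arg_cong2[of _ _ _ _ "(*)"]) (subst sum_Pow_alternating, auto)
 also have "... = (SUM f:{f : ?F. f ` ?N = ?N}. (-1) ^ n * (\<Prod>j<n. a j (f j)))"
  using finF by (simp add: sum.inter_filter if_distrib[of "%x. x * _"] cong: if_cong)
 also have "... = (\<Sum>q | q permutes ?N. (-1) ^ n * (\<Prod>j<n. a j (q j)))"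
 proof (rule sum.reindex_bij_witness[where j = "%f x. if x : ?N then f x else x" and i = "%q. restrict q ?N"])
  fix f assume f: "f : {f : ?F. f ` ?N = ?N}"
  show "restrict (%x. if x : ?N then f x else x) ?N = f" using f by (auto simp: PiE_iff extensional_def)
  have "inj_on f ?N" using f by (intro eq_card_imp_inj_on) auto
  hence "bij_betw f ?N ?N" using f by (simp add: bij_betw_def)
  hence "bij_betw (%x. if x : ?N then f x else x) ?N ?N" by (rule bij_betw_cong[THEN iffD1, rotated]) auto
  thus "(%x. if x : ?N then f x else x) : {q. q permutes ?N}" by (intro CollectI bij_imp_permutes) auto
  show "(-1) ^ n * (\<Prod>j<n. a j (if j : ?N then f j else j)) = (-1) ^ n * (\<Prod>j<n. a j (f j))" by simp
 next
  fix q assume p: "q : {q. q permutes ?N}"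
  show "(%x. if x : ?N then restrict q ?N x else x) = q" using p by (auto simp: permutes_def)
  show "restrict q ?N : {f : ?F. f ` ?N = ?N}"
   using p permutes_image[of q ?N] by (auto)
 qed
 finally show ?thesis by (simp add: sum_distrib_left)
qed

lemma generator_in_span:
 fixes xs :: "'a::complex_hilbert list"
 shows "generator (SGen xs) : cvec.span (range (%(n, x). generator (SGen (replicate n x))))"
proof -
 define n where "n = length xs"
 \<comment> \<open>The coefficients of the polarisation identity that \<open>ryser\<close> yields,
   with the factorial from \<open>sym_ker\<close>.\<close>
 define v where "v = (SUM S:Pow {..<n}. ((-1) ^ n * (-1) ^ card S / fact n) *c generator (SGen (replicate n (SUM i:S. xs ! i))))"
 have "generator (SGen xs) = v"
 proof (rule total_eqI[OF total_generator])
  fix g :: "'a sgen formal completion" assume "g : range generator"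
  then obtain ws where g: "g = generator (SGen ws)" by (metis (no_types) rangeE sgen.exhaust)
  show "cinner g (generator (SGen xs)) = cinner g v"
  proof (cases "length ws = n")
   case True
   have "cinner g v = (SUM S:Pow {..<n}. ((-1) ^ n * (-1) ^ card S / fact n) * (\<Prod>j<n. SUM i:S. cinner (ws ! j) (xs ! i)))"
    by (simp add: v_def g cinner_sum_right cinner_scaleC_right sym_ker_replicate True)
   also have "... = ((-1) ^ n / fact n) * (SUM S:Pow {..<n}. (-1) ^ card S * (\<Prod>j<n. SUM i:S. cinner (ws ! j) (xs ! i)))"
    by (simp add: sum_distrib_left mult.assoc)
   also have "... = (\<Sum>p | p permutes {..<n}. \<Prod>j<n. cinner (ws ! j) (xs ! p j)) / fact n"
    unfolding ryser by (simp)
   also have "... = cinner g (generator (SGen xs))" using True by (simp add: g sym_ker_def n_def)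
   finally show ?thesis by simp
  next
   case False
   thus ?thesis by (simp add: g v_def cinner_sum_right cinner_scaleC_right) (simp add: sym_ker_def n_def)
  qed
 qed
 also have "v : cvec.span (range (%(n, x). generator (SGen (replicate n x))))"
  unfolding v_def by (intro cvec.span_sum cvec.span_scale cvec.span_base) auto
 finally show ?thesis .
qed

lemma powser_coeffs_zero:
 fixes a :: "nat => complex"
 assumes "!!t. (%n. a n * t ^ n) sums 0"
 shows "a n = 0"
proof (induction n rule: less_induct)
 case (less n)
 have s: "(%m. a (m + n) * t ^ m) sums 0" if t: "t ~= 0" for t
 proof -
  have "(\<Sum>m<n. a m * t ^ m) = 0" using less by simp
  hence "(%m. a (m + n) * t ^ (m + n)) sums 0" using sums_split_initial_segment[OF assms[of t], of n] by simp
  hence "(%m. (a (m + n) * t ^ (m + n)) / t ^ n) sums (0 / t ^ n)" by (rule sums_divide)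
  thus ?thesis using t by (simp add: power_add)
 qed
 have "((%_. 0) ---> a (0 + n)) (at (0::complex))"
  by (rule powser_limit_0_strong[where s = 1 and a = "%m. a (m + n)"]) (use s in auto)
 thus ?case using tendsto_unique[OF _ tendsto_const] by (metis add_0 at_neq_bot)
qed

text \<open>For a vector orthogonal to all exponentials, rescaling \<open>x\<close> by a complex
  \<open>t\<close> gives a power series in \<open>t\<close> that vanishes identically. Its
  coefficients are multiples of the inner products with the tensor powers of \<open>x\<close>, whose
  span contains all generators by \<open>generator_in_span\<close>.\<close>

lemma total_exponentials: "total (range (nexp :: 'a::complex_hilbert => _))"
proof (rule totalI)
 fix z :: "'a fock" assume z: "!!s. s : range nexp ==> cinner s z = 0"
 have rep: "cinner z (generator (SGen (replicate n x))) = 0" for n x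
 proof -
  define a where "a n = cinner z ((1 / sqrt (fact n)) *r generator (SGen (replicate n x)))" for n
  have hom: "generator (SGen (replicate n (t *c x))) = t ^ n *c generator (SGen (replicate n x))" for n t
  proof (rule total_eqI[OF total_generator])
   fix g :: "'a fock" assume "g : range generator"
   then obtain ws where g: "g = generator (SGen ws)" by (metis (no_types) rangeE sgen.exhaust)
   show "cinner g (generator (SGen (replicate n (t *c x)))) = cinner g (t ^ n *c generator (SGen (replicate n x)))"
    by (simp add: g cinner_scaleC_right sym_ker_replicate prod.distrib)
  qed
  have "(%n. a n * t ^ n) sums 0" for t
  proof -
   have s: "(%n. (1 / sqrt (fact n)) *r generator (SGen (replicate n (t *c x)))) sums
     (\<Sum>n. (1 / sqrt (fact n)) *r generator (SGen (replicate n (t *c x))))"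
    using summable_norm_cancel[OF summable_exp_series] by (rule summable_sums)
   have "(%n. cinner z ((1 / sqrt (fact n)) *r generator (SGen (replicate n (t *c x))))) sums
     cinner z (\<Sum>n. (1 / sqrt (fact n)) *r generator (SGen (replicate n (t *c x))))"
    by (rule bounded_linear.sums[OF bounded_linear_cinner_right s])
   moreover have "cinner z (\<Sum>n. (1 / sqrt (fact n)) *r generator (SGen (replicate n (t *c x)))) = 0"
   proof -
    have "cinner (nexp (t *c x)) z = 0" by (rule z) simp
    hence "cinner z (nexp (t *c x)) = 0" by (metis cinner_commute complex_cnj_zero)
    thus ?thesis by (simp add: normalized_exponential_def)
   qed
   ultimately show ?thesis by (simp add: a_def hom cinner_scaleC_right mult.commute)
  qed
  hence "a n = 0" by (rule powser_coeffs_zero)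
  thus ?thesis by (simp add: a_def)
 qed
 have rep': "cinner s z = 0" if "s : range (%(n, x). generator (SGen (replicate n x)))" for s
  using that rep by (auto) (metis cinner_commute complex_cnj_zero)
 show "z = 0"
 proof (rule totalD[OF total_generator])
  fix g :: "'a sgen formal completion" assume "g : range generator"
  then obtain ws where g: "g = generator (SGen ws)" by (metis (no_types) rangeE sgen.exhaust)
  show "cinner g z = 0" unfolding g by (rule orthogonal_span[OF rep' generator_in_span])
 qed
qed

lemma total_varpi: "total (varpi ` (step_funs :: (real => 'k::complex_hilbert) set))"
proof (rule totalI)
 fix z :: "'k Fock" assume z: "!!s. s : varpi ` (step_funs :: (real => 'k) set) ==> cinner s z = 0"
 show "z = 0"
 proof (rule totalD[OF total_exponentials])
  fix s :: "'k Fock" assume "s : range nexp"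
  then obtain x where s: "s = nexp x" by blast
  have "x : closure (L2_class ` step_funs)" by (simp add: step_dense)
  then obtain a where a: "!!n. a n : L2_class ` step_funs" "a ----> x" unfolding closure_sequential by blast
  have "(%n. cinner (nexp (a n)) z) ----> cinner s z"
   unfolding s by (intro tendsto_cinner exp_continuous a(2) tendsto_const)
  moreover have "cinner (nexp (a n)) z = 0" for n
   using a(1)[of n] z by (auto simp: varpi_def)
  ultimately show "cinner s z = 0" by (simp add: LIMSEQ_const_iff)
 qed
qed

section \<open>Operators on Fock space\<close>

definition kf :: "(real => 'k::complex_hilbert) => (real => 'k) => complex" where
 "kf f g = cinner (varpi f) (varpi g)"

text \<open>The integrand in the exponent of <varpi f, varpi g>. As it is pointwise in time,
  factorisations of inner products over time intervals become additivity of integrals.\<close>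

definition eker :: "'k::complex_inner => 'k => complex" where
 "eker a b = cinner a b - cinner a a / 2 - cinner b b / 2"

lemma eker_0 [simp]: "eker 0 0 = 0" by (simp add: eker_def)

lemma eker_integrable:
 assumes "f : step_funs" "g : step_funs" shows "integrable lebesgue (%t. eker (f t) (g t))"
 unfolding eker_def using assms by (intro Bochner_Integration.integrable_diff integrable_divide sq_integrable_cinner) auto

lemma kf_eq:
 assumes "f : step_funs" "g : step_funs"
 shows "kf f g = exp (LINT t|lebesgue. eker (f t) (g t))"
proof -
 have i: "integrable lebesgue (%t. cinner (f t) (g t))" "integrable lebesgue (%t. cinner (f t) (f t) / 2)" "integrable lebesgue (%t. cinner (g t) (g t) / 2)"
  using assms by (auto intro!: sq_integrable_cinner)
 have "(LINT t|lebesgue. eker (f t) (g t)) = (LINT t|lebesgue. cinner (f t) (g t)) - (LINT t|lebesgue. cinner (f t) (f t) / 2) - (LINT t|lebesgue. cinner (g t) (g t) / 2)"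
  unfolding eker_def by (simp only: Bochner_Integration.integral_diff i Bochner_Integration.integrable_diff)
 also have "... = cinner (L2_class f) (L2_class g) - cinner (L2_class f) (L2_class f) / 2 - cinner (L2_class g) (L2_class g) / 2"
  using assms by (simp add: cinner_L2_class)
 finally have e: "(LINT t|lebesgue. eker (f t) (g t)) = cinner (L2_class f) (L2_class g) - cinner (L2_class f) (L2_class f) / 2 - cinner (L2_class g) (L2_class g) / 2" .
 show ?thesis unfolding e by (simp add: kf_def varpi_def cinner_exp_exp cinner_self_norm algebra_simps)
qed

lemma norm_varpi [simp]: "norm (varpi f) = 1" by (simp add: varpi_def)

lemma kf_self [simp]: "kf f f = 1" by (simp add: kf_def cinner_self_norm)

lemma kf_commute: "kf f g = cnj (kf g f)" unfolding kf_def by (rule cinner_commute)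

lemma kf_mult:
 assumes "f : step_funs" "g : step_funs" "f1 : step_funs" "g1 : step_funs" "f2 : step_funs" "g2 : step_funs"
  and "!!t. eker (f t) (g t) = eker (f1 t) (g1 t) + eker (f2 t) (g2 t)"
 shows "kf f g = kf f1 g1 * kf f2 g2"
 using assms by (simp add: kf_eq eker_integrable exp_add[symmetric])

abbreviation lo :: "real => (real => 'k::complex_hilbert) => real => 'k" where "lo t f == cut {0..<t} f"
abbreviation hi :: "real => (real => 'k::complex_hilbert) => real => 'k" where "hi t f == cut {t..} f"

lemmas step_cut = step_cut_ge step_cut_lt

lemma kf_split:
 assumes "f : step_funs" "g : step_funs"
 shows "kf f g = kf (lo t f) (lo t g) * kf (hi t f) (hi t g)"
proof (rule kf_mult)
 show "eker (f s) (g s) = eker (lo t f s) (lo t g s) + eker (hi t f s) (hi t g s)" for s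
  using step_neg[OF assms(1), of s] step_neg[OF assms(2), of s] by (auto simp: cut_def indicator_def)
qed (use assms in "auto simp: step_cut")

lemma kf_shift:
 assumes "f : step_funs" "g : step_funs" "r >= 0"
 shows "kf (%s. f (s - r)) (%s. g (s - r)) = kf f g"
 using lebesgue_integral_real_affine[of 1 "%t. eker (f t) (g t)" "- r"] assms by (simp add: kf_eq step_shift)

lemma cut_simps [simp]:
 "lo t (lo t f) = lo t f" "hi t (hi t f) = hi t f" "lo t (hi t f) = (%_. 0)" "hi t (lo t f) = (%_. 0)"
 "lo t (%_. 0) = (%_. 0)" "hi t (%_. 0) = (%_. 0)"
 by (auto simp: cut_def indicator_def)

definition glue :: "real => (real => 'k::complex_hilbert) => (real => 'k) => real => 'k" where
 "glue t f g = (%s. lo t f s + hi t g s)"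

lemma glue_simps [simp]: "lo t (glue t f g) = lo t f" "hi t (glue t f g) = hi t g"
 by (auto simp: glue_def cut_def indicator_def)

lemma step_glue [simp]: "f : step_funs ==> g : step_funs ==> glue t f g : step_funs"
 unfolding glue_def by (intro step_add step_cut)

lemmas step_simps [simp] = step_cut step_shift step_unshift step_zero

lemma total_uvarpi: "total ((%(u, f). u ox f) ` (UNIV \<times> (step_funs :: (real => 'k::complex_hilbert) set)) :: ('h::complex_hilbert, 'k) hf set)"
 by (rule total_mono[OF total_tensor[OF total_UNIV total_varpi]]) auto

lemma uvarpi_op_eqI:
 fixes T T' :: "('h::complex_hilbert, 'k::complex_hilbert) hf =>L 'b::complex_hilbert"
 assumes "T : bops" "T' : bops" "!!u f. f : step_funs ==> blinfun_apply T (u ox f) = blinfun_apply T' (u ox f)"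
 shows "T = T'"
 by (rule total_op_eqI[OF total_uvarpi]) (use assms in auto)

lemma uvarpi_eqI:
 fixes x y :: "('h::complex_hilbert, 'k::complex_hilbert) hf"
 assumes "!!u f. f : step_funs ==> cinner (u ox f) x = cinner (u ox f) y"
 shows "x = y"
 by (rule total_eqI[OF total_uvarpi]) (use assms in auto)

lemma gram_isometry_on:
 fixes a :: "'i => 'a::complex_hilbert" and b :: "'i => 'b::complex_hilbert"
 assumes g: "!!i j. i : I ==> j : I ==> cinner (b i) (b j) = cinner (a i) (a j)" and tot: "total (a ` I)"
 obtains V where "V : bops" "!!i. i : I ==> blinfun_apply V (a i) = b i"
  "!!x y. cinner (blinfun_apply V x) (blinfun_apply V y) = cinner x y"
proof -
 define a' where "a' i = (if i : I then a i else 0)" for i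
 define b' where "b' i = (if i : I then b i else 0)" for i
 have "total (range a')" by (rule total_mono[OF tot]) (force simp: a'_def)
 moreover have "cinner (b' i) (b' j) = cinner (a' i) (a' j)" for i j using g by (simp add: a'_def b'_def)
 ultimately obtain V where V: "V : bops" "!!i. blinfun_apply V (a' i) = b' i" "!!x y. cinner (blinfun_apply V x) (blinfun_apply V y) = cinner x y"
  using gram_isometry_total[of b' a', where thesis = "EX V:bops. (ALL i. blinfun_apply V (a' i) = b' i) & (ALL x y. cinner (blinfun_apply V x) (blinfun_apply V y) = cinner x y)"]
  by blast
 thus ?thesis using that[OF V(1) _ V(3)] by (metis a'_def b'_def)
qed

section \<open>Projections, shifts and the time splitting of Fock space\<close>

lemma fock_id_props:
 "fock_id J : bops" "fock_id J oo fock_id J = fock_id J" "adj (fock_id J) = fock_id J"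
proof -
 have sub: "cvec.subspace (fock_sub J)" unfolding fock_sub_def by (intro csubspace_closure cvec.subspace_span)
 have cl: "closed (fock_sub J)" by (simp add: fock_sub_def)
 note P = closed_proj_props[OF sub cl, folded fock_id_def]
 show "fock_id J : bops" by (rule P)
 show "fock_id J oo fock_id J = fock_id J" by (rule blinfun_eqI) (simp add: P)
 have 1: "cinner (fock_id J x) y = cinner (fock_id J x) (fock_id J y)" for x y
  using P(3)[OF P(2), of x y] by (simp add: cinner_diff_right)
 have 2: "cinner x (fock_id J y) = cinner (fock_id J x) (fock_id J y)" for x y
  using 1[of y x] by (metis cinner_commute)
 show "adj (fock_id J) = fock_id J" by (rule adjI[OF P(1)]) (metis 1 2)
qed

text \<open>\<open>J'\<close> plays the role of the complement of \<open>J\<close>, up to times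
  where \<open>f\<close> vanishes. Generators of \<open>fock_sub J\<close> see only the part of
  \<open>f\<close> inside \<open>J\<close>, and the normalising constants of \<open>varpi f\<close>
  and \<open>varpi (cut J f)\<close> differ by the factor \<open>kf (%_. 0) (cut J' f)\<close>. So
  \<open>varpi f\<close> minus the right-hand side is orthogonal to \<open>fock_sub J\<close>, to
  which the right-hand side belongs.\<close>

lemma fock_id_varpi:
 fixes f :: "real => 'k::complex_hilbert"
 assumes f: "f : step_funs" and J: "cut J f : step_funs" "cut J' f : step_funs"
  and split: "!!t. f t = 0 \<or> (t : J & t \<notin> J') \<or> (t \<notin> J & t : J')"
 shows "fock_id J (varpi f) = kf (%_. 0) (cut J' f) *c varpi (cut J f)"
proof -
 have sub: "cvec.subspace (fock_sub J)" unfolding fock_sub_def by (intro csubspace_closure cvec.subspace_span)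
 have cl: "closed (fock_sub J)" by (simp add: fock_sub_def)
 note P = closed_proj_props[OF sub cl, folded fock_id_def]
 define G where "G = {generator (SGen xs) | xs. set xs \<subseteq> {L2_class f | f::real => 'k. sq_integrable f & (ALL t. t \<notin> J --> f t = 0)}}"
 have FG: "fock_sub J = closure (cvec.span G)" by (simp add: fock_sub_def G_def)
 define x where "x = L2_class (cut J f)"
 have xin: "x : {L2_class f | f::real => 'k. sq_integrable f & (ALL t. t \<notin> J --> f t = 0)}"
  unfolding x_def using J by (intro CollectI exI[of _ "cut J f"]) (auto simp: cut_def)
 have mem: "varpi (cut J f) : fock_sub J"
 proof -
  have "(%N. \<Sum>n<N. (1 / sqrt (fact n)) *r generator (SGen (replicate n x))) ----> (\<Sum>n. (1 / sqrt (fact n)) *r generator (SGen (replicate n x)))"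
   using summable_LIMSEQ[OF summable_norm_cancel[OF summable_exp_series]] .
  moreover have "(\<Sum>n<N. (1 / sqrt (fact n)) *r generator (SGen (replicate n x))) : cvec.span G" for N
   unfolding scaleR_scaleC
   by (intro cvec.span_sum cvec.span_scale cvec.span_base) (use xin in \<open>auto simp: G_def intro!: exI[of _ "replicate _ x"]\<close>)
  ultimately have "(\<Sum>n. (1 / sqrt (fact n)) *r generator (SGen (replicate n x))) : fock_sub J"
   unfolding FG closure_sequential
   by (intro exI[of _ "%N. \<Sum>n<N. (1 / sqrt (fact n)) *r generator (SGen (replicate n x))"]) simp
  thus ?thesis
   unfolding varpi_def normalized_exponential_def x_def[symmetric] scaleR_scaleC by (rule cvec.subspace_scale[OF sub])
 qed
 define c where "c = kf (%_. 0) (cut J' f)"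
 have c_eq: "c = of_real (exp (- (norm (L2_class (cut J' f)))\<^sup>2 / 2))"
 proof -
  have "L2_class (%t. 0 *c (0::'k)) = 0 *c L2_class (%_. 0)" by (rule L2_class_scaleC[OF sq_integrable_0])
  hence "L2_class (%_. 0::'k) = 0" by simp
  thus ?thesis by (simp add: c_def kf_def varpi_def cinner_exp_exp exp_of_real[symmetric])
 qed
 have norms: "(norm (L2_class f))^2 = (norm (L2_class (cut J f)))^2 + (norm (L2_class (cut J' f)))^2"
 proof -
  have "(LINT t|lebesgue. (norm (f t))^2) = (LINT t|lebesgue. (norm (cut J f t))^2 + (norm (cut J' f t))^2)"
  proof (rule Bochner_Integration.integral_cong[OF refl])
   show "(norm (f t))^2 = (norm (cut J f t))^2 + (norm (cut J' f t))^2" for t using split[of t] by (auto simp: cut_def)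
  qed
  also have "... = (LINT t|lebesgue. (norm (cut J f t))^2) + (LINT t|lebesgue. (norm (cut J' f t))^2)"
   using step_sq_integrable[OF J(1)] step_sq_integrable[OF J(2)] by (intro Bochner_Integration.integral_add) (auto simp: sq_integrable_def)
  finally show ?thesis using f J by (simp add: norm_L2_class)
 qed
 have orthG: "cinner y (varpi f - c *c varpi (cut J f)) = 0" if "y : G" for y
 proof -
  from that have "EX xs. y = generator (SGen xs) & set xs \<subseteq> {L2_class f | f::real => 'k. sq_integrable f & (ALL t. t \<notin> J --> f t = 0)}"
   by (auto simp: G_def)
  then obtain xs where y: "y = generator (SGen xs)" and xs: "set xs \<subseteq> {L2_class f | f::real => 'k. sq_integrable f & (ALL t. t \<notin> J --> f t = 0)}" by blast
  have ip: "cinner (xs ! i) (L2_class f) = cinner (xs ! i) (L2_class (cut J f))" if "i < length xs" for i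
  proof -
   have "xs ! i : {L2_class f | f::real => 'k. sq_integrable f & (ALL t. t \<notin> J --> f t = 0)}" using that xs nth_mem by blast
   then obtain g where g: "xs ! i = L2_class g" "sq_integrable g" "!!t. t \<notin> J ==> g t = 0" by blast
   have eq: "cinner (g t) (f t) = cinner (g t) (cut J f t)" for t using g(3)[of t] by (auto simp: cut_def indicator_def)
   show ?thesis unfolding g(1) cinner_L2_class[OF g(2) step_sq_integrable[OF f]] cinner_L2_class[OF g(2) step_sq_integrable[OF J(1)]] eq ..
  qed
  have "cinner y (varpi f) = c * cinner y (varpi (cut J f))"
  proof -
   have "exp (- (norm (L2_class f))\<^sup>2 / 2) = exp (- (norm (L2_class (cut J' f)))\<^sup>2 / 2) * exp (- (norm (L2_class (cut J f)))\<^sup>2 / 2)"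
    unfolding norms exp_add[symmetric] by (simp)
   moreover have "(\<Prod>i<length xs. cinner (xs ! i) (L2_class f)) = (\<Prod>i<length xs. cinner (xs ! i) (L2_class (cut J f)))"
    by (intro prod.cong refl) (simp add: ip)
   ultimately show ?thesis unfolding y varpi_def cinner_generator_exp c_eq by simp
  qed
  thus ?thesis by (simp add: cinner_diff_right cinner_scaleC_right)
 qed
 have orth: "cinner y (varpi f - c *c varpi (cut J f)) = 0" if "y : fock_sub J" for y
  using that unfolding FG by (rule orthogonal_closure[rotated]) (rule orthogonal_span[OF orthG])
 have cm: "c *c varpi (cut J f) : fock_sub J" by (rule cvec.subspace_scale[OF sub mem])
 have "fock_id J (varpi f - c *c varpi (cut J f)) = 0"
 proof -
  let ?w = "varpi f - c *c varpi (cut J f)"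
  have "cinner (fock_id J ?w) (fock_id J ?w) = cinner (fock_id J ?w) ?w"
   using P(3)[OF P(2), of ?w ?w] by (simp add: cinner_diff_right)
  also have "... = 0" by (rule orth[OF P(2)])
  finally show ?thesis by (simp add: cinner_zero_iff)
 qed
 thus ?thesis using P(4)[OF cm] by (simp add: blinfun.diff_right c_def)
qed

lemma fock_id_lo: "f : step_funs ==> fock_id {0..<t} (varpi f) = kf (%_. 0) (hi t f) *c varpi (lo t f)"
 by (rule fock_id_varpi) (use step_neg[of f] in "auto simp: step_cut intro: leI")

lemma fock_id_hi: "f : step_funs ==> fock_id {t..} (varpi f) = kf (%_. 0) (lo t f) *c varpi (hi t f)"
 by (rule fock_id_varpi) (use step_neg[of f] in "auto simp: step_cut intro: leI")

text \<open>Translation preserves \<open>kf\<close>, so a Gram matrix argument produces the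
  operator, and totality of the exponential vectors resolves the definite description.\<close>

lemma fock_shift_props:
 fixes f :: "real => 'k::complex_hilbert"
 assumes r: "r >= 0"
 shows "(fock_shift r :: 'k Fock =>L 'k Fock) : bops" "f : step_funs ==> fock_shift r (varpi f) = varpi (%s. f (s - r))"
  "cinner (fock_shift r x) (fock_shift r y) = cinner x (y :: 'k Fock)"
proof -
 obtain V where V: "V : bops" "!!f::real => 'k. f : step_funs ==> blinfun_apply V (varpi f) = varpi (%s. f (s - r))"
  "!!x y. cinner (blinfun_apply V x) (blinfun_apply V y) = cinner x y"
  by (rule gram_isometry_on[OF _ total_varpi, where b = "%f. varpi (%s. f (s - r))"])
   (use kf_shift[OF _ _ r] in "auto simp: kf_def intro: that")
 have "fock_shift r = V"
  unfolding fock_shift_def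
  by (rule the_equality) (use V in "auto intro: total_op_eqI[OF total_varpi]")
 thus "(fock_shift r :: 'k Fock =>L 'k Fock) : bops" "f : step_funs ==> fock_shift r (varpi f) = varpi (%s. f (s - r))"
  "cinner (fock_shift r x) (fock_shift r y) = cinner x (y :: 'k Fock)" using V by auto
qed

lemma adj_fock_shift:
 assumes r: "r >= 0" and f: "f : step_funs"
 shows "adj (fock_shift r) (varpi (hi r f)) = varpi (unshift r f)"
proof -
 have "varpi (hi r f) = fock_shift r (varpi (unshift r f))" using fock_shift_props(2)[OF r step_unshift[OF f, of r]] by (simp add: shift_unshift)
 thus ?thesis using isometry_adj_comp(2)[OF fock_shift_props(1,3)[OF r]] by simp
qed

lemma fock_id_shift:
 assumes r: "r >= 0" shows "fock_id {r..} oo fock_shift r = (fock_shift r :: 'k::complex_hilbert Fock =>L _)"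
proof (rule total_op_eqI[OF total_varpi])
 show "fock_id {r..} oo fock_shift r : bops" "(fock_shift r :: 'k Fock =>L _) : bops" using fock_shift_props(1)[OF r] fock_id_props by auto
 fix s :: "'k Fock" assume "s : varpi ` step_funs"
 then obtain f :: "real => 'k" where f: "s = varpi f" "f : step_funs" by blast
 have "lo r (%s. f (s - r)) = (%_. 0)" "hi r (%s. f (s - r)) = (%s. f (s - r))"
  using step_neg[OF f(2)] by (auto simp: cut_def indicator_def)
 thus "(fock_id {r..} oo fock_shift r) s = fock_shift r s"
  using f r by (simp add: fock_shift_props(2) fock_id_hi)
qed

lemma fock_split_props:
 fixes f :: "real => 'k::complex_hilbert" and u :: "'h::complex_hilbert"
 shows "(fock_split r :: ('h, 'k) hf =>L _) : bops"
  "f : step_funs ==> fock_split r (u ox f) = (u ox lo r f) ox hi r f"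
  "cinner (fock_split r x) (fock_split r y) = cinner x (y :: ('h, 'k) hf)"
proof -
 obtain V where V: "V : bops" "!!p. p : (UNIV :: 'h set) \<times> (step_funs :: (real => 'k) set) ==>
   blinfun_apply V ((%(u, f). u ox f) p) = (%(u, f). (u ox lo r f) ox hi r f) p"
  "!!x y. cinner (blinfun_apply V x) (blinfun_apply V y) = cinner x y"
 proof (rule gram_isometry_on[OF _ total_uvarpi, where b = "%(u, f). (u ox lo r f) ox hi r f"])
  fix p q :: "'h \<times> (real => 'k)" assume "p : UNIV \<times> step_funs" "q : UNIV \<times> step_funs"
  hence "kf (snd p) (snd q) = kf (lo r (snd p)) (lo r (snd q)) * kf (hi r (snd p)) (hi r (snd q))" by (intro kf_split) auto
  thus "cinner ((%(u, f). (u ox lo r f) ox hi r f) p) ((%(u, f). (u ox lo r f) ox hi r f) q)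
    = cinner ((%(u, f). u ox f) p) ((%(u, f). u ox f) q)" by (simp add: kf_def split_beta)
 qed (rule that)
 have V2: "blinfun_apply V (u ox f) = (u ox lo r f) ox hi r f" if "f : step_funs" for u f
  using V(2)[of "(u, f)"] that by simp
 have "fock_split r = V"
  unfolding fock_split_def
  by (rule the_equality) (use V in "auto intro: uvarpi_op_eqI")
 thus "(fock_split r :: ('h, 'k) hf =>L _) : bops"
  "f : step_funs ==> fock_split r (u ox f) = (u ox lo r f) ox hi r f"
  "cinner (fock_split r x) (fock_split r y) = cinner x (y :: ('h, 'k) hf)" using V by auto
qed

lemma fock_split_total:
 fixes f g :: "real => 'k::complex_hilbert" and u :: "'h::complex_hilbert"
 assumes "f : step_funs" "g : step_funs"
 shows "fock_split r (u ox glue r f g) = (u ox lo r f) ox hi r g"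
 using fock_split_props(2)[of "glue r f g" r u] assms by simp

section \<open>Adapted operators\<close>

definition adapted :: "real => (('h::complex_hilbert, 'k::complex_hilbert) fop) => bool" where
 "adapted t Z \<longleftrightarrow> Z : bops & (ALL f:step_funs. ALL g:step_funs. ALL u v. cinner (u ox f) (Z (v ox g)) =
  kf (hi t f) (hi t g) * cinner (u ox lo t f) (Z (v ox lo t g)))"

lemma adaptedD:
 fixes Z :: "('h::complex_hilbert, 'k::complex_hilbert) fop"
 assumes "adapted t Z" "f : step_funs" "g : step_funs"
 shows "cinner (u ox f) (Z (v ox g)) =
  kf (hi t f) (hi t g) * cinner (u ox lo t f) (Z (v ox lo t g))"
 using assms unfolding adapted_def by blast

abbreviation pl :: "real => ('h::complex_hilbert, 'k::complex_hilbert) fop" where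
 "pl t == id_blinfun \<otimes> fock_id {0..<t}"

lemma pl_bops: "pl t : bops" "adj (pl t) = pl t" "pl t oo pl t = pl t"
 by (simp_all add: adj_tensor_op tensor_op_comp fock_id_props)

lemma pl_apply: "f : step_funs ==> pl t (u ox f) = kf (%_. 0) (hi t f) *c (u ox lo t f)"
 by (simp add: fock_id_props fock_id_lo tensor_scaleC_right)

text \<open>An adapted operator maps the vectors before \<open>t\<close> into themselves:
  adaptedness with the vacuum after \<open>t\<close> on the right is the formula for the projection
  \<open>pl t\<close>.\<close>

lemma adapted_pl:
 fixes Z :: "('h::complex_hilbert, 'k::complex_hilbert) fop"
 assumes Z: "adapted t Z" and g: "g : step_funs"
 shows "pl t (Z (v ox lo t g)) = Z (v ox lo t g)"
proof (rule uvarpi_eqI)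
 fix u :: 'h and f :: "real => 'k" assume f: "f : step_funs"
 have "cinner (u ox f) (pl t (Z (v ox lo t g))) = cinner (pl t (u ox f)) (Z (v ox lo t g))"
  using cinner_adj_left[OF pl_bops(1), of t "u ox f"] by (simp add: pl_bops)
 also have "... = kf (hi t f) (%_. 0) * cinner (u ox lo t f) (Z (v ox lo t g))"
  unfolding pl_apply[OF f] cinner_scaleC_left kf_commute[of "hi t f"] ..
 also have "... = cinner (u ox f) (Z (v ox lo t g))"
  using adaptedD[OF Z f step_cut(2)[OF g], where u=u and v=v] by simp
 finally show "cinner (u ox f) (pl t (Z (v ox lo t g))) = cinner (u ox f) (Z (v ox lo t g))" .
qed

text \<open>\<open>fock_split t\<close> is isometric but in general not onto. Its range contains
  every product of a vector before \<open>t\<close> with an exponential vector after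
  \<open>t\<close>, which is what allows its adjoint to be undone.\<close>

lemma fock_split_range:
 fixes x :: "('h::complex_hilbert, 'k::complex_hilbert) hf"
 assumes x: "pl t x = x" and k: "k : step_funs"
 shows "fock_split t (adj (fock_split t) (x ox hi t k)) = x ox hi t k"
proof -
 let ?S = "fock_split t :: ('h, 'k) hf =>L _"
 have S: "?S : bops" by (rule fock_split_props)
 have SS: "?S (adj ?S (?S y)) = ?S y" for y using isometry_adj_comp(2)[OF fock_split_props(1,3), of t y] by simp
 have "?S oo adj ?S oo ket (varpi (hi t k)) oo pl t = ket (varpi (hi t k)) oo pl t"
 proof (rule uvarpi_op_eqI)
  show "?S oo adj ?S oo ket (varpi (hi t k)) oo pl t : bops" "ket (varpi (hi t k)) oo pl t : bops" using S pl_bops by auto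
  fix u :: 'h and f :: "real => 'k" assume f: "f : step_funs"
  have "?S (adj ?S ((u ox lo t f) ox hi t k)) = (u ox lo t f) ox hi t k"
   using SS[of "u ox glue t f k"] f k by (simp add: fock_split_total)
  thus "(?S oo adj ?S oo ket (varpi (hi t k)) oo pl t) (u ox f) = (ket (varpi (hi t k)) oo pl t) (u ox f)"
   unfolding blinfun_apply_blinfun_compose pl_apply[OF f] using S by (simp add: bopsD tensor_scaleC_left)
 qed
 from arg_cong[OF this, of "%T. blinfun_apply T x"] show ?thesis by (simp add: x)
qed

lemma adapted_split:
 fixes Z :: "('h::complex_hilbert, 'k::complex_hilbert) fop"
 assumes Z: "adapted t Z" and g: "g : step_funs"
 shows "fock_split t (Z (v ox g)) = Z (v ox lo t g) ox hi t g"
proof -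
 have S: "fock_split t : bops" by (rule fock_split_props)
 have "Z (v ox g) = adj (fock_split t) (Z (v ox lo t g) ox hi t g)"
 proof (rule uvarpi_eqI)
  fix u :: 'h and f :: "real => 'k" assume f: "f : step_funs"
  show "cinner (u ox f) (Z (v ox g)) = cinner (u ox f) (adj (fock_split t) (Z (v ox lo t g) ox hi t g))"
   unfolding adaptedD[OF Z f g] by (simp add: cinner_adj_right S fock_split_props(2) f kf_def)
 qed
 thus ?thesis using fock_split_range[OF adapted_pl[OF Z g] g] by simp
qed

text \<open>With \<open>X\<close> moved to the left as its adjoint, both vectors factorise at
  \<open>t\<close>, and the inner product of the factors after \<open>t\<close> is the required
  scalar.\<close>

lemma adapted_product:
 fixes Z :: "('h::complex_hilbert, 'k::complex_hilbert) fop"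
 assumes Z: "adapted t Z" and X: "adapted t X" "adapted t (adj X)"
 shows "adapted t (X oo Z)"
 unfolding adapted_def
proof (intro conjI ballI allI)
 have b: "X : bops" "Z : bops" using X Z by (auto simp: adapted_def)
 thus "X oo Z : bops" by simp
 fix f g :: "real => 'k" and u v :: 'h assume f: "f : step_funs" and g: "g : step_funs"
 have "cinner (u ox f) ((X oo Z) (v ox g)) = cinner (fock_split t (adj X (u ox f))) (fock_split t (Z (v ox g)))"
  using b by (simp add: fock_split_props(3) cinner_adj_left)
 also have "... = kf (hi t f) (hi t g) * cinner (u ox lo t f) ((X oo Z) (v ox lo t g))"
  unfolding adapted_split[OF X(2) f] adapted_split[OF Z g] using b by (simp add: kf_def cinner_adj_left)
 finally show "cinner (u ox f) ((X oo Z) (v ox g)) = kf (hi t f) (hi t g) * cinner (u ox lo t f) ((X oo Z) (v ox lo t g))" .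
qed

section \<open>Slices of bounded processes\<close>

definition slice :: "'f::complex_hilbert => ('h::complex_hilbert, 'f) tensor op => 'f => 'h op" where
 "slice e Z e' = adj (ket e) oo Z oo ket e'"

lemma cinner_slice: "cinner u (slice e Z e' v) = cinner (u \<odot> e) (Z (v \<odot> e'))"
 by (simp add: slice_def cinner_adj_right)

lemma slice_bops [simp]: "Z : bops ==> slice e Z e' : bops" by (simp add: slice_def)

lemma closed_limit_in_vn:
 assumes A: "von_neumann_algebra A" and X: "X ----> Y" "!!n. X n : A" "Y : bops"
 shows "Y : A"
proof (rule limitin_closedin[OF _ vn_closed[OF A]])
 have "Bseq X" using X(1) convergentI convergent_imp_Bseq by blast
 then obtain C where C: "!!n. norm (X n) <= C" unfolding Bseq_def by blast
 show "limitin ultraweak X Y sequentially"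
 proof (rule limitin_ultraweak_bounded)
  show "((%i. cinner x (X i y)) ---> cinner x (Y y)) sequentially" for x y
   by (intro tendsto_cinner tendsto_const blinfun.tendsto X(1))
  show "\<forall>\<^sub>F i in sequentially. norm (X i) <= C" using C by simp
  show "\<forall>\<^sub>F i in sequentially. X i : bops" using X(2) vn_subset_bops[OF A] by (simp add: subset_iff)
 qed (use X(3) in auto)
qed (use X(2) in auto)

lemma norm_slice_le: "norm (slice e Z e') <= norm Z * (norm e * norm e')" if Z: "Z : bops"
proof (rule norm_blinfun_bound)
 fix v
 let ?y = "slice e Z e' v"
 have "norm ?y * norm ?y = cmod (cinner ?y ?y)" by (simp add: cinner_self_norm power2_eq_square norm_mult)
 also have "... = cmod (cinner (?y \<odot> e) (Z (v \<odot> e')))" by (simp only: cinner_slice)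
 also have "... <= norm Z * (norm (?y \<odot> e) * norm (v \<odot> e'))" by (rule uw_term_le)
 also have "... = norm ?y * (norm Z * (norm e * norm e') * norm v)" by simp
 finally show "norm ?y <= norm Z * (norm e * norm e') * norm v" by (rule le_of_mult_self_le) simp
qed auto

text \<open>A process in \<open>A\<close> is only required to have slices in \<open>A\<close> at
  exponential vectors of step functions; sesquilinearity and norm continuity extend this to all
  vectors.\<close>

lemma slice_all_in:
 fixes Z :: "('h::complex_hilbert, 'f::complex_hilbert) tensor op"
 assumes A: "von_neumann_algebra A" and Z: "Z : bops" and tot: "total G"
  and G: "!!e e'. e : G ==> e' : G ==> slice e Z e' : A"
 shows "slice e Z e' : A"
proof -
 note sub = vn_subspace[OF A]
 have lin: "slice (c *c e) Z e' = cnj c *c slice e Z e'" "slice e Z (c *c e') = c *c slice e Z e'"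
  "slice (e + f) Z e' = slice e Z e' + slice f Z e'" "slice e Z (e' + f) = slice e Z e' + slice e Z f" "slice 0 Z e' = 0" "slice e Z 0 = 0" for c e e' f
  by (rule blinfun_cinner_eqI, simp add: cinner_slice tensor_scaleC_right tensor_add_right cinner_scaleC_left cinner_scaleC_right cinner_add_left
    cinner_add_right bopsD[OF Z] blinfun.add_left blinfun.add_right)+
 have ind: "P x" if "!!g. g : G ==> P g" "P 0" "!!c x. P x ==> P (c *c x)" "!!x y. P x ==> P y ==> P (x + y)"
  "!!a x. a ----> x ==> (!!n. P (a n)) ==> P x" for P :: "'f => bool" and x
 proof -
  have sp: "P y" if y: "y : cvec.span G" for y
   using y by (induction rule: cvec.span_induct_alt) (use \<open>P 0\<close> that(1) \<open>!!g. g : G ==> P g\<close> \<open>!!c x. P x ==> P (c *c x)\<close> \<open>!!x y. P x ==> P y ==> P (x + y)\<close> in auto)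
  have "x : closure (cvec.span G)" using tot by (simp add: total_def)
  then obtain a where "!!n. a n : cvec.span G" "a ----> x" unfolding closure_sequential by blast
  thus ?thesis using that(5) sp by blast
 qed
 have s0: "0 : A" by (rule cvec.subspace_0[OF sub])
 have conv: "(%n. slice (a n) Z (b n)) ----> slice x Z y" if "a ----> x" "b ----> y" for a b x y
 proof (rule LIM_zero_cancel, rule Lim_null_comparison)
  have m: "slice u Z w - slice u' Z w = slice (u - u') Z w" "slice u Z w - slice u Z w' = slice u Z (w - w')" for u u' w w'
   using lin(3)[of "u - u'" u' w] lin(4)[of u "w - w'" w'] by (simp_all add: algebra_simps)
  have "norm (slice (a n) Z (b n) - slice x Z y) <= norm Z * (norm (a n - x) * norm (b n)) + norm Z * (norm x * norm (b n - y))" for n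
  proof -
   have "slice (a n) Z (b n) - slice x Z y = slice (a n - x) Z (b n) + slice x Z (b n - y)" by (simp add: m[symmetric])
   thus ?thesis using norm_triangle_le[OF add_mono[OF norm_slice_le[OF Z] norm_slice_le[OF Z]]] by metis
  qed
  thus "\<forall>\<^sub>F n in sequentially. norm (slice (a n) Z (b n) - slice x Z y) <= norm Z * (norm (a n - x) * norm (b n)) + norm Z * (norm x * norm (b n - y))" by simp
  have "(%n. norm Z * (norm (a n - x) * norm (b n)) + norm Z * (norm x * norm (b n - y))) ---->
   norm Z * (norm (x - x) * norm y) + norm Z * (norm x * norm (y - y))" by (intro tendsto_intros that)
  thus "(%n. norm Z * (norm (a n - x) * norm (b n)) + norm Z * (norm x * norm (b n - y))) ----> 0" by simp
 qed
 have 1: "slice e Z g : A" if g: "g : G" for e g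
  by (rule ind[of "%e. slice e Z g : A"])
   (auto simp: lin G g s0 intro!: cvec.subspace_add[OF sub] cvec.subspace_scale[OF sub], rule closed_limit_in_vn[OF A conv[OF _ tendsto_const]], use Z in auto)
 show ?thesis
  by (rule ind[of "%e'. slice e Z e' : A"])
   (auto simp: lin 1 s0 intro!: cvec.subspace_add[OF sub] cvec.subspace_scale[OF sub], rule closed_limit_in_vn[OF A conv[OF tendsto_const]], use Z in auto)
qed

lemma matrix_element_as_process:
 fixes Y :: "real => ('h::complex_hilbert, 'k::complex_hilbert) fop"
 assumes "t >= 0" "g : step_funs"
 shows "matrix_element f (as_process Y t) g u = slice (varpi f) (Y t) (varpi g) u"
proof -
 have "u ox g : exp_domain" unfolding exp_domain_def using assms(2) by (intro cvec.span_base) blast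
 thus ?thesis using assms by (simp add: matrix_element_def as_process_def slice_def)
qed

lemma bounded_process_adapted:
 fixes Y :: "real => ('h::complex_hilbert, 'k::complex_hilbert) fop"
 assumes Y: "bounded_process_in A Y" and t: "t >= 0"
 shows "adapted t (Y t)"
 unfolding adapted_def
proof (intro conjI ballI allI)
 show "Y t : bops" using Y t by (simp add: bounded_process_in_def)
 fix f g :: "real => 'k" and u v :: 'h assume fg: "f : step_funs" "g : step_funs"
 have "operator_process (as_process Y)" using Y by (simp add: bounded_process_in_def process_in_def)
 hence "ALL f:step_funs. ALL g:step_funs. ALL u. matrix_element f (as_process Y t) g u =
    cinner (varpi (hi t f)) (varpi (hi t g)) *c matrix_element (lo t f) (as_process Y t) (lo t g) u"
  unfolding operator_process_def using t by blast
 note this[rule_format, OF fg, of v]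
 hence "slice (varpi f) (Y t) (varpi g) v = kf (hi t f) (hi t g) *c slice (varpi (lo t f)) (Y t) (varpi (lo t g)) v"
  unfolding matrix_element_as_process[OF t fg(2)] matrix_element_as_process[OF t step_cut(2)[OF fg(2)]] kf_def .
 from arg_cong[OF this, of "cinner u"]
 show "cinner (u ox f) (Y t (v ox g)) =
  kf (hi t f) (hi t g) * cinner (u ox lo t f) (Y t (v ox lo t g))"
  by (simp add: cinner_slice cinner_scaleC_right)
qed

lemma bounded_process_slice_in:
 fixes Y :: "real => ('h::complex_hilbert, 'k::complex_hilbert) fop"
 assumes A: "von_neumann_algebra A" and Y: "bounded_process_in A Y" and t: "t >= 0"
 shows "slice e (Y t) e' : A"
proof (rule slice_all_in[OF A _ total_varpi])
 show "Y t : bops" using Y t by (simp add: bounded_process_in_def)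
 fix x y :: "'k Fock" assume "x : varpi ` step_funs" "y : varpi ` step_funs"
 then obtain f g where fg: "x = varpi f" "y = varpi g" "f : step_funs" "g : step_funs" by blast
 have "EX a:A. blinfun_apply a = matrix_element f (as_process Y t) g"
  using Y t fg unfolding bounded_process_in_def process_in_def by blast
 then obtain a where a: "a : A" "blinfun_apply a = matrix_element f (as_process Y t) g" by blast
 have "a = slice x (Y t) y" by (rule blinfun_eqI) (simp add: a(2) matrix_element_as_process[OF t fg(4)] fg)
 thus "slice x (Y t) y : A" using a(1) by simp
qed

section \<open>Flows\<close>

lemma vn_tensor_corner:
 fixes x :: "('h::complex_hilbert, 'f::complex_hilbert) tensor op"
 assumes A: "A \<subseteq> bops" and p: "p : bops" and x: "x : A \<otimes>\<^sub>N {z : bops. p oo z oo p = z}" and pa: "adj p = p"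
 shows "(id_blinfun \<otimes> p) oo x oo (id_blinfun \<otimes> p) = x"
proof (rule blinfun_cinner_eqI)
 fix y z :: "('h, 'f) tensor"
 let ?P = "id_blinfun \<otimes> p :: ('h, 'f) tensor op"
 let ?S = "{S \<otimes> T | S T. S : A & T : {z : bops. p oo z oo p = z}}"
 have P: "?P : bops" "adj ?P = ?P" using p by (auto simp: adj_tensor_op pa)
 show "cinner z ((?P oo x oo ?P) y) = cinner z (x y)"
 proof (rule continuous_map_euclidean_eqI[OF x[unfolded vn_tensor_def], where f = "%x. cinner z ((?P oo x oo ?P) y)"])
  show "continuous_map ultraweak euclidean (%x. cinner z ((?P oo x oo ?P) y))"
   using continuous_map_compose[OF continuous_map_conj[OF P(1,1)] continuous_map_vec[of z y]] by (simp add: o_def P)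
  fix X assume "X : cvec.span ?S"
  hence "?P oo X oo ?P = X"
  proof (induction rule: cvec.span_induct_alt)
   case (step c s X)
   then obtain S T where s: "s = S \<otimes> T" "S : bops" "T : bops" "p oo T oo p = T" using A by blast
   have "?P oo s oo ?P = s" using s p by (simp add: tensor_op_comp)
   moreover have "?P oo (c *c s + X) oo ?P = c *c (?P oo s oo ?P) + (?P oo X oo ?P)"
    using P(1) by (intro blinfun_eqI) (simp add: blinfun.add_left blinfun.add_right bopsD)
   ultimately show ?case using step by simp
  qed (intro blinfun_eqI, simp)
  thus "cinner z ((?P oo X oo ?P) y) = cinner z (X y)" by simp
 qed (rule continuous_map_vec)
qed

text \<open>Two passes of \<open>strong_limit_total\<close>, first for the operators and then for
  their adjoints, each applied to the scalar valued operators obtained by composing with a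
  functional such as \<open>butterfly (1::complex) h\<close>.\<close>

lemma weak_limit_total:
 fixes T :: "'i => 'a::complex_hilbert =>L 'b::complex_hilbert"
 assumes G: "total G" and H: "total H" and T: "!!i. T i : bops" and l: "l : bops" and bnd: "eventually (%i. norm (T i) <= C) F"
  and c: "!!g h. g : G ==> h : H ==> ((%i. cinner h (T i g)) ---> cinner h (l g)) F"
 shows "((%i. cinner x (T i y)) ---> cinner x (l y)) F"
proof -
 have C: "eventually (%i. norm (butterfly (1::complex) h oo S i) <= norm (butterfly (1::complex) h) * D) F"
  if "eventually (%i. norm (S i) <= D) F" for h :: "'c::complex_hilbert" and S :: "'i => 'd::complex_hilbert =>L 'c" and D
  using that by eventually_elim (meson norm_blinfun_compose order_trans mult_left_mono norm_ge_zero)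
 have 1: "((%i. cinner h (T i y)) ---> cinner h (l y)) F" if h: "h : H" for h y
  using strong_limit_total[OF G, of "%i. butterfly (1::complex) h oo T i" "butterfly 1 h oo l" _ F y, OF _ _ C[OF bnd]] T l c[OF _ h]
  by (simp add: scaleC_complex_def)
 have "((%i. cinner y (adj (T i) h)) ---> cinner y (adj l h)) F" if h: "h : H" for h
  using tendsto_cnj[OF 1[OF h, of y]] T l by (simp add: cinner_adj_right cinner_commute[symmetric])
 moreover have "eventually (%i. norm (adj (T i)) <= C) F"
  using bnd by eventually_elim (meson T norm_adj_le order_trans)
 ultimately have "((%i. cinner y (adj (T i) x)) ---> cinner y (adj l x)) F"
  using strong_limit_total[OF H, of "%i. butterfly (1::complex) y oo adj (T i)" "butterfly 1 y oo adj l" _ F x, OF _ _ C] T l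
  by (simp add: scaleC_complex_def)
 from tendsto_cnj[OF this] show ?thesis using T l by (simp add: cinner_adj_right cinner_commute[symmetric])
qed

definition lslice :: "'c::complex_hilbert => ('c, 'h::complex_hilbert) tensor op => 'c => 'h op" where
 "lslice e F e' = adj (lket e) oo F oo lket e'"

lemma cinner_lslice: "cinner u (lslice e F e' v) = cinner (e \<odot> u) (F (e' \<odot> v))"
 by (simp add: lslice_def cinner_adj_right)

locale flow =
 fixes A :: "('h::complex_hilbert op) set"
  and j :: "real => ('h op) => ('h, 'k::complex_hilbert) fop"
 assumes A: "von_neumann_algebra A" and flow: "qs_flow A j"
begin

lemma Ab: "a : A ==> a : bops" using vn_subset_bops[OF A] by blast

lemma j_process: "a : A ==> bounded_process_in A (%t. j t a)"
 using flow by (simp add: qs_flow_def qs_cocycle_def mapping_process_def)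

lemma j_bops: "t >= 0 ==> a : A ==> j t a : bops"
 using j_process by (auto simp: bounded_process_in_def)

lemma j_adj: "t >= 0 ==> a : A ==> j t (adj a) = adj (j t a)" using flow by (simp add: qs_flow_def)

lemma j_repn: "t >= 0 ==> repn A (j t)"
 using flow j_bops by (auto simp: repn_def qs_flow_def qs_cocycle_def mapping_process_def)

lemma j_adapted: "t >= 0 ==> a : A ==> adapted t (j t a)" "t >= 0 ==> a : A ==> adapted t (adj (j t a))"
 using bounded_process_adapted[OF j_process] vn_adj[OF A] j_adj by metis+

lemma j_slice: "t >= 0 ==> a : A ==> slice e (j t a) e' : A"
 using bounded_process_slice_in[OF A j_process] .

lemma j_normal:
 assumes t: "t >= 0" and f: "limitin ultraweak f a F" "eventually (%i. f i : A) F" and a: "a : A"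
 shows "((%i. cinner x (j t (f i) y)) ---> cinner x (j t a y)) F"
proof -
 have "continuous_map (subtopology ultraweak A) ultraweak (j t)" using j_repn[OF t] by (simp add: repn_def normal_on_def)
 moreover have "limitin (subtopology ultraweak A) f a F" using f a by (simp add: limitin_subtopology)
 ultimately have "limitin ultraweak (j t \<circ> f) (j t a) F" by (rule continuous_map_limit)
 from limitin_ultraweak_weak[OF this] show ?thesis by simp
qed

lemma j_weak_continuous:
 assumes a: "a : A" and t: "t >= 0"
 shows "((%s. cinner x (j s a y)) ---> cinner x (j t a y)) (at t within {0..})"
proof -
 have "continuous_map (top_of_set {0..}) ultraweak (%t. j t a)" using flow a by (simp add: qs_flow_def)
 hence "continuous_map (top_of_set {0..}) euclidean ((%T. cinner x (blinfun_apply T y)) \<circ> (%t. j t a))"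
  by (rule continuous_map_compose[OF _ continuous_map_vec])
 thus ?thesis using t by (simp add: continuous_on_def)
qed

section \<open>Implementing the maps of the cocycle identity\<close>

definition Wj :: "real => ('h, 'k) hf =>L ('h, (nat \<times> ('h, 'k) hf) ell2) tensor" where
 "Wj t = (SOME W. W : bops & (ALL x y. cinner (blinfun_apply W x) (blinfun_apply W y) = cinner x y) &
  (ALL a:A. (a \<otimes> id_blinfun) oo W = W oo j t a))"

lemma Wj:
 assumes t: "t >= 0"
 shows "Wj t : bops" "cinner (Wj t x) (Wj t y) = cinner x y" "a : A ==> (a \<otimes> id_blinfun) oo Wj t = Wj t oo j t a"
  "a : A ==> j t a = adj (Wj t) oo (a \<otimes> id_blinfun) oo Wj t"
proof -
 have "\<exists>W :: ('h, 'k) hf =>L ('h, (nat \<times> ('h, 'k) hf) ell2) tensor.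
  W : bops & (ALL x y. cinner (blinfun_apply W x) (blinfun_apply W y) = cinner x y) &
  (ALL a:A. (a \<otimes> id_blinfun) oo W = W oo j t a)"
  by (rule repn_structure[OF A j_repn[OF t]]) blast
 from someI_ex[OF this, folded Wj_def]
 show W: "Wj t : bops" "cinner (Wj t x) (Wj t y) = cinner x y" "a : A ==> (a \<otimes> id_blinfun) oo Wj t = Wj t oo j t a" for x y a by auto
 assume a: "a : A"
 have "adj (Wj t) oo (a \<otimes> id_blinfun) oo Wj t = (adj (Wj t) oo Wj t) oo j t a"
  by (simp add: blinfun_compose_algebra(1) W(3)[OF a])
 thus "j t a = adj (Wj t) oo (a \<otimes> id_blinfun) oo Wj t" using isometry_adj_comp(1)[OF W(1,2)] by simp
qed

text \<open>The compression by \<open>pl r\<close> is the part of \<open>j r a\<close> before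
  \<open>r\<close>, and adaptedness gives the factorisation. Any competitor lies in the same corner,
  so it is determined by its matrix elements between exponential vectors before \<open>r\<close>,
  which the factorisation prescribes.\<close>

lemma restrict_eq:
 assumes r: "r >= 0" and a: "a : A"
 shows "restrict_process A j r a = pl r oo j r a oo pl r"
proof -
 let ?S = "fock_split r :: ('h, 'k) hf =>L _"
 let ?x = "pl r oo j r a oo pl r"
 note P = fock_id_props
 have S: "?S : bops" by (rule fock_split_props)
 have A': "A \<subseteq> bops" by (rule vn_subset_bops[OF A])
 have na: "noise_alg {0..<r} = {z : bops. fock_id {0..<r} oo z oo fock_id {0..<r} = (z :: 'k Fock =>L _)}" by (simp add: noise_alg_def)
 have xb: "?x : bops" using j_bops[OF r a] pl_bops by auto
 have sl: "slice e ?x e' = slice (fock_id {0..<r} e) (j r a) (fock_id {0..<r} e')" for e e'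
 proof (rule blinfun_cinner_eqI)
  fix v u :: 'h
  have "cinner (u \<odot> e) (pl r y) = cinner (u \<odot> fock_id {0..<r} e) y" for y
   using cinner_adj_left[OF pl_bops(1), of r "u \<odot> e" y] by (simp add: pl_bops P)
  thus "cinner u (slice e ?x e' v) = cinner u (slice (fock_id {0..<r} e) (j r a) (fock_id {0..<r} e') v)"
   by (simp add: cinner_slice P)
 qed
 have "?x : A \<otimes>\<^sub>N noise_alg {0..<r}"
  unfolding na
 proof (rule vn_tensor_of_slices[OF A' xb P])
  show "adj (ket e) oo ?x oo ket e' : A" for e e'
   using j_slice[OF r a] sl[of e e'] by (simp add: slice_def)
  have "pl r (pl r y) = (pl r y :: ('h, 'k) hf)" for y using arg_cong[OF pl_bops(3), of "%T. blinfun_apply T y"] by simp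
  thus "pl r oo ?x oo pl r = ?x" by (intro blinfun_eqI) simp
 qed
 moreover have mat: "cinner (u ox f) ((adj ?S oo (x \<otimes> fock_id {r..}) oo ?S) (v ox g)) =
   kf (hi r f) (hi r g) * cinner (u ox lo r f) (x (v ox lo r g))"
  if "x : bops" and fg: "f : step_funs" "g : step_funs" for x u v f g
  using that fock_id_hi[OF step_cut(1)[OF fg(2)], of r r]
  by (simp add: cinner_adj_right S fock_split_props(2) fock_id_props) (simp add: kf_def)
 have "j r a = adj ?S oo (?x \<otimes> fock_id {r..}) oo ?S"
 proof (rule total_form_eqI[OF total_uvarpi total_uvarpi j_bops[OF r a]])
  show "adj ?S oo (?x \<otimes> fock_id {r..}) oo ?S : bops" using xb P S by auto
  fix s s' :: "('h, 'k) hf" assume "s : (%(u, f). u ox f) ` (UNIV \<times> step_funs)" "s' : (%(u, f). u ox f) ` (UNIV \<times> step_funs)"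
  then obtain u f v g where s: "s = u ox f" "s' = v ox g" and fg: "f : step_funs" "g : step_funs" by auto
  have "pl r (w ox lo r h) = w ox lo r h" if "h : step_funs" for w :: 'h and h :: "real => 'k"
   using pl_apply[OF step_cut(2)[OF that], of r w] by simp
  hence "cinner (u ox lo r f) (?x (v ox lo r g)) = cinner (u ox lo r f) (j r a (v ox lo r g))"
   using cinner_adj_left[OF pl_bops(1), of r "u ox lo r f"] fg unfolding blinfun_apply_blinfun_compose pl_bops(2) by metis
  thus "cinner s (j r a s') = cinner s ((adj ?S oo (?x \<otimes> fock_id {r..}) oo ?S) s')"
   unfolding s mat[OF xb fg] adaptedD[OF j_adapted(1)[OF r a] fg] by simp
 qed
 moreover have "x = y" if x: "x : A \<otimes>\<^sub>N noise_alg {0..<r}" "j r a = adj ?S oo (x \<otimes> fock_id {r..}) oo ?S"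
  and y: "y : A \<otimes>\<^sub>N noise_alg {0..<r}" "j r a = adj ?S oo (y \<otimes> fock_id {r..}) oo ?S" for x y
 proof -
  have b: "x : bops" "y : bops" using x(1) y(1) vn_tensor_props(1)[OF A', of "noise_alg {0..<r}"] by (auto simp: noise_alg_def)
  have c: "pl r oo z oo pl r = z" if "z : A \<otimes>\<^sub>N noise_alg {0..<r}" for z :: "('h, 'k) fop"
   using vn_tensor_corner[OF A' P(1) that[unfolded na] P(3)] .
  have red: "cinner (u ox f) (z (v ox g)) = cnj (kf (%_. 0) (hi r f)) * kf (%_. 0) (hi r g) *
    cinner (u ox lo r f) (z (v ox lo r g))"
   if z: "z : A \<otimes>\<^sub>N noise_alg {0..<r}" "z : bops" and fg: "f : step_funs" "g : step_funs" for z :: "('h, 'k) fop" and u v f g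
  proof -
   have "cinner (u ox f) (z (v ox g)) = cinner (u ox f) ((pl r oo z oo pl r) (v ox g))" by (simp only: c[OF z(1)])
   also have "... = cinner (pl r (u ox f)) (z (pl r (v ox g)))"
    using cinner_adj_left[OF pl_bops(1), of r "u ox f"] unfolding blinfun_apply_blinfun_compose pl_bops(2) by metis
   finally show ?thesis unfolding pl_apply[OF fg(1)] pl_apply[OF fg(2)] bopsD[OF z(2)] by (simp add: cinner_scaleC_left cinner_scaleC_right)
  qed
  show ?thesis
  proof (rule total_form_eqI[OF total_uvarpi total_uvarpi b])
   fix s s' :: "('h, 'k) hf" assume "s : (%(u, f). u ox f) ` (UNIV \<times> step_funs)" "s' : (%(u, f). u ox f) ` (UNIV \<times> step_funs)"
   then obtain u f v g where s: "s = u ox f" "s' = v ox g" and fg: "f : step_funs" "g : step_funs" by auto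
   have l: "lo r f : step_funs" "lo r g : step_funs" using fg by simp_all
   have "cinner (u ox lo r f) (x (v ox lo r g)) = cinner (u ox lo r f) (y (v ox lo r g))"
    using mat[OF b(1) l, where u=u and v=v] mat[OF b(2) l, where u=u and v=v] unfolding x(2)[symmetric] y(2)[symmetric] by simp
   thus "cinner s (x s') = cinner s (y s')" unfolding s red[OF x(1) b(1) fg] red[OF y(1) b(2) fg] by simp
  qed
 qed
 ultimately show ?thesis unfolding restrict_process_def by (intro the_equality) blast+
qed

text \<open>Slicing the conjugated operator means slicing \<open>Z\<close> at vectors shifted back,
  so the slices stay in \<open>A\<close>; since the shift maps into the future of \<open>s\<close>,
  the result lies in the corner \<open>noise_alg {s..}\<close>.\<close>

lemma sigma_eq:
 fixes Z :: "('h, 'k) fop"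
 assumes s: "s >= 0" and Z: "Z : bops" and sl: "!!e e'. slice e Z e' : A"
 shows "sigma A s Z = (id_blinfun \<otimes> fock_shift s) oo Z oo (id_blinfun \<otimes> adj (fock_shift s))" (is "_ = ?X")
  "sigma A s Z : A \<otimes>\<^sub>N noise_alg {s..}" "sigma A s Z : bops"
  "slice e (sigma A s Z) e' = slice (adj (fock_shift s) e) Z (adj (fock_shift s) e')"
proof -
 have A': "A \<subseteq> bops" by (rule vn_subset_bops[OF A])
 let ?T = "id_blinfun \<otimes> adj (fock_shift s) :: ('h, 'k) fop"
 have T: "(fock_shift s :: 'k Fock =>L _) : bops" by (rule fock_shift_props[OF s])
 have Tb: "?T : bops" "adj ?T = id_blinfun \<otimes> fock_shift s" using T by (auto simp: adj_tensor_op)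
 show eq: "sigma A s Z = ?X"
  unfolding sigma_def Tb(2)[symmetric]
 proof (rule tensor_map_eqI[OF A' order_refl _ _ continuous_map_conj[OF Tb(1,1)]])
  show "Z : A \<otimes>\<^sub>N bops" using vn_tensor_all_of_slices[OF A' Z] sl by (simp add: slice_def)
  fix S :: "'h op" and R :: "'k Fock =>L 'k Fock" assume "S : A" "R : bops"
  thus "adj ?T oo (S \<otimes> R) oo ?T = S \<otimes> (fock_shift s oo R oo adj (fock_shift s))"
   unfolding Tb(2) using T Ab by (simp add: tensor_op_comp)
 qed (use Tb T in "auto intro!: blinfun_eqI simp: blinfun.add_left blinfun.add_right bopsD")
 have Xb: "?X : bops" using T Z by auto
 thus "sigma A s Z : bops" by (simp add: eq)
 show sl2: "slice e (sigma A s Z) e' = slice (adj (fock_shift s) e) Z (adj (fock_shift s) e')" for e e'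
 proof (rule blinfun_cinner_eqI)
  fix v u :: 'h
  have "cinner (u \<odot> e) ((id_blinfun \<otimes> fock_shift s) y) = cinner (u \<odot> adj (fock_shift s) e) y" for y
   using cinner_adj_right[OF Tb(1), of "u \<odot> e" y] T by (simp add: Tb(2))
  thus "cinner u (slice e (sigma A s Z) e' v) = cinner u (slice (adj (fock_shift s) e) Z (adj (fock_shift s) e') v)"
   using T by (simp add: cinner_slice eq)
 qed
 show "sigma A s Z : A \<otimes>\<^sub>N noise_alg {s..}"
  unfolding noise_alg_def
 proof (rule vn_tensor_of_slices[OF A' _ fock_id_props])
  let ?P = "id_blinfun \<otimes> fock_id {s..} :: ('h, 'k) fop"
  show "adj (ket e) oo sigma A s Z oo ket e' : A" for e e' using sl sl2[of e e'] by (simp add: slice_def)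
  have 1: "?P oo adj ?T = adj ?T" unfolding Tb(2) using T by (simp add: tensor_op_comp fock_id_shift[OF s] fock_id_props)
  have "?T oo ?P = adj (?P oo adj ?T)" using Tb(1) by (simp add: adj_comp adj_tensor_op fock_id_props)
  hence 2: "?T oo ?P = ?T" using Tb(1) unfolding 1 by (simp)
  show "?P oo sigma A s Z oo ?P = sigma A s Z"
   unfolding eq Tb(2)[symmetric]
   using arg_cong[OF 1, of "%T. blinfun_apply T _"] arg_cong[OF 2, of "%T. blinfun_apply T _"] by (intro blinfun_eqI) (simp del: tensor_op_apply)
 qed (use Xb eq in auto)
qed

text \<open>Fixing the exponential vectors after \<open>s\<close> on both sides slices the second
  leg, on which \<open>khat\<close> acts as the identity. What remains is \<open>j s\<close> applied
  to a slice of the shifted operator, that is, to the slice of \<open>Z\<close> at the functions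
  moved back by \<open>s\<close>.\<close>

lemma cocycle_step:
 assumes s: "s >= 0" and Z: "Z : bops" and sl: "!!e e'. slice e Z e' : A" and x: "pl s x = x" and f: "f : step_funs" and g: "g : step_funs"
 shows "cinner (u ox f) (khat A j s (sigma A s Z) (adj (fock_split s) (x ox hi s g))) =
  cinner (u ox lo s f) (j s (slice (varpi (unshift s f)) Z (varpi (unshift s g))) x)"
proof -
 let ?S = "fock_split s :: ('h, 'k) hf =>L _"
 let ?W = "Wj s oo pl s" and ?X = "sigma A s Z"
 let ?b = "slice (varpi (unshift s f)) Z (varpi (unshift s g))"
 have S: "?S : bops" by (rule fock_split_props)
 have W: "?W : bops" "adj ?W = pl s oo adj (Wj s)" using Wj(1)[OF s] adj_comp[OF Wj(1)[OF s] pl_bops(1), of s] by (auto simp: pl_bops)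
 note X = sigma_eq[OF s Z sl]
 have rm: "tensor_map A (noise_alg {s..}) (restrict_process A j s) (%z. z) ?X = right_map ?W ?X"
 proof (rule tensor_map_right[OF vn_subset_bops[OF A] _ W(1) _ X(2)])
  show "restrict_process A j s a = adj ?W oo (a \<otimes> id_blinfun) oo ?W" if a: "a : A" for a
   unfolding restrict_eq[OF s a] W(2) Wj(4)[OF s a] by (simp add: blinfun_compose_algebra(1))
 qed (auto simp: noise_alg_def)
 have b: "?b = slice (varpi (hi s f)) ?X (varpi (hi s g))"
  unfolding X(4) adj_fock_shift[OF s f] adj_fock_shift[OF s g] ..
 have rs: "adj (ket (varpi (hi s f))) oo right_map ?W ?X oo ket (varpi (hi s g)) = adj ?W oo (?b \<otimes> id_blinfun) oo ?W"
  unfolding right_map_slice[OF W(1) X(3)] b unfolding slice_def ..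
 have "cinner (u ox f) (khat A j s ?X (adj ?S (x ox hi s g))) =
   cinner (u ox lo s f) ((adj (ket (varpi (hi s f))) oo right_map ?W ?X oo ket (varpi (hi s g))) x)"
  unfolding khat_def rm by (simp add: cinner_adj_right S fock_split_props(2)[OF f] fock_split_range[OF x g])
 also have "... = cinner (u ox lo s f) ((pl s oo j s ?b oo pl s) x)"
  unfolding rs W(2) Wj(4)[OF s sl] by (simp)
 also have "... = cinner (pl s (u ox lo s f)) (j s ?b x)"
  using cinner_adj_left[OF pl_bops(1), of s "u ox lo s f"] unfolding blinfun_apply_blinfun_compose pl_bops(2) x by metis
 also have "pl s (u ox lo s f) = u ox lo s f" using pl_apply[OF step_cut(2)[OF f], of s u] by simp
 finally show ?thesis .
qed

lemma cocycle_increment: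
 assumes Y: "multiplier_cocycle A j Y" and s: "s >= 0" and h: "h >= 0" and f: "f : step_funs" and g: "g : step_funs"
 shows "cinner (u ox f) (Y (s + h) (v ox g)) - cinner (u ox f) (Y s (v ox g)) =
  cinner (u ox lo s f) (j s (slice (varpi (unshift s f)) (Y h - id_blinfun) (varpi (unshift s g))) (Y s (v ox lo s g)))"
proof -
 have Yp: "bounded_process_in A Y" using Y by (simp add: multiplier_cocycle_def)
 have Yb: "Y t : bops" if "t >= 0" for t using Yp that by (simp add: bounded_process_in_def)
 have Ysl: "slice e (Y h) e' : A" for e e' by (rule bounded_process_slice_in[OF A Yp h])
 have idsl: "slice e id_blinfun e' = cinner e e' *c id_blinfun" for e e' :: "'k Fock"
  by (rule blinfun_cinner_eqI) (simp add: cinner_slice cinner_scaleC_right)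
 note ad = bounded_process_adapted[OF Yp s]
 let ?x = "Y s (v ox lo s g)"
 let ?f = "varpi (unshift s f)" and ?g = "varpi (unshift s g)"
 have Ys: "Y s (v ox g) = adj (fock_split s) (?x ox hi s g)"
  using isometry_adj_comp(2)[OF fock_split_props(1,3), of s "Y s (v ox g)"] by (simp add: adapted_split[OF ad g])
 have "Y (s + h) = khat A j s (sigma A s (Y h)) oo Y s" using Y s h by (simp add: multiplier_cocycle_def)
 hence 1: "cinner (u ox f) (Y (s + h) (v ox g)) = cinner (u ox lo s f) (j s (slice ?f (Y h) ?g) ?x)"
  using cocycle_step[OF s Yb[OF h] Ysl adapted_pl[OF ad g] f g] by (simp add: Ys)
 \<comment> \<open>Shift invariance identifies the scalar from the slice of the identity with the
   factor that adaptedness of \<open>Y s\<close> produces; this accounts for the subtracted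
   identity.\<close>
 have kk: "cinner ?f ?g = kf (hi s f) (hi s g)"
  using kf_shift[OF step_unshift[OF f] step_unshift[OF g] s, of s s] by (simp add: shift_unshift kf_def)
 have lin: "linear_on A (j s)" using j_repn[OF s] by (simp add: repn_def)
 have "slice ?f (Y h - id_blinfun) ?g = slice ?f (Y h) ?g + (- cinner ?f ?g) *c id_blinfun"
  by (rule blinfun_cinner_eqI) (simp add: cinner_slice blinfun.diff_left blinfun.add_left cinner_diff_right cinner_scaleC_right)
 hence "j s (slice ?f (Y h - id_blinfun) ?g) = j s (slice ?f (Y h) ?g) + (- cinner ?f ?g) *c id_blinfun"
  using lin[unfolded linear_on_def] Ysl vn_id[OF A] cvec.subspace_scale[OF vn_subspace[OF A] vn_id[OF A]] j_repn[OF s] unfolding repn_def by metis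
 hence "cinner (u ox lo s f) (j s (slice ?f (Y h - id_blinfun) ?g) ?x) =
   cinner (u ox lo s f) (j s (slice ?f (Y h) ?g) ?x) - kf (hi s f) (hi s g) * cinner (u ox lo s f) ?x"
  by (simp add: blinfun.add_left blinfun.diff_left cinner_diff_right cinner_scaleC_right kk)
 thus ?thesis unfolding 1 adaptedD[OF ad f g, of u v] by simp
qed

section \<open>The ampliated flow\<close>

lemma lslice_F: "F : bops \<otimes>\<^sub>N A ==> lslice e F e' : A"
 unfolding lslice_def by (rule lslice_in[OF A order_refl])

lemma left_map_lslice:
 assumes t: "t >= 0" and X: "X : bops" "lslice e X e' : A"
 shows "lslice e (left_map (Wj t) X) e' = j t (lslice e X e')"
 unfolding Wj(4)[OF t X(2)] using left_map_slice[OF Wj(1)[OF t] X(1), of e e'] by (simp add: lslice_def)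

context
 fixes t :: real
 assumes t: "t >= 0"
begin

abbreviation (input) "VV == (assoc3 :: (complex \<times> 'k, ('h, (nat \<times> ('h, 'k) hf) ell2) tensor) tensor =>L _) oo (id_blinfun \<otimes> Wj t)"

lemma VV: "VV : bops" "cinner (VV x) (VV y) = cinner x y" "VV (c \<odot> u) = assoc3 (c \<odot> Wj t u)"
proof -
 note W = Wj(1,2)[OF t]
 show b: "VV : bops" using W assoc3_props(1) by auto
 show v: "VV (c \<odot> u) = assoc3 (c \<odot> Wj t u)" for c u using W by simp
 show "cinner (VV x) (VV y) = cinner x y"
 proof (rule isometry_on_total[OF b total_tensor_range])
  fix p q :: "(complex \<times> 'k) \<times> ('h, 'k) hf"
  show "cinner (VV ((%(x, y). x \<odot> y) p)) (VV ((%(x, y). x \<odot> y) q)) = cinner ((%(x, y). x \<odot> y) p) ((%(x, y). x \<odot> y) q)"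
   using W by (simp add: split_beta v assoc3_props(3) del: blinfun_apply_blinfun_compose)
 qed
qed

lemma norm_left_map_le:
 fixes X :: "('k, 'h) ch op"
 assumes X: "X : bops" shows "norm (left_map (Wj t) X) <= norm X"
proof (rule norm_blinfun_bound)
 fix x
 have nV: "norm (VV y) = norm y" for y using VV(2)[of y y] unfolding cinner_self_norm of_real_eq_iff by (simp)
 let ?y = "left_map (Wj t) X x"
 have "norm ?y * norm ?y = cmod (cinner ?y ?y)" by (simp add: cinner_self_norm power2_eq_square norm_mult)
 also have "... = cmod (cinner (VV ?y) ((X \<otimes> id_blinfun) (VV x)))"
  unfolding left_map_def using cinner_adj_right[OF VV(1)] by simp
 also have "... <= norm (X \<otimes> (id_blinfun :: (nat \<times> ('h, 'k) hf) ell2 =>L _)) * (norm (VV ?y) * norm (VV x))" by (rule uw_term_le)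
 also have "... <= norm X * (norm ?y * norm x)" unfolding nV by (intro mult_right_mono norm_amp_le X) auto
 finally have "norm ?y * norm ?y <= norm ?y * (norm X * norm x)" by (simp add: ac_simps)
 thus "norm ?y <= norm X * norm x" by (rule le_of_mult_self_le) simp
qed auto

context
 fixes F :: "('k, 'h) ch op"
 assumes F: "F : bops \<otimes>\<^sub>N A"
begin

lemma F_bops: "F : bops" using F vn_tensor_props(1)[OF order_refl vn_subset_bops[OF A]] by blast

lemma ktilde_eq: "ktilde A j t F = left_map (Wj t) F" "ktilde A j t F : bops" "norm (ktilde A j t F) <= norm F"
proof -
 show e: "ktilde A j t F = left_map (Wj t) F"
  unfolding ktilde_def by (rule tensor_map_left[OF vn_subset_bops[OF A] order_refl Wj(1)[OF t] Wj(4)[OF t] F])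
 show "ktilde A j t F : bops" unfolding e by (rule left_map_bops[OF Wj(1)[OF t] F_bops])
 show "norm (ktilde A j t F) <= norm F" unfolding e by (rule norm_left_map_le[OF F_bops])
qed

lemma ktilde_lslice: "lslice e (ktilde A j t F) e' = j t (lslice e F e')"
 unfolding ktilde_eq by (rule left_map_lslice[OF t F_bops lslice_F[OF F]])

text \<open>The amplification of \<open>F\<close> leaves the range of the isometry invariant. On
  elementary tensors this is the intertwining relation for \<open>Wj t\<close>; matrix elements are
  ultraweakly continuous in \<open>F\<close>, which extends it. It provides the part of the
  multiplicativity of \<open>ktilde\<close> that \<open>norm_ktilde_apply\<close> uses.\<close>

lemma VV_intertwines: "VV oo (adj VV oo (F \<otimes> id_blinfun) oo VV) = (F \<otimes> id_blinfun) oo VV"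
proof (rule total_form_eqI[OF total_UNIV total_tensor_range])
 show "VV oo (adj VV oo (F \<otimes> id_blinfun) oo VV) : bops" "(F \<otimes> id_blinfun) oo VV : bops"
  using VV(1) F_bops by auto
 fix y and x :: "('k, ('h, 'k) hf) ch" assume "x : range (%(x, y). x \<odot> y)"
 then obtain c u where x: "x = c \<odot> u" by auto
 let ?I = "id_blinfun :: (nat \<times> ('h, 'k) hf) ell2 =>L _"
 have *: "cinner (adj VV y) ((adj VV oo (F \<otimes> ?I) oo VV) x) = cinner y ((F \<otimes> ?I) (VV x))"
 proof (rule continuous_map_euclidean_eqI[OF F[unfolded vn_tensor_def], where f = "%F. cinner (adj VV y) ((adj VV oo (F \<otimes> ?I) oo VV) x)"])
  show "continuous_map ultraweak euclidean (%F. cinner (adj VV y) ((adj VV oo (F \<otimes> ?I) oo VV) x))"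
   using continuous_map_compose[OF continuous_map_amp_conj[OF VV(1)] continuous_map_vec] by (simp add: o_def)
  show "continuous_map ultraweak euclidean (%F. cinner y ((F \<otimes> ?I) (VV x)))"
   using continuous_map_compose[OF continuous_map_amp continuous_map_vec] by (simp add: o_def)
  fix X :: "('k, 'h) ch op" assume "X : cvec.span {S \<otimes> T | S T. S : bops & T : A}"
  hence "X : bops & VV (adj VV ((X \<otimes> ?I) (VV x))) = (X \<otimes> ?I) (VV x)"
  proof (induction rule: cvec.span_induct_alt)
   case base thus ?case using tensor_op_scaleC_left[of "0 :: ('k, 'h) ch op" ?I 0] by (simp)
  next
   case (step z s X)
   then obtain S T where s: "s = S \<otimes> T" "S : bops" "T : A" by blast
   note Tb = Ab[OF s(3)]
   have am: "(s \<otimes> ?I) (assoc3 (c \<odot> w)) = assoc3 (S c \<odot> (T \<otimes> ?I) w)" for w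
   proof -
    have "(s \<otimes> ?I) oo assoc3 oo lket c = assoc3 oo lket (S c) oo (T \<otimes> ?I)"
     by (rule total_op_eqI[OF total_tensor_range]) (use s Tb assoc3_props(1) in "auto simp: assoc3_props(2)")
    from arg_cong[OF this, of "%T. blinfun_apply T w"] show ?thesis by simp
   qed
   have "(T \<otimes> ?I) (Wj t u) = Wj t (j t T u)" using arg_cong[OF Wj(3)[OF t s(3)], of "%T. blinfun_apply T u"] by simp
   hence e: "(s \<otimes> ?I) (VV x) = VV (S c \<odot> j t T u)" unfolding x VV(3) am by simp
   have sb: "s : bops" using s Tb by auto
   have "VV (adj VV ((s \<otimes> ?I) (VV x))) = (s \<otimes> ?I) (VV x)" unfolding e isometry_adj_comp(2)[OF VV(1,2)] ..
   thus ?case using step sb VV(1) bops_adj[OF VV(1)] tensor_op_add_left[of "z *c s" X ?I] tensor_op_scaleC_left[of s ?I z]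
    by (simp add: bops_add bops_scaleC blinfun.add_left blinfun.add_right bopsD del: blinfun_apply_blinfun_compose)
  qed
  thus "cinner (adj VV y) ((adj VV oo (X \<otimes> ?I) oo VV) x) = cinner y ((X \<otimes> ?I) (VV x))"
   using cinner_adj_left[OF VV(1), of y] by simp
 qed
 thus "cinner y ((VV oo (adj VV oo (F \<otimes> ?I) oo VV)) x) = cinner y (((F \<otimes> ?I) oo VV) x)"
  using cinner_adj_left[OF VV(1), of y] by simp
qed

lemma norm_ktilde_apply: "cinner (ktilde A j t F x) (ktilde A j t F x) = cinner x (left_map (Wj t) (adj F oo F) x)"
proof -
 let ?I = "id_blinfun :: (nat \<times> ('h, 'k) hf) ell2 =>L _"
 have a: "(adj F oo F) \<otimes> ?I = adj (F \<otimes> ?I) oo (F \<otimes> ?I)" using F_bops by (simp add: adj_tensor_op tensor_op_comp)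
 have "cinner (ktilde A j t F x) (ktilde A j t F x) = cinner (VV (ktilde A j t F x)) (VV (ktilde A j t F x))" by (rule VV(2)[symmetric])
 also have "... = cinner ((F \<otimes> ?I) (VV x)) ((F \<otimes> ?I) (VV x))"
  using arg_cong[OF VV_intertwines, of "%T. blinfun_apply T x"] unfolding ktilde_eq left_map_def by simp
 also have "... = cinner x (left_map (Wj t) (adj F oo F) x)"
  unfolding left_map_def a using VV(1) F_bops by (simp add: cinner_adj_right)
 finally show ?thesis .
qed

end

end

text \<open>Matrix elements at elementary tensors are those of \<open>j s\<close> at slices of
  \<open>X\<close>, continuous in \<open>s\<close>; the uniform bound extends this to all
  vectors.\<close>

lemma left_map_weak:
 fixes X :: "('k, 'h) ch op"
 assumes X: "X : bops" "!!e e'. lslice e X e' : A" and t: "t >= 0"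
 shows "((%s. cinner x (left_map (Wj s) X y)) ---> cinner x (left_map (Wj t) X y)) (at t within {0..})"
proof -
 \<comment> \<open>The absolute value makes the operators meaningful for every real
   \<open>s\<close>; at non-negative times nothing changes.\<close>
 let ?T = "%s. left_map (Wj \<bar>s\<bar>) X"
 have "((%s. cinner x (?T s y)) ---> cinner x (?T t y)) (at t within {0..})"
 proof (rule weak_limit_total[OF total_tensor_range total_tensor_range])
  show "?T i : bops" "?T t : bops" for i by (auto intro!: left_map_bops Wj(1) X(1))
  show "\<forall>\<^sub>F i in at t within {0..}. norm (?T i) <= norm X"
   by (intro always_eventually allI norm_left_map_le X) simp
  fix g h :: "('k, ('h, 'k) hf) ch" assume "g : range (%(x, y). x \<odot> y)" "h : range (%(x, y). x \<odot> y)"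
  then obtain c u d v where gh: "g = c \<odot> u" "h = d \<odot> v" by auto
  have e: "cinner h (?T s g) = cinner v (j \<bar>s\<bar> (lslice d X c) u)" for s
   using left_map_lslice[OF _ X(1) X(2), of "\<bar>s\<bar>" d c] cinner_lslice[of v d "?T s" c u] by (simp add: gh)
  show "((%s. cinner h (?T s g)) ---> cinner h (?T t g)) (at t within {0..})"
   unfolding e using j_weak_continuous[OF X(2) t, of v d c u] t
   by (auto elim!: Lim_transform_eventually simp: eventually_at_filter)
 qed
 thus ?thesis using t by (auto elim!: Lim_transform_eventually simp: eventually_at_filter)
qed

text \<open>Weak continuity together with convergence of the norms gives strong continuity. The
  squared norm is a matrix element of \<open>left_map\<close> at \<open>adj F oo F\<close>, whose
  slices are again in \<open>A\<close>, so weak continuity covers it as well.\<close>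

lemma ktilde_continuous:
 fixes F :: "('k, 'h) ch op"
 assumes F: "F : bops \<otimes>\<^sub>N A" and t: "t >= 0"
 shows "((%s. ktilde A j s F x) ---> ktilde A j t F x) (at t within {0..})"
proof -
 let ?K = "%s. ktilde A j s F x"
 have ev: "\<forall>\<^sub>F s in at t within {0..}. s >= 0" by (auto simp: eventually_at_filter)
 have Fb: "F : bops" by (rule F_bops[OF t F])
 have 1: "((%s. cinner y (?K s)) ---> cinner y (?K t)) (at t within {0..})" for y
  using left_map_weak[OF Fb lslice_F[OF F] t, of y x] unfolding ktilde_eq(1)[OF t F]
  by (rule Lim_transform_eventually) (use ev in eventually_elim, simp add: ktilde_eq(1)[OF _ F])
 have sl: "lslice e (adj F oo F) e' : A" for e e'
  unfolding lslice_def by (rule lslice_adj_mult_in[OF A Fb]) (use lslice_F[OF F] in "simp add: lslice_def")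
 have 2: "((%s. cinner (?K s) (?K s)) ---> cinner (?K t) (?K t)) (at t within {0..})"
  unfolding norm_ktilde_apply[OF t F]
  by (rule Lim_transform_eventually[OF left_map_weak[OF bops_comp[OF bops_adj[OF Fb] Fb] sl t]])
   (use ev in eventually_elim, simp add: norm_ktilde_apply[OF _ F])
 have "((%s. cinner (?K s) (?K s) - cinner (?K t) (?K s) - cnj (cinner (?K t) (?K s)) + cinner (?K t) (?K t)) --->
   cinner (?K t) (?K t) - cinner (?K t) (?K t) - cnj (cinner (?K t) (?K t)) + cinner (?K t) (?K t)) (at t within {0..})"
  by (intro tendsto_intros 1 2)
 moreover have "cinner (?K s) (?K s) - cinner (?K t) (?K s) - cnj (cinner (?K t) (?K s)) + cinner (?K t) (?K t) = complex_of_real ((norm (?K s - ?K t))^2)" for s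
  unfolding cinner_self_norm[symmetric] cinner_commute[of "?K s" "?K t", symmetric] by (simp add: cinner_diff_left cinner_diff_right)
 ultimately have "((%s. complex_of_real ((norm (?K s - ?K t))^2)) ---> of_real 0) (at t within {0..})" by (simp add: cinner_self_norm)
 hence "((%s. (norm (?K s - ?K t))^2) ---> 0) (at t within {0..})" by (simp only: tendsto_of_real_iff)
 hence "((%s. sqrt ((norm (?K s - ?K t))^2)) ---> sqrt 0) (at t within {0..})" by (rule tendsto_real_sqrt)
 thus ?thesis by (simp add: tendsto_norm_zero_iff LIM_zero_iff)
qed

end

section \<open>Right derivatives and measurability\<close>

text \<open>For each slope e > 0 consider the points up to which the increment of \<open>f\<close>
  is bounded with slope \<open>e\<close>. Their supremum must be \<open>b\<close>: continuity closes
  the estimate at the supremum, and the right derivative pushes it further.\<close>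

lemma right_derivative_zero:
 fixes f :: "real => 'a::real_normed_vector"
 assumes ab: "a <= b" and c: "continuous_on {a..b} f"
  and d: "!!x. a <= x ==> x < b ==> (f has_vector_derivative 0) (at x within {x..b})"
 shows "f b = f a"
proof -
 have main: "norm (f b - f a) <= e * (b - a)" if e: "e > 0" for e
 proof -
  define S where "S = {x : {a..b}. ALL y:{a..x}. norm (f y - f a) <= e * (y - a)}"
  have aS: "a : S" using ab by (simp add: S_def)
  have bdd: "bdd_above S" by (rule bdd_aboveI[of _ b]) (simp add: S_def)
  define s where "s = Sup S"
  have s: "a <= s" "s <= b"
   unfolding s_def by (rule cSup_upper[OF aS bdd], rule cSup_least) (use aS in "auto simp: S_def")
  have lt: "norm (f y - f a) <= e * (y - a)" if "a <= y" "y < s" for y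
  proof -
   have "EX x:S. y < x" by (rule less_cSupD) (use aS that in "auto simp: s_def")
   then obtain x where "x : S" "y < x" by blast
   thus ?thesis using that by (simp add: S_def)
  qed
  have s_le: "norm (f s - f a) <= e * (s - a)"
  proof (cases "s = a")
   case False
   hence as: "a < s" using s by simp
   have "(f ---> f s) (at s within {a..s})"
    using c s continuous_on_subset[OF c, of "{a..s}"] by (simp add: continuous_on_def)
   hence "(f ---> f s) (at_left s)" using as by (simp add: at_within_Icc_at_left)
   hence "((%y. norm (f y - f a) - e * (y - a)) ---> norm (f s - f a) - e * (s - a)) (at_left s)"
    by (intro tendsto_intros)
   moreover have "\<forall>\<^sub>F y in at_left s. norm (f y - f a) - e * (y - a) <= 0"
    using eventually_at_left_real[OF as] by eventually_elim (use lt in auto)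
   ultimately have "norm (f s - f a) - e * (s - a) <= 0" by (intro tendsto_upperbound) auto
   thus ?thesis by simp
  qed simp
  have "s = b"
  proof (rule ccontr)
   assume "s ~= b" hence sb: "s < b" using s by simp
   from d[OF s(1) sb] have "(f has_derivative (%h. h *r 0)) (at s within {s..b})" by (simp add: has_vector_derivative_def)
   then obtain r where r: "r > 0" "!!y. y : {s..b} ==> norm (y - s) < r ==> norm (f y - f s - (y - s) *r 0) <= e * norm (y - s)"
    using e unfolding has_derivative_within_alt by blast
   define x where "x = min b (s + r / 2)"
   have x: "s < x" "x <= b" "x < s + r" using r sb by (auto simp: x_def)
   have "norm (f y - f a) <= e * (y - a)" if y: "a <= y" "y <= x" for y
   proof (cases "y < s")
    case True thus ?thesis using lt y by simp
   next
    case False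
    hence "norm (f y - f s) <= e * (y - s)" using r(2)[of y] y x by simp
    thus ?thesis using norm_triangle_ineq[of "f y - f s" "f s - f a"] s_le by (simp add: algebra_simps)
   qed
   hence "x : S" using x s by (simp add: S_def)
   thus False using cSup_upper[OF _ bdd, of x] x by (simp add: s_def)
  qed
  thus ?thesis using s_le by simp
 qed
 have "norm (f b - f a) <= 0"
 proof (rule field_le_epsilon)
  fix e :: real assume "e > 0"
  have "norm (f b - f a) <= (e / (b - a + 1)) * (b - a)" using \<open>e > 0\<close> ab by (intro main) simp
  also have "... <= e" using \<open>e > 0\<close> ab by (simp add: field_simps)
  finally show "norm (f b - f a) <= 0 + e" by simp
 qed
 thus ?thesis by simp
qed

text \<open>Matrix elements of the cocycle are differentiated only from the right. Subtracting the
  indefinite integral, whose right derivative is \<open>p\<close> by right continuity, reduces the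
  claim to \<open>right_derivative_zero\<close>.\<close>

lemma integral_right_derivative:
 fixes P :: "real => 'a::banach"
 assumes ab: "a <= b" and c: "continuous_on {a..b} P" and i: "p integrable_on {a..b}"
  and d: "!!x. a <= x ==> x < b ==> (P has_vector_derivative p x) (at x within {x..b})"
  and r: "!!x. a <= x ==> x < b ==> continuous (at x within {x..b}) p"
 shows "integral {a..b} p = P b - P a"
proof -
 define f where "f x = P x - integral {a..x} p" for x
 have "f b = f a"
 proof (rule right_derivative_zero[OF ab])
  show "continuous_on {a..b} f" unfolding f_def by (intro continuous_intros c indefinite_integral_continuous_1 i)
  fix x assume x: "a <= x" "x < b"
  have ix: "p integrable_on {x..b}" "p integrable_on {a..u}" if "u <= b" for u
   by (rule integrable_on_subinterval[OF i], use x that in auto)+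
  have "((%u. integral {x..u} p) has_vector_derivative p x) (at x within {x..b} - {})"
   by (rule integral_has_vector_derivative_continuous_at[OF ix(1)]) (use x r in auto)
  hence "((%u. integral {a..x} p + integral {x..u} p) has_vector_derivative 0 + p x) (at x within {x..b})"
   by (intro has_vector_derivative_add has_vector_derivative_const) simp
  hence "((%u. integral {a..u} p) has_vector_derivative p x) (at x within {x..b})"
   unfolding add_0
  proof (rule has_vector_derivative_transform_within[OF _ zero_less_one])
   show "x : {x..b}" using x by simp
   show "integral {a..x} p + integral {x..u} p = integral {a..u} p" if "u : {x..b}" for u
    using Henstock_Kurzweil_Integration.integral_combine[OF _ _ ix(2)[of u], of x] x that by simp
  qed
  from has_vector_derivative_diff[OF d[OF x] this]
  show "(f has_vector_derivative 0) (at x within {x..b})" unfolding f_def by simp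
 qed
 thus ?thesis by (simp add: f_def algebra_simps)
qed

text \<open>Sampling \<open>z\<close> at the next grid point to the right of \<open>s\<close> makes
  right continuity sufficient for convergence.\<close>

lemma strongly_measurable_rcont:
 fixes z :: "real => 'a::real_normed_vector"
 assumes c: "!!s. s >= 0 ==> continuous (at s within {s..}) z"
 shows "strongly_measurable (%s. indicator {0..T} s *r z s)"
 unfolding strongly_measurable_def
proof (intro exI conjI allI)
 fix n :: nat
 let ?N = "real (Suc n)"
 \<comment> \<open>Outside [0, T] the grid index is set to -1, which marks the value 0 and keeps the
   range finite.\<close>
 define g where "g t = (if t : {0..T} then real_of_int \<lfloor>?N * t\<rfloor> else -1)" for t
 have "g : borel_measurable borel" unfolding g_def by measurable
 hence "g : borel_measurable lebesgue" by (simp add: measurable_completion)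
 moreover have "g ` space lebesgue \<subseteq> real_of_int ` {-1..\<lfloor>?N * T\<rfloor>} \<union> {-1}"
 proof
  fix y assume "y : g ` space lebesgue"
  then obtain t where t: "y = g t" by blast
  show "y : real_of_int ` {-1..\<lfloor>?N * T\<rfloor>} \<union> {-1}"
  proof (cases "t : {0..T}")
   case True
   hence "?N * t <= ?N * T" "0 <= ?N * t" by (auto)
   hence "\<lfloor>?N * t\<rfloor> <= \<lfloor>?N * T\<rfloor>" "0 <= \<lfloor>?N * t\<rfloor>" by (simp_all only: floor_mono zero_le_floor)
   hence "\<lfloor>?N * t\<rfloor> : {-1..\<lfloor>?N * T\<rfloor>}" unfolding atLeastAtMost_iff by linarith
   thus ?thesis using True t unfolding g_def by simp
  qed (auto simp: t g_def)
 qed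
 hence "finite (g ` space lebesgue)" by (rule finite_subset) simp
 ultimately have "simple_function lebesgue g" by (rule simple_function_borel_measurable)
 from simple_function_compose1[OF this, of "%m. if m < 0 then 0 else z ((m + 1) / ?N)"]
 have "simple_function lebesgue (%t. if g t < 0 then 0 else z ((g t + 1) / ?N))" .
 moreover have "(%t. if g t < 0 then 0 else z ((g t + 1) / ?N)) = (%t. indicator {0..T} t *r z ((real_of_int \<lfloor>?N * t\<rfloor> + 1) / ?N))"
 proof
  fix t
  have "\<not> g t < 0" if "t : {0..T}" using that by (simp add: g_def not_less)
  thus "(if g t < 0 then 0 else z ((g t + 1) / ?N)) = indicator {0..T} t *r z ((real_of_int \<lfloor>?N * t\<rfloor> + 1) / ?N)"
   by (cases "t : {0..T}") (auto simp: g_def simp del: of_nat_Suc)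
 qed
 ultimately show "simple_function lebesgue (%t. indicator {0..T} t *r z ((real_of_int \<lfloor>?N * t\<rfloor> + 1) / ?N))" by simp
next
 have "(%n. indicator {0..T} t *r z ((real_of_int \<lfloor>real (Suc n) * t\<rfloor> + 1) / real (Suc n))) ----> indicator {0..T} t *r z t" for t
 proof (cases "t : {0..T}")
  case True
  define p where "p n = (real_of_int \<lfloor>real (Suc n) * t\<rfloor> + 1) / real (Suc n)" for n
  have p: "t <= p n" "p n <= t + 1 / real (Suc n)" for n
  proof -
   define N where "N = real (Suc n)"
   have N: "N > 0" by (simp add: N_def)
   have e: "(N * t) / N = t" "(N * t + 1) / N = t + 1 / N" using N by (simp_all add: add_divide_distrib)
   have "(N * t) / N <= (real_of_int \<lfloor>N * t\<rfloor> + 1) / N" "(real_of_int \<lfloor>N * t\<rfloor> + 1) / N <= (N * t + 1) / N"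
    by ((rule divide_right_mono; use floor_correct[of "N * t"] N in linarith)+)
   thus "t <= p n" "p n <= t + 1 / real (Suc n)" unfolding p_def N_def[symmetric] e .
  qed
  have "(%n. t + 1 / real (Suc n)) ----> t + 0" by (rule tendsto_add[OF tendsto_const LIMSEQ_Suc[OF lim_const_over_n]])
  hence u: "(%n. t + 1 / real (Suc n)) ----> t" by simp
  have "p ----> t" by (rule tendsto_sandwich[OF _ _ tendsto_const u]) (intro always_eventually allI p)+
  hence "(z \<circ> p) ----> z t" using c[of t] True p(1) unfolding continuous_within_sequentially by (simp)
  thus ?thesis using True by (simp add: p_def o_def)
 qed simp
 thus "AE t in lebesgue. (%n. indicator {0..T} t *r z ((real_of_int \<lfloor>real (Suc n) * t\<rfloor> + 1) / real (Suc n))) ----> indicator {0..T} t *r z t" by simp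
qed

lemma strongly_measurable_indicator:
 fixes z :: "real => 'a::complex_inner"
 assumes "strongly_measurable z" "S : sets lebesgue"
 shows "strongly_measurable (%t. indicator S t *r z t)"
proof -
 obtain r where r: "!!n. simple_function lebesgue (r n)" "AE t in lebesgue. (%n. r n t) ----> z t"
  using assms(1) unfolding strongly_measurable_def by blast
 show ?thesis
  unfolding strongly_measurable_def
 proof (intro exI[of _ "%n t. indicator S t *r r n t"] conjI allI)
  show "simple_function lebesgue (%t. indicator S t *r r n t)" for n
   by (rule simple_function_compose2[OF simple_function_indicator[OF assms(2)] r(1)])
  show "AE t in lebesgue. (%n. indicator S t *r r n t) ----> indicator S t *r z t"
   using r(2) by eventually_elim (intro tendsto_intros)
 qed
qed

lemma bounded_set_integrable:
 fixes p :: "real => 'b::{banach, second_countable_topology}"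
 assumes m: "(%s. indicator {a..b} s *r p s) : borel_measurable lebesgue" and B: "!!s. s : {a..b} ==> norm (p s) <= B"
 shows "set_integrable lebesgue {a..b} p"
 unfolding set_integrable_def
proof (rule Bochner_Integration.integrable_bound)
 show "integrable lebesgue (%s. indicator {a..b} s *r B)" by (simp add: emeasure_lborel_Icc_eq)
 have "norm (p s) <= \<bar>B\<bar>" if "s : {a..b}" for s using B[OF that] by simp
 thus "AE s in lebesgue. norm (indicator {a..b} s *r p s) <= norm (indicator {a..b} s *r B)" by (auto split: split_indicator)
qed (rule m)

section \<open>Local constancy and boundedness of step functions\<close>

lemma step_right_const:
 assumes "f : step_funs" shows "EX d>0. ALL y:{x..<x + d}. f y = f x"
 using assms
proof (induction rule: step_induct)
 case zero show ?case by (intro exI[of _ 1]) simp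
next
 case (add f a b c)
 obtain d where d: "d > 0 & (ALL y:{x..<x + d}. f y = f x)" using add.IH ..
 define e where "e = (if x < a then a - x else if x < b then b - x else 1)"
 have e: "e > 0" by (simp add: e_def)
 have ind: "y : {a..<b} \<longleftrightarrow> x : {a..<b}" if "y : {x..<x + e}" for y using that by (auto simp: e_def split: if_splits)
 have "f y + indicator {a..<b} y *r c = f x + indicator {a..<b} x *r c" if "y : {x..<x + min d e}" for y
 proof -
  have "y : {x..<x + d}" "y : {x..<x + e}" using that by auto
  with conjunct2[OF d] ind have "f y = f x" "(y : {a..<b}) = (x : {a..<b})" by blast+
  thus ?thesis unfolding indicator_def by (simp only:)
 qed
 moreover have "min d e > 0" using d e by simp
 ultimately show ?case by blast
qed

lemma steps_right_const:
 fixes f :: "'i => real => 'k::complex_hilbert"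
 assumes "finite I" "!!i. i : I ==> f i : step_funs" shows "EX d>0. ALL i:I. ALL y:{x..<x + d}. f i y = f i x"
 using assms
proof (induction I rule: finite_induct)
 case empty show ?case by (intro exI[of _ 1]) simp
next
 case (insert i I)
 have "EX d>0. ALL i:I. ALL y:{x..<x + d}. f i y = f i x" by (rule insert.IH) (rule insert.prems, simp)
 then obtain d where d: "d > 0 & (ALL i:I. ALL y:{x..<x + d}. f i y = f i x)" ..
 have "f i : step_funs" using insert.prems by simp
 from step_right_const[OF this, of x] obtain e where e: "e > 0 & (ALL y:{x..<x + e}. f i y = f i x)" ..
 have "f k y = f k x" if "k : insert i I" "y : {x..<x + min d e}" for k y
  using conjunct2[OF d, THEN bspec, THEN bspec, of k y] conjunct2[OF e, THEN bspec, of y] that by fastforce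
 moreover have "min d e > 0" using d e by simp
 ultimately show ?case by blast
qed

lemma step_bounded:
 assumes "f : step_funs" shows "EX C. ALL x. norm (f x) <= C"
 using assms
proof (induction rule: step_induct)
 case zero show ?case by (intro exI[of _ 0]) simp
next
 case (add f a b c)
 then obtain C where C: "!!x. norm (f x) <= C" by blast
 have "norm (f x + indicator {a..<b} x *r c) <= C + norm c" for x
  using norm_triangle_ineq[of "f x" "indicator {a..<b} x *r c"] C[of x] using add_increasing2[OF norm_ge_zero[of c] C[of x]] by (auto simp: indicator_def split: if_splits)
 thus ?case by blast
qed

lemma step_rcont:
 assumes "f : step_funs" shows "continuous (at s within {s..}) f"
proof -
 obtain d where d: "d > 0 & (ALL y:{s..<s + d}. f y = f s)" using step_right_const[OF assms, of s] ..
 have eq: "f s = f y" if "y : {s..}" "y ~= s & dist y s < d" for y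
  using conjunct2[OF d, THEN bspec, of y] that by (simp add: dist_real_def)
 have "\<forall>\<^sub>F y in at s within {s..}. f s = f y"
  unfolding eventually_at using eq conjunct1[OF d] by (intro exI[of _ d]) simp
 hence "(f ---> f s) (at s within {s..})" by (rule Lim_transform_eventually[OF tendsto_const])
 thus ?thesis by (simp add: continuous_within)
qed

section \<open>The gradient operator and ampliations\<close>

lemma lin_operatorD:
 assumes "lin_operator D"
 shows "cvec.subspace (dom D)" "x : dom D ==> y : dom D ==> the (D (x + y)) = the (D x) + the (D y)"
  "x : dom D ==> the (D (c *c x)) = c *c the (D x)" "the (D 0) = 0"
proof -
 show 1: "cvec.subspace (dom D)" "x : dom D ==> y : dom D ==> the (D (x + y)) = the (D x) + the (D y)"
  "x : dom D ==> the (D (c *c x)) = c *c the (D x)" for x y c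
  using assms by (auto simp: lin_operator_def linear_on_def)
 show "the (D 0) = 0" using 1(3)[of 0 0] cvec.subspace_0[OF 1(1)] by simp
qed

lemma lin_operator_sum:
 assumes D: "lin_operator D" and "!!i. i : I ==> a i : dom D"
 shows "the (D (SUM i:I. a i)) = (SUM i:I. the (D (a i))) & (SUM i:I. a i) : dom D"
 using assms(2) by (induction I rule: infinite_finite_induct)
  (simp_all add: lin_operatorD[OF D] cvec.subspace_0[OF lin_operatorD(1)[OF D]] cvec.subspace_add[OF lin_operatorD(1)[OF D]] del: domIff)

text \<open>Both \<open>nabla\<close> and \<open>ampliation\<close> prescribe a linear operator by
  its values on a spanning set. Such an operator exists and is unique as soon as the span of the
  prescribed graph has only 0 over 0.\<close>

lemma graph_operator:
 fixes S :: "('a::complex_vector \<times> 'b::complex_vector) set"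
 assumes single: "!!y. (0, y) : cvec.span S ==> y = 0"
 shows "\<exists>!D. lin_operator D & dom D = cvec.span (fst ` S) & (ALL p:S. D (fst p) = Some (snd p))"
proof -
 note sc = scaleC_prod_def
 have uniq: "y = y'" if "(x, y) : cvec.span S" "(x, y') : cvec.span S" for x y y'
  using single[of "y - y'"] cvec.span_diff[OF that] by simp
 define D where "D x = (if EX y. (x, y) : cvec.span S then Some (SOME y. (x, y) : cvec.span S) else None)" for x
 have D: "D x = Some y" if "(x, y) : cvec.span S" for x y
  using that uniq by (auto simp: D_def)
 have domD: "x : dom D \<longleftrightarrow> (EX y. (x, y) : cvec.span S)" for x by (auto simp: D_def dom_def)
 have sub: "cvec.subspace (dom D)"
 proof (rule cvec.subspaceI)
  show "0 : dom D" using cvec.span_zero[of S] by (auto simp: domD zero_prod_def)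
  fix x y c assume "x : dom D"
  then obtain x' where x: "(x, x') : cvec.span S" by (auto simp: domD)
  thus "c *c x : dom D" using cvec.span_scale[of "(x, x')" S c] by (auto simp: domD sc)
  assume "y : dom D"
  then obtain y' where "(y, y') : cvec.span S" by (auto simp: domD)
  thus "x + y : dom D" using cvec.span_add[OF x, of "(y, y')"] by (auto simp: domD)
 qed
 have lin: "lin_operator D"
  unfolding lin_operator_def linear_on_def
 proof (intro conjI sub ballI allI)
  fix x y c assume "x : dom D" "y : dom D"
  then obtain x' y' where "(x, x') : cvec.span S" "(y, y') : cvec.span S" by (auto simp: domD)
  thus "the (D (x + y)) = the (D x) + the (D y)" using D cvec.span_add[of "(x, x')" S "(y, y')"] by simp
 next
  fix x c assume "x : dom D"
  then obtain x' where "(x, x') : cvec.span S" by (auto simp: domD)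
  thus "the (D (c *c x)) = c *c the (D x)" using D cvec.span_scale[of "(x, x')" S c] by (simp add: sc)
 qed
 have fst_in: "fst p : cvec.span (fst ` S)" if "p : cvec.span S" for p
  using that
  by (induction rule: cvec.span_induct_alt) (auto simp: sc cvec.span_zero intro!: cvec.span_add cvec.span_scale intro: cvec.span_base)
 have "dom D \<subseteq> cvec.span (fst ` S)"
 proof
  fix x assume "x : dom D"
  then obtain y where "(x, y) : cvec.span S" unfolding domD ..
  from fst_in[OF this] show "x : cvec.span (fst ` S)" by simp
 qed
 moreover have "cvec.span (fst ` S) \<subseteq> dom D"
 proof (rule cvec.span_minimal[OF _ sub])
  show "fst ` S \<subseteq> dom D" unfolding domD[abs_def] subset_iff domD using cvec.span_base by fastforce
 qed
 ultimately have dom: "dom D = cvec.span (fst ` S)" by auto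
 show ?thesis
 proof (rule ex1I[of _ D])
  show "lin_operator D & dom D = cvec.span (fst ` S) & (ALL p:S. D (fst p) = Some (snd p))"
   using lin dom D cvec.span_base by (metis prod.collapse)
  fix D' assume D': "lin_operator D' & dom D' = cvec.span (fst ` S) & (ALL p:S. D' (fst p) = Some (snd p))"
  have "the (D' x) = the (D x) & x : dom D" if "x : cvec.span (fst ` S)" for x
   using that
  proof (induction rule: cvec.span_induct_alt)
   case base thus ?case using lin D' by (simp add: lin_operatorD cvec.subspace_0)
  next
   case (step c x y)
   then obtain p where p: "p : S" "x = fst p" by blast
   hence "D x = Some (snd p)" using D[of x "snd p"] cvec.span_base[of p S] by simp
   moreover have "D' x = Some (snd p)" using D' p by blast
   ultimately have x: "x : dom D" "the (D' x) = the (D x)" by auto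
   have "c *c x : dom D" using x cvec.subspace_scale[OF sub] by blast
   moreover have "dom D' = dom D" using D' dom by simp
   ultimately show ?case
    using step.IH x lin_operatorD(2,3)[OF lin] lin_operatorD(2,3)[OF conjunct1[OF D']] cvec.subspace_add[OF sub] by (simp del: domIff)
  qed
  hence eq: "the (D' x) = the (D x)" if "x : dom D" for x using that dom by blast
  have dd: "dom D' = dom D" using D' dom by simp
  show "D' = D"
  proof (intro ext option.expand)
   show "(D' x = None) = (D x = None)" for x using dd by (metis domIff)
   show "D' x ~= None ==> D x ~= None ==> the (D' x) = the (D x)" for x by (rule eq) (simp add: domIff)
  qed
 qed
qed

lemma exp_domain_rep:
 assumes "z : exp_domain"
 shows "EX n u f. (ALL i<n. f i : step_funs) & z = (\<Sum>i<(n::nat). u i ox f i)"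
 using assms unfolding exp_domain_def
proof (induction rule: cvec.span_induct_alt)
 case base show ?case by (intro exI[of _ 0]) simp
next
 case (step c x y)
 then obtain n u f v g where "ALL i<n. f i : step_funs" "y = (\<Sum>i<(n::nat). u i ox f i)" "x = v ox g" "g : step_funs" by auto
 thus ?case
  by (intro exI[of _ "Suc n"] exI[of _ "u(n := c *c v)"] exI[of _ "f(n := g)"]) (auto simp: tensor_scaleC_left)
qed

text \<open>Differentiate the vanishing combination along k + x h at x = 0, where \<open>h\<close>
  has the value \<open>d\<close> on an interval to the right of \<open>s\<close> so short that all
  \<open>f i\<close> are constant there. This extracts the values \<open>f i s\<close> from the
  exponential vectors, and so makes \<open>nabla\<close> well defined.\<close>

lemma kf_sum_derivative:
 fixes f :: "'i => real => 'k::complex_hilbert"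
 assumes I: "finite I" and f: "!!i. i : I ==> f i : step_funs" and s: "s >= 0"
  and z: "!!k. k : step_funs ==> (SUM i:I. a i * kf k (f i)) = 0" and k: "k : step_funs"
 shows "(SUM i:I. a i * kf k (f i) * cinner d (f i s)) = 0"
proof -
 obtain e where e': "e > 0 & (ALL i:I. ALL y:{s..<s + e}. f i y = f i s)"
  using steps_right_const[where f = f, OF I f, of s] ..
 have e: "e > 0" "!!i y. i : I ==> y : {s..<s + e} ==> f i y = f i s" using conjunct1[OF e'] conjunct2[OF e', THEN bspec, THEN bspec] .
 define h where "h t = indicator {s..<s+e} t *r d" for t
 have hs: "h : step_funs" unfolding h_def using s by (rule step_indicator)
 have b: "cinner (L2_class h) (L2_class (f i)) = of_real e * cinner d (f i s)" if i: "i : I" for i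
 proof -
  have "cinner (h t) (f i t) = indicator {s..<s+e} t *r cinner d (f i s)" for t
   using e(2)[OF i, of t] by (auto simp: h_def indicator_def)
  thus ?thesis using hs f[OF i] e(1) by (simp add: cinner_L2_class scaleR_conv_of_real)
 qed
 define c where "c i = a i * exp (- of_real ((norm (L2_class (f i)))^2) / 2 + cinner (L2_class k) (L2_class (f i)))" for i
 have kfe: "kf k' (f i) = exp (- of_real ((norm (L2_class k'))^2) / 2) * exp (- of_real ((norm (L2_class (f i)))^2) / 2 + cinner (L2_class k') (L2_class (f i)))" for k' i
  by (simp add: kf_def varpi_def cinner_exp_exp exp_add[symmetric] algebra_simps)
 \<comment> \<open>The common factor from the normalisation of \<open>k'\<close> is split off,
   leaving a sum of exponentials in \<open>x\<close>.\<close>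
 have sum0: "(SUM i:I. c i * exp (of_real x * (of_real e * cinner d (f i s)))) = 0" for x
 proof -
  have st: "(%t. of_real x *c h t) : step_funs" by (rule step_scaleC[OF hs])
  define k' where "k' t = k t + of_real x *c h t" for t
  have k': "k' : step_funs" using step_add[OF k st] by (simp add: k'_def[abs_def] add.commute)
  have L: "L2_class k' = L2_class k + of_real x *c L2_class h"
   unfolding k'_def using k hs st by (simp add: L2_class_add L2_class_scaleC)
  have "(SUM i:I. a i * kf k' (f i)) = exp (- of_real ((norm (L2_class k'))^2) / 2) * (SUM i:I. c i * exp (of_real x * (of_real e * cinner d (f i s))))"
   unfolding sum_distrib_left
   by (intro sum.cong refl) (simp add: kfe[of k'] c_def L cinner_add_left cinner_scaleC_left b exp_add[symmetric] algebra_simps)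
  thus ?thesis using z[OF k'] by simp
 qed
 have "((%x::real. SUM i:I. c i * exp (of_real x * (of_real e * cinner d (f i s)))) has_vector_derivative
   (SUM i:I. c i * (of_real e * cinner d (f i s)))) (at 0)"
 proof (rule has_vector_derivative_sum)
  fix i
  have "((%x. c i * exp (x * (of_real e * cinner d (f i s)))) has_field_derivative c i * (of_real e * cinner d (f i s))) (at (of_real 0))"
   by (auto intro!: derivative_eq_intros)
  from has_vector_derivative_real_field[OF this]
  show "((%x::real. c i * exp (of_real x * (of_real e * cinner d (f i s)))) has_vector_derivative c i * (of_real e * cinner d (f i s))) (at 0)" .
 qed
 hence "((%x::real. 0) has_vector_derivative (SUM i:I. c i * (of_real e * cinner d (f i s)))) (at 0)" unfolding sum0 .
 hence "(SUM i:I. c i * (of_real e * cinner d (f i s))) = 0" using vector_derivative_unique_at has_vector_derivative_const by blast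
 hence "of_real e * (SUM i:I. c i * cinner d (f i s)) = 0" by (simp add: sum_distrib_left mult.left_commute)
 hence "(SUM i:I. c i * cinner d (f i s)) = 0" using e(1) by simp
 moreover have "(SUM i:I. a i * kf k (f i) * cinner d (f i s)) = exp (- of_real ((norm (L2_class k))^2) / 2) * (SUM i:I. c i * cinner d (f i s))"
  unfolding sum_distrib_left by (intro sum.cong refl) (simp add: kfe[of k] c_def)
 ultimately show ?thesis by simp
qed

lemma nabla_props:
 assumes s: "s >= 0"
 shows "lin_operator (nabla s :: ('h::complex_hilbert, 'k::complex_hilbert) hf \<rightharpoonup> _)"
  "dom (nabla s :: ('h, 'k) hf \<rightharpoonup> _) = exp_domain"
  "f : step_funs ==> nabla s (u ox f :: ('h, 'k) hf) = Some ((1, f s) \<odot> (u ox f))"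
proof -
 define S where "S = {(u ox f, (1::complex, f s) \<odot> (u ox f)) | (u::'h) (f::real => 'k). f : step_funs}"
 have rep: "EX n u f. (ALL i<n. f i : step_funs) & p = (\<Sum>i<(n::nat). u i ox f i, \<Sum>i<n. (1, f i s) \<odot> (u i ox f i))"
  if "p : cvec.span S" for p
  using that
 proof (induction rule: cvec.span_induct_alt)
  case base show ?case by (intro exI[of _ 0]) (simp add: zero_prod_def)
 next
  case (step c x y)
  then obtain n u f v g where y: "ALL i<n. f i : step_funs" "y = (\<Sum>i<(n::nat). u i ox f i, \<Sum>i<n. (1, f i s) \<odot> (u i ox f i))"
   and x: "x = (v ox g, (1, g s) \<odot> (v ox g))" "g : step_funs" unfolding S_def by blast
  show ?case
   by (rule exI[of _ "Suc n"], rule exI[of _ "u(n := c *c v)"], rule exI[of _ "f(n := g)"])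
    (use x y in "auto simp: less_Suc_eq tensor_scaleC_left tensor_scaleC_right scaleC_prod_def add.commute")
 qed
 have single: "y = 0" if y0: "(0, y) : cvec.span S" for y
 proof -
  obtain n u f where f: "ALL i<n. f i : step_funs" and z: "0 = (\<Sum>i<(n::nat). u i ox f i)" and y: "y = (\<Sum>i<n. (1, f i s) \<odot> (u i ox f i))"
   using rep[OF y0] by auto
  have k0: "(\<Sum>i<n. cinner w (u i) * kf k (f i)) = 0" for w k
   using arg_cong[OF z[symmetric], of "cinner (w ox k)"] by (simp add: cinner_sum_right kf_def)
  show ?thesis
  proof (rule totalD[OF total_tensor[OF total_UNIV total_uvarpi]])
   fix x :: "('k, ('h, 'k) hf) ch"
   assume "x : {s \<odot> s' | s s'. s : UNIV & s' : (%(u, f). u ox f) ` (UNIV \<times> step_funs)}"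
   then obtain a d w k where x: "x = (a, d) \<odot> (w ox k)" and k: "k : step_funs" by auto
   \<comment> \<open>The scalar component vanishes by \<open>k0\<close>, the component along
     \<open>d\<close> by differentiating the same relation.\<close>
   have "cinner x y = cnj a * (\<Sum>i<n. cinner w (u i) * kf k (f i)) + (\<Sum>i<n. cinner w (u i) * kf k (f i) * cinner d (f i s))"
    by (simp add: x y cinner_sum_right kf_def cinner_prod_def cinner_complex_def sum_distrib_left sum.distrib algebra_simps)
   also have "(\<Sum>i<n. cinner w (u i) * kf k (f i) * cinner d (f i s)) = 0"
    by (rule kf_sum_derivative[OF _ _ s _ k]) (use f k0 in auto)
   finally show "cinner x y = 0" by (simp add: k0)
  qed
 qed
 have fS: "cvec.span (fst ` S) = exp_domain"
  unfolding exp_domain_def S_def by (rule arg_cong[of _ _ cvec.span]) (force)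
 have "nabla s = (THE D. lin_operator D & dom D = cvec.span (fst ` S) & (ALL p:S. D (fst p) = Some (snd p)))"
  unfolding nabla_def fS by (rule arg_cong[of _ _ The]) (simp add: S_def fun_eq_iff, metis)
 note N = theI'[OF graph_operator[of S, OF single], folded this]
 show "lin_operator (nabla s :: ('h, 'k) hf \<rightharpoonup> _)" "dom (nabla s :: ('h, 'k) hf \<rightharpoonup> _) = exp_domain"
  using N by (simp_all add: fS)
 assume "f : step_funs"
 hence "(u ox f, (1, f s) \<odot> (u ox f)) : S" unfolding S_def by blast
 from bspec[OF conjunct2[OF conjunct2[OF N]] this]
 show "nabla s (u ox f :: ('h, 'k) hf) = Some ((1, f s) \<odot> (u ox f))" by simp
qed

lemma exp_in [simp]: "f : step_funs ==> u ox f : exp_domain"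
 unfolding exp_domain_def by (rule cvec.span_base) blast

lemma nabla_sum:
 assumes "s >= 0" "!!i. i : I ==> f i : step_funs"
 shows "the (nabla s (SUM i:I. u i ox f i)) = (SUM i:I. (1, f i s) \<odot> (u i ox f i))"
 using lin_operator_sum[OF nabla_props(1)[OF assms(1)], of I "%i. u i ox f i"] assms by (simp add: nabla_props)

lemma ampliation_props:
 fixes X :: "'a::complex_hilbert \<rightharpoonup> 'a"
 assumes X: "lin_operator X"
 shows "lin_operator (ampliation X :: ('c::complex_hilbert, 'a) tensor \<rightharpoonup> _)"
  "dom (ampliation X :: ('c, 'a) tensor \<rightharpoonup> _) = cvec.span {x \<odot> z | x z. z : dom X}"
  "z : dom X ==> ampliation X ((x::'c) \<odot> z) = Some (x \<odot> the (X z))"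
proof -
 define S where "S = {(x \<odot> z, x \<odot> the (X z)) | (x::'c) z. z : dom X}"
 \<comment> \<open>Slicing the first leg sends pairs in the span of the prescribed graph to pairs in
   the graph of \<open>X\<close>; hence that span is single valued.\<close>
 have rep: "adj (lket e) (fst p) : dom X & the (X (adj (lket e) (fst p))) = adj (lket e) (snd p)" if "p : cvec.span S" for p e
  using that
 proof (induction rule: cvec.span_induct_alt)
  case base show ?case using lin_operatorD(4)[OF X] cvec.subspace_0[OF lin_operatorD(1)[OF X]] by simp
 next
  case (step c p y)
  then obtain x z where p: "p = (x \<odot> z, x \<odot> the (X z))" "z : dom X" unfolding S_def by blast
  have 1: "adj (lket e) (c *c v + w) = c *c adj (lket e) v + adj (lket e) w" for v w :: "('c, 'a) tensor"
   by (simp add: blinfun.add_right bopsD)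
  show ?case
   using step p lin_operatorD(2,3)[OF X] cvec.subspace_scale[OF lin_operatorD(1)[OF X]] cvec.subspace_add[OF lin_operatorD(1)[OF X]]
   by (simp add: 1 scaleC_prod_def)
 qed
 have single: "y = 0" if y0: "(0, y) : cvec.span S" for y
 proof (rule totalD[OF total_tensor_range])
  fix x :: "('c, 'a) tensor" assume "x : range (%(x, y). x \<odot> y)"
  then obtain e h where x: "x = e \<odot> h" by auto
  have "cinner h (adj (lket e) y) = 0" using rep[OF y0, of e] lin_operatorD(4)[OF X] by simp
  thus "cinner x y = 0" by (simp add: x cinner_adj_right)
 qed
 have fS: "cvec.span (fst ` S) = cvec.span {x \<odot> z | x z. z : dom X}"
  unfolding S_def by (rule arg_cong[of _ _ cvec.span]) (force)
 have "ampliation X = (THE D. lin_operator D & dom D = cvec.span (fst ` S) & (ALL p:S. D (fst p) = Some (snd p)))"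
  unfolding ampliation_def fS by (rule arg_cong[of _ _ The]) (simp add: S_def fun_eq_iff, metis)
 note N = theI'[OF graph_operator[of S, OF single], folded this]
 show "lin_operator (ampliation X :: ('c, 'a) tensor \<rightharpoonup> _)"
  "dom (ampliation X :: ('c, 'a) tensor \<rightharpoonup> _) = cvec.span {x \<odot> z | x z. z : dom X}"
  using N by (simp_all only: fS)
 assume "z : dom X"
 hence "(x \<odot> z, x \<odot> the (X z)) : S" unfolding S_def by blast
 from bspec[OF conjunct2[OF conjunct2[OF N]] this]
 show "ampliation X ((x::'c) \<odot> z) = Some (x \<odot> the (X z))" by simp
qed

section \<open>Quantum stochastic integrals\<close>

lemma Delta_props:
 shows "(Delta :: ('k::complex_hilbert, 'b::complex_hilbert) ch =>L _) : bops"
  "Delta ((a, d::'k) \<odot> (y::'b)) = (0, d) \<odot> y"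
  "cinner ((0, d) \<odot> y) (Delta x) = cinner ((0, d) \<odot> y) (x :: ('k, 'b) ch)"
  "cinner ((a, 0) \<odot> y) (Delta_perp x) = cinner ((a, 0) \<odot> y) (x :: ('k, 'b) ch)"
  "Delta_perp x + Delta x = (x :: ('k, 'b) ch)"
proof -
 let ?D = "Blinfun (%(z::complex, c::'k). (0::complex, c))"
 have D: "?D : bops" "blinfun_apply ?D p = (0, snd p)" for p
  using bops_Blinfun[of "%(z::complex, c::'k). (0::complex, c)" 1]
  by (cases p, auto simp: linear_on_def scaleC_prod_def norm_snd_le)+
 have b: "(Delta :: ('k, 'b) ch =>L _) : bops" and v: "Delta ((a, d::'k) \<odot> (y::'b)) = (0, d) \<odot> y" for a d y
  using D by (auto simp: Delta_def)
 thus "(Delta :: ('k, 'b) ch =>L _) : bops" "Delta ((a, d::'k) \<odot> (y::'b)) = (0, d) \<odot> y" by auto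
 have "adj ?D = ?D" by (rule adjI[OF D(1)]) (simp add: D cinner_prod_def)
 hence a: "adj Delta = (Delta :: ('k, 'b) ch =>L _)" using D by (simp add: Delta_def adj_tensor_op)
 have c: "cinner x' (Delta x) = cinner (Delta x') x" for x x' :: "('k, 'b) ch"
  using cinner_adj_left[OF b, of x' x] by (simp add: a)
 show "cinner ((0, d) \<odot> y) (Delta x) = cinner ((0, d) \<odot> y) (x :: ('k, 'b) ch)" by (simp add: c v)
 have "((0, 0) :: complex \<times> 'k) \<odot> y = 0" by (simp flip: zero_prod_def)
 thus "cinner ((a, 0) \<odot> y) (Delta_perp x) = cinner ((a, 0) \<odot> y) (x :: ('k, 'b) ch)"
  by (simp add: Delta_perp_def blinfun.diff_left cinner_diff_right c v)
 show "Delta_perp x + Delta x = (x :: ('k, 'b) ch)" by (simp add: Delta_perp_def blinfun.diff_left)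
qed

lemma ket2_props:
 "ket2 x y : bops" "blinfun_apply (ket2 x y) u = x \<odot> (u \<odot> y)"
 unfolding ket2_def
 by (rule bops_Blinfun[where C = "norm x * norm y"], auto simp: linear_on_def tensor_add_left tensor_add_right tensor_scaleC_left tensor_scaleC_right)+

section \<open>Adapted integrands\<close>

lemma varpi_perturb:
 assumes f: "f : step_funs" and s: "s >= 0"
 shows "(%n. varpi (%t. f t + indicator {s..<s + 1 / real (Suc n)} t *r w)) ----> varpi f"
 unfolding varpi_def
proof (rule exp_continuous)
 let ?h = "%n t. indicator {s..<s + 1 / real (Suc n)} t *r w"
 have h: "?h n : step_funs" for n using s by (rule step_indicator)
 have "(norm (L2_class (?h n)))^2 = (1 / real (Suc n)) * (norm w)^2" for n
 proof -
  have "(norm (?h n t))^2 = indicator {s..<s + 1 / real (Suc n)} t *r (norm w)^2" for t by (simp add: indicator_def)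
  thus ?thesis using h[of n] by (simp add: norm_L2_class del: of_nat_Suc)
 qed
 hence "(%n. (norm (L2_class (?h n)))^2) ----> 0"
  using LIMSEQ_Suc[OF lim_const_over_n[of "(norm w)^2"]] by (simp del: of_nat_Suc)
 hence "(%n. sqrt ((norm (L2_class (?h n)))^2)) ----> sqrt 0" by (rule tendsto_real_sqrt)
 hence "(%n. L2_class (?h n)) ----> 0" by (simp add: tendsto_norm_zero_iff)
 hence "(%n. L2_class f + L2_class (?h n)) ----> L2_class f + 0" by (intro tendsto_intros)
 thus "(%n. L2_class (%t. f t + ?h n t)) ----> L2_class f" using f h by (simp add: L2_class_add)
qed

text \<open>The form in which adaptedness enters the estimate: against \<open>z s\<close>, the part
  of \<open>f\<close> after \<open>s\<close> counts only through its inner product with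
  \<open>varpi (hi s g)\<close>.\<close>

definition adapted_vec :: "(real => 'k) => (real => ('k::complex_hilbert, ('h::complex_hilbert, 'k) hf) ch) => bool" where
 "adapted_vec g z \<longleftrightarrow> (ALL s>=0. ALL f:step_funs. ALL x u. cinner (x \<odot> (u ox f)) (z s) =
  kf (hi s f) (hi s g) * cinner (x \<odot> (u ox glue s f g)) (z s))"

text \<open>The definition of \<open>qs_integrable\<close> tests only vectors whose first leg (1, f
  s) is tied to \<open>f\<close>. Giving \<open>f\<close> the value \<open>d\<close> on a shrinking
  interval to the right of \<open>s\<close> decouples the two: in the limit the exponential vector
  is that of \<open>f\<close>, while the first leg stays (1, d). Every first leg is a combination of
  (1, 0) and some (1, d).\<close>

lemma qs_integrable_adapted:
 fixes G :: "real => ('k::complex_hilbert, ('h::complex_hilbert, 'k) hf) ch \<rightharpoonup> _"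
 assumes G: "qs_integrable G" and s: "s >= 0" and f: "f : step_funs" and g: "g : step_funs"
 shows "cinner (x \<odot> (u ox f)) (the (G s (the (nabla s (v ox g))))) =
  kf (hi s f) (hi s g) * cinner (x \<odot> (u ox lo s f)) (the (G s ((1, g s) \<odot> (v ox lo s g))))"
proof -
 define z where "z = the (G s (the (nabla s (v ox g))))"
 define z' where "z' = the (G s ((1, g s) \<odot> (v ox lo s g)))"
 have 1: "cinner ((1, f s) \<odot> (u ox f)) z = kf (hi s f) (hi s g) * cinner ((1, f s) \<odot> (u ox lo s f)) z'"
  if f: "f : step_funs" for f u
 proof -
  have "blinfun_apply (adj (ket2 (1, f s) (varpi f))) z = kf (hi s f) (hi s g) *c blinfun_apply (adj (ket2 (1, f s) (varpi (lo s f)))) z'"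
   using G s f g unfolding qs_integrable_def z_def z'_def kf_def ket2_props ket_apply by blast
  from arg_cong[OF this, of "cinner u"] show ?thesis by (simp add: cinner_adj_right ket2_props cinner_scaleC_right)
 qed
 have 2: "cinner ((1, d) \<odot> (u ox f)) z = kf (hi s f) (hi s g) * cinner ((1, d) \<odot> (u ox lo s f)) z'" for d
 proof -
  define F where "F n t = f t + indicator {s..<s + 1 / real (Suc n)} t *r (d - f s)" for n t
  have F: "F n : step_funs" for n unfolding F_def[abs_def] using f s by (rule step_add_indicator)
  have Fs: "F n s = d" "lo s (F n) = lo s f" "hi s (F n) = (%t. hi s f t + indicator {s..<s + 1 / real (Suc n)} t *r (d - f s))" for n
   by (auto simp: F_def cut_def indicator_def)
  have lim1: "(%n. cinner ((1, d) \<odot> (u ox F n)) z) ----> cinner ((1, d) \<odot> (u ox f)) z"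
   unfolding F_def
   by (intro tendsto_cinner tendsto_const bounded_linear.tendsto[OF blinfun.bounded_linear_right, of _ _ _ "lket (1, d) oo lket u", simplified] varpi_perturb[OF f s])
  have lim2: "(%n. kf (hi s (F n)) (hi s g) * cinner ((1, d) \<odot> (u ox lo s f)) z') ---->
    kf (hi s f) (hi s g) * cinner ((1, d) \<odot> (u ox lo s f)) z'"
   unfolding Fs kf_def using f s by (intro tendsto_intros tendsto_cinner varpi_perturb) simp_all
  show ?thesis
   using 1[OF F, of _ u] LIMSEQ_unique[OF lim1] lim2 unfolding Fs by simp
 qed
 obtain a d where x: "x = (a, d)" by force
 have "x = (a - 1) *c (1, 0) + (1, d)" by (simp add: x scaleC_prod_def scaleC_complex_def)
 hence "x \<odot> y = (a - 1) *c ((1, 0) \<odot> y) + (1, d) \<odot> y" for y :: "('h, 'k) hf"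
  by (simp only: tensor_add_left tensor_scaleC_left)
 thus ?thesis unfolding z_def[symmetric] z'_def[symmetric]
  by (simp only: cinner_add_left cinner_scaleC_left 2[of 0] 2[of d]) (simp add: algebra_simps)
qed

lemma qs_integrable_adapted_vec:
 fixes G :: "real => ('k::complex_hilbert, ('h::complex_hilbert, 'k) hf) ch \<rightharpoonup> _"
 assumes G: "qs_integrable G" and g: "g : step_funs"
 shows "adapted_vec g (%s. the (G s (the (nabla s (v ox g)))))"
 unfolding adapted_vec_def
proof (intro allI ballI impI)
 fix s :: real and f :: "real => 'k" and x u assume s: "s >= 0" and f: "f : step_funs"
 show "cinner (x \<odot> (u ox f)) (the (G s (the (nabla s (v ox g))))) = kf (hi s f) (hi s g) *
   cinner (x \<odot> (u ox glue s f g)) (the (G s (the (nabla s (v ox g)))))"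
  unfolding qs_integrable_adapted[OF G s f g] qs_integrable_adapted[OF G s step_glue[OF f g] g] by simp
qed

lemma step_support:
 assumes "f : step_funs" shows "EX T. ALL t>=T. f t = 0"
 using assms
proof (induction rule: step_induct)
 case (add f a b c)
 then obtain T where T: "ALL t>=T. f t = 0" by blast
 show ?case by (rule exI[of _ "max T b"]) (use T in "simp")
qed simp

text \<open>The image of \<open>varpi f\<close> under the projection that leaves the part before
  \<open>s\<close> alone and projects the part after \<open>s\<close> onto the line of
  \<open>varpi (hi s g)\<close>.\<close>

definition qproj :: "real => (real => 'k::complex_hilbert) => (real => 'k) => 'k Fock" where
 "qproj s g f = kf (hi s g) (hi s f) *c varpi (glue s f g)"

lemma eker_diff:
 "eker a b - eker a c - eker c b = cinner (a - c) (b - c :: 'k::complex_hilbert)"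
 by (simp add: eker_def cinner_diff_left cinner_diff_right)

lemma step_diff [simp]: "f : step_funs ==> g : step_funs ==> (%t. f t - g t :: 'k::complex_hilbert) : step_funs"
 using step_add[of f "%t. (-1) *c g t"] step_scaleC[of g "-1"] by (simp)

lemma step_cinner_integrable:
 assumes "f : step_funs" "g : step_funs" "S : sets lebesgue"
 shows "set_integrable lebesgue S (%t. cinner (f t) (g t))"
 unfolding set_integrable_def
 by (rule integrable_mult_indicator[OF assms(3)]) (use assms in "auto intro: sq_integrable_cinner")

text \<open>After \<open>s\<close> the two functions are compared through \<open>g\<close>, before
  \<open>s\<close> directly. By \<open>eker_diff\<close> the exponents differ by the integral of <f
  - g, f' - g>, so the dependence on \<open>s\<close> is an indefinite integral that can be
  differentiated.\<close>

lemma cinner_qproj: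
 assumes f: "f : step_funs" "f' : step_funs" and g: "g : step_funs" and s: "s >= 0"
 shows "cinner (qproj s g f) (qproj s g f') =
  exp ((LINT t|lebesgue. eker (f t) (g t) + eker (g t) (f' t)) + integral {0..s} (%t. cinner (f t - g t) (f' t - g t)))"
proof -
 have "cinner (qproj s g f) (qproj s g f') = kf (hi s f) (hi s g) * kf (hi s g) (hi s f') * kf (glue s f g) (glue s f' g)"
  unfolding qproj_def cinner_scaleC_left cinner_scaleC_right kf_commute[of "hi s f" "hi s g"] by (simp add: kf_def)
 also have "kf (glue s f g) (glue s f' g) = kf (lo s f) (lo s f')"
  using kf_split[of "glue s f g" "glue s f' g" s] f g by simp
 also have "kf (hi s f) (hi s g) * kf (hi s g) (hi s f') * kf (lo s f) (lo s f') =
   exp (LINT t|lebesgue. eker (hi s f t) (hi s g t) + eker (hi s g t) (hi s f' t) + eker (lo s f t) (lo s f' t))"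
  using f g by (simp add: kf_eq exp_add[symmetric] eker_integrable)
 also have "(LINT t|lebesgue. eker (hi s f t) (hi s g t) + eker (hi s g t) (hi s f' t) + eker (lo s f t) (lo s f' t)) =
   (LINT t|lebesgue. (eker (f t) (g t) + eker (g t) (f' t)) + indicator {0..<s} t *r cinner (f t - g t) (f' t - g t))"
 proof (rule Bochner_Integration.integral_cong[OF refl])
  fix t
  show "eker (hi s f t) (hi s g t) + eker (hi s g t) (hi s f' t) + eker (lo s f t) (lo s f' t) =
    (eker (f t) (g t) + eker (g t) (f' t)) + indicator {0..<s} t *r cinner (f t - g t) (f' t - g t)"
   using step_neg[OF f(1), of t] step_neg[OF f(2), of t] step_neg[OF g, of t] s
   unfolding eker_diff[symmetric] by (auto simp: cut_def indicator_def)
 qed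
 also have "... = (LINT t|lebesgue. eker (f t) (g t) + eker (g t) (f' t)) + (LINT t:{0..<s}|lebesgue. cinner (f t - g t) (f' t - g t))"
  unfolding set_lebesgue_integral_def
  using f g step_cinner_integrable[of "%t. f t - g t" "%t. f' t - g t" "{0..<s}"]
  by (intro Bochner_Integration.integral_add) (auto simp: set_integrable_def intro: eker_integrable)
 also have "(LINT t:{0..<s}|lebesgue. cinner (f t - g t) (f' t - g t)) = integral {0..<s} (%t. cinner (f t - g t) (f' t - g t))"
  using f g by (intro set_lebesgue_integral_eq_integral step_cinner_integrable) auto
 also have "... = integral {0..s} (%t. cinner (f t - g t) (f' t - g t))"
  by (rule integral_spike_set; rule negligible_subset[of "{s}"]) auto
 finally show ?thesis .
qed

lemma tensor_sum_norm:
 "complex_of_real ((norm (SUM i:I. u i \<odot> x i))^2) = (SUM i:I. SUM j:I. cinner (u i) (u j) * cinner (x i) (x j))"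
 unfolding cinner_self_norm[symmetric] by (simp add: cinner_sum_left cinner_sum_right) (rule sum.swap)

text \<open>The integrated quantity is the right derivative of the squared norm of \<open>\<Sum>i. u i \<odot> qproj s g (f i)\<close>,
 which increases to the squared norm of \<open>\<Sum>i. u i \<odot> varpi (f i)\<close>.\<close>

lemma qproj_weight:
 fixes f :: "'i => real => 'k::complex_hilbert" and u :: "'i => 'h::complex_hilbert"
 assumes I: "finite I" and f: "!!i. i : I ==> f i : step_funs" and g: "g : step_funs" and rt: "0 <= r" "r <= t"
 defines "w == %s. SUM i:I. ((0::complex), f i s - g s) \<odot> (u i \<odot> qproj s g (f i))"
 shows "set_integrable lebesgue {r..t} (%s. (norm (w s))^2)"
  "(LINT s:{r..t}|lebesgue. (norm (w s))^2) <= (norm (SUM i:I. u i ox f i))^2"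
proof -
 define c where "c i j = (LINT t|lebesgue. eker (f i t) (g t) + eker (g t) (f j t))" for i j
 define e where "e i j t = cinner (f i t - g t) (f j t - g t)" for i j t
 define E where "E i j s = exp (c i j + integral {0..s} (e i j))" for i j s
 define P where "P s = (SUM i:I. SUM j:I. cinner (u i) (u j) * E i j s)" for s
 define p where "p s = (SUM i:I. SUM j:I. cinner (u i) (u j) * (e i j s * E i j s))" for s
 have qq: "cinner (qproj s g (f i)) (qproj s g (f j)) = E i j s" if "i : I" "j : I" "s >= 0" for i j s
  using cinner_qproj[OF f[OF that(1)] f[OF that(2)] g that(3)] by (simp add: E_def c_def e_def[abs_def])
 have P: "P s = complex_of_real ((norm (SUM i:I. u i \<odot> qproj s g (f i)))^2)" if "s >= 0" for s
  unfolding tensor_sum_norm P_def using that by (intro sum.cong refl) (simp add: qq)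
 have p: "p s = complex_of_real ((norm (w s))^2)" if "s >= 0" for s
  unfolding w_def tensor_sum_norm p_def using that
  by (intro sum.cong refl) (simp add: qq e_def cinner_prod_def)
 have ei: "set_integrable lebesgue {0..T} (e i j)" if "i : I" "j : I" for i j T
  unfolding e_def[abs_def] using f g that by (intro step_cinner_integrable) auto
 hence ei': "e i j integrable_on {0..T}" if "i : I" "j : I" for i j T using that set_lebesgue_integral_eq_integral(1) by blast
 have Ec: "continuous_on {0..T} (E i j)" if "i : I" "j : I" for i j T
  unfolding E_def using that by (intro continuous_intros indefinite_integral_continuous_1 ei')
 have er: "continuous (at s within {s..}) (e i j)" if "i : I" "j : I" for i j s
  unfolding e_def continuous_within
  using step_rcont[OF f[OF that(1)], of s] step_rcont[OF f[OF that(2)], of s] step_rcont[OF g, of s]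
  by (intro tendsto_cinner tendsto_intros) (simp_all add: continuous_within)
 have Er: "continuous (at s within {s..}) (E i j)" if "i : I" "j : I" "s >= 0" for i j s
 proof -
  have "continuous (at s within {s..s+1}) (E i j)"
  proof (rule continuous_within_subset)
   show "continuous (at s within {0..s+1}) (E i j)"
    by (rule bspec[OF Ec[OF that(1,2), of "s + 1", unfolded continuous_on_eq_continuous_within]]) (use that in simp)
  qed (use that in auto)
  thus ?thesis by (simp add: at_within_Icc_at_right at_within_Ici_at_right)
 qed
 have pr: "continuous (at s within {s..}) p" if "s >= 0" for s
  unfolding p_def using that by (intro continuous_intros er Er)
 have Pd: "(P has_vector_derivative p s) (at s within {s..T})" if s: "0 <= s" "s < T" for s T
 proof -
  have "((%s. E i j s) has_vector_derivative e i j s * E i j s) (at s within {s..T})" if ij: "i : I" "j : I" for i j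
  proof -
   have "((%u. integral {s..u} (e i j)) has_vector_derivative e i j s) (at s within {s..T} - {})"
    by (rule integral_has_vector_derivative_continuous_at)
     (use s integrable_subinterval_real[OF ei'[OF ij, of T]] in "auto intro: continuous_within_subset[OF er[OF ij]]")
   hence "((%u. c i j + integral {0..s} (e i j) + integral {s..u} (e i j)) has_vector_derivative 0 + e i j s) (at s within {s..T})"
    by (intro has_vector_derivative_add has_vector_derivative_const) simp
   hence "((%u. c i j + integral {0..u} (e i j)) has_vector_derivative e i j s) (at s within {s..T})"
    unfolding add_0
   proof (rule has_vector_derivative_transform_within[OF _ zero_less_one])
    show "c i j + integral {0..s} (e i j) + integral {s..u} (e i j) = c i j + integral {0..u} (e i j)" if "u : {s..T}" for u
     using Henstock_Kurzweil_Integration.integral_combine[OF _ _ ei'[OF ij, of u], of s] s that by simp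
   qed (use s in auto)
   from field_vector_diff_chain_within[OF this, of exp "exp (c i j + integral {0..s} (e i j))"]
   show ?thesis by (simp add: o_def E_def DERIV_exp[THEN DERIV_subset])
  qed
  thus ?thesis unfolding P_def p_def by (intro has_vector_derivative_sum has_vector_derivative_mult_right)
 qed
 have int: "set_integrable lebesgue {0..T} p" for T
 proof -
  have "set_integrable lebesgue {0..T} (%s. e i j s * E i j s)" if ij: "i : I" "j : I" for i j
  proof -
   have "bounded (E i j ` {0..T})" using compact_continuous_image[OF Ec[OF ij]] compact_imp_bounded by blast
   moreover have "E i j : borel_measurable (lebesgue_on {0..T})" using Ec[OF ij] by (intro continuous_imp_measurable_on_sets_lebesgue) auto
   ultimately show ?thesis using absolutely_integrable_bounded_measurable_product[of "(*)" "E i j" "{0..T}" "e i j"] ei[OF ij]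
    by (simp add: mult.commute bilinear_conv_bounded_bilinear bounded_bilinear_mult)
  qed
  thus ?thesis
   unfolding p_def by (intro absolutely_integrable_sum I set_integrable_mult_right) auto
 qed
 have ire: "set_integrable lebesgue {0..T} (%s. (norm (w s))^2)" for T
 proof -
  have "set_integrable lebesgue {0..T} (%s. complex_of_real ((norm (w s))^2))"
   using int[of T] by (rule set_integrable_cong[THEN iffD1, rotated -1]) (auto simp: p)
  thus ?thesis unfolding set_integrable_def scaleR_conv_of_real of_real_mult[symmetric] complex_of_real_integrable_eq by simp
 qed
 show "set_integrable lebesgue {r..t} (%s. (norm (w s))^2)"
  by (rule set_integrable_subset[OF ire[of t]]) (use rt in auto)
 \<comment> \<open>Beyond the supports of all functions involved \<open>qproj\<close> acts as the
   identity, so the increasing quantity ends at the squared norm of the original vector.\<close>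
 have "EX T>=t. (ALL s>=T. g s = 0) & (ALL i:I. ALL s>=T. f i s = 0)"
  using I f
 proof (induction I rule: finite_induct)
  case empty
  obtain T where T: "ALL t>=T. g t = 0" using step_support[OF g] ..
  thus ?case by (intro exI[of _ "max t T"]) simp
 next
  case (insert i I)
  then obtain T where T: "T >= t" "ALL s>=T. g s = 0" "ALL i:I. ALL s>=T. f i s = 0" by auto
  obtain T' where T': "ALL t>=T'. f i t = 0" using step_support[of "f i"] insert.prems by auto
  show ?case using T T' by (intro exI[of _ "max T T'"]) simp
 qed
 then obtain T where T: "T >= t" "!!s. s >= T ==> g s = 0" "!!i s. i : I ==> s >= T ==> f i s = 0" by blast
 have qT: "qproj T g (f i) = varpi (f i)" if "i : I" for i
 proof -
  have "hi T g = (%_. 0)" "hi T (f i) = (%_. 0)" "glue T (f i) g = f i"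
   using T(2,3) step_neg[OF f[OF that]] that by (auto simp: cut_def indicator_def glue_def)
  thus ?thesis by (simp add: qproj_def)
 qed
 have T0: "0 <= T" using T rt by simp
 have "(LINT s:{r..t}|lebesgue. (norm (w s))^2) <= (LINT s:{0..T}|lebesgue. (norm (w s))^2)"
  unfolding set_lebesgue_integral_def
 proof (rule integral_mono)
  show "integrable lebesgue (%s. indicator {r..t} s *r (norm (w s))^2)"
   using set_integrable_subset[OF ire[of t], of "{r..t}"] rt by (simp add: set_integrable_def)
  show "integrable lebesgue (%s. indicator {0..T} s *r (norm (w s))^2)" using ire by (simp add: set_integrable_def)
  show "indicator {r..t} s *r (norm (w s))^2 <= indicator {0..T} s *r (norm (w s))^2" for s
   using T rt by (simp add: indicator_def)
 qed
 also have "... = Re (LINT s:{0..T}|lebesgue. p s)"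
 proof -
  have "(LINT s:{0..T}|lebesgue. p s) = complex_of_real (LINT s:{0..T}|lebesgue. (norm (w s))^2)"
   unfolding set_lebesgue_integral_def integral_complex_of_real[symmetric]
   by (rule Bochner_Integration.integral_cong) (auto simp: p indicator_def)
  thus ?thesis by simp
 qed
 also have "(LINT s:{0..T}|lebesgue. p s) = P T - P 0"
  unfolding set_lebesgue_integral_eq_integral(2)[OF int]
 proof (rule integral_right_derivative[OF T0])
  show "continuous_on {0..T} P" unfolding P_def by (intro continuous_intros Ec)
  show "p integrable_on {0..T}" using set_lebesgue_integral_eq_integral(1)[OF int] .
  show "continuous (at x within {x..T}) p" if "0 <= x" "x < T" for x by (rule continuous_within_subset[OF pr[OF that(1)]]) auto
 qed (rule Pd)
 also have "Re ... <= (norm (SUM i:I. u i ox f i))^2"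
  using T0 by (simp add: P qT del: of_real_power)
 finally show "(LINT s:{r..t}|lebesgue. (norm (w s))^2) <= (norm (SUM i:I. u i ox f i))^2" .
qed

text \<open>Inherited from the inner product of \<open>complex L2\<close>, with functions cut off
  outside \<open>S\<close>.\<close>

lemma Cauchy_Schwarz_real:
 fixes n m :: "real => real"
 assumes S: "S : sets lebesgue" "S \<subseteq> {0..}" and m: "(%s. indicator S s * n s) : borel_measurable lebesgue" "(%s. indicator S s * m s) : borel_measurable lebesgue"
  and i: "set_integrable lebesgue S (%s. (n s)^2)" "set_integrable lebesgue S (%s. (m s)^2)"
 shows "set_integrable lebesgue S (%s. n s * m s)"
  "\<bar>LINT s:S|lebesgue. n s * m s\<bar> <= sqrt (LINT s:S|lebesgue. (n s)^2) * sqrt (LINT s:S|lebesgue. (m s)^2)"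
proof -
 have sq: "sq_integrable (%s. complex_of_real (indicator S s * n s)) &
   (norm (L2_class (%s. complex_of_real (indicator S s * n s))))^2 = (LINT s:S|lebesgue. (n s)^2)"
  if n: "(%s. indicator S s * n s) : borel_measurable lebesgue" "set_integrable lebesgue S (%s. (n s)^2)" for n :: "real => real"
 proof -
  have "(%s. complex_of_real (indicator S s * n s)) : borel_measurable lebesgue" using n(1) by measurable
  hence sm: "strongly_measurable (%s. complex_of_real (indicator S s * n s))"
   unfolding strongly_measurable_def using borel_measurable_implies_sequence_metric[of "%s. complex_of_real (indicator S s * n s)" lebesgue 0]
   by (auto)
  have e: "(norm (complex_of_real (indicator S s * n s)))^2 = indicator S s *r (n s)^2" for s by (simp add: indicator_def)
  have sq: "sq_integrable (%s. complex_of_real (indicator S s * n s))"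
   unfolding sq_integrable_def e using sm n(2) S(2) by (auto simp: set_integrable_def indicator_def)
  thus ?thesis by (simp only: norm_L2_class e set_lebesgue_integral_def)
 qed
 note n = sq[OF m(1) i(1)] and m = sq[OF m(2) i(2)]
 let ?n = "%s. complex_of_real (indicator S s * n s)" and ?m = "%s. complex_of_real (indicator S s * m s)"
 have e: "cinner (?n s) (?m s) = complex_of_real (indicator S s *r (n s * m s))" for s by (simp add: cinner_complex_def indicator_def)
 have "integrable lebesgue (%s. complex_of_real (indicator S s *r (n s * m s)))"
  using sq_integrable_cinner[OF conjunct1[OF n] conjunct1[OF m]] unfolding e .
 thus "set_integrable lebesgue S (%s. n s * m s)" by (simp only: set_integrable_def complex_of_real_integrable_eq)
 have "\<bar>LINT s:S|lebesgue. n s * m s\<bar> = cmod (cinner (L2_class ?n) (L2_class ?m))"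
  unfolding cinner_L2_class[OF conjunct1[OF n] conjunct1[OF m]] e set_lebesgue_integral_def by (simp only: integral_complex_of_real norm_of_real)
 also have "... <= norm (L2_class ?n) * norm (L2_class ?m)" by (rule cmod_cinner_le)
 also have "... = sqrt (LINT s:S|lebesgue. (n s)^2) * sqrt (LINT s:S|lebesgue. (m s)^2)"
  unfolding conjunct2[OF n, symmetric] conjunct2[OF m, symmetric] by simp
 finally show "\<bar>LINT s:S|lebesgue. n s * m s\<bar> <= sqrt (LINT s:S|lebesgue. (n s)^2) * sqrt (LINT s:S|lebesgue. (m s)^2)" .
qed

section \<open>Integrable vector paths and the fundamental estimate\<close>

definition qs_vec :: "(real => ('k::complex_hilbert, 'b::complex_hilbert) ch) => bool" where
 "qs_vec z \<longleftrightarrow> locally_integrable (%s. Delta_perp (z s)) & locally_sq_integrable (%s. Delta (z s))"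

text \<open>The bound of the fundamental estimate: the drift part of \<open>z\<close> enters through
  its L1 norm, the noise part through its L2 norm and, weighted with the bound \<open>C\<close> of
  the comparison function, also through its L1 norm.\<close>

definition qs_bound :: "real => (real => ('k::complex_hilbert, 'b::complex_hilbert) ch) => real => real => real" where
 "qs_bound C z r t = (LINT s:{r..t}|lebesgue. norm (Delta_perp (z s)) + C * norm (Delta (z s))) + sqrt (LINT s:{r..t}|lebesgue. (norm (Delta (z s)))^2)"

lemma qs_vec_facts:
 fixes z :: "real => ('k::complex_hilbert, 'b::complex_hilbert) ch"
 assumes z: "qs_vec z" and r: "0 <= r"
 shows "set_integrable lebesgue {r..t} (%s. norm (Delta_perp (z s)))" "set_integrable lebesgue {r..t} (%s. (norm (Delta (z s)))^2)"
  "set_integrable lebesgue {r..t} (%s. norm (Delta (z s)))" "(%s. indicator {r..t} s * norm (Delta (z s))) : borel_measurable lebesgue"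
  "strongly_measurable (%s. indicator {r..t} s *r z s)"
proof -
 have sub: "{r..t} \<subseteq> {0..max 0 t}" using r by auto
 show 1: "set_integrable lebesgue {r..t} (%s. norm (Delta_perp (z s)))" and 2: "set_integrable lebesgue {r..t} (%s. (norm (Delta (z s)))^2)"
  using z sub unfolding qs_vec_def locally_integrable_def locally_sq_integrable_def
  by (auto elim!: allE[of _ "max 0 t"] intro: set_integrable_subset)
 have sm: "strongly_measurable (%s. indicator {r..t} s *r x s)" if "ALL T>=0. strongly_measurable (%s. indicator {0..T} s *r x s)"
  for x :: "real => ('k, 'b) ch"
 proof -
  have "strongly_measurable (%s. indicator {r..t} s *r (indicator {0..max 0 t} s *r x s))"
   by (rule strongly_measurable_indicator) (use that in simp_all)
  moreover have "indicator {r..t} s *r (indicator {0..max 0 t} s *r x s) = indicator {r..t} s *r x s" for s using sub by (auto simp: indicator_def)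
  ultimately show ?thesis by (simp only:)
 qed
 have sm1: "strongly_measurable (%s. indicator {r..t} s *r Delta_perp (z s))" and sm2: "strongly_measurable (%s. indicator {r..t} s *r Delta (z s))"
  using z by (auto intro!: sm simp: qs_vec_def locally_integrable_def locally_sq_integrable_def)
 have "indicator {r..t} s *r Delta_perp (z s) + indicator {r..t} s *r Delta (z s) = indicator {r..t} s *r z s" for s
  by (simp add: scaleR_add_right[symmetric] Delta_props(5))
 thus "strongly_measurable (%s. indicator {r..t} s *r z s)" using strongly_measurable_add[OF sm1 sm2] by simp
 have "(%s. sqrt ((norm (indicator {r..t} s *r Delta (z s)))^2)) : borel_measurable lebesgue"
  using strongly_measurable_norm[OF sm2] by measurable
 thus 3: "(%s. indicator {r..t} s * norm (Delta (z s))) : borel_measurable lebesgue" by simp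
 have c: "set_integrable lebesgue {r..t} (%s. 1 + (norm (Delta (z s)))^2)"
  by (intro set_integral_add(1) 2) (simp add: emeasure_lborel_Icc_eq)
 show "set_integrable lebesgue {r..t} (%s. norm (Delta (z s)))"
  unfolding set_integrable_def
 proof (rule Bochner_Integration.integrable_bound[OF c[unfolded set_integrable_def]])
  have "x <= 1 + x\<^sup>2" if "x >= 0" for x :: real using sum_squares_bound[of x 1] that by simp
  thus "AE s in lebesgue. norm (indicator {r..t} s *r norm (Delta (z s))) <= norm (indicator {r..t} s *r (1 + (norm (Delta (z s)))^2))"
   by (auto simp: indicator_def)
 qed (use 3 in simp)
qed

lemma qs_vec_cinner_integrable:
 fixes z :: "real => ('k::complex_hilbert, 'b::complex_hilbert) ch"
 assumes z: "qs_vec z" and r: "0 <= r" and f: "f : step_funs"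
 shows "set_integrable lebesgue {r..t} (%s. cinner ((1, f s) \<odot> y) (z s))"
proof -
 note Z = qs_vec_facts[OF z r, of t]
 obtain C where C: "!!s. norm (f s) <= C" using step_bounded[OF f] by blast
 have C0: "C >= 0" using order_trans[OF norm_ge_zero C[of 0]] .
 have split: "cinner ((1::complex, d) \<odot> y) w = cinner ((1, 0) \<odot> y) (Delta_perp w) + cinner ((0, d) \<odot> y) (Delta w)" for d :: 'k and w
 proof -
  have "(1::complex, d) \<odot> y = (1, 0) \<odot> y + (0, d) \<odot> y" using tensor_add_left[of "(1::complex, 0)" "(0, d)" y] by simp
  thus ?thesis by (simp add: cinner_add_left Delta_props)
 qed
 have bound: "norm (cinner ((1, f s) \<odot> y) (z s)) <= norm y * (norm (Delta_perp (z s)) + C * norm (Delta (z s)))" for s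
 proof -
  have "norm (cinner ((0, f s) \<odot> y) (Delta (z s))) <= (norm (f s) * norm y) * norm (Delta (z s))"
   using cmod_cinner_le[of "(0, f s) \<odot> y" "Delta (z s)"] by (simp)
  also have "... <= (C * norm y) * norm (Delta (z s))" by (intro mult_right_mono C) auto
  finally have "norm (cinner ((0, f s) \<odot> y) (Delta (z s))) <= (C * norm y) * norm (Delta (z s))" .
  moreover have "norm (cinner ((1, 0::'k) \<odot> y) (Delta_perp (z s))) <= norm y * norm (Delta_perp (z s))"
   using cmod_cinner_le[of "(1, 0::'k) \<odot> y" "Delta_perp (z s)"] by (simp)
  ultimately show ?thesis unfolding split[of "f s" "z s"] by (intro norm_triangle_le) (simp add: algebra_simps)
 qed
 have "set_integrable lebesgue {r..t} (%s. norm y * (norm (Delta_perp (z s)) + C * norm (Delta (z s))))"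
  by (intro set_integrable_mult_right set_integral_add(1) Z)
 thus ?thesis
  unfolding set_integrable_def
 proof (rule Bochner_Integration.integrable_bound)
  have "strongly_measurable (%s. indicator {0..max 0 t} s *r ((1::complex, f s) \<odot> y))"
  proof (rule strongly_measurable_rcont)
   fix s :: real
   have "((%s. ket y (1::complex, f s)) ---> ket y (1, f s)) (at s within {s..})"
    using step_rcont[OF f, of s] by (intro blinfun.tendsto tendsto_Pair tendsto_const) (simp add: continuous_within)
   thus "continuous (at s within {s..}) (%s. ((1::complex), f s) \<odot> y)" by (simp add: continuous_within)
  qed
  from strongly_measurable_cinner[OF this Z(5)]
  have "(%s. cinner (indicator {0..max 0 t} s *r ((1, f s) \<odot> y)) (indicator {r..t} s *r z s)) : borel_measurable lebesgue" .
  moreover have "cinner (indicator {0..max 0 t} s *r ((1, f s) \<odot> y)) (indicator {r..t} s *r z s) = indicator {r..t} s *r cinner ((1, f s) \<odot> y) (z s)" for s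
   using r by (auto simp: indicator_def)
  ultimately show "(%s. indicator {r..t} s *r cinner ((1, f s) \<odot> y) (z s)) : borel_measurable lebesgue" by simp
  show "AE s in lebesgue. norm (indicator {r..t} s *r cinner ((1, f s) \<odot> y) (z s)) <=
    norm (indicator {r..t} s *r (norm y * (norm (Delta_perp (z s)) + C * norm (Delta (z s)))))"
   using bound C0 by (intro AE_I2) (auto simp: indicator_def)
 qed
qed

text \<open>Split (1, f i) into (1, 0), (0, g) and (0, f i - g). The first two parts involve only
  the whole vector \<open>x\<close>, with \<open>C\<close> bounding \<open>g\<close>. In the third,
  adaptedness replaces \<open>varpi (f i)\<close> by \<open>qproj s g (f i)\<close>; by
  \<open>qproj_weight\<close> the resulting vectors \<open>w s\<close> are square integrable in time
  with total mass at most the squared norm of \<open>x\<close>, and the Cauchy-Schwarz inequality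
  finishes the estimate.\<close>

lemma qs_estimate:
 fixes f :: "'i => real => 'k::complex_hilbert" and u :: "'i => 'h::complex_hilbert"
 assumes z: "qs_vec z" "adapted_vec g z" and g: "g : step_funs" and C: "!!s. norm (g s) <= C"
  and I: "finite I" and f: "!!i. i : I ==> f i : step_funs" and rt: "0 <= r" "r <= t"
 shows "cmod (SUM i:I. LINT s:{r..t}|lebesgue. cinner ((1, f i s) \<odot> (u i ox f i)) (z s)) <=
  norm (SUM i:I. u i ox f i) * qs_bound C z r t"
proof -
 define x where "x = (SUM i:I. u i ox f i)"
 define w where "w s = (SUM i:I. ((0::complex), f i s - g s) \<odot> (u i \<odot> qproj s g (f i)))" for s
 note Z = qs_vec_facts[OF z(1) rt(1), of t]
 have W: "set_integrable lebesgue {r..t} (%s. (norm (w s))^2)" "(LINT s:{r..t}|lebesgue. (norm (w s))^2) <= (norm x)^2"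
  unfolding w_def x_def by (rule qproj_weight[OF I f g rt]; assumption)+
 have C0: "C >= 0" using order_trans[OF norm_ge_zero C[of 0]] .
 have eq: "(SUM i:I. cinner ((1, f i s) \<odot> (u i ox f i)) (z s)) =
   cinner ((1, 0) \<odot> x) (Delta_perp (z s)) + cinner ((0, g s) \<odot> x) (Delta (z s)) + cinner (w s) (Delta (z s))" if s: "s >= 0" for s
 proof -
  have "cinner ((1, f i s) \<odot> (u i ox f i)) (z s) = cinner ((1, 0) \<odot> (u i ox f i)) (Delta_perp (z s)) +
    cinner ((0, g s) \<odot> (u i ox f i)) (Delta (z s)) + cinner ((0, f i s - g s) \<odot> (u i \<odot> qproj s g (f i))) (Delta (z s))" if i: "i : I" for i
  proof -
   let ?y = "u i ox f i"
   have "(1::complex, f i s) \<odot> ?y = (1, 0) \<odot> ?y + (0, g s) \<odot> ?y + (0, f i s - g s) \<odot> ?y"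
    using tensor_add_left[of "(1::complex, g s)" "(0, f i s - g s)" ?y] tensor_add_left[of "(1::complex, 0)" "(0, g s)" ?y] by simp
   moreover have "cinner ((0, f i s - g s) \<odot> ?y) (z s) = cinner ((0, f i s - g s) \<odot> (u i \<odot> qproj s g (f i))) (z s)"
    using z(2) s f[OF i] unfolding adapted_vec_def qproj_def
    by (simp add: tensor_scaleC_right cinner_scaleC_left kf_commute[of "hi s g"])
   ultimately show ?thesis by (simp add: cinner_add_left Delta_props)
  qed
  thus ?thesis by (simp add: x_def w_def tensor_sum_right cinner_sum_left sum.distrib)
 qed
 have mn: "(%s. indicator {r..t} s * norm (w s)) : borel_measurable lebesgue"
 proof -
  have "(%s. sqrt (indicator {r..t} s *r (norm (w s))^2)) : borel_measurable lebesgue"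
   by (rule measurable_compose[OF borel_measurable_integrable[OF W(1)[unfolded set_integrable_def]] borel_measurable_sqrt])
  moreover have "sqrt (indicator {r..t} s *r (norm (w s))^2) = indicator {r..t} s * norm (w s)" for s by (simp add: indicator_def)
  ultimately show ?thesis by simp
 qed
 note CS = Cauchy_Schwarz_real[OF _ _ mn Z(4) W(1) Z(2)]
 have CSi: "set_integrable lebesgue {r..t} (%s. norm (w s) * norm (Delta (z s)))" by (rule CS) (use rt in auto)
 have CSb: "\<bar>LINT s:{r..t}|lebesgue. norm (w s) * norm (Delta (z s))\<bar> <= norm x * sqrt (LINT s:{r..t}|lebesgue. (norm (Delta (z s)))^2)"
 proof (rule order_trans[OF CS(2)])
  have "sqrt (LINT s:{r..t}|lebesgue. (norm (w s))^2) <= norm x" using W(2) by (simp add: real_sqrt_le_iff[of _ "(norm x)^2", simplified])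
  thus "sqrt (LINT s:{r..t}|lebesgue. (norm (w s))^2) * sqrt (LINT s:{r..t}|lebesgue. (norm (Delta (z s)))^2) <= norm x * sqrt (LINT s:{r..t}|lebesgue. (norm (Delta (z s)))^2)"
   by (intro mult_right_mono real_sqrt_ge_zero) (auto simp: set_lebesgue_integral_def)
 qed (use rt in auto)
 have i1: "set_integrable lebesgue {r..t} (%s. norm x * (norm (Delta_perp (z s)) + C * norm (Delta (z s))))"
  by (intro set_integrable_mult_right set_integral_add(1) Z)
 have i0: "set_integrable lebesgue {r..t} (%s. cinner ((1, f i s) \<odot> (u i ox f i)) (z s))" if "i : I" for i
  by (rule qs_vec_cinner_integrable[OF z(1) rt(1) f[OF that]])
 have "(SUM i:I. LINT s:{r..t}|lebesgue. cinner ((1, f i s) \<odot> (u i ox f i)) (z s)) =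
   (LINT s:{r..t}|lebesgue. SUM i:I. cinner ((1, f i s) \<odot> (u i ox f i)) (z s))"
  using i0 by (simp add: set_lebesgue_integral_def set_integrable_def scaleR_sum_right)
 also have "cmod ... <= (LINT s:{r..t}|lebesgue. norm x * (norm (Delta_perp (z s)) + C * norm (Delta (z s))) + norm (w s) * norm (Delta (z s)))"
  unfolding set_lebesgue_integral_def
 proof (rule Bochner_Integration.integral_norm_bound_integral)
  show "integrable lebesgue (%s. indicator {r..t} s *r (SUM i:I. cinner ((1, f i s) \<odot> (u i ox f i)) (z s)))"
   using i0 by (simp add: set_integrable_def scaleR_sum_right)
  show "integrable lebesgue (%s. indicator {r..t} s *r (norm x * (norm (Delta_perp (z s)) + C * norm (Delta (z s))) + norm (w s) * norm (Delta (z s))))"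
   using set_integral_add(1)[OF i1 CSi] by (simp add: set_integrable_def)
  fix s
  have "cmod (SUM i:I. cinner ((1, f i s) \<odot> (u i ox f i)) (z s)) <=
    norm x * (norm (Delta_perp (z s)) + C * norm (Delta (z s))) + norm (w s) * norm (Delta (z s))" if "s >= 0"
  proof -
   have 1: "cmod (cinner ((1, 0::'k) \<odot> x) (Delta_perp (z s))) <= norm x * norm (Delta_perp (z s))"
    using cmod_cinner_le[of "(1, 0::'k) \<odot> x" "Delta_perp (z s)"] by (simp)
   have "cmod (cinner ((0, g s) \<odot> x) (Delta (z s))) <= (norm (g s) * norm x) * norm (Delta (z s))"
    using cmod_cinner_le[of "(0, g s) \<odot> x" "Delta (z s)"] by (simp)
   also have "... <= (C * norm x) * norm (Delta (z s))" by (intro mult_right_mono C) auto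
   finally show ?thesis unfolding eq[OF that]
    using norm_triangle_ineq[of "cinner ((1, 0) \<odot> x) (Delta_perp (z s))" "cinner ((0, g s) \<odot> x) (Delta (z s))"]
     1 cmod_cinner_le[of "w s" "Delta (z s)"] by (intro norm_triangle_le) (simp add: algebra_simps)
  qed
  thus "norm (indicator {r..t} s *r (SUM i:I. cinner ((1, f i s) \<odot> (u i ox f i)) (z s))) <=
    indicator {r..t} s *r (norm x * (norm (Delta_perp (z s)) + C * norm (Delta (z s))) + norm (w s) * norm (Delta (z s)))"
   using rt by (simp add: indicator_def)
 qed
 also have "... = norm x * (LINT s:{r..t}|lebesgue. norm (Delta_perp (z s)) + C * norm (Delta (z s))) + (LINT s:{r..t}|lebesgue. norm (w s) * norm (Delta (z s)))"
  using set_integral_add(2)[OF i1 CSi] by simp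
 also have "... <= norm x * qs_bound C z r t" using CSb by (simp add: qs_bound_def algebra_simps)
 finally show ?thesis by (simp only: x_def)
qed

section \<open>Integrals as vectors determined by their matrix elements\<close>

definition qs_vector :: "(real => ('k::complex_hilbert, ('h::complex_hilbert, 'k) hf) ch) => real => real => ('h, 'k) hf => bool" where
 "qs_vector z r t x \<longleftrightarrow> (ALL u. ALL f:step_funs. cinner (u ox f) x = (LINT s:{r..t}|lebesgue. cinner ((1, f s) \<odot> (u ox f)) (z s)))"

lemma qs_vector_unique: "qs_vector z r t x ==> qs_vector z r t y ==> x = y"
 by (rule uvarpi_eqI) (simp add: qs_vector_def)

text \<open>The estimate bounds the functional given by the integrals on the span of the exponential
  vectors; extended to a bounded operator \<open>V\<close> into the scalars, it is represented by
  the vector \<open>adj V 1\<close>.\<close>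

lemma qs_vector_exists:
 fixes g :: "real => 'k::complex_hilbert" and z :: "real => ('k, ('h::complex_hilbert, 'k) hf) ch"
 assumes z: "qs_vec z" "adapted_vec g z" and g: "g : step_funs" and C: "!!s. norm (g s) <= C" and rt: "0 <= r" "r <= t"
 shows "EX x. qs_vector z r t x & norm x <= qs_bound C z r t"
proof -
 \<comment> \<open>The indices run over a whole type, so functions that are not step functions are
   replaced by 0.\<close>
 define fl where "fl f = (if f : step_funs then f else (%_. 0::'k))" for f
 have fl: "fl f : step_funs" for f by (simp add: fl_def)
 define a where "a = (%(u::'h, f). u ox fl f)"
 define b where "b = (%(u::'h, f). cnj (LINT s:{r..t}|lebesgue. cinner ((1, fl f s) \<odot> (u ox fl f)) (z s)))"
 have bnd: "norm (lincomb b v) <= qs_bound C z r t * norm (lincomb a v)" for v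
 proof -
  let ?I = "{i. formal_coeff v i ~= 0}" and ?u = "%i. formal_coeff v i *c fst i" and ?f = "%i. fl (snd i)"
  have "lincomb a v = (SUM i:?I. ?u i ox (?f i))" by (simp add: lincomb_def a_def split_beta tensor_scaleC_left)
  moreover have "cnj (lincomb b v) = (SUM i:?I. LINT s:{r..t}|lebesgue. cinner ((1, ?f i s) \<odot> (?u i ox (?f i))) (z s))"
   by (simp add: lincomb_def b_def split_beta scaleC_complex_def tensor_scaleC_left tensor_scaleC_right cinner_scaleC_left)
  moreover have "norm (cnj (lincomb b v)) = norm (lincomb b v)" by (rule complex_mod_cnj)
  ultimately show ?thesis
   using qs_estimate[where u = ?u and f = ?f and I = ?I, OF z g C finite_formal_coeff fl rt] by (simp only: mult.commute)
 qed
 have "0 <= qs_bound C z r t"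
  using order_trans[OF norm_ge_zero C[of 0]]
  by (auto simp: qs_bound_def set_lebesgue_integral_def)
 then obtain V where V: "V : bops" "!!i. blinfun_apply V (a i) = b i" "norm V <= qs_bound C z r t"
  by (rule family_extension[OF bnd]) (rule that)
 define x where "x = adj V 1"
 have "qs_vector z r t x"
  unfolding qs_vector_def
 proof (intro allI ballI)
  fix u :: 'h and f :: "real => 'k" assume f: "f : step_funs"
  have "cinner (u ox f) x = cnj (V (a (u, f)))"
   unfolding x_def cinner_adj_right[OF V(1)] by (simp add: cinner_complex_def a_def fl_def f)
  thus "cinner (u ox f) x = (LINT s:{r..t}|lebesgue. cinner ((1, f s) \<odot> (u ox f)) (z s))"
   by (simp add: V(2) b_def fl_def f)
 qed
 moreover have "norm x <= norm (adj V) * norm (1::complex)" unfolding x_def by (rule norm_blinfun)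
 ultimately show ?thesis using norm_adj_le[OF V(1)] V(3) by (auto)
qed

text \<open>Uniform continuity of indefinite integrals on [0, T]; this is what makes integral
  processes norm continuous.\<close>

lemma qs_bound_small:
 fixes z :: "real => ('k::complex_hilbert, 'b::complex_hilbert) ch"
 assumes z: "qs_vec z" and T: "0 <= T" and e: "e > 0"
 shows "EX d>0. ALL r t. 0 <= r & r <= t & t <= T & t - r < d --> qs_bound C z r t < e"
proof -
 note Z = qs_vec_facts[OF z order_refl, of T]
 let ?a = "%s. norm (Delta_perp (z s)) + C * norm (Delta (z s))" and ?b = "%s. (norm (Delta (z s)))^2"
 have i: "set_integrable lebesgue {0..T} ?a" "set_integrable lebesgue {0..T} ?b"
  by (intro set_integral_add(1) set_integrable_mult_right Z)+
 have unif: "EX d>0. ALL r t. 0 <= r & r <= t & t <= T & t - r < d --> (LINT s:{r..t}|lebesgue. h s) < e"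
  if h: "set_integrable lebesgue {0..T} h" and e: "e > 0" for h :: "real => real" and e
 proof -
  have hi: "h integrable_on {0..T}" using set_lebesgue_integral_eq_integral(1)[OF h] .
  have "uniformly_continuous_on {0..T} (%x. integral {0..x} h)"
   by (intro compact_uniformly_continuous indefinite_integral_continuous_1 hi) simp
  then obtain d where d: "d > 0" "!!r t. r : {0..T} ==> t : {0..T} ==> dist t r < d ==> dist (integral {0..t} h) (integral {0..r} h) < e"
   using e unfolding uniformly_continuous_on_def by metis
  have "(LINT s:{r..t}|lebesgue. h s) < e" if rt: "0 <= r" "r <= t" "t <= T" "t - r < d" for r t
  proof -
   have "(LINT s:{r..t}|lebesgue. h s) = integral {r..t} h"
    by (rule set_lebesgue_integral_eq_integral(2)[OF set_integrable_subset[OF h]]) (use rt in auto)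
   also have "... = integral {0..t} h - integral {0..r} h"
    using Henstock_Kurzweil_Integration.integral_combine[OF rt(1,2) integrable_subinterval_real[OF hi, of 0 t]] rt by simp
   also have "... < e" using d(2)[of r t] rt by (simp add: dist_real_def)
   finally show ?thesis .
  qed
  thus ?thesis using d(1) by blast
 qed
 from unif[OF i(1), of "e/2"] obtain d1 where d1: "d1 > 0" "!!r t. 0 <= r & r <= t & t <= T & t - r < d1 ==> (LINT s:{r..t}|lebesgue. ?a s) < e / 2" using e by auto
 from unif[OF i(2), of "(e/2)^2"] obtain d2 where d2: "d2 > 0" "!!r t. 0 <= r & r <= t & t <= T & t - r < d2 ==> (LINT s:{r..t}|lebesgue. ?b s) < (e/2)^2" using e by auto
 have "qs_bound C z r t < e" if "0 <= r & r <= t & t <= T & t - r < min d1 d2" for r t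
 proof -
  have "sqrt (LINT s:{r..t}|lebesgue. ?b s) < e / 2" using d2(2)[of r t] that e by (intro real_less_lsqrt) auto
  thus ?thesis using d1(2)[of r t] that by (simp add: qs_bound_def)
 qed
 thus ?thesis using d1(1) d2(1) by (intro exI[of _ "min d1 d2"]) simp
qed

lemma qs_vector_diff:
 fixes z :: "real => ('k::complex_hilbert, ('h::complex_hilbert, 'k) hf) ch"
 assumes z: "qs_vec z" and rt: "0 <= r" "r <= t" and x: "qs_vector z 0 r x" "qs_vector z 0 t y"
 shows "qs_vector z r t (y - x)"
 unfolding qs_vector_def
proof (intro allI ballI)
 fix u :: 'h and f :: "real => 'k" assume f: "f : step_funs"
 let ?h = "%s. cinner ((1, f s) \<odot> (u ox f)) (z s)"
 have i: "set_integrable lebesgue {p..q} ?h" if "0 <= p" for p q by (rule qs_vec_cinner_integrable[OF z that f])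
 have "integral {0..r} ?h + integral {r..t} ?h = integral {0..t} ?h"
  by (rule Henstock_Kurzweil_Integration.integral_combine[OF rt]) (use set_lebesgue_integral_eq_integral(1)[OF i] in auto)
 thus "cinner (u ox f) (y - x) = (LINT s:{r..t}|lebesgue. ?h s)"
  using x f rt by (simp add: qs_vector_def cinner_diff_right set_lebesgue_integral_eq_integral(2)[OF i] algebra_simps)
qed

text \<open>The increment from \<open>r\<close> to \<open>t\<close> is itself the integral over
  [r, t], so \<open>qs_bound\<close> controls it.\<close>

lemma qs_vector_path:
 fixes g :: "real => 'k::complex_hilbert" and z :: "real => ('k, ('h::complex_hilbert, 'k) hf) ch"
 assumes z: "qs_vec z" "adapted_vec g z" and g: "g : step_funs"
 shows "EX x. (ALL t>=0. qs_vector z 0 t (x t)) & continuous_on {0..} x"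
proof -
 obtain C where C: "!!s. norm (g s) <= C" using step_bounded[OF g] by blast
 have "ALL t. EX x. t >= 0 --> qs_vector z 0 t x" using qs_vector_exists[OF z g C order_refl] by blast
 then obtain x where x: "!!t. t >= 0 ==> qs_vector z 0 t (x t)" by metis
 have inc: "norm (x t - x r) <= qs_bound C z r t" if "0 <= r" "r <= t" for r t
  using qs_vector_exists[OF z g C that] qs_vector_unique[OF qs_vector_diff[OF z(1) that x x]] that by fastforce
 have "continuous_on {0..} x"
  unfolding continuous_on_iff
 proof (intro ballI allI impI)
  fix t e :: real assume t: "t : {0..}" and e: "e > 0"
  then obtain d where d: "d > 0" "!!r s. 0 <= r & r <= s & s <= t + 1 & s - r < d ==> qs_bound C z r s < e"
   using qs_bound_small[OF z(1), of "t + 1" e C] by auto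
  have "dist (x s) (x t) < e" if "s : {0..}" "dist s t < min d 1" for s
  proof (cases "s <= t")
   case True
   thus ?thesis using inc[of s t] d(2)[of s t] that by (simp add: dist_norm norm_minus_commute)
  next
   case False
   thus ?thesis using inc[of t s] d(2)[of t s] that t by (simp add: dist_norm)
  qed
  thus "EX d>0. ALL s:{0..}. dist s t < d --> dist (x s) (x t) < e" using d(1) by (intro exI[of _ "min d 1"]) simp
 qed
 thus ?thesis using x by blast
qed

section \<open>The integral process\<close>

lemma exp_subspace: "cvec.subspace exp_domain" unfolding exp_domain_def by (rule cvec.subspace_span)

lemma LINT_cong_pos:
 "(!!s. 0 <= s ==> h s = h' s) ==> (LINT s:{0..t}|lebesgue. h s) = (LINT s:{0..t}|lebesgue. (h' s :: complex))" for t :: real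
 unfolding set_lebesgue_integral_def by (rule Bochner_Integration.integral_cong) (auto simp: indicator_def)

context
 fixes G :: "real => ('k::complex_hilbert, ('h::complex_hilbert, 'k) hf) ch \<rightharpoonup> ('k, ('h, 'k) hf) ch"
 assumes G: "qs_integrable G"
begin

abbreviation (input) "zz \<zeta> == %s. the (G s (the (nabla s \<zeta>)))"

lemma zz_vec: "w : exp_domain ==> qs_vec (zz w)"
 using G by (simp add: qs_vec_def qs_integrable_def)

lemma zz_lin:
 assumes "s >= 0" "w : exp_domain" "x : exp_domain"
 shows "zz (w + x) s = zz w s + zz x s" "zz (c *c w) s = c *c zz w s"
proof -
 have l: "lin_operator (G s)" "lin_operator (nabla s :: ('h, 'k) hf \<rightharpoonup> _)" "!!w. w : exp_domain ==> the (nabla s w) : dom (G s)"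
  using G assms(1) nabla_props(1)[OF assms(1)] by (auto simp: qs_integrable_def simp del: domIff)
 note n = lin_operatorD(2,3)[OF l(2), unfolded nabla_props(2)[OF assms(1)]]
 show "zz (w + x) s = zz w s + zz x s" "zz (c *c w) s = c *c zz w s"
  using lin_operatorD(2,3)[OF l(1)] l(3) n assms by (simp_all del: domIff)
qed

lemma qs_vector_lin:
 assumes e: "w : exp_domain" "p : exp_domain" and x: "qs_vector (zz w) 0 t x" "qs_vector (zz p) 0 t y"
 shows "qs_vector (zz (w + p)) 0 t (x + y)" "qs_vector (zz (c *c w)) 0 t (c *c x)"
proof -
 show "qs_vector (zz (w + p)) 0 t (x + y)"
  unfolding qs_vector_def
 proof (intro allI ballI)
  fix u :: 'h and f :: "real => 'k" assume f: "f : step_funs"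
  note i = qs_vec_cinner_integrable[OF zz_vec order_refl f, of _ t "u ox f"]
  have "(LINT s:{0..t}|lebesgue. cinner ((1, f s) \<odot> (u ox f)) (zz (w + p) s)) =
   (LINT s:{0..t}|lebesgue. cinner ((1, f s) \<odot> (u ox f)) (zz w s) + cinner ((1, f s) \<odot> (u ox f)) (zz p s))"
   by (rule LINT_cong_pos) (simp add: zz_lin e cinner_add_right)
  thus "cinner (u ox f) (x + y) = (LINT s:{0..t}|lebesgue. cinner ((1, f s) \<odot> (u ox f)) (zz (w + p) s))"
   using x f set_integral_add(2)[OF i[OF e(1)] i[OF e(2)]] by (simp add: qs_vector_def cinner_add_right)
 qed
 show "qs_vector (zz (c *c w)) 0 t (c *c x)"
  unfolding qs_vector_def
 proof (intro allI ballI)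
  fix u :: 'h and f :: "real => 'k" assume f: "f : step_funs"
  have "(LINT s:{0..t}|lebesgue. cinner ((1, f s) \<odot> (u ox f)) (zz (c *c w) s)) =
   (LINT s:{0..t}|lebesgue. c * cinner ((1, f s) \<odot> (u ox f)) (zz w s))"
   by (rule LINT_cong_pos) (simp add: zz_lin(2)[OF _ e(1,1)] cinner_scaleC_right)
  thus "cinner (u ox f) (c *c x) = (LINT s:{0..t}|lebesgue. cinner ((1, f s) \<odot> (u ox f)) (zz (c *c w) s))"
   using x f by (simp add: qs_vector_def cinner_scaleC_right)
 qed
qed

text \<open>The estimate works with a single comparison function \<open>g\<close>, hence for single
  exponential vectors; linearity extends the construction to their span.\<close>

lemma qs_path:
 assumes "w : exp_domain"
 shows "EX x. (ALL t>=0. qs_vector (zz w) 0 t (x t)) & continuous_on {0..} x"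
proof -
 have "w : exp_domain & (EX x. (ALL t>=0. qs_vector (zz w) 0 t (x t)) & continuous_on {0..} x)"
  using assms unfolding exp_domain_def
 proof (induction rule: cvec.span_induct_alt)
  case base
  have "zz 0 s = 0" if "s >= 0" for s using zz_lin(2)[OF that _ _, of 0 0 0] cvec.subspace_0[OF exp_subspace] by simp
  hence "ALL t>=0. qs_vector (zz 0) 0 t 0" unfolding qs_vector_def using LINT_cong_pos[of _ "%_. 0"] by simp
  thus ?case by (auto intro!: cvec.span_zero)
 next
  case (step c w p)
  then obtain v g where z: "w = v ox g" and g: "g : step_funs" by blast
  have ze: "w : exp_domain" and xe: "p : exp_domain" using exp_in[OF g, of v] step unfolding z exp_domain_def by blast+
  obtain x where x: "ALL t>=0. qs_vector (zz w) 0 t (x t)" "continuous_on {0..} x"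
   using qs_vector_path[OF zz_vec[OF ze] _ g] qs_integrable_adapted_vec[OF G g, of v] unfolding z by blast
  obtain y where y: "ALL t>=0. qs_vector (zz p) 0 t (y t)" "continuous_on {0..} y" using step by blast
  have ce: "c *c w : exp_domain" using cvec.subspace_scale[OF exp_subspace ze] .
  have "ALL t>=0. qs_vector (zz (c *c w + p)) 0 t (c *c x t + y t)"
   using qs_vector_lin(1)[OF ce xe qs_vector_lin(2)[OF ze xe]] x(1) y(1) by blast
  moreover have "continuous_on {0..} (%t. c *c x t + y t)"
   by (intro continuous_on_add bounded_linear.continuous_on[OF bounded_linear_scaleC] x y)
  moreover note cvec.subspace_add[OF exp_subspace ce xe, unfolded exp_domain_def]
  ultimately show ?case by (intro conjI exI[of _ "%t. c *c x t + y t"])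
 qed
 thus ?thesis ..
qed

lemma qs_vector_exp:
 assumes w: "w : exp_domain" "w' : exp_domain" and x: "qs_vector (zz w) 0 t x"
 shows "cinner w' x = (LINT s:{0..t}|lebesgue. cinner (the (nabla s w')) (zz w s))"
proof -
 obtain n u f where f: "ALL i<n. f i : step_funs" and w': "w' = (\<Sum>i<(n::nat). u i ox f i)"
  using exp_domain_rep[OF w(2)] by blast
 have i: "set_integrable lebesgue {0..t} (%s. cinner ((1, f i s) \<odot> (u i ox f i)) (zz w s))" if "i < n" for i
  by (rule qs_vec_cinner_integrable[OF zz_vec[OF w(1)] order_refl]) (use f that in simp)
 have "(LINT s:{0..t}|lebesgue. cinner (the (nabla s w')) (zz w s)) =
   (LINT s:{0..t}|lebesgue. \<Sum>i<n. cinner ((1, f i s) \<odot> (u i ox f i)) (zz w s))"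
  unfolding w' by (rule LINT_cong_pos) (subst nabla_sum, use f in "simp_all add: cinner_sum_left")
 also have "... = (\<Sum>i<n. LINT s:{0..t}|lebesgue. cinner ((1, f i s) \<odot> (u i ox f i)) (zz w s))"
  unfolding set_lebesgue_integral_def scaleR_sum_right
  by (rule Bochner_Integration.integral_sum) (use i in "simp add: set_integrable_def")
 also have "... = cinner w' x" using x f by (simp add: w' cinner_sum_left qs_vector_def)
 finally show ?thesis ..
qed

end

lemma qs_integral_eqI:
 assumes X: "continuous_process X"
  and v: "!!t z z'. t >= 0 ==> z : exp_domain ==> z' : exp_domain ==> cinner z' (the (X t z)) =
    (LINT s:{0..t}|lebesgue. cinner (the (nabla s z')) (the (G s (the (nabla s z)))))"
 shows "qs_integral G = X"
 unfolding qs_integral_def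
proof (rule the_equality)
 fix X' assume X': "continuous_process X' & (ALL t>=0. ALL z:exp_domain. ALL z':exp_domain. cinner z' (the (X' t z)) =
    (LINT s:{0..t}|lebesgue. cinner (the (nabla s z')) (the (G s (the (nabla s z))))))"
 show "X' = X"
 proof (intro ext)
  fix t z
  have P: "operator_process X" "operator_process X'" using X X' by (auto simp: continuous_process_def)
  show "X' t z = X t z"
  proof (cases "t >= 0")
   case True
   have d: "dom (X t) = exp_domain" "dom (X' t) = exp_domain" using P True by (auto simp: operator_process_def)
   show ?thesis
   proof (cases "z : exp_domain")
    case True
    have "the (X' t z) = the (X t z)" by (rule uvarpi_eqI) (use X' v \<open>t >= 0\<close> True in simp)
    thus ?thesis using d True by (metis domD option.sel)
   next
    case False thus ?thesis using d by (metis domIff)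
   qed
  qed (use P in "simp add: operator_process_def")
 qed
qed (use X v in blast)

theorem qs_integral_props:
 fixes G :: "real => ('k::complex_hilbert, ('h::complex_hilbert, 'k) hf) ch \<rightharpoonup> ('k, ('h, 'k) hf) ch"
 assumes G: "qs_integrable G"
 shows "continuous_process (qs_integral G)"
  "t >= 0 ==> w : exp_domain ==> qs_vector (%s. the (G s (the (nabla s w)))) 0 t (the (qs_integral G t w))"
proof -
 let ?z = "%w s. the (G s (the (nabla s w)))"
 define x where "x t w = (THE x. qs_vector (?z w) 0 t x)" for t w
 have x_eq: "x t w = y" if "qs_vector (?z w) 0 t y" for t w y
  unfolding x_def using that qs_vector_unique by (intro the_equality) blast+
 have x: "qs_vector (?z w) 0 t (x t w)" if "t >= 0" "w : exp_domain" for t w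
 proof -
  have "EX y. qs_vector (?z w) 0 t y" using qs_path[OF G that(2)] that(1) by blast
  then obtain y where y: "qs_vector (?z w) 0 t y" ..
  from y show ?thesis unfolding x_eq[OF y] .
 qed
 have xc: "continuous_on {0..} (%t. x t w)" if "w : exp_domain" for w
 proof -
  have "EX y. (ALL t>=0. qs_vector (?z w) 0 t (y t)) & continuous_on {0..} y" by (rule qs_path[OF G that])
  then obtain y where y: "ALL t>=0. qs_vector (?z w) 0 t (y t)" "continuous_on {0..} y" by blast
  have "x t w = y t" if "t : {0..}" for t using x_eq y(1) that by simp
  from continuous_on_cong[THEN iffD2, OF refl this y(2)] show ?thesis .
 qed
 define X where "X t = (if t < 0 then Map.empty else (Some \<circ> x t) |` exp_domain)" for t :: real
 have Xv: "the (X t w) = x t w" if "t >= 0" "w : exp_domain" for t w using that by (simp add: X_def)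
 have dX: "dom (X t) = exp_domain" if "t >= 0" for t using that by (auto simp: X_def)
 have "operator_process X"
  unfolding operator_process_def
 proof (intro conjI allI impI ballI)
  show "X t = Map.empty" if "t < 0" for t using that by (simp add: X_def)
  fix t :: real assume t: "t >= 0"
  show "dom (X t) = exp_domain" by (rule dX[OF t])
  show "lin_operator (X t)"
   unfolding lin_operator_def linear_on_def dX[OF t]
  proof (intro conjI ballI allI)
   show "cvec.subspace (exp_domain :: ('h, 'k) hf set)" by (rule exp_subspace)
   fix w p :: "('h, 'k) hf" and c assume e: "w : exp_domain" 
   thus "the (X t (c *c w)) = c *c the (X t w)"
    using x_eq[OF qs_vector_lin(2)[OF G e e x[OF t e] x[OF t e]]] t by (simp add: Xv cvec.subspace_scale[OF exp_subspace])
   assume e': "p : exp_domain"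
   show "the (X t (w + p)) = the (X t w) + the (X t p)"
    using x_eq[OF qs_vector_lin(1)[OF G e e' x[OF t e] x[OF t e']]] t e e' by (simp add: Xv cvec.subspace_add[OF exp_subspace])
  qed
  fix f g :: "real => 'k" and u assume f: "f : step_funs" and g: "g : step_funs"
  have me: "matrix_element f (X t) g u = adj (ket (varpi f)) (x t (u ox g))" if "g : step_funs" for f g
   using that t by (simp add: matrix_element_def Xv)
  show "matrix_element f (X t) g u = cinner (varpi (hi t f)) (varpi (hi t g)) *c matrix_element (lo t f) (X t) (lo t g) u"
   unfolding me[OF g] me[OF step_cut(2)[OF g]]
  proof (rule cinner_extI)
   fix v
   let ?h = "%f g s. cinner ((1, f s) \<odot> (v ox f)) (?z (u ox g) s)"
   \<comment> \<open>For s < t the future of \<open>s\<close> splits at \<open>t\<close>; the part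
     after \<open>t\<close> is the adaptedness factor of the integral.\<close>
   have eq: "?h f g s = kf (hi t f) (hi t g) * ?h (lo t f) (lo t g) s" if s: "0 <= s" "s < t" for s
   proof -
    have ll: "lo s (lo t h) = lo s h" "lo t h s = h s" "lo t (hi s h) = hi s (lo t h)" "hi t (hi s h) = hi t h" for h :: "real => 'k"
     using s by (auto simp: cut_def indicator_def)
    have "kf (hi s f) (hi s g) = kf (lo t (hi s f)) (lo t (hi s g)) * kf (hi t (hi s f)) (hi t (hi s g))" by (rule kf_split) (use f g in auto)
    hence "kf (hi s f) (hi s g) = kf (hi s (lo t f)) (hi s (lo t g)) * kf (hi t f) (hi t g)" unfolding ll .
    thus ?thesis
     unfolding qs_integrable_adapted[OF G s(1) f g] qs_integrable_adapted[OF G s(1) step_cut(2)[OF f] step_cut(2)[OF g]] ll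
     by simp
   qed
   have "(LINT s:{0..t}|lebesgue. ?h f g s) = (LINT s:{0..t}|lebesgue. kf (hi t f) (hi t g) * ?h (lo t f) (lo t g) s)"
   proof -
    have i: "set_integrable lebesgue {0..t} (?h f g)" if "f : step_funs" "g : step_funs" for f g
     by (rule qs_vec_cinner_integrable[OF zz_vec[OF G] order_refl that(1)]) (use that in simp)
    show ?thesis
     unfolding set_lebesgue_integral_def
    proof (rule integral_cong_AE)
     show "(%s. indicator {0..t} s *r ?h f g s) : borel_measurable lebesgue"
      using i[OF f g] unfolding set_integrable_def by (rule borel_measurable_integrable)
     have "set_integrable lebesgue {0..t} (%s. kf (hi t f) (hi t g) * ?h (lo t f) (lo t g) s)"
      by (intro set_integrable_mult_right i) (use f g in auto)
     thus "(%s. indicator {0..t} s *r (kf (hi t f) (hi t g) * ?h (lo t f) (lo t g) s)) : borel_measurable lebesgue"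
      unfolding set_integrable_def by (rule borel_measurable_integrable)
     \<comment> \<open>At s = t the two integrands may differ, as \<open>lo t f\<close> vanishes at
       \<open>t\<close>.\<close>
     have "AE s in lebesgue. s ~= t" by (rule AE_I[of _ _ "{t}"]) auto
     thus "AE s in lebesgue. indicator {0..t} s *r ?h f g s = indicator {0..t} s *r (kf (hi t f) (hi t g) * ?h (lo t f) (lo t g) s)"
      by eventually_elim (use eq in "auto simp: indicator_def")
    qed
   qed
   thus "cinner v (adj (ket (varpi f)) (x t (u ox g))) =
     cinner v (cinner (varpi (hi t f)) (varpi (hi t g)) *c adj (ket (varpi (lo t f))) (x t (u ox lo t g)))"
    using x[OF t exp_in[OF g, of u]] x[OF t exp_in[OF step_cut(2)[OF g], of u]] f
    unfolding cinner_scaleC_right by (simp add: cinner_adj_right qs_vector_def kf_def)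
  qed
 next
  fix p w :: "('h, 'k) hf" assume e: "w : exp_domain"
  have "continuous_on {0..} (%t. cinner p (x t w))"
   using xc[OF e] by (auto simp: continuous_on_def intro: tendsto_cinner)
  hence "(%t. cinner p (x t w)) : borel_measurable (lebesgue_on {0..})" by (rule continuous_imp_measurable_on_sets_lebesgue) auto
  thus "(%t. cinner p (the (X t w))) : borel_measurable (lebesgue_on {0..})"
   by (rule measurable_cong[THEN iffD1, rotated]) (use e in "simp add: Xv")
 qed
 hence cp: "continuous_process X"
  unfolding continuous_process_def
  by (intro conjI ballI continuous_on_cong[THEN iffD2, OF refl _ xc]) (simp_all add: Xv)
 have "qs_integral G = X"
  by (rule qs_integral_eqI[OF cp]) (use qs_vector_exp[OF G _ _ x] in "simp add: Xv")
 thus "continuous_process (qs_integral G)"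
  "t >= 0 ==> w : exp_domain ==> qs_vector (%s. the (G s (the (nabla s w)))) 0 t (the (qs_integral G t w))"
  using cp x by (simp_all add: Xv)
qed

section \<open>Perturbation equations\<close>

text \<open>The regularity that integrands inherit from step functions and continuous paths; it
  implies measurability and local integrability.\<close>

definition rcont_bounded :: "(real => 'a::real_normed_vector) => bool" where
 "rcont_bounded z \<longleftrightarrow> (ALL s>=0. continuous (at s within {s..}) z) & (ALL T. EX B. ALL s:{0..T}. norm (z s) <= B)"

lemma rcont_bounded_sum:
 assumes "!!i. i : I ==> rcont_bounded (z i)" shows "rcont_bounded (%s. SUM i:I. z i s)"
 unfolding rcont_bounded_def
proof (intro conjI allI impI)
 show "continuous (at s within {s..}) (%s. SUM i:I. z i s)" if "s >= 0" for s
  by (intro continuous_sum) (use assms that in "simp add: rcont_bounded_def")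
 fix T
 have "ALL i:I. EX B. ALL s:{0..T}. norm (z i s) <= B" using assms by (simp add: rcont_bounded_def)
 then obtain B where "ALL i:I. ALL s:{0..T}. norm (z i s) <= B i" by metis
 hence "norm (SUM i:I. z i s) <= (SUM i:I. B i)" if "s : {0..T}" for s using that by (intro sum_norm_le) auto
 thus "EX B. ALL s:{0..T}. norm (SUM i:I. z i s) <= B" by blast
qed

lemma rcont_bounded_blinfun: 
 assumes "rcont_bounded z" shows "rcont_bounded (%s. blinfun_apply T (z s))"
 unfolding rcont_bounded_def
proof (intro conjI allI impI)
 show "continuous (at s within {s..}) (%s. blinfun_apply T (z s))" if "s >= 0" for s
  using assms that unfolding rcont_bounded_def continuous_within by (intro blinfun.tendsto tendsto_const) auto
 fix t obtain B where "ALL s:{0..t}. norm (z s) <= B" using assms unfolding rcont_bounded_def by blast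
 hence "norm (blinfun_apply T (z s)) <= norm T * B" if "s : {0..t}" for s
  using norm_blinfun[of T "z s"] that by (meson mult_left_mono norm_ge_zero order_trans)
 thus "EX B. ALL s:{0..t}. norm (blinfun_apply T (z s)) <= B" by blast
qed

lemma rcont_bounded_integrable:
 fixes p :: "real => 'a::euclidean_space"
 assumes "rcont_bounded p" shows "set_integrable lebesgue {0..T} p"
proof -
 obtain B where B: "ALL s:{0..T}. norm (p s) <= B" using assms unfolding rcont_bounded_def by blast
 have "strongly_measurable (%s. indicator {0..T} s *r p s)"
  by (rule strongly_measurable_rcont) (use assms in "simp add: rcont_bounded_def")
 then obtain r where r: "!!n. simple_function lebesgue (r n)" "AE t in lebesgue. (%n. r n t) ----> indicator {0..T} t *r p t"
  unfolding strongly_measurable_def by blast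
 have "(%t. lim (%n. r n t)) : borel_measurable lebesgue" by (intro borel_measurable_lim_metric borel_measurable_simple_function r)
 moreover have "AE t in lebesgue. lim (%n. r n t) = indicator {0..T} t *r p t" using r(2) by eventually_elim (rule limI)
 ultimately have "(%s. indicator {0..T} s *r p s) : borel_measurable lebesgue" by (rule borel_measurable_AE)
 thus ?thesis by (rule bounded_set_integrable) (use B in auto)
qed

lemma rcont_bounded_norm: "rcont_bounded z ==> rcont_bounded (%s. norm (z s))"
 by (auto simp: rcont_bounded_def intro: continuous_norm)

lemma rcont_bounded_power2: 
 fixes h :: "real => real" assumes h: "rcont_bounded h" shows "rcont_bounded (%s. (h s)^2)"
 unfolding rcont_bounded_def
proof (intro conjI allI impI)
 show "continuous (at s within {s..}) (%s. (h s)^2)" if "s >= 0" for s using h that by (auto simp: rcont_bounded_def intro: continuous_power)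
 fix T obtain B where B: "ALL s:{0..T}. norm (h s) <= B" using h unfolding rcont_bounded_def by blast
 have "norm ((h s)^2) <= B\<^sup>2" if "s : {0..T}" for s using power_mono[of "norm (h s)" B 2] B that by simp
 thus "EX B. ALL s:{0..T}. norm ((h s)^2) <= B" by blast
qed

lemma rcont_bounded_qs_vec:
 assumes "rcont_bounded z" and eq: "!!s. s >= 0 ==> z' s = z s"
 shows "qs_vec z'"
proof -
 have e: "indicator {0..T} s *r blinfun_apply D (z' s) = indicator {0..T} s *r blinfun_apply D (z s)" for D :: "_ =>L _" and s T :: real
  using eq[of s] by (auto simp: indicator_def)
 have m: "strongly_measurable (%s. indicator {0..T} s *r blinfun_apply D (z' s))" for D :: "_ =>L _" and T
  unfolding e by (rule strongly_measurable_rcont) (use rcont_bounded_blinfun[OF assms(1), of D] in "simp add: rcont_bounded_def")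
 note n = rcont_bounded_norm[OF rcont_bounded_blinfun[OF assms(1)]]
 have i: "set_integrable lebesgue {0..T} (%s. h (blinfun_apply D (z' s)))" if "rcont_bounded (%s. h (blinfun_apply D (z s)))"
  for h :: "_ => real" and D :: "_ =>L _" and T
 proof -
  have "indicator {0..T} s *r h (blinfun_apply D (z' s)) = indicator {0..T} s *r h (blinfun_apply D (z s))" for s
   using eq[of s] by (auto simp: indicator_def)
  thus ?thesis using rcont_bounded_integrable[OF that, of T] by (simp only: set_integrable_def)
 qed
 show ?thesis
  unfolding qs_vec_def locally_integrable_def locally_sq_integrable_def
  using m i[OF n] i[of "%x. (norm x)^2", OF rcont_bounded_power2[OF n]] by (intro conjI allI impI) assumption+
qed

text \<open>The function exp (-L s) times the integral of \<open>f\<close> up to \<open>s\<close> is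
  non-increasing and starts at 0.\<close>

lemma Gronwall_zero:
 fixes f :: "real => real"
 assumes c: "continuous_on {0..T} f" and p: "!!t. t : {0..T} ==> 0 <= f t"
  and b: "!!t. t : {0..T} ==> f t <= L * integral {0..t} f" and t: "t : {0..T}"
 shows "f t = 0"
proof -
 define h where "h s = exp (- L * s) * integral {0..s} f" for s
 have i: "f integrable_on {0..s}" if "s <= T" for s using c that by (intro integrable_continuous_real) (auto intro: continuous_on_subset)
 have hc: "continuous_on {0..t} h" unfolding h_def
  using t by (intro continuous_intros indefinite_integral_continuous_1 i) auto
 have "h t <= h 0"
 proof (rule DERIV_nonpos_imp_decreasing_open[OF _ _ hc])
  fix x assume x: "0 < x" "x < t"
  have "((%s. integral {0..s} f) has_vector_derivative f x) (at x within {0..T})"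
   by (rule integral_has_vector_derivative[OF c]) (use x t in auto)
  moreover have "at x within {0..T} = at x" using x t by (intro at_within_interior) simp
  ultimately have "((%s. integral {0..s} f) has_real_derivative f x) (at x)"
   by (simp only: has_real_derivative_iff_has_vector_derivative)
  hence "(h has_real_derivative exp (- L * x) * (f x - L * integral {0..x} f)) (at x)"
   unfolding h_def by (auto intro!: derivative_eq_intros simp: algebra_simps)
  moreover have "exp (- L * x) * (f x - L * integral {0..x} f) <= 0" using b[of x] x t by (intro mult_nonneg_nonpos) auto
  ultimately show "EX y. (h has_real_derivative y) (at x) & y <= 0" by blast
 qed (use t in auto)
 hence "integral {0..t} f <= 0" by (simp add: h_def mult_le_0_iff)
 moreover have "0 <= integral {0..t} f" using p t by (intro integral_nonneg i) auto
 ultimately show ?thesis using b[OF t] p[OF t] by simp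
qed

lemma operator_processD:
 assumes "operator_process X" "t >= 0"
 shows "dom (X t) = exp_domain" "lin_operator (X t)"
 using assms by (auto simp: operator_process_def)

lemma process_eqI:
 fixes X X' :: "real => ('h::complex_hilbert, 'k::complex_hilbert) hf \<rightharpoonup> ('h, 'k) hf"
 assumes X: "operator_process X" "operator_process X'"
  and eq: "!!t u f. t >= 0 ==> f : step_funs ==> the (X t (u ox f)) = the (X' t (u ox f))"
 shows "t >= 0 ==> z : exp_domain ==> the (X t z) = the (X' t z)" "X = X'"
proof -
 show 1: "the (X t z) = the (X' t z)" if t: "t >= 0" and z: "z : exp_domain" for t z
 proof -
  obtain n u f where f: "ALL i<n. f i : step_funs" "z = (\<Sum>i<(n::nat). u i ox f i)"
   using exp_domain_rep[OF z] by blast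
  have s: "the (Z t (\<Sum>i<n. u i ox f i)) = (\<Sum>i<n. the (Z t (u i ox f i)))" if "operator_process Z" for Z
   using lin_operator_sum[OF operator_processD(2)[OF that t], of "{..<n}" "%i. u i ox f i"] f(1)
   by (simp add: operator_processD(1)[OF that t] del: domIff)
  show ?thesis unfolding f(2) s[OF X(1)] s[OF X(2)] by (rule sum.cong) (use eq[OF t] f(1) in auto)
 qed
 show "X = X'"
 proof (intro ext)
  fix t z
  show "X t z = X' t z"
  proof (cases "t >= 0")
   case True
   note d = operator_processD(1)[OF X(1) True] operator_processD(1)[OF X(2) True]
   show ?thesis
   proof (cases "z : exp_domain")
    case z: True
    show ?thesis
     using 1[OF True z] z d by (metis domD option.sel)
   next
    case False thus ?thesis using d by (metis domIff)
   qed
  qed (use X in "simp add: operator_process_def")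
 qed
qed

context flow
begin

context
 fixes F :: "('k, 'h) ch op"
 assumes F: "F : bops \<otimes>\<^sub>N A"
begin

section \<open>The integrand of the perturbation equation and uniqueness\<close>

lemma integrand_props:
 assumes X: "operator_process X" and t: "t >= 0"
 shows "lin_operator (perturbation_integrand A j F X t)"
  "z : exp_domain ==> x \<odot> z : dom (perturbation_integrand A j F X t)"
  "z : exp_domain ==> the (perturbation_integrand A j F X t (x \<odot> z)) = ktilde A j t F (x \<odot> the (X t z))"
proof -
 note Xt = operator_processD[OF X t]
 note a = ampliation_props[OF Xt(2), where ?'c = "complex \<times> 'k", unfolded Xt(1)]
 note K = ktilde_eq(2)[OF t F]
 let ?G = "perturbation_integrand A j F X t"
 have d: "dom ?G = dom (ampliation (X t) :: ('k, _) ch \<rightharpoonup> _)"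
  by (auto simp: perturbation_integrand_def map_comp_def split: option.splits)
 have v: "the (?G y) = ktilde A j t F (the (ampliation (X t) y))" if "y : dom (ampliation (X t))" for y
  using that by (auto simp: perturbation_integrand_def)
 show "lin_operator ?G"
  unfolding lin_operator_def linear_on_def d
  using lin_operatorD[OF a(1)] K cvec.subspace_add[OF lin_operatorD(1)[OF a(1)]] cvec.subspace_scale[OF lin_operatorD(1)[OF a(1)]]
  by (simp add: v bopsD blinfun.add_right del: domIff)
 assume z: "z : exp_domain"
 show in_dom: "x \<odot> z : dom ?G" unfolding d using a(3)[OF z, of x] by auto
 show "the (?G (x \<odot> z)) = ktilde A j t F (x \<odot> the (X t z))"
  using v[of "x \<odot> z"] in_dom a(3)[OF z, of x] unfolding d by simp
qed

lemma integrand_nabla: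
 assumes X: "operator_process X" and t: "t >= 0" and g: "g : step_funs"
 shows "the (perturbation_integrand A j F X t (the (nabla t (v ox g)))) = ktilde A j t F ((1, g t) \<odot> the (X t (v ox g)))"
 using integrand_props(3)[OF X t exp_in[OF g, of v], of "(1, g t)"] by (simp add: nabla_props(3)[OF t g])

lemma norm_one_pair: "norm c <= C ==> norm ((1::complex), c) <= 1 + C"
 using norm_Pair_le[of "1::complex" c] by simp

text \<open>Strong continuity and uniform boundedness of \<open>ktilde\<close> in time combine with
  right continuity of \<open>g\<close> and continuity of \<open>x\<close>.\<close>

lemma ktilde_rcont_bounded:
 assumes g: "g : step_funs" and x: "continuous_on {0..} x"
 shows "rcont_bounded (%s. ktilde A j s F ((1, g s) \<odot> x s))"
 unfolding rcont_bounded_def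
proof (intro conjI allI impI)
 fix s :: real assume s: "s >= 0"
 define y where "y r = (1::complex, g r) \<odot> x r" for r
 have gr: "((%r. (1::complex, g r)) ---> (1, g s)) (at s within {s..})"
  using step_rcont[OF g, of s] by (intro tendsto_Pair tendsto_const) (simp add: continuous_within)
 have xr: "(x ---> x s) (at s within {s..})"
  using x s by (auto simp: continuous_on_def intro: tendsto_within_subset)
 have yr: "(y ---> y s) (at s within {s..})"
 proof (rule LIM_zero_cancel, rule Lim_null_comparison)
  show "\<forall>\<^sub>F r in at s within {s..}. norm (y r - y s) <= norm ((1::complex, g r) - (1, g s)) * norm (x r) + norm (1::complex, g s) * norm (x r - x s)"
  proof (intro always_eventually allI)
   fix r
   have "y r - y s = ((1, g r) - (1, g s)) \<odot> x r + (1, g s) \<odot> (x r - x s)"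
    unfolding y_def tensor_diff_left tensor_diff_right by simp
   thus "norm (y r - y s) <= norm ((1::complex, g r) - (1, g s)) * norm (x r) + norm (1::complex, g s) * norm (x r - x s)"
    using norm_triangle_ineq[of "((1, g r) - (1, g s)) \<odot> x r" "(1, g s) \<odot> (x r - x s)"] by (simp only: norm_tensor)
  qed
  have "((%r. norm ((1::complex, g r) - (1, g s)) * norm (x r) + norm (1::complex, g s) * norm (x r - x s)) --->
    norm ((1::complex, g s) - (1, g s)) * norm (x s) + norm (1::complex, g s) * norm (x s - x s)) (at s within {s..})"
   by (intro tendsto_add tendsto_mult tendsto_norm tendsto_diff tendsto_const gr xr)
  thus "((%r. norm ((1::complex, g r) - (1, g s)) * norm (x r) + norm (1::complex, g s) * norm (x r - x s)) ---> 0) (at s within {s..})" by simp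
 qed
 have Kr: "((%r. ktilde A j r F (y s)) ---> ktilde A j s F (y s)) (at s within {s..})"
  by (rule tendsto_within_subset[OF ktilde_continuous[OF F s]]) (use s in auto)
 have "((%r. ktilde A j r F (y r)) ---> ktilde A j s F (y s)) (at s within {s..})"
 proof (rule LIM_zero_cancel, rule Lim_null_comparison)
  show "\<forall>\<^sub>F r in at s within {s..}. norm (ktilde A j r F (y r) - ktilde A j s F (y s)) <=
    norm F * norm (y r - y s) + norm (ktilde A j r F (y s) - ktilde A j s F (y s))"
   unfolding eventually_at
  proof (intro exI[of _ 1] conjI ballI impI)
   fix r assume "r : {s..}"
   hence r: "r >= 0" using s by simp
   have "norm (ktilde A j r F (y r - y s)) <= norm F * norm (y r - y s)"
    using norm_blinfun[of "ktilde A j r F" "y r - y s"] ktilde_eq(3)[OF r F] by (meson mult_right_mono norm_ge_zero order_trans)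
   thus "norm (ktilde A j r F (y r) - ktilde A j s F (y s)) <= norm F * norm (y r - y s) + norm (ktilde A j r F (y s) - ktilde A j s F (y s))"
    using norm_triangle_ineq[of "ktilde A j r F (y r - y s)" "ktilde A j r F (y s) - ktilde A j s F (y s)"]
    by (simp add: blinfun.diff_right)
  qed simp
  have "((%r. norm F * norm (y r - y s) + norm (ktilde A j r F (y s) - ktilde A j s F (y s))) --->
    norm F * norm (y s - y s) + norm (ktilde A j s F (y s) - ktilde A j s F (y s))) (at s within {s..})"
   by (intro tendsto_add tendsto_mult tendsto_norm tendsto_diff tendsto_const yr Kr)
  thus "((%r. norm F * norm (y r - y s) + norm (ktilde A j r F (y s) - ktilde A j s F (y s))) ---> 0) (at s within {s..})" by simp
 qed
 thus "continuous (at s within {s..}) (%s. ktilde A j s F ((1, g s) \<odot> x s))" by (simp add: continuous_within y_def)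
next
 fix T
 obtain C where C: "!!s. norm (g s) <= C" using step_bounded[OF g] by blast
 have "bounded (x ` {0..T})" using x by (intro compact_imp_bounded compact_continuous_image) (auto intro: continuous_on_subset)
 then obtain B where B: "!!s. s : {0..T} ==> norm (x s) <= B" unfolding bounded_iff by blast
 have "norm (ktilde A j s F ((1, g s) \<odot> x s)) <= norm F * ((1 + C) * B)" if s: "s : {0..T}" for s
 proof -
  have "norm (ktilde A j s F ((1, g s) \<odot> x s)) <= norm (ktilde A j s F) * norm ((1::complex, g s) \<odot> x s)" by (rule norm_blinfun)
  also have "... <= norm F * ((1 + C) * B)"
   unfolding norm_tensor using s B[OF s] norm_one_pair[OF C[of s]] order_trans[OF norm_ge_zero C[of s]]
   by (intro mult_mono ktilde_eq(3)[OF _ F]) auto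
  finally show ?thesis .
 qed
 thus "EX B. ALL s:{0..T}. norm (ktilde A j s F ((1, g s) \<odot> x s)) <= B" by blast
qed

lemma strong_solution_path:
 fixes v :: 'h
 assumes X: "strong_solution A j F X" and g: "g : step_funs"
 defines "x == %t. the (X t (v ox g))" and "z == %s. the (perturbation_integrand A j F X s (the (nabla s (v ox g))))"
 shows "continuous_on {0..} x" "t >= 0 ==> qs_vector z 0 t (x t - v ox g)" "adapted_vec g z" "s >= 0 ==> z s = ktilde A j s F ((1, g s) \<odot> x s)"
proof -
 let ?w = "v ox g" and ?G = "perturbation_integrand A j F X"
 have P: "operator_process X" and G: "qs_integrable ?G" and eq: "!!t. t >= 0 ==> x t = ?w + the (qs_integral ?G t ?w)"
  using X exp_in[OF g, of v] by (auto simp: strong_solution_def x_def)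
 have "continuous_on {0..} (%t. the (qs_integral ?G t ?w))"
  using qs_integral_props(1)[OF G] exp_in[OF g, of v] by (simp add: continuous_process_def)
 hence "continuous_on {0..} (%t. ?w + the (qs_integral ?G t ?w))" by (intro continuous_intros)
 thus "continuous_on {0..} x" by (rule continuous_on_cong[THEN iffD2, OF refl, rotated]) (simp add: eq)
 show "qs_vector z 0 t (x t - ?w)" if "t >= 0"
  using qs_integral_props(2)[OF G that exp_in[OF g, of v]] by (simp add: eq[OF that] z_def)
 show "adapted_vec g z" unfolding z_def by (rule qs_integrable_adapted_vec[OF G g])
 show "z s = ktilde A j s F ((1, g s) \<odot> x s)" if "s >= 0" unfolding z_def x_def by (rule integrand_nabla[OF P that g])
qed

text \<open>On each exponential vector the difference \<open>d\<close> of two solutions is the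
  integral of \<open>ktilde\<close> applied to (1, g) \<odot> d. The fundamental estimate bounds it
  by an L1 and an L2 norm of \<open>d\<close>; the factor sqrt t turns the former into an L2 norm,
  so the squared norm of \<open>d\<close> satisfies Gronwall's inequality.\<close>

lemma strong_solution_unique:
 assumes X: "strong_solution A j F X" and X': "strong_solution A j F X'"
 shows "X = X'"
proof (rule process_eqI)
 show "operator_process X" "operator_process X'" using X X' by (auto simp: strong_solution_def)
 fix t :: real and v :: 'h and g :: "real => 'k" assume t: "t >= 0" and g: "g : step_funs"
 let ?w = "v ox g"
 define d where "d t = the (X t ?w) - the (X' t ?w)" for t
 define z where "z s = ktilde A j s F ((1, g s) \<odot> d s)" for s
 note p = strong_solution_path[where v = v, OF X g] and p' = strong_solution_path[where v = v, OF X' g]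
 let ?z = "%s. the (perturbation_integrand A j F X s (the (nabla s ?w)))" and ?z' = "%s. the (perturbation_integrand A j F X' s (the (nabla s ?w)))"
 have dc: "continuous_on {0..} d" unfolding d_def by (intro continuous_intros p(1) p'(1))
 have z_eq: "z s = ?z s - ?z' s" if "s >= 0" for s
  unfolding z_def d_def p(4)[OF that] p'(4)[OF that] tensor_diff_right blinfun.diff_right ..
 have rb: "rcont_bounded z" unfolding z_def by (rule ktilde_rcont_bounded[OF g dc])
 have zv: "qs_vec z" by (rule rcont_bounded_qs_vec[OF rb refl])
 have za: "adapted_vec g z"
  using p(3) p'(3) by (simp add: adapted_vec_def z_eq cinner_diff_right algebra_simps)
 have qi: "qs_vec ?z" "qs_vec ?z'" using X X' zz_vec[OF _ exp_in[OF g, of v]] by (auto simp: strong_solution_def)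
 have dv: "qs_vector z 0 t (d t)" if t: "t >= 0" for t
  unfolding qs_vector_def
 proof (intro allI ballI)
  fix u :: 'h and f :: "real => 'k" assume f: "f : step_funs"
  let ?e = "%s. (1, f s) \<odot> (u ox f)"
  have "(LINT s:{0..t}|lebesgue. cinner (?e s) (z s)) = (LINT s:{0..t}|lebesgue. cinner (?e s) (?z s) - cinner (?e s) (?z' s))"
   by (rule LINT_cong_pos) (simp add: z_eq cinner_diff_right)
  also have "... = cinner (u ox f) (d t)"
   unfolding set_integral_diff(2)[OF qs_vec_cinner_integrable[OF qi(1) order_refl f] qs_vec_cinner_integrable[OF qi(2) order_refl f]]
    p(2)[OF t, unfolded qs_vector_def, rule_format, OF f, symmetric] p'(2)[OF t, unfolded qs_vector_def, rule_format, OF f, symmetric]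
   by (simp add: cinner_diff_right d_def)
  finally show "cinner (u ox f) (d t) = (LINT s:{0..t}|lebesgue. cinner (?e s) (z s))" ..
 qed
 obtain C where C: "!!s. norm (g s) <= C" using step_bounded[OF g] by blast
 have C0: "C >= 0" using order_trans[OF norm_ge_zero C[of 0]] .
 define M where "M = norm F * (1 + C)"
 have zn: "norm (z s) <= M * norm (d s)" if "s >= 0" for s
 proof -
  have "norm (z s) <= norm (ktilde A j s F) * norm ((1::complex, g s) \<odot> d s)" unfolding z_def by (rule norm_blinfun)
  also have "... <= norm F * ((1 + C) * norm (d s))"
   unfolding norm_tensor using norm_one_pair[OF C[of s]] C0 by (intro mult_mono ktilde_eq(3)[OF that F]) auto
  finally show ?thesis by (simp add: M_def)
 qed
 \<comment> \<open>\<open>a\<close> bounds the integrand of the L1 part of \<open>qs_bound\<close>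
   relative to the norm of \<open>d\<close>, and \<open>b\<close> does the same for the L2
   part.\<close>
 define a where "a = (norm (Delta_perp :: ('k, ('h, 'k) hf) ch =>L _) + C * norm (Delta :: ('k, ('h, 'k) hf) ch =>L _)) * M"
 define b where "b = norm (Delta :: ('k, ('h, 'k) hf) ch =>L _) * M"
 have M0: "M >= 0" using C0 by (simp add: M_def)
 have pos: "a >= 0" "b >= 0" using C0 M0 by (auto simp: a_def b_def)
 have Dn: "norm (blinfun_apply D (z s)) <= norm D * M * norm (d s)" if "s >= 0" for s and D :: "_ =>L ('k, ('h, 'k) hf) ch"
  using norm_blinfun[of D "z s"] mult_left_mono[OF zn[OF that] norm_ge_zero[of D]] by (simp)
 have b1: "norm (Delta_perp (z s)) + C * norm (Delta (z s)) <= a * norm (d s)" if "s >= 0" for s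
  using Dn[OF that, of Delta_perp] mult_left_mono[OF Dn[OF that, of Delta] C0] by (simp add: a_def algebra_simps)
 have b2: "(norm (Delta (z s)))^2 <= b\<^sup>2 * (norm (d s))^2" if "s >= 0" for s
  using power_mono[OF Dn[OF that, of Delta], of 2] by (simp add: b_def power_mult_distrib)
 define l where "l s = (norm (d s))^2" for s
 have lc: "continuous_on {0..T} l" for T unfolding l_def by (intro continuous_intros continuous_on_subset[OF dc]) auto
 have li: "set_integrable lebesgue {0..T} l" and ni: "set_integrable lebesgue {0..T} (%s. norm (d s))" for T
  by (rule absolutely_integrable_continuous_real[OF lc], rule absolutely_integrable_continuous_real) (intro continuous_intros continuous_on_subset[OF dc], auto)
 have est: "l r <= (a * sqrt t + b)^2 * integral {0..r} l" if r: "r : {0..t}" for r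
 proof -
  let ?I = "LINT s:{0..r}|lebesgue. l s"
  note zf = qs_vec_facts[OF zv order_refl, of r]
  have I0: "0 <= ?I" by (auto simp: set_lebesgue_integral_def l_def)
  have "(LINT s:{0..r}|lebesgue. norm (Delta_perp (z s)) + C * norm (Delta (z s))) <= (LINT s:{0..r}|lebesgue. a * norm (d s))"
   by (intro set_integral_mono set_integral_add(1) set_integrable_mult_right zf ni) (use b1 in auto)
  also have "... = a * (LINT s:{0..r}|lebesgue. 1 * norm (d s))" by simp
  finally have 0: "(LINT s:{0..r}|lebesgue. norm (Delta_perp (z s)) + C * norm (Delta (z s))) <= a * (LINT s:{0..r}|lebesgue. 1 * norm (d s))" .
  have "(LINT s:{0..r}|lebesgue. 1 * norm (d s)) <= sqrt r * sqrt ?I"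
  proof -
   have m: "(%s. indicator {0..r} s * norm (d s)) : borel_measurable lebesgue"
    using borel_measurable_integrable[OF ni[of r, unfolded set_integrable_def]] by simp
   have "\<bar>LINT s:{0..r}|lebesgue. 1 * norm (d s)\<bar> <= sqrt (LINT s:{0..r}|lebesgue. 1\<^sup>2) * sqrt (LINT s:{0..r}|lebesgue. (norm (d s))^2)"
    by (rule Cauchy_Schwarz_real(2)[OF _ _ _ m]) (use li in "auto simp: l_def set_integrable_def integrable_indicator_iff emeasure_lborel_Icc_eq intro!: borel_measurable_indicator")
   also have "(LINT s:{0..r}|lebesgue. (1::real)^2) = r" using r by (simp add: set_lebesgue_integral_def)
   finally show ?thesis by (simp add: l_def)
  qed
  also have "... <= sqrt t * sqrt ?I" using r I0 by (intro mult_right_mono) auto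
  finally have 1: "(LINT s:{0..r}|lebesgue. norm (Delta_perp (z s)) + C * norm (Delta (z s))) <= a * (sqrt t * sqrt ?I)"
   using order_trans[OF 0 mult_left_mono[OF _ pos(1)]] by blast
  have "(LINT s:{0..r}|lebesgue. (norm (Delta (z s)))^2) <= (LINT s:{0..r}|lebesgue. b\<^sup>2 * l s)"
   by (intro set_integral_mono set_integrable_mult_right zf li) (use b2 in "auto simp: l_def")
  hence "sqrt (LINT s:{0..r}|lebesgue. (norm (Delta (z s)))^2) <= sqrt (b\<^sup>2 * ?I)" by simp
  also have "... = b * sqrt ?I" using pos by (simp add: real_sqrt_mult)
  finally have "qs_bound C z 0 r <= (a * sqrt t + b) * sqrt ?I" using 1 by (simp add: qs_bound_def algebra_simps)
  moreover have "norm (d r) <= qs_bound C z 0 r"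
   using qs_vector_exists[OF zv za g C order_refl, of r] qs_vector_unique[OF dv] r by auto
  ultimately have "norm (d r) <= (a * sqrt t + b) * sqrt ?I" by simp
  from power_mono[OF this norm_ge_zero, of 2]
  have "l r <= (a * sqrt t + b)^2 * ?I" using I0 by (simp add: l_def power_mult_distrib)
  thus ?thesis using set_lebesgue_integral_eq_integral(2)[OF li] by simp
 qed
 have "l t = 0" by (rule Gronwall_zero[OF lc _ est]) (use t in "auto simp: l_def")
 thus "the (X t ?w) = the (X' t ?w)" by (simp add: l_def d_def)
qed

end

end

section \<open>Stochastic derivatives\<close>

abbreviation gen1 :: "'a::complex_hilbert => 'a fock" where "gen1 x == generator (SGen [x])"

lemma gen1_props:
 fixes x y :: "'a::complex_hilbert"
 shows "cinner (gen1 x) (gen1 y) = cinner x y" "gen1 (a *r x) = a *r gen1 x"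
  "cinner (gen1 x) (nexp y) = of_real (exp (- (norm y)\<^sup>2 / 2)) * cinner x y"
proof -
 show 1: "cinner (gen1 x) (gen1 y) = cinner x y" for x y using sym_ker_replicate[of "[x]" 1 y] by simp
 have "cinner (gen1 (a *r x) - a *r gen1 x) (gen1 (a *r x) - a *r gen1 x) = 0"
  by (simp add: cinner_diff_left cinner_diff_right 1 del: cinner_generator)
 thus "gen1 (a *r x) = a *r gen1 x" by (simp add: cinner_zero_iff)
 show "cinner (gen1 x) (nexp y) = of_real (exp (- (norm y)\<^sup>2 / 2)) * cinner x y"
  by (simp add: cinner_generator_exp)
qed

abbreviation cst :: "real => 'k::complex_hilbert => real => 'k" where "cst t c == cut {0..<t} (%_. c)"

lemma cst_props:
 fixes c d :: "'k::complex_hilbert"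
 assumes t: "t >= 0"
 shows "cst t c : step_funs" "cinner (L2_class (cst t c)) (L2_class (cst t d)) = of_real t * cinner c d"
  "(norm (L2_class (cst t c)))^2 = t * (norm c)^2"
proof -
 have s: "cst t c : step_funs" for c :: 'k unfolding cut_def by (rule step_indicator) simp
 thus "cst t c : step_funs" .
 have "cinner (cst t c s) (cst t d s) = indicator {0..<t} s *r cinner c d" for s by (simp add: cut_def indicator_def)
 thus "cinner (L2_class (cst t c)) (L2_class (cst t d)) = of_real t * cinner c d"
  using s t by (simp add: cinner_L2_class scaleR_conv_of_real)
 have "(norm (cst t c s))^2 = indicator {0..<t} s *r (norm c)^2" for s by (simp add: cut_def indicator_def)
 thus "(norm (L2_class (cst t c)))^2 = t * (norm c)^2" using s t by (simp add: norm_L2_class)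
qed

lemma V_iso_props:
 fixes c :: "'k::complex_hilbert" and u :: "'h::complex_hilbert"
 assumes t: "t > 0"
 shows "(V_iso t :: ('k, 'h) tensor =>L _) : bops"
  "V_iso t (c \<odot> u) = (1 / sqrt t) *r (u \<odot> gen1 (L2_class (cst t c)))"
proof -
 define b where "b = (%(c::'k, u::'h). u \<odot> gen1 ((1 / sqrt t) *r L2_class (cst t c)))"
 have g: "cinner (b i) (b j) = cinner ((%(x, y). x \<odot> y) i) ((%(x, y). x \<odot> y) j)" for i j
  using t by (simp add: b_def split_beta gen1_props cst_props of_real_mult[symmetric] del: cinner_generator of_real_mult)
 obtain V where V: "V : bops" "!!i. blinfun_apply V ((%(x, y). x \<odot> y) i) = b i"
  using gram_isometry_total[of b "%(x, y). x \<odot> y", OF g total_tensor_range] by metis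
 have v: "blinfun_apply V (c \<odot> u) = u \<odot> gen1 ((1 / sqrt t) *r L2_class (cst t c))" for c u
  using V(2)[of "(c, u)"] by (simp add: b_def)
 have "V_iso t = V"
  unfolding V_iso_def by (rule the_equality) (use V(1) v in "auto intro!: total_op_eqI[OF total_tensor_range]")
 thus "(V_iso t :: ('k, 'h) tensor =>L _) : bops" "V_iso t (c \<odot> u) = (1 / sqrt t) *r (u \<odot> gen1 (L2_class (cst t c)))"
  using V(1) v by (simp_all add: gen1_props(2) tensor_scaleR_right)
qed

lemma block_iso_props:
 fixes c :: "'k::complex_hilbert" and u :: "'h::complex_hilbert"
 shows "(block_iso :: ('k, 'h) ch =>L _) : bops"
  "block_iso ((z, c) \<odot> u) = (z *c u, c \<odot> u)"
  "adj block_iso (block_iso x) = (x :: ('k, 'h) ch)"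
proof -
 define b where "b = (%((z::complex, c::'k), u::'h). (z *c u, c \<odot> u))"
 have g: "cinner (b i) (b j) = cinner ((%(x, y). x \<odot> y) i) ((%(x, y). x \<odot> y) j)" for i j
  by (simp add: b_def split_beta cinner_prod_def cinner_scaleC_left cinner_scaleC_right cinner_complex_def algebra_simps)
 obtain V where V: "V : bops" "!!i. blinfun_apply V ((%(x, y). x \<odot> y) i) = b i"
  "!!x y. cinner (blinfun_apply V x) (blinfun_apply V y) = cinner x y"
  by (rule gram_isometry_total[of b "%(x, y). x \<odot> y", OF g total_tensor_range]) (rule that)
 have v: "blinfun_apply V ((z, c) \<odot> u) = (z *c u, c \<odot> u)" for z c u
  using V(2)[of "((z, c), u)"] by (simp add: b_def)
 have "block_iso = V"
  unfolding block_iso_def by (rule the_equality) (use V(1) v in "auto intro!: total_op_eqI[OF total_tensor_range]")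
 thus "(block_iso :: ('k, 'h) ch =>L _) : bops" "block_iso ((z, c) \<odot> u) = (z *c u, c \<odot> u)"
  "adj block_iso (block_iso x) = (x :: ('k, 'h) ch)"
  using V(1) v isometry_adj_comp(2)[OF V(1,3)] by simp_all
qed

lemma block_row_apply: "block_row S T (x, y) = S x + T y"
proof -
 have "bounded_linear (%p. blinfun_apply S (fst p) + blinfun_apply T (snd p))"
  by (intro bounded_linear_add bounded_linear_compose[OF blinfun.bounded_linear_right] bounded_linear_fst bounded_linear_snd)
 thus ?thesis unfolding block_row_def split_beta by (simp add: bounded_linear_Blinfun_apply)
qed

lemma block_column_apply: "block_column S T x = (S x, T x)"
proof -
 have "bounded_linear (%x. (blinfun_apply S x, blinfun_apply T x))"
  by (intro bounded_linear_Pair blinfun.bounded_linear_right)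
 thus ?thesis by (simp add: block_column_def bounded_linear_Blinfun_apply)
qed

text \<open>The exponential vector of \<open>cst t c\<close> to first order: the vacuum plus the
  one-particle term, without normalisation. Up to the factor 1 / sqrt t it is what the block
  operators of the stochastic derivative make of (1, c).\<close>

definition vac1 :: "real => 'k::complex_hilbert => 'k Fock" where
 "vac1 t c = varpi (%_. 0) + gen1 (L2_class (cst t c))"

text \<open>The factors 1 / sqrt t of the row and of the column combine to 1 / t.\<close>

lemma block_derivative:
 fixes Z :: "('h::complex_hilbert, 'k::complex_hilbert) fop"
 assumes t: "t > 0" and Z: "Z : bops"
 shows "cinner (block_iso ((1, c) \<odot> u)) ((block_column ((1 / sqrt t) *r adj (ket (varpi (%_. 0)))) (adj (V_iso t)) oo Z oo
   block_row ((1 / sqrt t) *r ket (varpi (%_. 0))) (V_iso t)) (block_iso ((1, d) \<odot> v))) =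
  of_real (1 / t) * cinner u (slice (vac1 t c) Z (vac1 t d) v)"
proof -
 have row: "block_row ((1 / sqrt t) *r ket (varpi (%_. 0))) (V_iso t) (block_iso ((1, d) \<odot> v)) = (1 / sqrt t) *r (v \<odot> vac1 t d)" for d and v :: 'h
  by (simp add: block_iso_props block_row_apply V_iso_props[OF t] vac1_def tensor_add_right scaleR_add_right scaleR_blinfun.rep_eq)
 have col: "cinner (block_iso ((1, c) \<odot> u)) (block_column ((1 / sqrt t) *r adj (ket (varpi (%_. 0)))) (adj (V_iso t)) w) =
   of_real (1 / sqrt t) * cinner (u \<odot> vac1 t c) w" for w
  by (simp add: block_iso_props block_column_apply cinner_prod_def V_iso_props[OF t] vac1_def tensor_add_right cinner_add_left
    cinner_adj_right scaleR_blinfun.rep_eq algebra_simps)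
 have "Z (a *r x) = a *r Z x" for a x by (simp add: blinfun.scaleR_right)
 thus ?thesis
  unfolding blinfun_apply_blinfun_compose row col using t
  by (simp add: cinner_slice of_real_mult[symmetric] del: of_real_mult)
qed

text \<open>With a = t |c|^2 the first squared norm is 2 + a - 2 exp(-a/2) (1 + a), and exp(-a/2) >=
  1 - a/2 bounds it by a^2.\<close>

lemma vac1_estimates:
 fixes c :: "'k::complex_hilbert"
 assumes t: "t >= 0"
 shows "norm (varpi (cst t c) - vac1 t c) <= t * (norm c)^2" "norm (vac1 t c - varpi (%_. 0)) <= sqrt t * norm c"
proof -
 define x where "x = L2_class (cst t c)"
 define a where "a = (norm x)^2"
 have a: "a = t * (norm c)^2" "a >= 0" using cst_props(3)[OF t, of c] t by (simp_all add: a_def x_def)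
 have z: "L2_class (%_. 0::'k) = 0"
  using L2_class_scaleC[OF sq_integrable_0, of 0, where 'a = 'k] by simp
 have xx: "cinner x x = of_real a" by (simp add: a_def cinner_self_norm)
 have o: "varpi (%_. 0::'k) = nexp 0" by (simp add: varpi_def z)
 have f: "varpi (cst t c) = nexp x" by (simp add: varpi_def x_def)
 have ip: "cinner (nexp x) (nexp 0) = of_real (exp (- a / 2))" "cinner (nexp 0) (nexp x) = of_real (exp (- a / 2))"
  by (simp_all add: cinner_exp_exp a_def exp_of_real[symmetric])
 have ig: "cinner (gen1 x) (nexp x) = of_real (exp (- a / 2) * a)" "cinner (gen1 x) (nexp 0) = 0"
  by (simp_all add: gen1_props(3) xx del: of_real_power) (simp add: a_def)
 have ig': "cinner (nexp x) (gen1 x) = of_real (exp (- a / 2) * a)" "cinner (nexp 0) (gen1 x) = 0"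
  using ig cinner_commute[of "nexp x" "gen1 x"] cinner_commute[of "nexp 0" "gen1 x"] by (simp_all del: cinner_generator)
 have n1: "cinner (nexp y) (nexp y) = 1" for y :: "'k L2" by (simp add: cinner_self_norm)
 have "complex_of_real ((norm (varpi (cst t c) - vac1 t c))^2) = of_real (2 + a - 2 * exp (- a / 2) * (1 + a))"
  unfolding cinner_self_norm[symmetric] vac1_def f o x_def[symmetric]
  by (simp add: cinner_diff_left cinner_diff_right cinner_add_left cinner_add_right ip ig ig' n1 gen1_props(1) xx algebra_simps del: cinner_generator)
 hence "(norm (varpi (cst t c) - vac1 t c))^2 = 2 + a - 2 * exp (- a / 2) * (1 + a)" unfolding of_real_eq_iff .
 moreover have "(1 - a / 2) * (1 + a) <= exp (- a / 2) * (1 + a)"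
  using exp_ge_add_one_self[of "- a / 2"] a(2) by (intro mult_right_mono) auto
 moreover have "(1 - a / 2) * (1 + a) = 1 + a / 2 - a\<^sup>2 / 2" by (simp add: power2_eq_square field_simps)
 ultimately have "(norm (varpi (cst t c) - vac1 t c))^2 <= a\<^sup>2" by linarith
 hence "norm (varpi (cst t c) - vac1 t c) <= a" using a(2) by (rule power2_le_imp_le)
 thus "norm (varpi (cst t c) - vac1 t c) <= t * (norm c)^2" by (simp add: a(1))
 have "complex_of_real ((norm (gen1 x))^2) = of_real a" unfolding cinner_self_norm[symmetric] gen1_props(1) xx ..
 hence "(norm (gen1 x))^2 = (sqrt t * norm c)^2" unfolding of_real_eq_iff using t by (simp add: a(1) power_mult_distrib)
 hence "norm (gen1 x) = sqrt t * norm c" using t by (simp)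
 thus "norm (vac1 t c - varpi (%_. 0)) <= sqrt t * norm c" by (simp add: vac1_def x_def)
qed

lemma vac1_limits:
 fixes c :: "'k::complex_hilbert"
 shows "((%t. vac1 t c) ---> varpi (%_. 0)) (at_right 0)" "((%t. varpi (cst t c)) ---> varpi (%_. 0)) (at_right 0)"
proof -
 have pos: "\<forall>\<^sub>F t in at_right (0::real). t > 0" by (simp add: eventually_at_right_less)
 have "((%t. sqrt t * norm c) ---> sqrt 0 * norm c) (at_right 0)" by (intro tendsto_intros)
 hence l: "((%t. sqrt t * norm c) ---> 0) (at_right 0)" by simp
 show 1: "((%t. vac1 t c) ---> varpi (%_. 0)) (at_right 0)"
  by (rule LIM_zero_cancel, rule Lim_null_comparison[OF _ l]) (use pos in eventually_elim, rule vac1_estimates(2), simp)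
 have "((%t. t * (norm c)^2) ---> 0 * (norm c)^2) (at_right 0)" by (intro tendsto_intros)
 hence l2: "((%t. t * (norm c)^2) ---> 0) (at_right 0)" by simp
 have "((%t. varpi (cst t c) - vac1 t c) ---> 0) (at_right 0)"
  by (rule Lim_null_comparison[OF _ l2]) (use pos in eventually_elim, rule vac1_estimates(1), simp)
 from tendsto_add[OF this 1] show "((%t. varpi (cst t c)) ---> varpi (%_. 0)) (at_right 0)" by simp
qed

lemma limitin_ultraweak_add:
 assumes "limitin ultraweak S s F" "limitin ultraweak T t F"
 shows "limitin ultraweak (%i. S i + T i) (s + t) F"
proof (rule limitin_ultraweakI)
 have b: "s : bops" "t : bops" "\<forall>\<^sub>F i in F. S i : bops" "\<forall>\<^sub>F i in F. T i : bops"
  using assms by (auto simp: limitin_def intro: openin_topspace[of ultraweak, simplified])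
 show "s + t : bops" using b by (simp)
 show "\<forall>\<^sub>F i in F. S i + T i : bops" using b(3,4) by eventually_elim (simp add: bops_add)
 fix x y :: "nat => 'a" assume s: "sq_summable x" "sq_summable y"
 show "((%i. uw x y (S i + T i)) ---> uw x y (s + t)) F"
  unfolding uw_add[OF s] by (intro tendsto_add limitin_ultraweakD assms s)
qed

lemma limitin_ultraweak_scaleC:
 assumes T: "limitin ultraweak T t F" and c: "(c ---> d) F"
 shows "limitin ultraweak (%i. c i *c T i) (d *c t) F"
proof (rule limitin_ultraweakI)
 have b: "t : bops" "\<forall>\<^sub>F i in F. T i : bops"
  using T by (auto simp: limitin_def intro: openin_topspace[of ultraweak, simplified])
 show "d *c t : bops" using b by (simp)
 show "\<forall>\<^sub>F i in F. c i *c T i : bops" using b(2) by eventually_elim (simp add: bops_scaleC)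
 fix x y :: "nat => 'a" assume s: "sq_summable x" "sq_summable y"
 show "((%i. uw x y (c i *c T i)) ---> uw x y (d *c t)) F"
  unfolding uw_scaleC[OF s] by (intro tendsto_mult limitin_ultraweakD T c s)
qed

lemma limitin_ultraweak_cong:
 assumes "limitin ultraweak S s F" "\<forall>\<^sub>F i in F. S i = T i" shows "limitin ultraweak T s F"
 using limitin_transform_eventually[OF assms(2,1)] .

lemma slice_lin:
 assumes Z: "Z : bops"
 shows "slice (e + f) Z e' = slice e Z e' + slice f Z e'" "slice e Z (e' + f) = slice e Z e' + slice e Z f"
 by (rule blinfun_cinner_eqI, simp add: cinner_slice tensor_add_right cinner_add_left cinner_add_right blinfun.add_left blinfun.add_right)+

section \<open>Right derivatives of a multiplier cocycle\<close>

locale multiplier = flow A j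
 for A :: "('h::complex_hilbert op) set"
  and j :: "real => ('h op) => ('h, 'k::complex_hilbert) fop" +
 fixes Y :: "real => ('h, 'k) fop"
  and F :: "('k, 'h) ch op"
 assumes Y: "multiplier_cocycle A j Y" and qc: "quasicontractive Y" and sc: "strongly_continuous Y"
  and sca: "strongly_continuous (%t. adj (Y t))" and deriv: "bounded_ultraweak_stochastic_derivative A Y F"
begin

lemma F: "F : bops \<otimes>\<^sub>N A" using deriv by (simp add: bounded_ultraweak_stochastic_derivative_def)

lemma Yp: "bounded_process_in A Y" using Y by (simp add: multiplier_cocycle_def)

lemma Yb: "t >= 0 ==> Y t : bops" using Yp by (simp add: bounded_process_in_def)

lemma Y0: "Y 0 = id_blinfun" using Y by (simp add: multiplier_cocycle_def)

abbreviation "Z t == Y t - id_blinfun"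

lemma Zb: "t >= 0 ==> Z t : bops" using Yb by (simp)

lemma Z_slice: "t >= 0 ==> slice e (Z t) e' : A"
proof -
 assume t: "t >= 0"
 have "slice e (Z t) e' = slice e (Y t) e' - cinner e e' *c id_blinfun"
  by (rule blinfun_cinner_eqI) (simp add: cinner_slice blinfun.diff_left cinner_diff_right cinner_scaleC_right)
 thus ?thesis using bounded_process_slice_in[OF A Yp t] vn_id[OF A]
  by (simp add: cvec.subspace_diff[OF vn_subspace[OF A]] cvec.subspace_scale[OF vn_subspace[OF A]])
qed

lemma Z_adapted: "t >= 0 ==> adapted t (Z t)"
 unfolding adapted_def
proof (intro conjI ballI allI)
 assume t: "t >= 0"
 show "Z t : bops" by (rule Zb[OF t])
 fix f g :: "real => 'k" and u v :: 'h assume fg: "f : step_funs" "g : step_funs"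
 show "cinner (u ox f) (Z t (v ox g)) = kf (hi t f) (hi t g) * cinner (u ox lo t f) (Z t (v ox lo t g))"
  using adaptedD[OF bounded_process_adapted[OF Yp t] fg, of u v] kf_split[OF fg, of t]
  by (simp add: blinfun.diff_left cinner_diff_right kf_def algebra_simps)
qed

text \<open>Quasicontractivity gives boundedness near 0, the uniform bound under which weak limits
  become ultraweak and vectors may vary with time.\<close>

lemma Z_bound: "EX K. \<forall>\<^sub>F t in at_right 0. norm (Z t) <= K"
proof -
 obtain w where w: "!!t. t >= 0 ==> exp (- w * t) * norm (Y t) <= 1" using qc unfolding quasicontractive_def by blast
 have "norm (Z t) <= exp \<bar>w\<bar> + norm (id_blinfun :: ('h, 'k) hf =>L _)" if t: "0 < t" "t < 1" for t
 proof -
  have "norm (Y t) = exp (w * t) * (exp (- w * t) * norm (Y t))" by (simp add: exp_add[symmetric])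
  also have "... <= exp (w * t) * 1" using w[of t] t by (intro mult_left_mono) auto
  also have "w * t <= \<bar>w\<bar> * 1" using t by (intro mult_mono) auto
  finally show ?thesis using norm_triangle_ineq4[of "Y t" id_blinfun] by simp
 qed
 moreover have "\<forall>\<^sub>F t in at_right (0::real). 0 < t & t < 1"
  using eventually_at_right_real[of 0 1] by (simp)
 ultimately show ?thesis by (metis (mono_tags, lifting) eventually_mono)
qed

text \<open>Local boundedness lets the vector vary with \<open>t\<close>.\<close>

lemma strong_null:
 fixes S :: "real => ('h, 'k) fop"
 assumes s: "!!x. ((%t. S t x) ---> 0) (at_right 0)" and b: "\<forall>\<^sub>F t in at_right 0. norm (S t) <= K" and x: "(x ---> y) (at_right 0)"
 shows "((%t. S t (x t)) ---> 0) (at_right 0)"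
proof (rule Lim_null_comparison)
 show "\<forall>\<^sub>F t in at_right 0. norm (S t (x t)) <= K * norm (x t - y) + norm (S t y)"
  using b
 proof eventually_elim
  case (elim t)
  have "norm (S t (x t - y)) <= K * norm (x t - y)"
   using norm_blinfun[of "S t" "x t - y"] mult_right_mono[OF elim norm_ge_zero[of "x t - y"]] by simp
  thus ?case using norm_triangle_ineq[of "S t (x t - y)" "S t y"] by (simp add: blinfun.diff_right)
 qed
 have "((%t. K * norm (x t - y) + norm (S t y)) ---> K * norm (y - y) + norm (0 :: ('h, 'k) hf)) (at_right 0)"
  by (intro tendsto_intros x s)
 thus "((%t. K * norm (x t - y) + norm (S t y)) ---> 0) (at_right 0)" by simp
qed

lemma Z_null: "((%t. Z t x) ---> 0) (at_right 0)" "((%t. adj (Z t) x) ---> 0) (at_right 0)"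
proof -
 have "((%t. Y t x) ---> Y 0 x) (at 0 within {0..})" "((%t. adj (Y t) x) ---> adj (Y 0) x) (at 0 within {0..})"
  using sc sca by (auto simp: strongly_continuous_def continuous_on_def)
 hence l: "((%t. Y t x - x) ---> x - x) (at_right 0)" "((%t. adj (Y t) x - x) ---> x - x) (at_right 0)"
  unfolding at_within_Ici_at_right Y0 adj_id id_blinfun.rep_eq by - (rule tendsto_diff[OF _ tendsto_const], assumption)+
 from l(1) show "((%t. Z t x) ---> 0) (at_right 0)" by (simp add: blinfun.diff_left)
 have "adj (Z t) = adj (Y t) - id_blinfun" if "t >= 0" for t
  by (rule adjI[OF Zb[OF that]]) (simp add: blinfun.diff_left cinner_diff_left cinner_diff_right cinner_adj_left Yb[OF that])
 hence "\<forall>\<^sub>F t in at_right 0. adj (Y t) x - x = adj (Z t) x"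
  using eventually_at_right_less[of 0] by (auto elim!: eventually_mono simp: blinfun.diff_left)
 with l(2) show "((%t. adj (Z t) x) ---> 0) (at_right 0)" by (simp add: Lim_transform_eventually)
qed

text \<open>Vectors of the form (1, c) under \<open>block_iso\<close> see all four blocks of the
  derivative at once. Testing with square summable sequences of such vectors gives an ultraweak
  limit of slices, as normality of the flow will require.\<close>

lemma vac1_slice_derivative:
 "limitin ultraweak (%t. of_real (1 / t) *c slice (vac1 t c) (Z t) (vac1 t d)) (lslice (1, c) F (1, d)) (at_right 0)"
proof (rule limitin_ultraweakI)
 show "lslice (1, c) F (1, d) : bops" by (rule Ab[OF lslice_F[OF F]])
 show "\<forall>\<^sub>F t in at_right 0. of_real (1 / t) *c slice (vac1 t c) (Z t) (vac1 t d) : bops"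
  using eventually_at_right_less[of 0] by eventually_elim (simp add: bops_scaleC Zb)
 fix x y :: "nat => 'h" assume s: "sq_summable x" "sq_summable y"
 let ?b = "%c x (n::nat). (block_iso :: ('k, 'h) ch =>L _) ((1, c) \<odot> x n)"
 let ?L = "%t. block_column ((1 / sqrt t) *r adj (ket (varpi (%_. 0)))) (adj (V_iso t)) oo Z t oo block_row ((1 / sqrt t) *r ket (varpi (%_. 0))) (V_iso t)"
 have bs: "sq_summable (?b c x)" if "sq_summable x" for c x
  using sq_summable_bounded_op[OF that, of "block_iso oo lket (1, c)"] by simp
 have "limitin ultraweak ?L (block_iso oo F oo adj block_iso) (at_right 0)"
  using deriv by (simp add: bounded_ultraweak_stochastic_derivative_def)
 from limitin_ultraweakD[OF this bs[OF s(1), of c] bs[OF s(2), of d]]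
 have "((%t. uw (?b c x) (?b d y) (?L t)) ---> uw (?b c x) (?b d y) (block_iso oo F oo adj block_iso)) (at_right 0)" .
 moreover have "uw (?b c x) (?b d y) (block_iso oo F oo adj block_iso) = uw x y (lslice (1, c) F (1, d))"
  unfolding uw_def by (rule suminf_cong)
   (simp add: cinner_lslice block_iso_props(3) cinner_adj_left[OF block_iso_props(1), symmetric] flip: block_iso_props(2))
 moreover have "\<forall>\<^sub>F t in at_right 0. uw (?b c x) (?b d y) (?L t) = uw x y (of_real (1 / t) *c slice (vac1 t c) (Z t) (vac1 t d))"
  using eventually_at_right_less[of 0]
 proof eventually_elim
  case (elim t)
  show ?case unfolding uw_def
   by (rule suminf_cong, simp only: block_derivative[OF elim Zb[OF less_imp_le[OF elim]]]) (simp add: cinner_scaleC_right)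
 qed
 ultimately show "((%t. uw x y (of_real (1 / t) *c slice (vac1 t c) (Z t) (vac1 t d))) ---> uw x y (lslice (1, c) F (1, d))) (at_right 0)"
  by (simp only: tendsto_cong)
qed

text \<open>The one-particle vectors of the stochastic derivative differ from exponential vectors by \<open>O(t)\<close>,
 which strong continuity of \<open>Y\<close> and of its adjoint turns into \<open>o(t)\<close>.\<close>

lemma cst_slice_derivative:
 "limitin ultraweak (%t. of_real (1 / t) *c slice (varpi (cst t c)) (Z t) (varpi (cst t d))) (lslice (1, c) F (1, d)) (at_right 0)"
proof -
 let ?e = "%t c. varpi (cst t c) - vac1 t c"
 \<comment> \<open>The correction between the two difference quotients, split so that each term has
   one small vector. With it on the left, \<open>Z t\<close> acts on the right vector; with it on
   the right, \<open>adj (Z t)\<close> acts on the left vector. Both images tend to 0.\<close>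
 let ?R = "%t. of_real (1 / t) *c (slice (?e t c) (Z t) (varpi (cst t d)) + slice (vac1 t c) (Z t) (?e t d))"
 obtain K where K: "\<forall>\<^sub>F t in at_right 0. norm (Z t) <= K" using Z_bound by blast
 have pos: "\<forall>\<^sub>F t in at_right (0::real). 0 < t" by (simp add: eventually_at_right_less)
 have t1: "\<forall>\<^sub>F t in at_right (0::real). t < 1" using eventually_at_right_real[of 0 1] by (auto elim: eventually_mono)
 have eb: "norm (complex_of_real (1 / t) *c ?e t c) <= (norm c)^2" if "t > 0" for t and c :: 'k
  using mult_left_mono[OF vac1_estimates(1)[of t c], of "1 / t"] that by (simp add: norm_scaleC norm_divide)
 have sl: "of_real (1 / t) *c slice (?e t c) (Z t) y = slice (complex_of_real (1 / t) *c ?e t c) (Z t) y"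
  "of_real (1 / t) *c slice y (Z t) (?e t d) = slice y (Z t) (complex_of_real (1 / t) *c ?e t d)" if "t > 0" for t y
  using Zb[of t] that by (auto intro!: blinfun_cinner_eqI simp: cinner_slice cinner_scaleC_right tensor_scaleC_right cinner_scaleC_left bopsD)
 have R: "?R t = slice (complex_of_real (1 / t) *c ?e t c) (Z t) (varpi (cst t d)) + slice (vac1 t c) (Z t) (complex_of_real (1 / t) *c ?e t d)" if "t > 0" for t
  unfolding scaleC_add_right sl[OF that] ..
 have "limitin ultraweak ?R 0 (at_right 0)"
 proof (rule limitin_ultraweak_bounded)
  show "\<forall>\<^sub>F t in at_right 0. ?R t : bops" using pos by eventually_elim (intro bops_scaleC bops_add slice_bops Zb, auto)
  show "\<forall>\<^sub>F t in at_right 0. norm (?R t) <= K * ((norm c)^2 * 1) + K * ((1 + norm c) * (norm d)^2)"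
   using pos t1 K
  proof eventually_elim
   case (elim t)
   have v: "norm (vac1 t c) <= 1 + norm c"
   proof -
    have "norm (vac1 t c) <= norm (varpi (%_. 0::'k)) + norm (vac1 t c - varpi (%_. 0))" by (rule norm_triangle_sub)
    also have "norm (vac1 t c - varpi (%_. 0)) <= sqrt t * norm c" using elim by (intro vac1_estimates) simp
    also have "sqrt t * norm c <= 1 * norm c" using elim by (intro mult_right_mono) auto
    finally show ?thesis by simp
   qed
   have K0: "K >= 0" using order_trans[OF norm_ge_zero elim(3)] .
   have Zt: "Z t : bops" using elim by (intro Zb) simp
   have "norm (slice (complex_of_real (1 / t) *c ?e t c) (Z t) (varpi (cst t d))) <= K * ((norm c)^2 * 1)"
    by (rule order_trans[OF norm_slice_le[OF Zt]]) (use elim eb[of t c] K0 in "intro mult_mono, auto")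
   moreover have "norm (slice (vac1 t c) (Z t) (complex_of_real (1 / t) *c ?e t d)) <= K * ((1 + norm c) * (norm d)^2)"
    by (rule order_trans[OF norm_slice_le[OF Zt]]) (use elim eb[of t d] K0 v in "intro mult_mono, auto")
   ultimately show ?case unfolding R[OF elim(1)] by (intro norm_triangle_le) simp
  qed
  fix u v :: 'h
  have l1: "((%t. Z t (v ox cst t d)) ---> 0) (at_right 0)"
   using vac1_limits(2)[of d] by (intro strong_null[OF Z_null(1) K]) (use blinfun.tendsto[OF tendsto_const, of _ _ _ "lket v"] in simp)
  have "\<forall>\<^sub>F t in at_right 0. norm (adj (Z t)) <= K" using K pos by eventually_elim (use norm_adj_le Zb in "meson less_imp_le order_trans")
  hence l2: "((%t. adj (Z t) (u \<odot> vac1 t c)) ---> 0) (at_right 0)"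
   using vac1_limits(1)[of c] by (intro strong_null[OF Z_null(2)]) (use blinfun.tendsto[OF tendsto_const, of _ _ _ "lket u"] in simp_all)
  have "((%t. cinner u (?R t v)) ---> 0) (at_right 0)"
  proof (rule Lim_null_comparison)
   show "\<forall>\<^sub>F t in at_right 0. norm (cinner u (?R t v)) <= (norm u * (norm c)^2) * norm (Z t (v ox cst t d)) +
     norm (adj (Z t) (u \<odot> vac1 t c)) * (norm v * (norm d)^2)"
    using pos
   proof eventually_elim
    case (elim t)
    have e: "cinner u (?R t v) = cinner (u \<odot> (complex_of_real (1 / t) *c ?e t c)) (Z t (v ox cst t d)) +
      cinner (adj (Z t) (u \<odot> vac1 t c)) (v \<odot> (complex_of_real (1 / t) *c ?e t d))"
     unfolding R[OF elim] blinfun.add_left cinner_add_right cinner_slice using elim by (simp only: cinner_adj_left Zb less_imp_le)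
    have "norm (cinner (u \<odot> (complex_of_real (1 / t) *c ?e t c)) (Z t (v ox cst t d))) <=
      (norm u * (norm c)^2) * norm (Z t (v ox cst t d))"
     by (rule order_trans[OF cmod_cinner_le mult_right_mono[OF _ norm_ge_zero]])
      (simp only: norm_tensor, rule mult_left_mono[OF eb[OF elim] norm_ge_zero])
    moreover have "norm (cinner (adj (Z t) (u \<odot> vac1 t c)) (v \<odot> (complex_of_real (1 / t) *c ?e t d))) <=
      norm (adj (Z t) (u \<odot> vac1 t c)) * (norm v * (norm d)^2)"
     by (rule order_trans[OF cmod_cinner_le mult_left_mono[OF _ norm_ge_zero]])
      (simp only: norm_tensor, rule mult_left_mono[OF eb[OF elim] norm_ge_zero])
    ultimately show ?case unfolding e by (intro norm_triangle_le add_mono)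
   qed
   have "((%t. (norm u * (norm c)^2) * norm (Z t (v ox cst t d)) + norm (adj (Z t) (u \<odot> vac1 t c)) * (norm v * (norm d)^2)) --->
     (norm u * (norm c)^2) * norm (0 :: ('h, 'k) hf) + norm (0 :: ('h, 'k) hf) * (norm v * (norm d)^2)) (at_right 0)"
    by (intro tendsto_intros l1 l2)
   thus "((%t. (norm u * (norm c)^2) * norm (Z t (v ox cst t d)) + norm (adj (Z t) (u \<odot> vac1 t c)) * (norm v * (norm d)^2)) ---> 0) (at_right 0)" by simp
  qed
  thus "((%t. cinner u (?R t v)) ---> cinner u ((0 :: 'h op) v)) (at_right 0)" by simp
 qed (auto simp: trivial_limit_at_right_real bops_zero)
 from limitin_ultraweak_add[OF vac1_slice_derivative[of c d] this]
 have "limitin ultraweak (%t. of_real (1 / t) *c slice (vac1 t c) (Z t) (vac1 t d) + ?R t) (lslice (1, c) F (1, d)) (at_right 0)" by simp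
 thus ?thesis
 proof (rule limitin_ultraweak_cong)
  show "\<forall>\<^sub>F t in at_right 0. of_real (1 / t) *c slice (vac1 t c) (Z t) (vac1 t d) + ?R t = of_real (1 / t) *c slice (varpi (cst t c)) (Z t) (varpi (cst t d))"
   using pos
  proof eventually_elim
   case (elim t)
   hence Zt: "Z t : bops" by (intro Zb) simp
   have "slice (vac1 t c) (Z t) (vac1 t d) + (slice (?e t c) (Z t) (varpi (cst t d)) + slice (vac1 t c) (Z t) (?e t d)) = slice (varpi (cst t c)) (Z t) (varpi (cst t d))"
    using slice_lin(1)[OF Zt, of "vac1 t c" "?e t c" "varpi (cst t d)"] slice_lin(2)[OF Zt, of "vac1 t c" "vac1 t d" "?e t d"] by simp
   thus ?case unfolding scaleC_add_right[symmetric] by simp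
  qed
 qed
qed

text \<open>Just after 0 both functions agree with their values at 0, so adaptedness of
  \<open>Z h\<close> reduces the slice to constant functions on [0, h); the remaining factor
  \<open>kf (hi h f) (hi h g)\<close> tends to \<open>kf f g\<close>.\<close>

lemma slice_derivative:
 assumes f: "f : step_funs" and g: "g : step_funs"
 shows "limitin ultraweak (%h. of_real (1 / h) *c slice (varpi f) (Z h) (varpi g)) (kf f g *c lslice (1, f 0) F (1, g 0)) (at_right 0)"
proof -
 obtain d where d: "d > 0 & (ALL y:{0..<0 + d}. f y = f 0)" using step_right_const[OF f, of 0] ..
 obtain e where e: "e > 0 & (ALL y:{0..<0 + e}. g y = g 0)" using step_right_const[OF g, of 0] ..
 have ev: "\<forall>\<^sub>F h in at_right 0. h > 0 & lo h f = cst h (f 0) & lo h g = cst h (g 0)"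
 proof -
  have "\<forall>\<^sub>F h in at_right 0. h : {0<..<min d e}" using d e by (intro eventually_at_right_real) simp
  thus ?thesis
  proof eventually_elim
   case (elim h)
   have y: "f y = f 0" "g y = g 0" if "y : {0..<h}" for y
    using conjunct2[OF d, THEN bspec, of y] conjunct2[OF e, THEN bspec, of y] that elim by simp_all
   have "lo h f y = cst h (f 0) y" "lo h g y = cst h (g 0) y" for y
    by (cases "y : {0..<h}"; simp add: cut_def y[of y])+
   thus ?case using elim by (intro conjI ext) simp_all
  qed
 qed
 have nz: "kf a b ~= 0" if "a : step_funs" "b : step_funs" for a b :: "real => 'k" using that by (simp add: kf_eq)
 have "((%h. cinner (varpi (cst h (f 0))) (varpi (cst h (g 0)))) ---> kf (%_. 0) (%_. 0 :: 'k)) (at_right 0)"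
  unfolding kf_def by (intro tendsto_cinner vac1_limits)
 hence "((%h. kf f g / kf (cst h (f 0)) (cst h (g 0))) ---> kf f g / 1) (at_right 0)"
  unfolding kf_def[symmetric] by (intro tendsto_divide tendsto_const) simp_all
 moreover have "\<forall>\<^sub>F h in at_right 0. kf f g / kf (cst h (f 0)) (cst h (g 0)) = kf (hi h f) (hi h g)"
  using ev
 proof eventually_elim
  case (elim h)
  thus ?case using kf_split[OF f g, of h] nz[OF cst_props(1) cst_props(1), of h h "f 0" "g 0"] by (simp)
 qed
 ultimately have k: "((%h. kf (hi h f) (hi h g)) ---> kf f g) (at_right 0)" by (simp add: Lim_transform_eventually)
 from limitin_ultraweak_scaleC[OF cst_slice_derivative[of "f 0" "g 0"] k]
 show ?thesis
 proof (rule limitin_ultraweak_cong)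
  show "\<forall>\<^sub>F h in at_right 0. kf (hi h f) (hi h g) *c of_real (1 / h) *c slice (varpi (cst h (f 0))) (Z h) (varpi (cst h (g 0))) =
    of_real (1 / h) *c slice (varpi f) (Z h) (varpi g)"
   using ev
  proof eventually_elim
   case (elim h)
   have "slice (varpi f) (Z h) (varpi g) = kf (hi h f) (hi h g) *c slice (varpi (lo h f)) (Z h) (varpi (lo h g))"
    by (rule blinfun_cinner_eqI) (use adaptedD[OF Z_adapted f g, of h] elim in "simp add: cinner_slice cinner_scaleC_right")
   thus ?case using elim by (simp)
  qed
 qed
qed

text \<open>Normality of \<open>j s\<close> carries the limit of \<open>slice_derivative\<close>
  through \<open>cocycle_increment\<close>. The limit lives on the parts of the functions before
  \<open>s\<close>, with a factor from those after \<open>s\<close>; adaptedness of the product of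
  the flow with \<open>Y s\<close> recombines them into the integrand at the full vectors.\<close>

lemma right_derivative:
 assumes f: "f : step_funs" and g: "g : step_funs" and s: "s >= 0"
 shows "((%h. (1 / h) *r (cinner (u ox f) (Y (s + h) (v ox g)) - cinner (u ox f) (Y s (v ox g)))) --->
  cinner ((1, f s) \<odot> (u ox f)) (ktilde A j s F ((1, g s) \<odot> Y s (v ox g)))) (at_right 0)"
proof -
 let ?f = "unshift s f" and ?g = "unshift s g" and ?x = "Y s (v ox lo s g)"
 let ?a = "lslice (1, f s) F (1, g s)"
 have u0: "?f 0 = f s" "?g 0 = g s" by (simp_all add: unshift_def)
 have a: "?a : A" by (rule lslice_F[OF F])
 have kk: "kf ?f ?g = kf (hi s f) (hi s g)"
  using kf_shift[OF step_unshift[OF f] step_unshift[OF g] s, of s s] by (simp add: shift_unshift)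
 have lin: "linear_on A (j s)" using j_repn[OF s] by (simp add: repn_def)
 have "((%h. cinner (u ox lo s f) (j s (of_real (1 / h) *c slice (varpi ?f) (Z h) (varpi ?g)) ?x)) --->
   cinner (u ox lo s f) (j s (kf ?f ?g *c lslice (1, ?f 0) F (1, ?g 0)) ?x)) (at_right 0)"
 proof (rule j_normal[OF s slice_derivative[OF step_unshift[OF f] step_unshift[OF g]]])
  show "\<forall>\<^sub>F h in at_right 0. of_real (1 / h) *c slice (varpi ?f) (Z h) (varpi ?g) : A"
   using eventually_at_right_less[of 0] by eventually_elim (intro cvec.subspace_scale[OF vn_subspace[OF A]] Z_slice, simp)
  show "kf ?f ?g *c lslice (1, ?f 0) F (1, ?g 0) : A" by (intro cvec.subspace_scale[OF vn_subspace[OF A]] lslice_F[OF F])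
 qed
 moreover have "cinner (u ox lo s f) (j s (kf ?f ?g *c lslice (1, ?f 0) F (1, ?g 0)) ?x) =
   cinner ((1, f s) \<odot> (u ox f)) (ktilde A j s F ((1, g s) \<odot> Y s (v ox g)))"
 proof -
  have "cinner (u ox lo s f) (j s (kf ?f ?g *c ?a) ?x) = kf (hi s f) (hi s g) * cinner (u ox lo s f) ((j s ?a oo Y s) (v ox lo s g))"
   using lin a by (simp add: linear_on_def kk cinner_scaleC_right)
  also have "... = cinner (u ox f) ((j s ?a oo Y s) (v ox g))"
   by (rule adaptedD[OF adapted_product[OF bounded_process_adapted[OF Yp s] j_adapted[OF s a]] f g, symmetric])
  also have "... = cinner ((1, f s) \<odot> (u ox f)) (ktilde A j s F ((1, g s) \<odot> Y s (v ox g)))"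
   by (simp add: ktilde_lslice[OF s F, symmetric] cinner_lslice)
  finally show ?thesis by (simp only: u0)
 qed
 moreover have "\<forall>\<^sub>F h in at_right 0. cinner (u ox lo s f) (j s (of_real (1 / h) *c slice (varpi ?f) (Z h) (varpi ?g)) ?x) =
   (1 / h) *r (cinner (u ox f) (Y (s + h) (v ox g)) - cinner (u ox f) (Y s (v ox g)))"
  using eventually_at_right_less[of 0]
 proof eventually_elim
  case (elim h)
  have "j s (of_real (1 / h) *c slice (varpi ?f) (Z h) (varpi ?g)) = of_real (1 / h) *c j s (slice (varpi ?f) (Z h) (varpi ?g))"
   using lin Z_slice[of h] elim by (simp add: linear_on_def)
  thus ?case using cocycle_increment[OF Y s _ f g, of h u v] elim by (simp add: cinner_scaleC_right scaleR_conv_of_real)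
 qed
 ultimately show ?thesis by (simp only: tendsto_cong)
qed

section \<open>The perturbation equation for the cocycle\<close>

abbreviation "G == perturbation_integrand A j F (as_process Y)"

lemma operator_process_Y: "operator_process (as_process Y)" using Yp by (simp add: bounded_process_in_def process_in_def)

lemma as_process_Y: "t >= 0 ==> z : exp_domain ==> the (as_process Y t z) = Y t z" by (simp add: as_process_def)

lemma integrand_Y: 
 assumes "s >= 0" "g : step_funs"
 shows "the (G s (the (nabla s (v ox g)))) = ktilde A j s F ((1, g s) \<odot> Y s (v ox g))"
 using integrand_nabla[OF F operator_process_Y assms] as_process_Y[OF assms(1) exp_in[OF assms(2)]] by simp

lemma Y_continuous: "continuous_on {0..} (%t. Y t x)" using sc by (simp add: strongly_continuous_def)

lemma qs_vec_Y: 
 assumes "z : exp_domain"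
 shows "qs_vec (%s. the (G s (the (nabla s z))))"
proof -
 obtain n u f where f: "ALL i<n. f i : step_funs" and z: "z = (\<Sum>i<(n::nat). u i ox f i)"
  using exp_domain_rep[OF assms] by blast
 show ?thesis
 proof (rule rcont_bounded_qs_vec)
  show "rcont_bounded (%s. \<Sum>i<n. ktilde A j s F ((1, f i s) \<odot> Y s (u i ox f i)))"
   by (intro rcont_bounded_sum ktilde_rcont_bounded[OF F] Y_continuous) (use f in auto)
  fix s :: real assume s: "s >= 0"
  have "the (G s (\<Sum>i<n. (1, f i s) \<odot> (u i ox f i))) = (\<Sum>i<n. the (G s ((1, f i s) \<odot> (u i ox f i))))"
   by (rule lin_operator_sum[THEN conjunct1, OF integrand_props(1)[OF F operator_process_Y s]]) (use f in "intro integrand_props(2)[OF F operator_process_Y s], auto")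
  also have "... = (\<Sum>i<n. ktilde A j s F ((1, f i s) \<odot> Y s (u i ox f i)))"
   by (rule sum.cong) (use f s in "simp_all add: integrand_props(3)[OF F operator_process_Y] as_process_Y")
  finally show "the (G s (the (nabla s z))) = (\<Sum>i<n. ktilde A j s F ((1, f i s) \<odot> Y s (u i ox f i)))"
   unfolding z using f by (subst nabla_sum[OF s]) auto
 qed
qed

lemma qs_integrable_Y: "qs_integrable G"
 unfolding qs_integrable_def
proof (intro conjI allI impI ballI)
 note I = integrand_props[OF F operator_process_Y]
 fix t :: real assume t: "t >= 0"
 show "lin_operator (G t)" by (rule I(1)[OF t])
 show "the (nabla t z) : dom (G t)" if "z : exp_domain" for z
 proof -
  obtain n u f where f: "ALL i<n. f i : step_funs" and z: "z = (\<Sum>i<(n::nat). u i ox f i)"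
   using exp_domain_rep[OF \<open>z : exp_domain\<close>] by blast
  have "(\<Sum>i<n. (1, f i t) \<odot> (u i ox f i)) : dom (G t)"
   by (rule lin_operator_sum[THEN conjunct2, OF I(1)[OF t]]) (use f in "intro I(2)[OF t], auto")
  thus ?thesis unfolding z using f by (subst nabla_sum[OF t]) auto
 qed
 fix f g :: "real => 'k" and u :: 'h assume f: "f : step_funs" and g: "g : step_funs"
 show "ket2 (1, g t) (varpi (lo t g)) u : dom (G t)" using I(2)[OF t] g unfolding ket2_props by simp
 \<comment> \<open>Between fixed first legs \<open>ktilde\<close> reduces to \<open>j t\<close> of a
   slice of \<open>F\<close>, so adaptedness of the integrand is that of the product of this
   operator with \<open>Y t\<close>.\<close>
 have a: "cinner ((1, f t) \<odot> (v ox f')) (ktilde A j t F ((1, g t) \<odot> Y t (u ox g'))) =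
   cinner (v ox f') ((j t (lslice (1, f t) F (1, g t)) oo Y t) (u ox g'))" for v f' g'
  by (simp add: ktilde_lslice[OF t F, symmetric] cinner_lslice)
 note ad = adaptedD[OF adapted_product[OF bounded_process_adapted[OF Yp t] j_adapted[OF t lslice_F[OF F]]] f g]
 show "adj (ket2 (1, f t) (varpi f)) (the (G t (the (nabla t (ket (varpi g) u))))) =
  cinner (varpi (hi t f)) (varpi (hi t g)) *c adj (ket2 (1, f t) (varpi (lo t f))) (the (G t (ket2 (1, g t) (varpi (lo t g)) u)))"
  unfolding ket_apply integrand_Y[OF t g] ket2_props
  by (rule cinner_extI) (use I(3)[OF t exp_in[OF step_cut(2)[OF g]]] as_process_Y[OF t exp_in[OF step_cut(2)[OF g]]]
    in "simp add: cinner_adj_right ket2_props a ad[unfolded blinfun_apply_blinfun_compose] kf_def cinner_scaleC_right")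
next
 fix z :: "('h, 'k) hf" assume "z : exp_domain"
 from qs_vec_Y[OF this] show "locally_integrable (%s. Delta_perp (the (G s (the (nabla s z)))))"
  "locally_sq_integrable (%s. Delta (the (G s (the (nabla s z)))))"
  by (simp_all add: qs_vec_def)
qed

lemma qs_vector_Y:
 assumes t: "t >= 0" and g: "g : step_funs"
 shows "qs_vector (%s. the (G s (the (nabla s (v ox g))))) 0 t (Y t (v ox g) - v ox g)"
 unfolding qs_vector_def
proof (intro allI ballI)
 fix u :: 'h and f :: "real => 'k" assume f: "f : step_funs"
 let ?z = "%s. ktilde A j s F ((1, g s) \<odot> Y s (v ox g))"
 define P where "P s = cinner (u ox f) (Y s (v ox g))" for s
 define p where "p s = cinner ((1, f s) \<odot> (u ox f)) (?z s)" for s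
 have rb: "rcont_bounded ?z" by (rule ktilde_rcont_bounded[OF F g Y_continuous])
 have i: "set_integrable lebesgue {0..t} p"
  unfolding p_def by (rule qs_vec_cinner_integrable[OF rcont_bounded_qs_vec[OF rb refl] order_refl f])
 have "integral {0..t} p = P t - P 0"
 proof (rule integral_right_derivative[OF t])
  have "continuous_on {0..t} (%s. Y s (v ox g))" by (rule continuous_on_subset[OF Y_continuous]) simp
  thus "continuous_on {0..t} P" by (auto simp: P_def continuous_on_def intro: tendsto_cinner)
  show "p integrable_on {0..t}" by (rule set_lebesgue_integral_eq_integral(1)[OF i])
  fix s assume s: "0 <= s" "s < t"
  have "(f ---> f s) (at s within {s..})" "(?z ---> ?z s) (at s within {s..})"
   using step_rcont[OF f, of s] rb s by (simp_all add: continuous_within rcont_bounded_def)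
  from tendsto_cinner[OF blinfun.tendsto[OF tendsto_const[of "ket (u ox f)"] tendsto_Pair[OF tendsto_const[of 1] this(1)]] this(2)]
  have "(p ---> p s) (at s within {s..})" by (simp add: p_def[abs_def])
  thus "continuous (at s within {s..t}) p" unfolding continuous_within by (rule tendsto_within_subset) auto
  have "((%h. (1 / h) *r (P (s + h) - P s)) ---> p s) (at_right 0)"
   unfolding P_def p_def by (rule right_derivative[OF f g s(1)])
  hence "((%h. (1 / (h - s)) *r (P h - P s)) ---> p s) (at_right s)"
   unfolding filterlim_at_right_to_0[of _ _ s] by (simp add: add.commute)
  from LIM_zero[OF this] have "((%h. norm ((1 / (h - s)) *r (P h - P s) - p s)) ---> 0) (at_right s)" by (rule tendsto_norm_zero)
  moreover have "\<forall>\<^sub>F h in at_right s. norm ((1 / (h - s)) *r (P h - P s) - p s) = norm (P h - P s - (h - s) *r p s) / norm (h - s)"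
   using eventually_at_right_less[of s]
  proof eventually_elim
   case (elim h)
   have "(1 / (h - s)) *r (P h - P s) - p s = (1 / (h - s)) *r (P h - P s - (h - s) *r p s)" using elim by (simp add: scaleR_diff_right)
   thus ?case using elim by (simp add: divide_inverse)
  qed
  ultimately have "((%h. norm (P h - P s - (h - s) *r p s) / norm (h - s)) ---> 0) (at_right s)" by (simp only: tendsto_cong)
  thus "(P has_vector_derivative p s) (at s within {s..t})"
   unfolding has_vector_derivative_def has_derivative_iff_norm at_within_Icc_at_right[OF s(2)]
   by (simp add: bounded_linear_scaleR_left)
 qed
 moreover have "(LINT s:{0..t}|lebesgue. p s) = integral {0..t} p" by (rule set_lebesgue_integral_eq_integral(2)[OF i])
 moreover have "(LINT s:{0..t}|lebesgue. cinner ((1, f s) \<odot> (u ox f)) (the (G s (the (nabla s (v ox g)))))) = (LINT s:{0..t}|lebesgue. p s)"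
  by (rule LINT_cong_pos) (simp add: p_def integrand_Y g)
 ultimately show "cinner (u ox f) (Y t (v ox g) - v ox g) =
   (LINT s:{0..t}|lebesgue. cinner ((1, f s) \<odot> (u ox f)) (the (G s (the (nabla s (v ox g))))))"
  by (simp add: P_def Y0 cinner_diff_right)
qed

lemma strong_solution_Y: "strong_solution A j F (as_process Y)"
 unfolding strong_solution_def
proof (intro conjI operator_process_Y qs_integrable_Y allI impI ballI)
 fix t :: real and z :: "('h, 'k) hf" assume t: "t >= 0" and z: "z : exp_domain"
 obtain n u f where f: "ALL i<n. f i : step_funs" and z': "z = (\<Sum>i<(n::nat). u i ox f i)"
  using exp_domain_rep[OF z] by blast
 have P: "operator_process (qs_integral G)" using qs_integral_props(1)[OF qs_integrable_Y] by (simp add: continuous_process_def)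
 have "the (qs_integral G t z) = (\<Sum>i<n. the (qs_integral G t (u i ox f i)))"
  unfolding z' by (rule lin_operator_sum[THEN conjunct1, OF operator_processD(2)[OF P t]]) (use f operator_processD(1)[OF P t] in "simp del: domIff")
 also have "... = (\<Sum>i<n. Y t (u i ox f i) - u i ox f i)"
  by (rule sum.cong) (use f in "auto intro!: qs_vector_unique[OF qs_integral_props(2)[OF qs_integrable_Y t] qs_vector_Y[OF t]]")
 also have "... = Y t z - z" by (simp add: z' sum_subtractf blinfun.sum_right)
 finally show "the (as_process Y t z) = z + the (qs_integral G t z)" by (simp add: as_process_Y[OF t z])
qed

end

theorem theorem6p1:
  fixes A :: "('h::complex_hilbert \<Rightarrow>\<^sub>L 'h) set"
    and j :: "real \<Rightarrow> ('h \<Rightarrow>\<^sub>L 'h) \<Rightarrow>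
      ('h, 'k::complex_hilbert Fock) tensor \<Rightarrow>\<^sub>L ('h, 'k Fock) tensor"
    and Y :: "real \<Rightarrow> ('h, 'k Fock) tensor \<Rightarrow>\<^sub>L ('h, 'k Fock) tensor"
  assumes "von_neumann_algebra A"
    and "qs_flow A j"
    and "multiplier_cocycle A j Y"
    and "quasicontractive Y"
    and "strongly_continuous Y"
    and "strongly_continuous (\<lambda>t. adj (Y t))"
    and "\<exists>F. bounded_ultraweak_stochastic_derivative A Y F"
  shows "\<exists>F \<in> bops \<otimes>\<^sub>N A. is_perturbation_process A j F (as_process Y)"
proof -
 obtain F where "bounded_ultraweak_stochastic_derivative A Y F" using assms(7) ..
 then interpret multiplier A j Y F using assms by unfold_locales
 show ?thesis using F strong_solution_Y strong_solution_unique[OF F _ strong_solution_Y] unfolding is_perturbation_process_def by blast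
qed

end
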